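(* Let $R$ be a commutative ring, $(A,C,\psi)$ a right-right entwining structure over $R$, and $\mathcal{C}:=A\otimes_RC$ the corresponding $A$-coring. 1. If ${}_RC$ is flat, then $\mathcal{M}_A^C(\psi)$ is a Grothendieck category with enough injective objects. 2. If ${}_RC$ is locally projective, then there are isomorphisms of categories $$\mathcal{M}_A^C(\psi)\simeq\mathrm{Rat}^C(\mathcal{M}_{\#_\psi^{op}(C,A)})\simeq\sigma[(A\otimes_RC)_{\#_\psi^{op}(C,A)}].$$ If ${}_RC$ is finitely generated and projective, then $\mathcal{M}_A^C(\psi)\simeq\mathcal{M}_{\#_\psi^{op}(C,A)}$.
   Context: $R$ is a commutative ring, $A$ an $R$-algebra (associative, with unity), $C$ an $R$-coalgebra with $\Delta_C(c)=\sum c_1\otimes c_2$ and counit $\varepsilon_C$. A right-right entwining structure $(A,C,\psi)$ is given by an $R$-linear map $\psi:C\otimes_RA\to A\otimes_RC$, $c\otimes a\mapsto\sum a_\psi\otimes c^\psi$ (a second copy of $\psi$ is written $\Psi$), with $\sum(a\tilde a)_\psi\otimes c^\psi=\sum a_\psi\tilde a_\Psi\otimes c^{\psi\Psi}$, $\sum(1_A)_\psi\otimes c^\psi=1_A\otimes c$, $\sum a_\psi\otimes\Delta_C(c^\psi)=\sum a_{\psi\Psi}\otimes c_1^\Psi\otimes c_2^\psi$, $\sum a_\psi\varepsilon_C(c^\psi)=\varepsilon_C(c)a$. An entwined module is a right $A$-module $M$ which is also a (counital) right $C$-comodule with $\varrho_M(m)=\sum m_{<0>}\otimes m_{<1>}$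 such that $\varrho_M(ma)=\sum m_{<0>}a_\psi\otimes m_{<1>}^\psi$. $\mathcal{M}_A^C(\psi)$ is the category of these with $A$-linear $C$-colinear maps. $\mathcal{C}=A\otimes_RC$ is an $A$-coring with $a(\tilde a\otimes c)=a\tilde a\otimes c$, $(\tilde a\otimes c)a=\sum\tilde aa_\psi\otimes c^\psi$, comultiplication $a\otimes c\mapsto\sum(a\otimes c_1)\otimes_A(1_A\otimes c_2)$, counit $a\otimes c\mapsto a\varepsilon_C(c)$. $\#_\psi^{op}(C,A):=\mathrm{Hom}_R(C,A)$ is a ring with product $(f\cdot g)(c)=\sum f(c_2)_\psi\,g(c_1^\psi)$ and unity $c\mapsto\varepsilon_C(c)1_A$; it is an $A$-ring with $(af)(c)=\sum a_\psi f(c^\psi)$, $(fa)(c)=f(c)a$. Right $\#_\psi^{op}(C,A)$-modules are right $A$-modules via $A\to\#_\psi^{op}(C,A)$, $a\mapsto[c\mapsto\varepsilon_C(c)a]$. $\mathcal{C}$ is a right $\#_\psi^{op}(C,A)$-module by $(a\otimes c)f=\sum(a\otimes c_1)\cdot f(c_2)$ (right $A$-action on $\mathcal{C}$). Entwined modules become right $\#_\psi^{op}(C,A)$-modules by $mf=\sum m_{<0>}f(m_{<1>})$; the isomorphisms in part 2 are induced by this functor, which is the identity on maps. A right $\#_\psi^{op}(C,A)$-module $M$ is $\#$-rational if for every $m\in M$ there is $\sum m_i\otimes c_i\in M\otimes_RC$ with $mf=\sum m_if(c_i)$ for all $f\in\#_\psi^{op}(C,A)$; $\mathrm{Rat}^C(\mathcal{M}_{\#_\psi^{op}(C,A)})$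 is the full subcategory of $\#$-rational modules in the category $\mathcal{M}_{\#_\psi^{op}(C,A)}$ of unital right modules. For a right module $K$ over a ring $S$, $\sigma[K_S]$ is the full subcategory of right $S$-modules isomorphic to submodules of quotients of direct sums of copies of $K$. An $R$-module $W$ is locally projective if for every surjective $R$-linear $\pi:L\to N$, every $R$-linear $g:W\to N$ and every finitely generated submodule $F\subseteq W$ there is an $R$-linear $g':W\to L$ with $\pi g'|_F=g|_F$. *)

theory Defs
  imports "HOL-Algebra.Module" "HOL-Algebra.AbelCoset" "HOL-Algebra.Free_Abelian_Groups" "HOL-Library.Equipollence"
begin

section \<open>Categories\<close>

text \<open>
  Composition carries the objects involved, because the composite of two maps between modules
  (as extensional functions) depends on the carrier of the source:
  \<open>Comp \<C> X Y Z g f\<close> is the composite of \<open>f : X \<rightarrow> Y\<close> and \<open>g : Y \<rightarrow> Z\<close>.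
\<close>

record ('o, 'm) cat =
  Obj :: "'o set"
  Hom :: "'o \<Rightarrow> 'o \<Rightarrow> 'm set"
  Ident :: "'o \<Rightarrow> 'm"
  Comp :: "'o \<Rightarrow> 'o \<Rightarrow> 'o \<Rightarrow> 'm \<Rightarrow> 'm \<Rightarrow> 'm"

locale category =
  fixes \<C> :: "('o, 'm) cat"
  assumes Ident_in: "X \<in> Obj \<C> \<Longrightarrow> Ident \<C> X \<in> Hom \<C> X X"
    and Comp_in: "\<lbrakk>X \<in> Obj \<C>; Y \<in> Obj \<C>; Z \<in> Obj \<C>; f \<in> Hom \<C> X Y; g \<in> Hom \<C> Y Z\<rbrakk>
      \<Longrightarrow> Comp \<C> X Y Z g f \<in> Hom \<C> X Z"
    and Comp_Ident_right: "\<lbrakk>X \<in> Obj \<C>; Y \<in> Obj \<C>; f \<in> Hom \<C> X Y\<rbrakk>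
      \<Longrightarrow> Comp \<C> X X Y f (Ident \<C> X) = f"
    and Comp_Ident_left: "\<lbrakk>X \<in> Obj \<C>; Y \<in> Obj \<C>; f \<in> Hom \<C> X Y\<rbrakk>
      \<Longrightarrow> Comp \<C> X Y Y (Ident \<C> Y) f = f"
    and Comp_assoc: "\<lbrakk>W \<in> Obj \<C>; X \<in> Obj \<C>; Y \<in> Obj \<C>; Z \<in> Obj \<C>;
        f \<in> Hom \<C> W X; g \<in> Hom \<C> X Y; h \<in> Hom \<C> Y Z\<rbrakk>
      \<Longrightarrow> Comp \<C> W Y Z h (Comp \<C> W X Y g f) = Comp \<C> W X Z (Comp \<C> X Y Z h g) f"

definition full_subcat :: "('o, 'm) cat \<Rightarrow> ('o \<Rightarrow> bool) \<Rightarrow> ('o, 'm) cat" where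
  "full_subcat \<C> P = \<C>\<lparr>Obj := {X \<in> Obj \<C>. P X}\<rparr>"

definition is_functor ::
  "('o, 'm) cat \<Rightarrow> ('p, 'n) cat \<Rightarrow> ('o \<Rightarrow> 'p) \<Rightarrow> ('o \<Rightarrow> 'o \<Rightarrow> 'm \<Rightarrow> 'n) \<Rightarrow> bool" where
  "is_functor \<C> \<D> F \<Phi> \<longleftrightarrow>
     category \<C> \<and> category \<D> \<and>
     F \<in> Obj \<C> \<rightarrow> Obj \<D> \<and>
     (\<forall>X \<in> Obj \<C>. \<forall>Y \<in> Obj \<C>. \<Phi> X Y \<in> Hom \<C> X Y \<rightarrow> Hom \<D> (F X) (F Y)) \<and>
     (\<forall>X \<in> Obj \<C>. \<Phi> X X (Ident \<C> X) = Ident \<D> (F X)) \<and>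
     (\<forall>X \<in> Obj \<C>. \<forall>Y \<in> Obj \<C>. \<forall>Z \<in> Obj \<C>. \<forall>f \<in> Hom \<C> X Y. \<forall>g \<in> Hom \<C> Y Z.
        \<Phi> X Z (Comp \<C> X Y Z g f) = Comp \<D> (F X) (F Y) (F Z) (\<Phi> Y Z g) (\<Phi> X Y f))"

text \<open>An isomorphism of categories, not merely an equivalence: bijective on objects and on maps.\<close>

definition is_cat_iso ::
  "('o, 'm) cat \<Rightarrow> ('p, 'n) cat \<Rightarrow> ('o \<Rightarrow> 'p) \<Rightarrow> ('o \<Rightarrow> 'o \<Rightarrow> 'm \<Rightarrow> 'n) \<Rightarrow> bool" where
  "is_cat_iso \<C> \<D> F \<Phi> \<longleftrightarrow>
     is_functor \<C> \<D> F \<Phi> \<and> bij_betw F (Obj \<C>) (Obj \<D>) \<and>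
     (\<forall>X \<in> Obj \<C>. \<forall>Y \<in> Obj \<C>. bij_betw (\<Phi> X Y) (Hom \<C> X Y) (Hom \<D> (F X) (F Y)))"

subsection \<open>Abelian categories\<close>

definition is_mono :: "('o, 'm) cat \<Rightarrow> 'o \<Rightarrow> 'o \<Rightarrow> 'm \<Rightarrow> bool" where
  "is_mono \<C> X Y f \<longleftrightarrow> f \<in> Hom \<C> X Y \<and>
     (\<forall>W \<in> Obj \<C>. \<forall>g \<in> Hom \<C> W X. \<forall>h \<in> Hom \<C> W X. Comp \<C> W X Y f g = Comp \<C> W X Y f h \<longrightarrow> g = h)"

definition is_epi :: "('o, 'm) cat \<Rightarrow> 'o \<Rightarrow> 'o \<Rightarrow> 'm \<Rightarrow> bool" where
  "is_epi \<C> X Y f \<longleftrightarrow> f \<in> Hom \<C> X Y \<and>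
     (\<forall>Z \<in> Obj \<C>. \<forall>g \<in> Hom \<C> Y Z. \<forall>h \<in> Hom \<C> Y Z. Comp \<C> X Y Z g f = Comp \<C> X Y Z h f \<longrightarrow> g = h)"

definition is_zero_obj :: "('o, 'm) cat \<Rightarrow> 'o \<Rightarrow> bool" where
  "is_zero_obj \<C> O' \<longleftrightarrow> O' \<in> Obj \<C> \<and>
     (\<forall>X \<in> Obj \<C>. (\<exists>!f. f \<in> Hom \<C> O' X) \<and> (\<exists>!f. f \<in> Hom \<C> X O'))"

definition is_zero_mor :: "('o, 'm) cat \<Rightarrow> 'o \<Rightarrow> 'o \<Rightarrow> 'm \<Rightarrow> bool" where
  "is_zero_mor \<C> X Y f \<longleftrightarrow>
     (\<exists>O'. is_zero_obj \<C> O' \<and> (\<exists>g \<in> Hom \<C> X O'. \<exists>h \<in> Hom \<C> O' Y. f = Comp \<C> X O' Y h g))"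

definition is_kernel :: "('o, 'm) cat \<Rightarrow> 'o \<Rightarrow> 'o \<Rightarrow> 'm \<Rightarrow> 'o \<Rightarrow> 'm \<Rightarrow> bool" where
  "is_kernel \<C> X Y f K k \<longleftrightarrow>
     K \<in> Obj \<C> \<and> k \<in> Hom \<C> K X \<and> is_zero_mor \<C> K Y (Comp \<C> K X Y f k) \<and>
     (\<forall>W \<in> Obj \<C>. \<forall>g \<in> Hom \<C> W X. is_zero_mor \<C> W Y (Comp \<C> W X Y f g) \<longrightarrow>
        (\<exists>!u. u \<in> Hom \<C> W K \<and> Comp \<C> W K X k u = g))"

definition is_cokernel :: "('o, 'm) cat \<Rightarrow> 'o \<Rightarrow> 'o \<Rightarrow> 'm \<Rightarrow> 'o \<Rightarrow> 'm \<Rightarrow> bool" where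
  "is_cokernel \<C> X Y f Q q \<longleftrightarrow>
     Q \<in> Obj \<C> \<and> q \<in> Hom \<C> Y Q \<and> is_zero_mor \<C> X Q (Comp \<C> X Y Q q f) \<and>
     (\<forall>W \<in> Obj \<C>. \<forall>g \<in> Hom \<C> Y W. is_zero_mor \<C> X W (Comp \<C> X Y W g f) \<longrightarrow>
        (\<exists>!u. u \<in> Hom \<C> Q W \<and> Comp \<C> Y Q W u q = g))"

definition is_binary_product :: "('o, 'm) cat \<Rightarrow> 'o \<Rightarrow> 'o \<Rightarrow> 'o \<Rightarrow> 'm \<Rightarrow> 'm \<Rightarrow> bool" where
  "is_binary_product \<C> X Y P p q \<longleftrightarrow>
     P \<in> Obj \<C> \<and> p \<in> Hom \<C> P X \<and> q \<in> Hom \<C> P Y \<and>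
     (\<forall>W \<in> Obj \<C>. \<forall>f \<in> Hom \<C> W X. \<forall>g \<in> Hom \<C> W Y.
        \<exists>!u. u \<in> Hom \<C> W P \<and> Comp \<C> W P X p u = f \<and> Comp \<C> W P Y q u = g)"

definition is_binary_coproduct :: "('o, 'm) cat \<Rightarrow> 'o \<Rightarrow> 'o \<Rightarrow> 'o \<Rightarrow> 'm \<Rightarrow> 'm \<Rightarrow> bool" where
  "is_binary_coproduct \<C> X Y P i j \<longleftrightarrow>
     P \<in> Obj \<C> \<and> i \<in> Hom \<C> X P \<and> j \<in> Hom \<C> Y P \<and>
     (\<forall>W \<in> Obj \<C>. \<forall>f \<in> Hom \<C> X W. \<forall>g \<in> Hom \<C> Y W.
        \<exists>!u. u \<in> Hom \<C> P W \<and> Comp \<C> X P W u i = f \<and> Comp \<C> Y P W u j = g)"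

text \<open>
  Freyd's axioms. They make no reference to an addition of maps; the additive structure is
  determined by them.
\<close>

definition is_abelian :: "('o, 'm) cat \<Rightarrow> bool" where
  "is_abelian \<C> \<longleftrightarrow> category \<C> \<and>
     (\<exists>O'. is_zero_obj \<C> O') \<and>
     (\<forall>X \<in> Obj \<C>. \<forall>Y \<in> Obj \<C>. \<exists>P p q. is_binary_product \<C> X Y P p q) \<and>
     (\<forall>X \<in> Obj \<C>. \<forall>Y \<in> Obj \<C>. \<exists>P i j. is_binary_coproduct \<C> X Y P i j) \<and>
     (\<forall>X \<in> Obj \<C>. \<forall>Y \<in> Obj \<C>. \<forall>f \<in> Hom \<C> X Y. \<exists>K k. is_kernel \<C> X Y f K k) \<and>
     (\<forall>X \<in> Obj \<C>. \<forall>Y \<in> Obj \<C>. \<forall>f \<in> Hom \<C> X Y. \<exists>Q q. is_cokernel \<C> X Y f Q q) \<and>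
     (\<forall>X \<in> Obj \<C>. \<forall>Y \<in> Obj \<C>. \<forall>f. is_mono \<C> X Y f \<longrightarrow>
        (\<exists>Z \<in> Obj \<C>. \<exists>g \<in> Hom \<C> Y Z. is_kernel \<C> Y Z g X f)) \<and>
     (\<forall>X \<in> Obj \<C>. \<forall>Y \<in> Obj \<C>. \<forall>f. is_epi \<C> X Y f \<longrightarrow>
        (\<exists>W \<in> Obj \<C>. \<exists>g \<in> Hom \<C> W X. is_cokernel \<C> W X g Y f))"

definition is_short_exact :: "('o, 'm) cat \<Rightarrow> 'o \<Rightarrow> 'o \<Rightarrow> 'o \<Rightarrow> 'm \<Rightarrow> 'm \<Rightarrow> bool" where
  "is_short_exact \<C> X Y Z f g \<longleftrightarrow> is_kernel \<C> Y Z g X f \<and> is_cokernel \<C> X Y f Z g"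

subsection \<open>Grothendieck categories\<close>

definition is_coproduct ::
  "('o, 'm) cat \<Rightarrow> 'i set \<Rightarrow> ('i \<Rightarrow> 'o) \<Rightarrow> 'o \<Rightarrow> ('i \<Rightarrow> 'm) \<Rightarrow> bool" where
  "is_coproduct \<C> I X P e \<longleftrightarrow>
     P \<in> Obj \<C> \<and> (\<forall>i \<in> I. e i \<in> Hom \<C> (X i) P) \<and>
     (\<forall>W \<in> Obj \<C>. \<forall>f. (\<forall>i \<in> I. f i \<in> Hom \<C> (X i) W) \<longrightarrow>
        (\<exists>!u. u \<in> Hom \<C> P W \<and> (\<forall>i \<in> I. Comp \<C> (X i) P W u (e i) = f i)))"

definition directed_set :: "'i set \<Rightarrow> ('i \<Rightarrow> 'i \<Rightarrow> bool) \<Rightarrow> bool" where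
  "directed_set I lq \<longleftrightarrow> I \<noteq> {} \<and> (\<forall>i \<in> I. lq i i) \<and>
     (\<forall>i \<in> I. \<forall>j \<in> I. \<forall>k \<in> I. lq i j \<longrightarrow> lq j k \<longrightarrow> lq i k) \<and>
     (\<forall>i \<in> I. \<forall>j \<in> I. \<exists>k \<in> I. lq i k \<and> lq j k)"

definition is_direct_system ::
  "('o, 'm) cat \<Rightarrow> 'i set \<Rightarrow> ('i \<Rightarrow> 'i \<Rightarrow> bool) \<Rightarrow> ('i \<Rightarrow> 'o) \<Rightarrow> ('i \<Rightarrow> 'i \<Rightarrow> 'm) \<Rightarrow> bool" where
  "is_direct_system \<C> I lq X t \<longleftrightarrow>
     (\<forall>i \<in> I. X i \<in> Obj \<C> \<and> t i i = Ident \<C> (X i)) \<and>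
     (\<forall>i \<in> I. \<forall>j \<in> I. lq i j \<longrightarrow> t i j \<in> Hom \<C> (X i) (X j)) \<and>
     (\<forall>i \<in> I. \<forall>j \<in> I. \<forall>k \<in> I. lq i j \<longrightarrow> lq j k \<longrightarrow>
        t i k = Comp \<C> (X i) (X j) (X k) (t j k) (t i j))"

definition is_system_map ::
  "('o, 'm) cat \<Rightarrow> 'i set \<Rightarrow> ('i \<Rightarrow> 'i \<Rightarrow> bool) \<Rightarrow> ('i \<Rightarrow> 'o) \<Rightarrow> ('i \<Rightarrow> 'i \<Rightarrow> 'm) \<Rightarrow>
     ('i \<Rightarrow> 'o) \<Rightarrow> ('i \<Rightarrow> 'i \<Rightarrow> 'm) \<Rightarrow> ('i \<Rightarrow> 'm) \<Rightarrow> bool" where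
  "is_system_map \<C> I lq X t Y s f \<longleftrightarrow>
     (\<forall>i \<in> I. f i \<in> Hom \<C> (X i) (Y i)) \<and>
     (\<forall>i \<in> I. \<forall>j \<in> I. lq i j \<longrightarrow>
        Comp \<C> (X i) (X j) (Y j) (f j) (t i j) = Comp \<C> (X i) (Y i) (Y j) (s i j) (f i))"

definition is_direct_limit ::
  "('o, 'm) cat \<Rightarrow> 'i set \<Rightarrow> ('i \<Rightarrow> 'i \<Rightarrow> bool) \<Rightarrow> ('i \<Rightarrow> 'o) \<Rightarrow> ('i \<Rightarrow> 'i \<Rightarrow> 'm) \<Rightarrow>
     'o \<Rightarrow> ('i \<Rightarrow> 'm) \<Rightarrow> bool" where
  "is_direct_limit \<C> I lq X t L l \<longleftrightarrow>
     L \<in> Obj \<C> \<and> (\<forall>i \<in> I. l i \<in> Hom \<C> (X i) L) \<and>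
     (\<forall>i \<in> I. \<forall>j \<in> I. lq i j \<longrightarrow> Comp \<C> (X i) (X j) L (l j) (t i j) = l i) \<and>
     (\<forall>W \<in> Obj \<C>. \<forall>w. (\<forall>i \<in> I. w i \<in> Hom \<C> (X i) W) \<and>
        (\<forall>i \<in> I. \<forall>j \<in> I. lq i j \<longrightarrow> Comp \<C> (X i) (X j) W (w j) (t i j) = w i) \<longrightarrow>
        (\<exists>!u. u \<in> Hom \<C> L W \<and> (\<forall>i \<in> I. Comp \<C> (X i) L W u (l i) = w i)))"

text \<open>Throughout, \<open>U\<close> is the collection of the index sets that count as small.\<close>

definition has_small_coproducts :: "'i set set \<Rightarrow> ('o, 'm) cat \<Rightarrow> bool" where
  "has_small_coproducts U \<C> \<longleftrightarrow>
     (\<forall>I \<in> U. \<forall>X. (\<forall>i \<in> I. X i \<in> Obj \<C>) \<longrightarrow> (\<exists>P e. is_coproduct \<C> I X P e))"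

definition has_exact_direct_limits :: "'i set set \<Rightarrow> ('o, 'm) cat \<Rightarrow> bool" where
  "has_exact_direct_limits U \<C> \<longleftrightarrow>
     (\<forall>I \<in> U. \<forall>lq X t Y s Z r f g L l M m N n \<phi> \<gamma>.
        directed_set I lq \<longrightarrow>
        is_direct_system \<C> I lq X t \<longrightarrow> is_direct_system \<C> I lq Y s \<longrightarrow> is_direct_system \<C> I lq Z r \<longrightarrow>
        is_system_map \<C> I lq X t Y s f \<longrightarrow> is_system_map \<C> I lq Y s Z r g \<longrightarrow>
        (\<forall>i \<in> I. is_short_exact \<C> (X i) (Y i) (Z i) (f i) (g i)) \<longrightarrow>
        is_direct_limit \<C> I lq X t L l \<longrightarrow> is_direct_limit \<C> I lq Y s M m \<longrightarrow>
        is_direct_limit \<C> I lq Z r N n \<longrightarrow>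
        \<phi> \<in> Hom \<C> L M \<longrightarrow> (\<forall>i \<in> I. Comp \<C> (X i) L M \<phi> (l i) = Comp \<C> (X i) (Y i) M (m i) (f i)) \<longrightarrow>
        \<gamma> \<in> Hom \<C> M N \<longrightarrow> (\<forall>i \<in> I. Comp \<C> (Y i) M N \<gamma> (m i) = Comp \<C> (Y i) (Z i) N (n i) (g i)) \<longrightarrow>
        is_short_exact \<C> L M N \<phi> \<gamma>)"

definition is_generator :: "('o, 'm) cat \<Rightarrow> 'o \<Rightarrow> bool" where
  "is_generator \<C> G \<longleftrightarrow> G \<in> Obj \<C> \<and>
     (\<forall>X \<in> Obj \<C>. \<forall>Y \<in> Obj \<C>. \<forall>f \<in> Hom \<C> X Y. \<forall>g \<in> Hom \<C> X Y. f \<noteq> g \<longrightarrow>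
        (\<exists>h \<in> Hom \<C> G X. Comp \<C> G X Y f h \<noteq> Comp \<C> G X Y g h))"

definition is_Grothendieck :: "'i set set \<Rightarrow> ('o, 'm) cat \<Rightarrow> bool" where
  "is_Grothendieck U \<C> \<longleftrightarrow>
     is_abelian \<C> \<and> has_small_coproducts U \<C> \<and> has_exact_direct_limits U \<C> \<and>
     (\<exists>G. is_generator \<C> G)"

definition is_injective_obj :: "('o, 'm) cat \<Rightarrow> 'o \<Rightarrow> bool" where
  "is_injective_obj \<C> E \<longleftrightarrow> E \<in> Obj \<C> \<and>
     (\<forall>X \<in> Obj \<C>. \<forall>Y \<in> Obj \<C>. \<forall>i f. is_mono \<C> X Y i \<longrightarrow> f \<in> Hom \<C> X E \<longrightarrow>
        (\<exists>g \<in> Hom \<C> Y E. Comp \<C> X Y E g i = f))"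

definition has_enough_injectives :: "('o, 'm) cat \<Rightarrow> bool" where
  "has_enough_injectives \<C> \<longleftrightarrow>
     (\<forall>X \<in> Obj \<C>. \<exists>E i. is_injective_obj \<C> E \<and> is_mono \<C> X E i)"


section \<open>Modules\<close>

text \<open>
  A right module over a (not necessarily commutative) ring \<open>S\<close> is kept in the library's record of
  modules; \<open>s \<odot>\<^bsub>M\<^esub> x\<close> stands for \<open>x s\<close>, whence the order of the factors in \<open>ract_assoc\<close>. Over a
  commutative ring this agrees with the library's \<^locale>\<open>module\<close>.
\<close>

locale right_module = S: ring S + M: abelian_group M
  for S :: "('s, 'k) ring_scheme" and M :: "('s, 'm, 'l) module_scheme" +
  assumes ract_closed: "\<lbrakk>s \<in> carrier S; x \<in> carrier M\<rbrakk> \<Longrightarrow> s \<odot>\<^bsub>M\<^esub> x \<in> carrier M"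
    and ract_l_distr: "\<lbrakk>s \<in> carrier S; t \<in> carrier S; x \<in> carrier M\<rbrakk>
      \<Longrightarrow> (s \<oplus>\<^bsub>S\<^esub> t) \<odot>\<^bsub>M\<^esub> x = s \<odot>\<^bsub>M\<^esub> x \<oplus>\<^bsub>M\<^esub> t \<odot>\<^bsub>M\<^esub> x"
    and ract_r_distr: "\<lbrakk>s \<in> carrier S; x \<in> carrier M; y \<in> carrier M\<rbrakk>
      \<Longrightarrow> s \<odot>\<^bsub>M\<^esub> (x \<oplus>\<^bsub>M\<^esub> y) = s \<odot>\<^bsub>M\<^esub> x \<oplus>\<^bsub>M\<^esub> s \<odot>\<^bsub>M\<^esub> y"
    and ract_assoc: "\<lbrakk>s \<in> carrier S; t \<in> carrier S; x \<in> carrier M\<rbrakk>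
      \<Longrightarrow> (s \<otimes>\<^bsub>S\<^esub> t) \<odot>\<^bsub>M\<^esub> x = t \<odot>\<^bsub>M\<^esub> (s \<odot>\<^bsub>M\<^esub> x)"
    and ract_one: "x \<in> carrier M \<Longrightarrow> \<one>\<^bsub>S\<^esub> \<odot>\<^bsub>M\<^esub> x = x"

text \<open>Linear maps are extensional functions, so that two of them are equal iff they agree on the carrier.\<close>

definition lin_maps ::
  "('s, 'k) ring_scheme \<Rightarrow> ('s, 'm, 'x) module_scheme \<Rightarrow> ('s, 'n, 'y) module_scheme \<Rightarrow> ('m \<Rightarrow> 'n) set" where
  "lin_maps S M N = {f \<in> carrier M \<rightarrow>\<^sub>E carrier N.
     (\<forall>x \<in> carrier M. \<forall>y \<in> carrier M. f (x \<oplus>\<^bsub>M\<^esub> y) = f x \<oplus>\<^bsub>N\<^esub> f y) \<and>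
     (\<forall>s \<in> carrier S. \<forall>x \<in> carrier M. f (s \<odot>\<^bsub>M\<^esub> x) = s \<odot>\<^bsub>N\<^esub> f x)}"

definition self_module :: "('r, 'k) ring_scheme \<Rightarrow> ('r, 'r) module" where
  "self_module R = \<lparr>carrier = carrier R, monoid.mult = monoid.mult R, monoid.one = monoid.one R,
     ring.zero = ring.zero R, ring.add = ring.add R, smult = monoid.mult R\<rparr>"

definition restrict_scalars :: "('r \<Rightarrow> 's) \<Rightarrow> ('s, 'm, 'x) module_scheme \<Rightarrow> ('r, 'm) module" where
  "restrict_scalars h M = \<lparr>carrier = carrier M, monoid.mult = monoid.mult M, monoid.one = monoid.one M,
     ring.zero = ring.zero M, ring.add = ring.add M, smult = (\<lambda>r x. h r \<odot>\<^bsub>M\<^esub> x)\<rparr>"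

definition direct_power :: "'i set \<Rightarrow> ('s, 'm, 'x) module_scheme \<Rightarrow> ('s, 'i \<Rightarrow> 'm) module" where
  "direct_power I K =
     \<lparr>carrier = {f \<in> I \<rightarrow>\<^sub>E carrier K. finite {i \<in> I. f i \<noteq> \<zero>\<^bsub>K\<^esub>}},
      monoid.mult = undefined, monoid.one = undefined,
      ring.zero = (\<lambda>i\<in>I. \<zero>\<^bsub>K\<^esub>),
      ring.add = (\<lambda>f g. \<lambda>i\<in>I. f i \<oplus>\<^bsub>K\<^esub> g i),
      smult = (\<lambda>s f. \<lambda>i\<in>I. s \<odot>\<^bsub>K\<^esub> f i)\<rparr>"

definition quotient_module :: "('s, 'm, 'x) module_scheme \<Rightarrow> 'm set \<Rightarrow> ('s, 'm set) module" where
  "quotient_module M N =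
     \<lparr>carrier = a_rcosets\<^bsub>M\<^esub> N,
      monoid.mult = undefined, monoid.one = undefined,
      ring.zero = N,
      ring.add = (\<lambda>X Y. X <+>\<^bsub>M\<^esub> Y),
      smult = (\<lambda>s X. \<Union>x\<in>X. N +>\<^bsub>M\<^esub> (s \<odot>\<^bsub>M\<^esub> x))\<rparr>"

definition mod_isomorphic ::
  "('s, 'k) ring_scheme \<Rightarrow> ('s, 'm, 'x) module_scheme \<Rightarrow> ('s, 'n, 'y) module_scheme \<Rightarrow> bool" where
  "mod_isomorphic S M N \<longleftrightarrow> (\<exists>f \<in> lin_maps S M N. bij_betw f (carrier M) (carrier N))"

definition mod_span :: "('s, 'k) ring_scheme \<Rightarrow> ('s, 'm, 'x) module_scheme \<Rightarrow> 'm set \<Rightarrow> 'm set" where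
  "mod_span S M X = \<Inter>{N. submodule N S M \<and> X \<subseteq> N}"

definition fin_gen :: "('s, 'k) ring_scheme \<Rightarrow> ('s, 'm, 'x) module_scheme \<Rightarrow> bool" where
  "fin_gen S M \<longleftrightarrow> (\<exists>X. finite X \<and> X \<subseteq> carrier M \<and> mod_span S M X = carrier M)"

subsection \<open>Tensor products over a commutative ring\<close>

type_synonym ('m, 'n) tens = "(('m \<times> 'n) \<Rightarrow>\<^sub>0 int) set"

text \<open>
  \<open>M \<otimes>\<^sub>R N\<close> is the free abelian group on the pairs modulo the subgroup generated by biadditivity
  and by the balancing relation \<open>(r x, y) \<sim> (x, r y)\<close>; its elements are cosets.
\<close>

definition tensor_relations ::
  "('r, 'k) ring_scheme \<Rightarrow> ('r, 'm, 'x) module_scheme \<Rightarrow> ('r, 'n, 'y) module_scheme \<Rightarrow> ('m, 'n) tens" where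
  "tensor_relations R M N =
     generate (free_Abelian_group (carrier M \<times> carrier N))
       ({frag_of (x \<oplus>\<^bsub>M\<^esub> x', y) - frag_of (x, y) - frag_of (x', y) | x x' y.
           x \<in> carrier M \<and> x' \<in> carrier M \<and> y \<in> carrier N} \<union>
        {frag_of (x, y \<oplus>\<^bsub>N\<^esub> y') - frag_of (x, y) - frag_of (x, y') | x y y'.
           x \<in> carrier M \<and> y \<in> carrier N \<and> y' \<in> carrier N} \<union>
        {frag_of (r \<odot>\<^bsub>M\<^esub> x, y) - frag_of (x, r \<odot>\<^bsub>N\<^esub> y) | r x y.
           r \<in> carrier R \<and> x \<in> carrier M \<and> y \<in> carrier N})"

definition tensor_group ::
  "('r, 'k) ring_scheme \<Rightarrow> ('r, 'm, 'x) module_scheme \<Rightarrow> ('r, 'n, 'y) module_scheme \<Rightarrow>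
     ('m, 'n) tens monoid" where
  "tensor_group R M N = free_Abelian_group (carrier M \<times> carrier N) Mod tensor_relations R M N"

definition tensor_class ::
  "('r, 'k) ring_scheme \<Rightarrow> ('r, 'm, 'x) module_scheme \<Rightarrow> ('r, 'n, 'y) module_scheme \<Rightarrow>
     (('m \<times> 'n) \<Rightarrow>\<^sub>0 int) \<Rightarrow> ('m, 'n) tens" where
  "tensor_class R M N z =
     tensor_relations R M N #>\<^bsub>free_Abelian_group (carrier M \<times> carrier N)\<^esub> z"

definition pure_tensor ::
  "('r, 'k) ring_scheme \<Rightarrow> ('r, 'm, 'x) module_scheme \<Rightarrow> ('r, 'n, 'y) module_scheme \<Rightarrow>
     'm \<Rightarrow> 'n \<Rightarrow> ('m, 'n) tens" where
  "pure_tensor R M N x y = tensor_class R M N (frag_of (x, y))"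

definition tensor ::
  "('r, 'k) ring_scheme \<Rightarrow> ('r, 'm, 'x) module_scheme \<Rightarrow> ('r, 'n, 'y) module_scheme \<Rightarrow>
     ('r, ('m, 'n) tens) module" where
  "tensor R M N =
     \<lparr>carrier = carrier (tensor_group R M N),
      monoid.mult = undefined, monoid.one = undefined,
      ring.zero = monoid.one (tensor_group R M N),
      ring.add = monoid.mult (tensor_group R M N),
      smult = (\<lambda>r t. \<Union>z\<in>t. tensor_class R M N
                 (frag_extend (\<lambda>(x, y). frag_of (r \<odot>\<^bsub>M\<^esub> x, y)) z))\<rparr>"

text \<open>
  Sweedler sums. If \<open>b\<close> is an \<open>R\<close>-bilinear map into \<open>P\<close> and \<open>t = \<Sum> x\<^sub>i \<otimes> y\<^sub>i\<close>, then
  \<open>tsum R M N P t b = \<Sum> b x\<^sub>i y\<^sub>i\<close>: it is the value at \<open>t\<close> of the linear map induced by \<open>b\<close>.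
\<close>

definition tsum ::
  "('r, 'k) ring_scheme \<Rightarrow> ('r, 'm, 'x) module_scheme \<Rightarrow> ('r, 'n, 'y) module_scheme \<Rightarrow>
     ('r, 'p, 'z) module_scheme \<Rightarrow> ('m, 'n) tens \<Rightarrow> ('m \<Rightarrow> 'n \<Rightarrow> 'p) \<Rightarrow> 'p" where
  "tsum R M N P t b =
     (THE f. f \<in> lin_maps R (tensor R M N) P \<and>
        (\<forall>x \<in> carrier M. \<forall>y \<in> carrier N. f (pure_tensor R M N x y) = b x y)) t"

subsection \<open>Universes\<close>

text \<open>
  Category-theoretic notions need a notion of smallness. Here \<open>U\<close> consists of the small subsets of
  a type. With a base set \<open>B\<close>, \<open>U\<close> is required to be closed under passing to sets of at most the same size, under small unions, and, up to size,
  under \<open>B\<close>-th powers, and to contain a copy of \<open>B\<close>. The small sets of a Grothendieck universe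
  containing \<open>B\<close> (the sets of size \<open>< \<kappa>\<close>, for \<open>\<kappa>\<close> inaccessible and \<open>|B| < \<kappa>\<close>) satisfy this; so does
  the collection of all subsets of a type of cardinality \<open>\<lambda> \<ge> |B|\<close> with \<open>\<lambda>\<^bsup>|B|\<^esup> = \<lambda>\<close>,
  and such types exist in HOL for every \<open>B\<close>.
\<close>

definition is_universe :: "'b set \<Rightarrow> 'u set set \<Rightarrow> bool" where
  "is_universe B U \<longleftrightarrow>
     (\<forall>X \<in> U. \<forall>Y. Y \<lesssim> X \<longrightarrow> Y \<in> U) \<and>
     (\<forall>I \<in> U. \<forall>X. (\<forall>i \<in> I. X i \<in> U) \<longrightarrow> (\<Union>i\<in>I. X i) \<in> U) \<and>
     (\<forall>X \<in> U. \<exists>Y \<in> U. (B \<rightarrow>\<^sub>E X) \<lesssim> Y) \<and>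
     (\<exists>Y \<in> U. B \<lesssim> Y)"

lemma is_universe_UNIV_list_pred:
  "is_universe (B :: 'b set) (UNIV :: ('b list \<Rightarrow> bool) set set)"
proof -
  define h :: "('b \<Rightarrow> 'b list \<Rightarrow> bool) \<Rightarrow> 'b list \<Rightarrow> bool"
    where "h = (\<lambda>f l. case l of [] \<Rightarrow> False | x # xs \<Rightarrow> f x xs)"
  have "inj h"
  proof (rule injI, intro ext)
    fix f g x xs assume "h f = h g"
    from fun_cong[OF this, of "x # xs"] show "f x xs = g x xs" by (simp add: h_def)
  qed
  then have "(B \<rightarrow>\<^sub>E X) \<lesssim> (UNIV :: ('b list \<Rightarrow> bool) set)" for X :: "('b list \<Rightarrow> bool) set"
    using inj_on_subset[of h UNIV "B \<rightarrow>\<^sub>E X"] by (auto simp: lepoll_def)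
  moreover have "inj_on (\<lambda>x l. l = [x]) B"
    by (rule inj_onI) (metis list.inject)
  then have "B \<lesssim> (UNIV :: ('b list \<Rightarrow> bool) set)"
    by (auto simp: lepoll_def)
  ultimately show ?thesis
    unfolding is_universe_def by blast
qed

text \<open>
  Flatness, projectivity and local projectivity refer to all \<open>R\<close>-modules of the universe. When \<open>U\<close>
  contains copies of \<open>R\<close>, \<open>W\<close> and of \<open>\<nat>\<close>, this is the same as referring to all \<open>R\<close>-modules:
  flatness can be tested on the ideals of \<open>R\<close>, the other two on the free module on the set \<open>W\<close>.
\<close>

definition flat_module ::
  "'u set set \<Rightarrow> ('r, 'k) ring_scheme \<Rightarrow> ('r, 'w, 'x) module_scheme \<Rightarrow> bool" where
  "flat_module U R W \<longleftrightarrow>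
     (\<forall>(L :: ('r, 'u) module) (N :: ('r, 'u) module) f.
        module R L \<longrightarrow> module R N \<longrightarrow> carrier L \<in> U \<longrightarrow> carrier N \<in> U \<longrightarrow>
        f \<in> lin_maps R L N \<longrightarrow> inj_on f (carrier L) \<longrightarrow>
        inj_on (\<lambda>t. tsum R L W (tensor R N W) t (\<lambda>x w. pure_tensor R N W (f x) w))
          (carrier (tensor R L W)))"

definition projective_module ::
  "'u set set \<Rightarrow> ('r, 'k) ring_scheme \<Rightarrow> ('r, 'w, 'x) module_scheme \<Rightarrow> bool" where
  "projective_module U R W \<longleftrightarrow>
     (\<forall>(L :: ('r, 'u) module) (N :: ('r, 'u) module) p g.
        module R L \<longrightarrow> module R N \<longrightarrow> carrier L \<in> U \<longrightarrow> carrier N \<in> U \<longrightarrow>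
        p \<in> lin_maps R L N \<longrightarrow> p ` carrier L = carrier N \<longrightarrow> g \<in> lin_maps R W N \<longrightarrow>
        (\<exists>g' \<in> lin_maps R W L. \<forall>w \<in> carrier W. p (g' w) = g w))"

definition locally_projective_module ::
  "'u set set \<Rightarrow> ('r, 'k) ring_scheme \<Rightarrow> ('r, 'w, 'x) module_scheme \<Rightarrow> bool" where
  "locally_projective_module U R W \<longleftrightarrow>
     (\<forall>(L :: ('r, 'u) module) (N :: ('r, 'u) module) p g F.
        module R L \<longrightarrow> module R N \<longrightarrow> carrier L \<in> U \<longrightarrow> carrier N \<in> U \<longrightarrow>
        p \<in> lin_maps R L N \<longrightarrow> p ` carrier L = carrier N \<longrightarrow> g \<in> lin_maps R W N \<longrightarrow>
        submodule F R W \<longrightarrow> fin_gen R (W\<lparr>carrier := F\<rparr>) \<longrightarrow>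
        (\<exists>g' \<in> lin_maps R W L. \<forall>w \<in> F. p (g' w) = g w))"

subsection \<open>The category of right modules\<close>

text \<open>
  The components of a record that carry no information are fixed, so that a right module one object
  and not many. This matters because isomorphisms of categories are bijective on objects.
\<close>

definition standard_module :: "('s, 'k) ring_scheme \<Rightarrow> ('s, 'm, 'x) module_scheme \<Rightarrow> bool" where
  "standard_module S M \<longleftrightarrow>
     monoid.mult M = undefined \<and> monoid.one M = undefined \<and>
     (\<forall>x y. \<not> (x \<in> carrier M \<and> y \<in> carrier M) \<longrightarrow> x \<oplus>\<^bsub>M\<^esub> y = undefined) \<and>
     (\<forall>s x. \<not> (s \<in> carrier S \<and> x \<in> carrier M) \<longrightarrow> s \<odot>\<^bsub>M\<^esub> x = undefined)"

definition mod_cat :: "'u set set \<Rightarrow> ('s, 'k) ring_scheme \<Rightarrow> (('s, 'u) module, 'u \<Rightarrow> 'u) cat" where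
  "mod_cat U S =
     \<lparr>Obj = {M. right_module S M \<and> standard_module S M \<and> carrier M \<in> U},
      Hom = (\<lambda>M N. lin_maps S M N),
      Ident = (\<lambda>M. \<lambda>x\<in>carrier M. x),
      Comp = (\<lambda>L M N g f. compose (carrier L) g f)\<rparr>"

definition subgenerated ::
  "'u set set \<Rightarrow> ('s, 'k) ring_scheme \<Rightarrow> ('s, 'p, 'x) module_scheme \<Rightarrow> ('s, 'm, 'y) module_scheme \<Rightarrow> bool"
where
  "subgenerated U S K M \<longleftrightarrow>
     (\<exists>I \<in> U. \<exists>N H. submodule N S (direct_power I K) \<and>
        submodule H S (quotient_module (direct_power I K) N) \<and>
        mod_isomorphic S M ((quotient_module (direct_power I K) N)\<lparr>carrier := H\<rparr>))"

definition sigma_cat ::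
  "'u set set \<Rightarrow> ('s, 'k) ring_scheme \<Rightarrow> ('s, 'p, 'x) module_scheme \<Rightarrow> (('s, 'u) module, 'u \<Rightarrow> 'u) cat"
where
  "sigma_cat U S K = full_subcat (mod_cat U S) (subgenerated U S K)"


section \<open>Entwining structures\<close>

text \<open>The library's \<^locale>\<open>algebra\<close> is commutative.\<close>

locale R_algebra = module R A + A: ring A
  for R :: "('r, 'k) ring_scheme" and A :: "('r, 'a, 'x) module_scheme" +
  assumes smult_mult_left: "\<lbrakk>r \<in> carrier R; a \<in> carrier A; b \<in> carrier A\<rbrakk>
      \<Longrightarrow> (r \<odot>\<^bsub>A\<^esub> a) \<otimes>\<^bsub>A\<^esub> b = r \<odot>\<^bsub>A\<^esub> (a \<otimes>\<^bsub>A\<^esub> b)"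
    and smult_mult_right: "\<lbrakk>r \<in> carrier R; a \<in> carrier A; b \<in> carrier A\<rbrakk>
      \<Longrightarrow> a \<otimes>\<^bsub>A\<^esub> (r \<odot>\<^bsub>A\<^esub> b) = r \<odot>\<^bsub>A\<^esub> (a \<otimes>\<^bsub>A\<^esub> b)"

text \<open>Iterated tensor products are bracketed to the right.\<close>

locale R_coalgebra = module R C
  for R :: "('r, 'k) ring_scheme" and C :: "('r, 'c, 'x) module_scheme" +
  fixes \<Delta> :: "'c \<Rightarrow> ('c, 'c) tens" and \<epsilon> :: "'c \<Rightarrow> 'r"
  assumes comult_linear: "\<Delta> \<in> lin_maps R C (tensor R C C)"
    and counit_linear: "\<epsilon> \<in> lin_maps R C (self_module R)"
    and coassoc: "c \<in> carrier C \<Longrightarrow>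
      tsum R C C (tensor R C (tensor R C C)) (\<Delta> c)
        (\<lambda>c1 c2. pure_tensor R C (tensor R C C) c1 (\<Delta> c2)) =
      tsum R C C (tensor R C (tensor R C C)) (\<Delta> c)
        (\<lambda>c1 c2. tsum R C C (tensor R C (tensor R C C)) (\<Delta> c1)
          (\<lambda>c11 c12. pure_tensor R C (tensor R C C) c11 (pure_tensor R C C c12 c2)))"
    and counit_left: "c \<in> carrier C \<Longrightarrow> tsum R C C C (\<Delta> c) (\<lambda>c1 c2. \<epsilon> c1 \<odot>\<^bsub>C\<^esub> c2) = c"
    and counit_right: "c \<in> carrier C \<Longrightarrow> tsum R C C C (\<Delta> c) (\<lambda>c1 c2. \<epsilon> c2 \<odot>\<^bsub>C\<^esub> c1) = c"

locale entwining = R_algebra R A + R_coalgebra R C \<Delta> \<epsilon>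
  for R :: "('r, 'k) ring_scheme" and A :: "('r, 'a, 'x) module_scheme"
    and C :: "('r, 'c, 'y) module_scheme"
    and \<Delta> :: "'c \<Rightarrow> ('c, 'c) tens" and \<epsilon> :: "'c \<Rightarrow> 'r" +
  fixes \<psi> :: "('c, 'a) tens \<Rightarrow> ('a, 'c) tens"
  assumes entwining_linear: "\<psi> \<in> lin_maps R (tensor R C A) (tensor R A C)"
    and entwining_mult: "\<lbrakk>c \<in> carrier C; a \<in> carrier A; a' \<in> carrier A\<rbrakk> \<Longrightarrow>
      \<psi> (pure_tensor R C A c (a \<otimes>\<^bsub>A\<^esub> a')) =
      tsum R A C (tensor R A C) (\<psi> (pure_tensor R C A c a))
        (\<lambda>b d. tsum R A C (tensor R A C) (\<psi> (pure_tensor R C A d a'))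
          (\<lambda>b' d'. pure_tensor R A C (b \<otimes>\<^bsub>A\<^esub> b') d'))"
    and entwining_one: "c \<in> carrier C \<Longrightarrow>
      \<psi> (pure_tensor R C A c \<one>\<^bsub>A\<^esub>) = pure_tensor R A C \<one>\<^bsub>A\<^esub> c"
    and entwining_comult: "\<lbrakk>c \<in> carrier C; a \<in> carrier A\<rbrakk> \<Longrightarrow>
      tsum R A C (tensor R A (tensor R C C)) (\<psi> (pure_tensor R C A c a))
        (\<lambda>b d. pure_tensor R A (tensor R C C) b (\<Delta> d)) =
      tsum R C C (tensor R A (tensor R C C)) (\<Delta> c)
        (\<lambda>c1 c2. tsum R A C (tensor R A (tensor R C C)) (\<psi> (pure_tensor R C A c2 a))
          (\<lambda>b d2. tsum R A C (tensor R A (tensor R C C)) (\<psi> (pure_tensor R C A c1 b))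
            (\<lambda>b' d1. pure_tensor R A (tensor R C C) b' (pure_tensor R C C d1 d2))))"
    and entwining_counit: "\<lbrakk>c \<in> carrier C; a \<in> carrier A\<rbrakk> \<Longrightarrow>
      tsum R A C A (\<psi> (pure_tensor R C A c a)) (\<lambda>b d. \<epsilon> d \<odot>\<^bsub>A\<^esub> b) = \<epsilon> c \<odot>\<^bsub>A\<^esub> a"

subsection \<open>Entwined modules\<close>

text \<open>The \<open>R\<close>-module underlying a right \<open>A\<close>-module, along \<open>r \<mapsto> r 1\<^sub>A\<close>.\<close>

definition base_module ::
  "('r, 'a, 'x) module_scheme \<Rightarrow> ('a, 'm, 'y) module_scheme \<Rightarrow> ('r, 'm) module" where
  "base_module A M = restrict_scalars (\<lambda>r. r \<odot>\<^bsub>A\<^esub> \<one>\<^bsub>A\<^esub>) M"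

record ('a, 'm, 'c) coact_module = "('a, 'm) module" +
  coact :: "'m \<Rightarrow> ('m, 'c) tens"

locale entwined_module = right_module A M
  for R :: "('r, 'k) ring_scheme" and A :: "('r, 'a, 'x) module_scheme"
    and C :: "('r, 'c, 'y) module_scheme"
    and \<Delta> :: "'c \<Rightarrow> ('c, 'c) tens" and \<epsilon> :: "'c \<Rightarrow> 'r"
    and \<psi> :: "('c, 'a) tens \<Rightarrow> ('a, 'c) tens"
    and M :: "('a, 'm, 'c) coact_module" +
  assumes coact_linear: "coact M \<in> lin_maps R (base_module A M) (tensor R (base_module A M) C)"
    and coact_coassoc: "m \<in> carrier M \<Longrightarrow>
      tsum R (base_module A M) C (tensor R (base_module A M) (tensor R C C)) (coact M m)
        (\<lambda>x c. pure_tensor R (base_module A M) (tensor R C C) x (\<Delta> c)) =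
      tsum R (base_module A M) C (tensor R (base_module A M) (tensor R C C)) (coact M m)
        (\<lambda>x c. tsum R (base_module A M) C (tensor R (base_module A M) (tensor R C C)) (coact M x)
          (\<lambda>x' c'. pure_tensor R (base_module A M) (tensor R C C) x' (pure_tensor R C C c' c)))"
    and coact_counit: "m \<in> carrier M \<Longrightarrow>
      tsum R (base_module A M) C (base_module A M) (coact M m)
        (\<lambda>x c. \<epsilon> c \<odot>\<^bsub>base_module A M\<^esub> x) = m"
    and coact_entwined: "\<lbrakk>m \<in> carrier M; a \<in> carrier A\<rbrakk> \<Longrightarrow>
      coact M (a \<odot>\<^bsub>M\<^esub> m) =
      tsum R (base_module A M) C (tensor R (base_module A M) C) (coact M m)
        (\<lambda>x c. tsum R A C (tensor R (base_module A M) C) (\<psi> (pure_tensor R C A c a))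
          (\<lambda>b d. pure_tensor R (base_module A M) C (b \<odot>\<^bsub>M\<^esub> x) d))"

definition entwined_maps ::
  "('r, 'k) ring_scheme \<Rightarrow> ('r, 'a, 'x) module_scheme \<Rightarrow> ('r, 'c, 'y) module_scheme \<Rightarrow>
     ('a, 'm, 'c) coact_module \<Rightarrow> ('a, 'n, 'c) coact_module \<Rightarrow> ('m \<Rightarrow> 'n) set" where
  "entwined_maps R A C M N = {f \<in> lin_maps A M N. \<forall>m \<in> carrier M.
     coact N (f m) =
     tsum R (base_module A M) C (tensor R (base_module A N) C) (coact M m)
       (\<lambda>x c. pure_tensor R (base_module A N) C (f x) c)}"

text \<open>
  \<open>M\<^sub>A\<^sup>C(\<psi>)\<close>. The coaction needs no condition outside the carrier, being extensional
  by \<open>coact_linear\<close>.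
\<close>

definition entwined_cat ::
  "'u set set \<Rightarrow> ('r, 'k) ring_scheme \<Rightarrow> ('r, 'a, 'x) module_scheme \<Rightarrow> ('r, 'c, 'y) module_scheme \<Rightarrow>
     ('c \<Rightarrow> ('c, 'c) tens) \<Rightarrow> ('c \<Rightarrow> 'r) \<Rightarrow> (('c, 'a) tens \<Rightarrow> ('a, 'c) tens) \<Rightarrow>
     (('a, 'u, 'c) coact_module, 'u \<Rightarrow> 'u) cat" where
  "entwined_cat U R A C \<Delta> \<epsilon> \<psi> =
     \<lparr>Obj = {M. entwined_module R A C \<Delta> \<epsilon> \<psi> M \<and> standard_module A M \<and> carrier M \<in> U},
      Hom = (\<lambda>M N. entwined_maps R A C M N),
      Ident = (\<lambda>M. \<lambda>x\<in>carrier M. x),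
      Comp = (\<lambda>L M N g f. compose (carrier L) g f)\<rparr>"

subsection \<open>The ring \<open>#\<^sub>\<psi>\<^sup>o\<^sup>p(C,A)\<close> and its modules\<close>

definition smash_op ::
  "('r, 'k) ring_scheme \<Rightarrow> ('r, 'a, 'x) module_scheme \<Rightarrow> ('r, 'c, 'y) module_scheme \<Rightarrow>
     ('c \<Rightarrow> ('c, 'c) tens) \<Rightarrow> ('c \<Rightarrow> 'r) \<Rightarrow> (('c, 'a) tens \<Rightarrow> ('a, 'c) tens) \<Rightarrow> ('c \<Rightarrow> 'a) ring" where
  "smash_op R A C \<Delta> \<epsilon> \<psi> =
     \<lparr>carrier = lin_maps R C A,
      monoid.mult = (\<lambda>f g. \<lambda>c\<in>carrier C. tsum R C C A (\<Delta> c)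
        (\<lambda>c1 c2. tsum R A C A (\<psi> (pure_tensor R C A c1 (f c2))) (\<lambda>b d. b \<otimes>\<^bsub>A\<^esub> g d))),
      monoid.one = (\<lambda>c\<in>carrier C. \<epsilon> c \<odot>\<^bsub>A\<^esub> \<one>\<^bsub>A\<^esub>),
      ring.zero = (\<lambda>c\<in>carrier C. \<zero>\<^bsub>A\<^esub>),
      ring.add = (\<lambda>f g. \<lambda>c\<in>carrier C. f c \<oplus>\<^bsub>A\<^esub> g c)\<rparr>"

definition smash_unit_map ::
  "('r, 'a, 'x) module_scheme \<Rightarrow> ('r, 'c, 'y) module_scheme \<Rightarrow> ('c \<Rightarrow> 'r) \<Rightarrow> 'a \<Rightarrow> 'c \<Rightarrow> 'a" where
  "smash_unit_map A C \<epsilon> a = (\<lambda>c\<in>carrier C. \<epsilon> c \<odot>\<^bsub>A\<^esub> a)"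

definition smash_rational ::
  "('r, 'k) ring_scheme \<Rightarrow> ('r, 'a, 'x) module_scheme \<Rightarrow> ('r, 'c, 'y) module_scheme \<Rightarrow>
     ('c \<Rightarrow> 'r) \<Rightarrow> ('c \<Rightarrow> 'a, 'm, 'z) module_scheme \<Rightarrow> bool" where
  "smash_rational R A C \<epsilon> M \<longleftrightarrow>
     (let M\<^sub>A = restrict_scalars (smash_unit_map A C \<epsilon>) M; M\<^sub>R = base_module A M\<^sub>A in
      \<forall>m \<in> carrier M. \<exists>t \<in> carrier (tensor R M\<^sub>R C). \<forall>f \<in> lin_maps R C A.
        f \<odot>\<^bsub>M\<^esub> m = tsum R M\<^sub>R C M\<^sub>R t (\<lambda>x c. f c \<odot>\<^bsub>M\<^sub>A\<^esub> x))"

definition rational_cat ::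
  "'u set set \<Rightarrow> ('r, 'k) ring_scheme \<Rightarrow> ('r, 'a, 'x) module_scheme \<Rightarrow> ('r, 'c, 'y) module_scheme \<Rightarrow>
     ('c \<Rightarrow> ('c, 'c) tens) \<Rightarrow> ('c \<Rightarrow> 'r) \<Rightarrow> (('c, 'a) tens \<Rightarrow> ('a, 'c) tens) \<Rightarrow>
     (('c \<Rightarrow> 'a, 'u) module, 'u \<Rightarrow> 'u) cat" where
  "rational_cat U R A C \<Delta> \<epsilon> \<psi> =
     full_subcat (mod_cat U (smash_op R A C \<Delta> \<epsilon> \<psi>)) (smash_rational R A C \<epsilon>)"

text \<open>The right \<open>A\<close>-action on the coring \<open>A \<otimes>\<^sub>R C\<close>, and the action of \<open>#\<^sub>\<psi>\<^sup>o\<^sup>p(C,A)\<close> derived from it.\<close>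

definition coring_ract ::
  "('r, 'k) ring_scheme \<Rightarrow> ('r, 'a, 'x) module_scheme \<Rightarrow> ('r, 'c, 'y) module_scheme \<Rightarrow>
     (('c, 'a) tens \<Rightarrow> ('a, 'c) tens) \<Rightarrow> ('a, 'c) tens \<Rightarrow> 'a \<Rightarrow> ('a, 'c) tens" where
  "coring_ract R A C \<psi> t a =
     tsum R A C (tensor R A C) t
       (\<lambda>a' c. tsum R A C (tensor R A C) (\<psi> (pure_tensor R C A c a))
         (\<lambda>b d. pure_tensor R A C (a' \<otimes>\<^bsub>A\<^esub> b) d))"

definition coring_smash_module ::
  "('r, 'k) ring_scheme \<Rightarrow> ('r, 'a, 'x) module_scheme \<Rightarrow> ('r, 'c, 'y) module_scheme \<Rightarrow>
     ('c \<Rightarrow> ('c, 'c) tens) \<Rightarrow> (('c, 'a) tens \<Rightarrow> ('a, 'c) tens) \<Rightarrow>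
     ('c \<Rightarrow> 'a, ('a, 'c) tens) module" where
  "coring_smash_module R A C \<Delta> \<psi> =
     \<lparr>carrier = carrier (tensor R A C),
      monoid.mult = undefined, monoid.one = undefined,
      ring.zero = \<zero>\<^bsub>tensor R A C\<^esub>,
      ring.add = ring.add (tensor R A C),
      smult = (\<lambda>f t. tsum R A C (tensor R A C) t
        (\<lambda>a c. tsum R C C (tensor R A C) (\<Delta> c)
          (\<lambda>c1 c2. coring_ract R A C \<psi> (pure_tensor R A C a c1) (f c2))))\<rparr>"

text \<open>The functor \<open>M\<^sub>A\<^sup>C(\<psi>) \<rightarrow> M\<^sub>#\<close> on objects: \<open>m f = \<Sum> m\<^sub>0 f(m\<^sub>1)\<close>.\<close>

definition entwined_to_smash ::
  "('r, 'k) ring_scheme \<Rightarrow> ('r, 'a, 'x) module_scheme \<Rightarrow> ('r, 'c, 'y) module_scheme \<Rightarrow>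
     ('a, 'm, 'c) coact_module \<Rightarrow> ('c \<Rightarrow> 'a, 'm) module" where
  "entwined_to_smash R A C M =
     \<lparr>carrier = carrier M, monoid.mult = monoid.mult M, monoid.one = monoid.one M,
      ring.zero = ring.zero M, ring.add = ring.add M,
      smult = (\<lambda>f m. if f \<in> lin_maps R C A \<and> m \<in> carrier M
        then tsum R (base_module A M) C (base_module A M) (coact M m) (\<lambda>x c. f c \<odot>\<^bsub>M\<^esub> x)
        else undefined)\<rparr>"

end

theory Submission
  imports Defs
begin

text \<open>
  The coaction turns every entwined module \<open>M\<close> into a submodule of \<open>M \<otimes> C\<close>, and \<open>N \<mapsto> N \<otimes> C\<close> is right adjoint
  to the functor that forgets coactions. If \<open>C\<close> is flat, kernels are computed as for modules, so that the category is abelian with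
  exact direct limits; the subobjects of \<open>A\<^sup>(\<nat>) \<otimes> C\<close> generate; and \<open>N \<otimes> C\<close> is injective when \<open>N\<close> is, for
  instance for \<open>N = Hom(A, D)\<close> with \<open>D\<close> the divisible hull of \<open>M\<close>.

  If \<open>C\<close> is locally projective, finitely many elements of \<open>C\<close> are fixed by some \<open>c \<mapsto> \<Sum> \<chi>\<^sub>j(c) d\<^sub>j\<close>. Hence functionals on \<open>C\<close>
  separate the elements of \<open>M \<otimes> C\<close>, which makes the coaction of a \<open>#\<close>-rational module unique and lets it restrict to
  submodules; and \<open>M\<close> embeds in \<open>M \<otimes> C\<close>, a quotient of a direct sum of copies of \<open>A \<otimes> C\<close>.
\<close>

text \<open>The objects of a category share one type and have carriers in \<open>U\<close>, whereas
  \<open>N \<otimes> C\<close>, direct sums, quotients and \<open>Hom(A, D)\<close> live on other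
  types. Each is built on its own type, shown to be small and copied back; closure of
  \<open>U\<close> under \<open>B\<close>-th powers keeps \<open>Hom(A, D)\<close> and the set of
  subobjects of \<open>A^(\<nat>) \<otimes> C\<close> small. The relations of a tensor product see a
  module only on its carrier, so records that agree there have the same tensors;
  \<open>agree\<close> exploits this whenever one module appears as two records.

  The laws of \<open>#\<close> are awkward to verify on the twisted product. On an entwined module,
  however, \<open>m (f g) = (m f) g\<close> is coassociativity paired with \<open>f\<close> and
  \<open>g\<close>, and \<open>A \<otimes> C\<close> is an entwined module on which \<open>#\<close>
  acts faithfully. Hence identities in \<open>#\<close> are proved on entwined modules and only then
  used in arbitrary \<open>#\<close>-modules.

  The passage from \<open>#\<close>-modules back to coactions rests on one computation: if
  \<open>D(c) = \<Sum> \<chi>_j(c) d_j\<close>, then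
  \<open>m (f \<circ> D) = \<Sum> (m \<chi>_j) f(d_j)\<close>, an expression in
  \<open>M \<otimes> C\<close> that serves all \<open>f\<close> at once.\<close>

abbreviation (input) in_carrier (infix "@:" 50) where "x @: M \<equiv> x \<in> carrier M"
abbreviation (input) zero_of ("0[_]") where "0[M] \<equiv> ring.zero M"
abbreviation (input) one_of ("1[_]") where "1[M] \<equiv> monoid.one M"
abbreviation (input) add_in ("_ +[_] _" [65, 0, 66] 65) where "x +[M] y \<equiv> ring.add M x y"
abbreviation (input) mult_in ("_ *[_] _" [70, 0, 71] 70) where "x *[M] y \<equiv> monoid.mult M x y"
abbreviation (input) smult_in ("_ .[_] _" [70, 0, 71] 70) where "s .[M] x \<equiv> smult M s x"

section \<open>Linear maps\<close>

text \<open>Members of \<open>lin_maps\<close> are extensional, which composites such as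
  \<open>%x. g (f x)\<close> are not. Without extensionality, composites and sums are linear as they
  stand, and \<open>restrict\<close> is inserted only where a member of a hom-set is wanted.\<close>

definition lin ::
  "('s, 'k) ring_scheme => ('s, 'm, 'x) module_scheme => ('s, 'n, 'y) module_scheme => ('m => 'n) => bool" where
  "lin S M N f \<longleftrightarrow> f \<in> carrier M \<rightarrow> carrier N \<and>
     (\<forall>x \<in> carrier M. \<forall>y \<in> carrier M. f (x +[M] y) = f x +[N] f y) \<and>
     (\<forall>s \<in> carrier S. \<forall>x \<in> carrier M. f (s .[M] x) = s .[N] f x)"

lemma linI:
  assumes "\<And>x. x @: M ==> f x @: N"
    and "\<And>x y. x @: M ==> y @: M ==> f (x +[M] y) = f x +[N] f y"
    and "\<And>s x. s @: S ==> x @: M ==> f (s .[M] x) = s .[N] f x"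
  shows "lin S M N f"
  using assms by (auto simp: lin_def)

lemma lin_closed: "lin S M N f ==> x @: M ==> f x @: N"
  and lin_add: "lin S M N f ==> x @: M ==> y @: M ==> f (x +[M] y) = f x +[N] f y"
  and lin_smult: "lin S M N f ==> s @: S ==> x @: M ==> f (s .[M] x) = s .[N] f x"
  by (auto simp: lin_def)

lemma lin_maps_iff: "f \<in> lin_maps S M N \<longleftrightarrow> lin S M N f \<and> f \<in> extensional (carrier M)"
  by (auto simp: lin_maps_def lin_def PiE_def)

lemma lin_mapsD: "f \<in> lin_maps S M N ==> lin S M N f"
  by (simp add: lin_maps_iff)

lemma lin_id: "lin S M M (%x. x)"
  by (simp add: lin_def)

lemma lin_compose: "lin S M N f ==> lin S N P g ==> lin S M P (%x. g (f x))"
  by (auto simp: lin_def Pi_iff)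

lemma lin_zero:
  assumes "abelian_group M" "abelian_group N" "lin S M N f"
  shows "f 0[M] = 0[N]"
proof -
  interpret M: abelian_group M by fact
  interpret N: abelian_group N by fact
  have "f 0[M] +[N] f 0[M] = f 0[M]" "f 0[M] @: N"
    using lin_add[OF assms(3), of "0[M]" "0[M]"] lin_closed[OF assms(3)] by auto
  then show ?thesis using N.add.r_cancel_one'[of "f 0[M]" "f 0[M]"] by simp
qed

lemma lin_minus:
  assumes "abelian_group M" "abelian_group N" "lin S M N f" "x @: M"
  shows "f (\<ominus>\<^bsub>M\<^esub> x) = \<ominus>\<^bsub>N\<^esub> f x"
proof -
  interpret M: abelian_group M by fact
  interpret N: abelian_group N by fact
  have "f (\<ominus>\<^bsub>M\<^esub> x) +[N] f x = 0[N]"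
    using lin_add[OF assms(3), of "\<ominus>\<^bsub>M\<^esub> x" x] assms lin_zero[OF assms(1-3)] by (simp add: M.l_neg)
  then show ?thesis using assms(4) lin_closed[OF assms(3)] N.minus_equality[of "f (\<ominus>\<^bsub>M\<^esub> x)" "f x"] by simp
qed

lemma lin_diff:
  assumes "abelian_group M" "abelian_group N" "lin S M N f" "x @: M" "y @: M"
  shows "f (x \<ominus>\<^bsub>M\<^esub> y) = f x \<ominus>\<^bsub>N\<^esub> f y"
proof -
  interpret M: abelian_group M by fact
  show ?thesis using assms by (simp add: a_minus_def lin_add[OF assms(3)] lin_minus[OF assms(1-3)])
qed

lemma abelian_group_diff_eq_zero:
  assumes "abelian_group N" "x @: N" "y @: N"
  shows "x \<ominus>\<^bsub>N\<^esub> y = 0[N] \<longleftrightarrow> x = y"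
proof -
  interpret abelian_group N by fact
  show ?thesis using add.inv_solve_right'[of "0[N]" x y] assms
    by (auto simp: a_minus_def r_neg)
qed

lemma lin_inj_onI:
  assumes "abelian_group M" "abelian_group N" "lin S M N f"
    "\<And>x. x @: M ==> f x = 0[N] ==> x = 0[M]"
  shows "inj_on f (carrier M)"
proof (rule inj_onI)
  interpret M: abelian_group M by fact
  interpret N: abelian_group N by fact
  fix x y assume xy: "x @: M" "y @: M" "f x = f y"
  then have "f (x \<ominus>\<^bsub>M\<^esub> y) = 0[N]"
    using lin_diff[OF assms(1-3)] lin_closed[OF assms(3)] by (simp add: abelian_group_diff_eq_zero[OF assms(2)])
  then have "x \<ominus>\<^bsub>M\<^esub> y = 0[M]" using assms(4) xy by simp
  then show "x = y" using xy abelian_group_diff_eq_zero[OF assms(1)] by simp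
qed

text \<open>Commutativity of \<open>R\<close> reconciles the two orders of factors in the
  associativity law.\<close>

lemma right_module_of_module:
  assumes "module R M" shows "right_module R M"
proof -
  interpret module R M by fact
  have "(s *[R] t) .[M] x = t .[M] (s .[M] x)"
    if "s @: R" "t @: R" "x @: M" for s t x
    using that by (simp add: R.m_comm[of s t] smult_assoc1)
  then show ?thesis
    by (intro right_module.intro right_module_axioms.intro)
      (simp_all add: smult_l_distr smult_r_distr R.ring_axioms M.abelian_group_axioms)
qed

lemma module_of_right_module:
  assumes "cring R" "right_module R M" shows "module R M"
proof -
  interpret R: cring R by fact
  interpret right_module R M by fact
  show ?thesis
  proof (rule moduleI)
    show "(a *[R] b) .[M] x = a .[M] (b .[M] x)"
      if "a @: R" "b @: R" "x @: M" for a b x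
      using that by (simp add: R.m_comm[of a b] ract_assoc)
  qed (simp_all add: ract_closed ract_l_distr ract_r_distr ract_one assms(1) M.abelian_group_axioms)
qed

lemma module_abelian_group: "module R M ==> abelian_group M"
  by (rule module.axioms)

lemma module_cring: "module R M ==> cring R"
  by (rule module.axioms)

lemma right_module_abelian_group: "right_module R M ==> abelian_group M"
  by (rule right_module.axioms)

lemma right_module_ring: "right_module R M ==> ring R"
  by (rule right_module.axioms)

lemma lin_cong:
  assumes "right_module S M" "lin S M N f" "\<And>x. x @: M ==> f x = g x"
  shows "lin S M N g"
proof -
  interpret right_module S M by fact
  show ?thesis using assms(3)
    by (intro linI) (auto simp flip: assms(3) simp: ract_closed lin_closed[OF assms(2)] lin_add[OF assms(2)] lin_smult[OF assms(2)])
qed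

lemma lin_restrict:
  assumes "right_module S M" "lin S M N f"
  shows "restrict f (carrier M) \<in> lin_maps S M N"
  using lin_cong[OF assms(1,2), of "restrict f (carrier M)"] by (simp add: lin_maps_iff)

lemma lin_inv:
  assumes "right_module S M" "lin S M N f" "bij_betw f (carrier M) (carrier N)"
  shows "lin S N M (inv_into (carrier M) f)"
proof -
  interpret right_module S M by fact
  let ?g = "inv_into (carrier M) f"
  have g: "?g y @: M" "f (?g y) = y" if "y @: N" for y
    using that assms(3) by (auto simp: bij_betw_def f_inv_into_f intro: inv_into_into)
  have gI: "?g y = x" if "x @: M" "f x = y" for x y
    using that assms(3) by (auto simp: bij_betw_def)
  show ?thesis
  proof (rule linI)
    show "?g (x +[N] y) = ?g x +[M] ?g y" if "x @: N" "y @: N" for x y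
      using that by (intro gI) (simp_all add: g lin_add[OF assms(2)])
    show "?g (s .[N] x) = s .[M] ?g x" if "s @: S" "x @: N" for s x
      using that by (intro gI) (simp_all add: g ract_closed lin_smult[OF assms(2)])
  qed (rule g(1))
qed

text \<open>Balancing is implied by linearity in each variable: both \<open>(r x, y)\<close> and
  \<open>(x, r y)\<close> go to \<open>r\<close> times the value at \<open>(x, y)\<close>.\<close>

definition bilin ::
  "('r, 'k) ring_scheme => ('r, 'm, 'x) module_scheme => ('r, 'n, 'y) module_scheme =>
     ('r, 'p, 'z) module_scheme => ('m => 'n => 'p) => bool" where
  "bilin R M N P b \<longleftrightarrow> (\<forall>y \<in> carrier N. lin R M P (%x. b x y)) \<and> (\<forall>x \<in> carrier M. lin R N P (%y. b x y))"

lemma bilinI: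
  "(\<And>y. y @: N ==> lin R M P (%x. b x y)) ==>
   (\<And>x. x @: M ==> lin R N P (%y. b x y)) ==> bilin R M N P b"
  by (simp add: bilin_def)

section \<open>Tensor products\<close>

context
  fixes R :: "('r, 'k) ring_scheme" and M :: "('r, 'm, 'x) module_scheme" and N :: "('r, 'n, 'y) module_scheme"
  assumes M: "module R M" and N: "module R N"
begin

interpretation M: module R M by (rule M)
interpretation N: module R N by (rule N)

private abbreviation (input) "FG \<equiv> free_Abelian_group (carrier M \<times> carrier N)"
private abbreviation (input) "Rel \<equiv> tensor_relations R M N"
private abbreviation (input) "cls \<equiv> tensor_class R M N"
private abbreviation (input) "T \<equiv> tensor R M N"

private lemma relators_in:
  "({frag_of (x +[M] x', y) - frag_of (x, y) - frag_of (x', y) | x x' y.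
           x @: M \<and> x' @: M \<and> y @: N} \<union>
        {frag_of (x, y +[N] y') - frag_of (x, y) - frag_of (x, y') | x y y'.
           x @: M \<and> y @: N \<and> y' @: N} \<union>
        {frag_of (r .[M] x, y) - frag_of (x, r .[N] y) | r x y.
           r @: R \<and> x @: M \<and> y @: N}) \<subseteq> carrier FG"
  by (auto dest!: subsetD[OF keys_diff])

private lemma normal_Rel: "Rel \<lhd> FG"
proof -
  interpret comm_group FG by (rule abelian_free_Abelian_group)
  show ?thesis
    unfolding tensor_relations_def
    by (rule iffD2[OF normal_iff_subgroup]) (rule generate_is_subgroup[OF relators_in])
qed

private lemma cls_eq:
  assumes "Poly_Mapping.keys z \<subseteq> carrier M \<times> carrier N" "Poly_Mapping.keys z' \<subseteq> carrier M \<times> carrier N"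
  shows "cls z = cls z' \<longleftrightarrow> z - z' \<in> Rel"
proof -
  interpret normal Rel FG by (rule normal_Rel)
  have "cls z = cls z' \<longleftrightarrow> z \<in> cls z'"
    unfolding tensor_class_def using assms
    by (metis carrier_free_Abelian_group_iff is_subgroup rcos_self repr_independence)
  also have "\<dots> \<longleftrightarrow> z - z' \<in> Rel"
    unfolding tensor_class_def r_coset_def by auto (metis diff_add_cancel)
  finally show ?thesis .
qed

private lemmas cls_eqI = iffD2[OF cls_eq]

private lemma carrier_T: "carrier T = cls ` {z. Poly_Mapping.keys z \<subseteq> carrier M \<times> carrier N}"
  by (auto simp: tensor_def tensor_group_def FactGroup_def RCOSETS_def tensor_class_def)

private lemma cls_add:
  assumes "Poly_Mapping.keys z \<subseteq> carrier M \<times> carrier N" "Poly_Mapping.keys z' \<subseteq> carrier M \<times> carrier N"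
  shows "cls z +[T] cls z' = cls (z + z')"
  using normal.rcos_sum[OF normal_Rel, of z z'] assms
  by (simp add: tensor_def tensor_group_def FactGroup_def tensor_class_def)

private lemma T_zero: "0[T] = cls 0"
proof -
  interpret normal Rel FG by (rule normal_Rel)
  show ?thesis
    by (simp add: tensor_def tensor_group_def FactGroup_def tensor_class_def) (metis coset_mult_one one_free_Abelian_group subset)
qed

private lemma abelian_T: "abelian_group T"
proof -
  interpret normal Rel FG by (rule normal_Rel)
  interpret FG: comm_group FG by (rule abelian_free_Abelian_group)
  have k: "Poly_Mapping.keys (z + z') \<subseteq> carrier M \<times> carrier N"
    if "Poly_Mapping.keys z \<subseteq> carrier M \<times> carrier N" "Poly_Mapping.keys z' \<subseteq> carrier M \<times> carrier N" for z z'
    using that keys_add[of z z'] by blast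
  show ?thesis
  proof (rule abelian_groupI)
    show "\<exists>y\<in>carrier T. y +[T] x = 0[T]" if x: "x @: T" for x
    proof -
      obtain z where z: "Poly_Mapping.keys z \<subseteq> carrier M \<times> carrier N" "x = cls z"
        using x carrier_T by auto
      then have "cls (-z) +[T] x = 0[T]" "cls (-z) @: T"
        by (auto simp: carrier_T T_zero cls_add)
      then show ?thesis by blast
    qed
  qed (auto simp: carrier_T cls_add k T_zero add_ac)
qed

private lemma pure_in: "x @: M ==> y @: N ==> pure_tensor R M N x y @: T"
  by (auto simp: carrier_T pure_tensor_def)

private lemma Rel_gen:
  "x @: M ==> x' @: M ==> y @: N ==>
     frag_of (x +[M] x', y) - frag_of (x, y) - frag_of (x', y) \<in> Rel"
  "x @: M ==> y @: N ==> y' @: N ==>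
     frag_of (x, y +[N] y') - frag_of (x, y) - frag_of (x, y') \<in> Rel"
  "r @: R ==> x @: M ==> y @: N ==>
     frag_of (r .[M] x, y) - frag_of (x, r .[N] y) \<in> Rel"
  unfolding tensor_relations_def by (rule generate.incl; blast)+

private lemma pure_addl: "x @: M ==> x' @: M ==> y @: N ==>
    pure_tensor R M N (x +[M] x') y = pure_tensor R M N x y +[T] pure_tensor R M N x' y"
  using Rel_gen(1)[of x x' y] keys_add[of "frag_of (x, y)" "frag_of (x', y)"]
  unfolding pure_tensor_def by (subst cls_add) (simp_all, rule cls_eqI, auto simp: diff_diff_eq)

private lemma pure_addr: "x @: M ==> y @: N ==> y' @: N ==>
    pure_tensor R M N x (y +[N] y') = pure_tensor R M N x y +[T] pure_tensor R M N x y'"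
  using Rel_gen(2)[of x y y'] keys_add[of "frag_of (x, y)" "frag_of (x, y')"]
  unfolding pure_tensor_def by (subst cls_add) (simp_all, rule cls_eqI, auto simp: diff_diff_eq)

lemma pure_balanced: "r @: R ==> x @: M ==> y @: N ==>
    pure_tensor R M N (r .[M] x) y = pure_tensor R M N x (r .[N] y)"
  using Rel_gen(3)[of r x y] unfolding pure_tensor_def by (intro cls_eqI) auto

text \<open>Turns the classes of negatives and of zero in the free group into pure tensors, so that
  tensors are sums, and not merely differences, of pure ones.\<close>

private lemma pure_neg:
  assumes "x @: M" "y @: N"
  shows "cls (- frag_of (x, y)) = pure_tensor R M N (\<ominus>\<^bsub>M\<^esub> x) y" "cls 0 = pure_tensor R M N x 0[N]"
proof -
  interpret T: abelian_group T by (rule abelian_T)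
  have 0: "pure_tensor R M N x 0[N] = 0[T]" if "x @: M" for x
    using pure_addr[of x "0[N]" "0[N]"] pure_in[of x "0[N]"] that by simp
  then show "cls 0 = pure_tensor R M N x 0[N]" using assms by (simp add: T_zero)
  have 0: "pure_tensor R M N 0[M] y = 0[T]"
    using pure_addl[of "0[M]" "0[M]" y] pure_in[of "0[M]" y] assms by simp
  have "pure_tensor R M N (\<ominus>\<^bsub>M\<^esub> x) y +[T] pure_tensor R M N x y = 0[T]"
    using pure_addl[of "\<ominus>\<^bsub>M\<^esub> x" x y] assms 0 by (simp add: M.l_neg)
  moreover have "cls (- frag_of (x, y)) +[T] pure_tensor R M N x y = 0[T]"
    using assms by (simp add: pure_tensor_def cls_add T_zero)
  moreover have "cls (- frag_of (x, y)) @: T" using assms by (auto simp: carrier_T)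
  ultimately show "cls (- frag_of (x, y)) = pure_tensor R M N (\<ominus>\<^bsub>M\<^esub> x) y"
    using assms pure_in by (metis M.a_inv_closed T.add.right_cancel)
qed

private lemma FG_induct [consumes 1, case_names 1 2 3]:
  assumes "Poly_Mapping.keys z \<subseteq> carrier M \<times> carrier N" "P 0"
    "\<And>x y. Poly_Mapping.keys x \<subseteq> carrier M \<times> carrier N ==> Poly_Mapping.keys y \<subseteq> carrier M \<times> carrier N ==>
       P x ==> P y ==> P (x - y)"
    "\<And>a. a \<in> carrier M \<times> carrier N ==> P (frag_of a)"
  shows "P z"
  using free_Abelian_group_induct[of z "carrier M \<times> carrier N" P] assms by metis

lemma tensor_induct_aux [consumes 1, case_names pure add]:
  assumes "t @: T"
    and pure: "\<And>x y. x @: M ==> y @: N ==> P (pure_tensor R M N x y)"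
    and add: "\<And>s t. s @: T ==> t @: T ==> P s ==> P t ==> P (s +[T] t)"
  shows "P t"
proof -
  \<comment> \<open>Induction in the free abelian group passes through differences, while
    \<open>P\<close> is closed only under sums. Carrying \<open>- z\<close> along turns
    \<open>x - y\<close> into \<open>x + (- y)\<close>.\<close>
  have "P (cls z) \<and> P (cls (- z))" if "Poly_Mapping.keys z \<subseteq> carrier M \<times> carrier N" for z
    using that
  proof (induction z rule: FG_induct)
    case 1 then show ?case using pure_neg(2)[of "0[M]" "0[N]"] pure[of "0[M]" "0[N]"] by simp
  next
    case (2 x y)
    have "cls (x - y) = cls x +[T] cls (-y)" "cls (- (x - y)) = cls (-x) +[T] cls y"
      using 2 by (simp_all add: cls_add)
    moreover have "cls x @: T" "cls (-x) @: T" "cls y @: T" "cls (-y) @: T"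
      using 2 by (auto simp: carrier_T)
    ultimately show ?case using 2 add by simp
  next
    case (3 a)
    then show ?case using pure_neg(1)[of "fst a" "snd a"] pure[of "fst a" "snd a"] pure[of "\<ominus>\<^bsub>M\<^esub> (fst a)" "snd a"]
      by (auto simp: pure_tensor_def)
  qed
  then show ?thesis using assms(1) carrier_T by auto
qed

section \<open>The universal property of the tensor product\<close>

private lemma additive_extension:
  assumes P: "abelian_group P"
    and b: "\<And>x y. x @: M ==> y @: N ==> b x y @: P"
      "\<And>x x' y. x @: M ==> x' @: M ==> y @: N ==> b (x +[M] x') y = b x y +[P] b x' y"
      "\<And>x y y'. x @: M ==> y @: N ==> y' @: N ==> b x (y +[N] y') = b x y +[P] b x y'"
      "\<And>r x y. r @: R ==> x @: M ==> y @: N ==> b (r .[M] x) y = b x (r .[N] y)"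
  obtains h where "h \<in> hom FG (add_monoid P)" "\<And>x y. x @: M ==> y @: N ==> h (frag_of (x, y)) = b x y"
    "\<And>z. z \<in> Rel ==> h z = 0[P]"
proof -
  interpret P: abelian_group P by fact
  interpret FG: comm_group FG by (rule abelian_free_Abelian_group)
  obtain h where h: "h \<in> hom FG (add_monoid P)"
     "\<And>p. p \<in> carrier M \<times> carrier N ==> h (frag_of p) = case_prod b p"
    using comm_group.free_Abelian_group_universal[OF P.a_comm_group, of "case_prod b" "carrier M \<times> carrier N"] b(1)
    by (auto simp: image_subset_iff)
  interpret h: group_hom FG "add_monoid P" h
    using h(1) by unfold_locales (auto simp: group_hom_axioms_def)
  have hd: "h (a - b) = h a \<ominus>\<^bsub>P\<^esub> h b" if "Poly_Mapping.keys a \<subseteq> carrier M \<times> carrier N" "Poly_Mapping.keys b \<subseteq> carrier M \<times> carrier N" for a b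
    using h.hom_mult[of a "- b"] h.hom_inv[of b] that by (simp add: a_minus_def a_inv_def)
  have kd: "Poly_Mapping.keys (a - b) \<subseteq> carrier M \<times> carrier N" if "Poly_Mapping.keys a \<subseteq> carrier M \<times> carrier N" "Poly_Mapping.keys b \<subseteq> carrier M \<times> carrier N" for a b
    using that keys_diff[of a b] by blast
  have "h z = 0[P]" if "z \<in> Rel" for z
  proof -
    have "Rel \<subseteq> kernel FG (add_monoid P) h"
      unfolding tensor_relations_def
    proof (rule FG.generate_subgroup_incl[OF _ h.subgroup_kernel], rule subsetI)
      fix z assume z: "z \<in> {frag_of (x +[M] x', y) - frag_of (x, y) - frag_of (x', y) | x x' y.
           x @: M \<and> x' @: M \<and> y @: N} \<union>
        {frag_of (x, y +[N] y') - frag_of (x, y) - frag_of (x, y') | x y y'.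
           x @: M \<and> y @: N \<and> y' @: N} \<union>
        {frag_of (r .[M] x, y) - frag_of (x, r .[N] y) | r x y.
           r @: R \<and> x @: M \<and> y @: N}"
      then have "z @: FG" using relators_in by (rule rev_subsetD)
      moreover have "h z = 0[P]"
      proof -
        have *: "(u +[P] v) \<ominus>\<^bsub>P\<^esub> u \<ominus>\<^bsub>P\<^esub> v = 0[P]" if "u @: P" "v @: P" for u v
          using that by (simp add: a_minus_def P.a_comm[of u v] P.a_assoc P.r_neg)
        show ?thesis using z by (auto simp: hd kd h(2) b * abelian_group_diff_eq_zero[OF P])
      qed
      ultimately show "z \<in> kernel FG (add_monoid P) h" by (simp add: kernel_def)
    qed
    then show ?thesis using that by (auto simp: kernel_def)
  qed
  then show ?thesis using h(2) by (intro that[OF h(1)]) auto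
qed

text \<open>Stated for additive balanced maps into an abelian group, because linearity cannot be
  asked for yet: the scalar action on the tensor product is itself obtained as such an induced map
  in \<open>smult_cls\<close>.\<close>

private lemma induced_additive:
  assumes P: "abelian_group P"
    and b: "\<And>x y. x @: M ==> y @: N ==> b x y @: P"
      "\<And>x x' y. x @: M ==> x' @: M ==> y @: N ==> b (x +[M] x') y = b x y +[P] b x' y"
      "\<And>x y y'. x @: M ==> y @: N ==> y' @: N ==> b x (y +[N] y') = b x y +[P] b x y'"
      "\<And>r x y. r @: R ==> x @: M ==> y @: N ==> b (r .[M] x) y = b x (r .[N] y)"
  shows "\<exists>f. (\<forall>t \<in> carrier T. f t @: P) \<and>
    (\<forall>s \<in> carrier T. \<forall>t \<in> carrier T. f (s +[T] t) = f s +[P] f t) \<and>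
    (\<forall>x \<in> carrier M. \<forall>y \<in> carrier N. f (pure_tensor R M N x y) = b x y)"
proof -
  interpret P: abelian_group P by fact
  interpret FG: comm_group FG by (rule abelian_free_Abelian_group)
  obtain h where h: "h \<in> hom FG (add_monoid P)" "\<And>x y. x @: M ==> y @: N ==> h (frag_of (x, y)) = b x y"
    "\<And>z. z \<in> Rel ==> h z = 0[P]"
    by (rule additive_extension[OF P, of b]) (simp_all add: b)
  interpret h: group_hom FG "add_monoid P" h
    using h(1) by unfold_locales (auto simp: group_hom_axioms_def)
  define f where "f t = h (SOME z. Poly_Mapping.keys z \<subseteq> carrier M \<times> carrier N \<and> t = cls z)" for t
  have f: "f (cls z) = h z" if z: "Poly_Mapping.keys z \<subseteq> carrier M \<times> carrier N" for z
  proof -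
    define z' where "z' = (SOME z'. Poly_Mapping.keys z' \<subseteq> carrier M \<times> carrier N \<and> cls z = cls z')"
    have z': "Poly_Mapping.keys z' \<subseteq> carrier M \<times> carrier N" "cls z = cls z'"
      using someI[of "%z'. Poly_Mapping.keys z' \<subseteq> carrier M \<times> carrier N \<and> cls z = cls z'" z] z
      by (auto simp: z'_def)
    then have r: "z - z' \<in> Rel" using cls_eq z by blast
    have "Poly_Mapping.keys (z - z') \<subseteq> carrier M \<times> carrier N" using z z' keys_diff[of z z'] by blast
    then have "h z = h (z - z') +[P] h z'"
      using h.hom_mult[of "z - z'" z'] z z' by simp
    also have "\<dots> = h z'" using h(3)[OF r] h.hom_closed[of z'] z' by simp
    finally show ?thesis by (simp add: f_def z'_def)
  qed
  show ?thesis
  proof (intro exI[of _ f] conjI ballI)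
    show "f t @: P" if "t @: T" for t
      using that f h.hom_closed by (auto simp: carrier_T)
    show "f (s +[T] t) = f s +[P] f t" if st: "s @: T" "t @: T" for s t
    proof -
      obtain z z' where z: "Poly_Mapping.keys z \<subseteq> carrier M \<times> carrier N" "s = cls z"
        "Poly_Mapping.keys z' \<subseteq> carrier M \<times> carrier N" "t = cls z'"
        using st carrier_T by auto
      then have "Poly_Mapping.keys (z + z') \<subseteq> carrier M \<times> carrier N" using keys_add[of z z'] by blast
      then show ?thesis using z h.hom_mult[of z z'] by (simp add: cls_add f)
    qed
    show "f (pure_tensor R M N x y) = b x y" if "x @: M" "y @: N" for x y
      using that by (simp add: pure_tensor_def f h)
  qed
qed

private lemma keys_scaled:
  assumes "r @: R" "Poly_Mapping.keys z \<subseteq> carrier M \<times> carrier N"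
  shows "Poly_Mapping.keys (frag_extend (%(x, y). frag_of (r .[M] x, y)) z) \<subseteq> carrier M \<times> carrier N"
  using assms keys_frag_extend[of "%(x, y). frag_of (r .[M] x, y)" z] by fastforce

text \<open>The action is defined as a union over representatives. The additive map induced by
  \<open>(x, y) \<mapsto> r x \<otimes> y\<close> takes at a class the value prescribed by any of
  its representatives, so all sets in that union are equal.\<close>

private lemma smult_cls:
  assumes r: "r @: R" and z: "Poly_Mapping.keys z \<subseteq> carrier M \<times> carrier N"
  shows "r .[T] cls z = cls (frag_extend (%(x, y). frag_of (r .[M] x, y)) z)"
proof -
  let ?e = "frag_extend (%(x, y). frag_of (r .[M] x, y))"
  interpret T: abelian_group T by (rule abelian_T)
  obtain f where f: "\<And>t. t @: T ==> f t @: T"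
    "\<And>s t. s @: T ==> t @: T ==> f (s +[T] t) = f s +[T] f t"
    "\<And>x y. x @: M ==> y @: N ==> f (pure_tensor R M N x y) = pure_tensor R M N (r .[M] x) y"
  proof -
    have "pure_tensor R M N (r .[M] (r' .[M] x)) y = pure_tensor R M N (r .[M] x) (r' .[N] y)"
      if "r' @: R" "x @: M" "y @: N" for r' x y
      using that r by (simp add: pure_balanced[symmetric] M.smult_assoc1[symmetric] M.m_comm)
    then have "\<exists>f. (\<forall>t \<in> carrier T. f t @: T) \<and>
      (\<forall>s \<in> carrier T. \<forall>t \<in> carrier T. f (s +[T] t) = f s +[T] f t) \<and>
      (\<forall>x \<in> carrier M. \<forall>y \<in> carrier N. f (pure_tensor R M N x y) = pure_tensor R M N (r .[M] x) y)"
      by (intro induced_additive[OF abelian_T]) (use r in \<open>simp_all add: pure_in pure_addl pure_addr M.smult_r_distr\<close>)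
    then show ?thesis using that by blast
  qed
  have fz: "f (cls z) = cls (?e z)" if "Poly_Mapping.keys z \<subseteq> carrier M \<times> carrier N" for z
    using that
  proof (induction z rule: FG_induct)
    case 1
    have "f 0[T] = 0[T]" using f(1)[of "0[T]"] f(2)[of "0[T]" "0[T]"] by simp
    then show ?case by (simp add: T_zero)
  next
    case (2 x y)
    have k: "Poly_Mapping.keys (x - y) \<subseteq> carrier M \<times> carrier N" using 2 keys_diff[of x y] by blast
    note ke = keys_scaled[OF r k] keys_scaled[OF r 2(2)]
    have c: "cls x @: T" "cls y @: T" "cls (x - y) @: T"
      "cls (?e (x - y)) @: T" "cls (?e y) @: T"
      unfolding carrier_T using 2 k ke by (auto simp del: frag_extend_diff intro!: imageI)
    have "cls x = cls (x - y) +[T] cls y" using 2 k by (subst cls_add) auto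
    then have "f (cls x) = f (cls (x - y)) +[T] f (cls y)" using f(2) c by simp
    moreover have "cls (?e x) = cls (?e (x - y)) +[T] cls (?e y)"
      unfolding cls_add[OF ke] by (simp add: frag_extend_diff)
    ultimately show ?case using 2 f(1) c by (metis T.add.right_cancel)
  next
    case (3 a)
    then show ?case using f(3)[of "fst a" "snd a"] by (auto simp: pure_tensor_def)
  qed
  interpret normal Rel FG by (rule normal_Rel)
  have "cls (?e z') = cls (?e z)" if "z' \<in> cls z" for z'
  proof -
    have "z' @: FG"
    proof -
      have "cls z \<subseteq> carrier FG"
        unfolding tensor_class_def by (rule r_coset_subset_G[OF subset]) (simp add: z)
      then show ?thesis using that by (rule subsetD)
    qed
    moreover have "cls z = cls z'" unfolding tensor_class_def
      using that z by (intro repr_independence is_subgroup) (simp_all add: tensor_class_def)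
    ultimately show ?thesis using fz[of z'] fz[OF z] by (metis carrier_free_Abelian_group_iff)
  qed
  moreover have "z \<in> cls z" unfolding tensor_class_def using z
    by (intro rcos_self is_subgroup) simp
  ultimately have "(\<Union>z'\<in>cls z. cls (?e z')) = cls (?e z)" by blast
  then show ?thesis by (simp add: tensor_def)
qed

lemma smult_pure: "r @: R ==> x @: M ==> y @: N ==>
    r .[T] pure_tensor R M N x y = pure_tensor R M N (r .[M] x) y"
  by (simp add: pure_tensor_def smult_cls)

private lemma smult_in: "r @: R ==> t @: T ==> r .[T] t @: T"
  using keys_scaled by (auto simp: carrier_T smult_cls)

private lemma smult_add: "r @: R ==> s @: T ==> t @: T ==>
    r .[T] (s +[T] t) = r .[T] s +[T] r .[T] t"
proof -
  assume r: "r @: R" and st: "s @: T" "t @: T"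
  obtain z z' where z: "Poly_Mapping.keys z \<subseteq> carrier M \<times> carrier N" "s = cls z"
    "Poly_Mapping.keys z' \<subseteq> carrier M \<times> carrier N" "t = cls z'"
    using st carrier_T by auto
  then have "Poly_Mapping.keys (z + z') \<subseteq> carrier M \<times> carrier N" using keys_add[of z z'] by blast
  then show "r .[T] (s +[T] t) = r .[T] s +[T] r .[T] t"
    using z by (simp add: cls_add smult_cls r keys_scaled frag_extend_add)
qed

lemma module_tensor: "module R T"
proof (rule moduleI)
  interpret T: abelian_group T by (rule abelian_T)
  fix a b x assume a: "a @: R" and b: "b @: R" and x: "x @: T"
  show "(a +[R] b) .[T] x = a .[T] x +[T] b .[T] x"
    using x by (induction rule: tensor_induct_aux)
      (use a b in \<open>auto simp: smult_pure M.smult_l_distr pure_addl smult_add smult_in T.add.m_ac\<close>)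
  show "(a *[R] b) .[T] x = a .[T] (b .[T] x)"
    using x by (induction rule: tensor_induct_aux)
      (use a b in \<open>auto simp: smult_pure M.smult_assoc1 smult_add smult_in\<close>)
next
  fix x assume x: "x @: T"
  show "1[R] .[T] x = x"
    using x by (induction rule: tensor_induct_aux) (auto simp: smult_pure smult_add)
qed (auto simp: M.is_cring abelian_T smult_in smult_add)

lemma pure_closed: "x @: M ==> y @: N ==> pure_tensor R M N x y @: T"
  by (rule pure_in)

lemma bilin_pure: "bilin R M N T (pure_tensor R M N)"
  by (intro bilinI linI) (auto simp: pure_in pure_addl pure_addr smult_pure pure_balanced)

lemma lin_ext:
  assumes "lin R T P f" "lin R T P g"
    "\<And>x y. x @: M ==> y @: N ==> f (pure_tensor R M N x y) = g (pure_tensor R M N x y)"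
    "t @: T"
  shows "f t = g t"
  using assms(4) by (induction rule: tensor_induct_aux) (auto simp: assms(3) lin_add[OF assms(1)] lin_add[OF assms(2)])

text \<open>Justifies the definite description behind \<open>tsum\<close>: existence is the induced
  additive map, restricted to the carrier to become extensional, and uniqueness is agreement on pure
  tensors. Computing with a Sweedler sum therefore always starts from a proof of
  \<open>bilin\<close>.\<close>

lemma tsum_spec:
  assumes P: "module R P" and b: "bilin R M N P b"
  shows "(%t. tsum R M N P t b) \<in> lin_maps R T P \<and>
    (\<forall>x \<in> carrier M. \<forall>y \<in> carrier N. tsum R M N P (pure_tensor R M N x y) b = b x y)"
proof -
  interpret P: module R P by (rule P)
  interpret T: module R T by (rule module_tensor)
  have b1: "lin R M P (%x. b x y)" if "y @: N" for y using b that by (simp add: bilin_def)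
  have b2: "lin R N P (%y. b x y)" if "x @: M" for x using b that by (simp add: bilin_def)
  obtain f where f: "\<And>t. t @: T ==> f t @: P"
    "\<And>s t. s @: T ==> t @: T ==> f (s +[T] t) = f s +[P] f t"
    "\<And>x y. x @: M ==> y @: N ==> f (pure_tensor R M N x y) = b x y"
  proof -
    have "\<exists>f. (\<forall>t \<in> carrier T. f t @: P) \<and>
      (\<forall>s \<in> carrier T. \<forall>t \<in> carrier T. f (s +[T] t) = f s +[P] f t) \<and>
      (\<forall>x \<in> carrier M. \<forall>y \<in> carrier N. f (pure_tensor R M N x y) = b x y)"
      by (intro induced_additive P.abelian_group_axioms)
        (simp_all add: lin_closed[OF b1] lin_add[OF b1] lin_add[OF b2] lin_smult[OF b1] lin_smult[OF b2])
    then show ?thesis using that by blast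
  qed
  have "f (r .[T] t) = r .[P] f t" if r: "r @: R" and t: "t @: T" for r t
    using t
  proof (induction rule: tensor_induct_aux)
    case (pure x y) then show ?case using r by (simp add: smult_pure f(3) lin_smult[OF b1])
  next
    case (add s t) then show ?case using r by (simp add: T.smult_r_distr P.smult_r_distr f)
  qed
  then have "lin R T P f" using f by (intro linI) auto
  then have f': "restrict f (carrier T) \<in> lin_maps R T P"
    by (rule lin_restrict[OF right_module_of_module[OF module_tensor]])
  let ?Q = "%f. f \<in> lin_maps R T P \<and> (\<forall>x \<in> carrier M. \<forall>y \<in> carrier N. f (pure_tensor R M N x y) = b x y)"
  have "?Q (The ?Q)"
  proof (rule theI[of ?Q])
    show "?Q (restrict f (carrier T))" using f' f(3) by (simp add: pure_in)
    fix g assume g: "?Q g"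
    show "g = restrict f (carrier T)"
    proof (rule extensionalityI[of _ "carrier T"])
      fix t assume "t @: T"
      then show "g t = restrict f (carrier T) t"
        using lin_ext[OF lin_mapsD lin_mapsD[OF f'], of g] g f(3) by (auto simp: pure_in)
    qed (use g f' in \<open>auto simp: lin_maps_iff\<close>)
  qed
  then show ?thesis by (simp add: tsum_def)
qed

lemma tsum_lin_maps: "module R P ==> bilin R M N P b ==> (%t. tsum R M N P t b) \<in> lin_maps R T P"
  and tsum_lin: "module R P ==> bilin R M N P b ==> lin R T P (%t. tsum R M N P t b)"
  and tsum_pure: "module R P ==> bilin R M N P b ==> x @: M ==> y @: N ==>
    tsum R M N P (pure_tensor R M N x y) b = b x y"
  using tsum_spec by (auto simp: lin_maps_iff)

end

lemma tensor_induct [consumes 3, case_names pure add]: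
  assumes "module R M" "module R N" "t @: tensor R M N"
    and "\<And>x y. x @: M ==> y @: N ==> P (pure_tensor R M N x y)"
    and "\<And>s t. s @: tensor R M N ==> t @: tensor R M N ==> P s ==> P t ==>
       P (s +[tensor R M N] t)"
  shows "P t"
  using assms by (rule tensor_induct_aux)

text \<open>The summand enters the description behind \<open>tsum\<close> only through its values on
  the carriers, so sums can be rewritten before bilinearity is established.\<close>

lemma tsum_cong:
  assumes "t = t'" "\<And>x y. x @: M ==> y @: N ==> b x y = b' x y"
  shows "tsum R M N P t b = tsum R M N P t' b'"
  using assms unfolding tsum_def by (simp cong: ball_cong)

section \<open>Calculus of Sweedler sums\<close>

text \<open>Rules that read off linearity in a variable from the shape of an expression. Nested
  Sweedler sums are reached through \<open>bilinI\<close>, one variable at a time.\<close>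

named_theorems lin_intros

declare module_tensor [simp] lin_id [lin_intros] bilinI [lin_intros]

lemma lin_plus:
  assumes "module R N" "lin R M N f" "lin R M N g"
  shows "lin R M N (%x. f x +[N] g x)"
proof -
  interpret N: module R N by fact
  note c = lin_closed[OF assms(2)] lin_closed[OF assms(3)]
  show ?thesis
    by (rule linI) (simp_all add: c lin_add[OF assms(2)] lin_add[OF assms(3)] lin_smult[OF assms(2)]
        lin_smult[OF assms(3)] N.smult_r_distr N.add.m_ac)
qed

lemma lin_scale:
  assumes "module R N" "lin R M N f" "r @: R"
  shows "lin R M N (%x. r .[N] f x)"
proof -
  interpret N: module R N by fact
  note c = lin_closed[OF assms(2)]
  have "r .[N] f (s .[M] x) = s .[N] (r .[N] f x)" if "s @: R" "x @: M" for s x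
    using that assms(3) by (simp add: lin_smult[OF assms(2)] c N.R.m_comm[of r s] flip: N.smult_assoc1)
  then show ?thesis
    by (intro linI) (simp_all add: c lin_add[OF assms(2)] N.smult_r_distr assms(3))
qed

lemma lin_zero_map: "module R N ==> lin R M N (%x. 0[N])"
proof -
  assume "module R N"
  then interpret N: module R N .
  show ?thesis by (rule linI) auto
qed

lemma lin_pure1 [lin_intros]:
  assumes "module R P" "module R N" "lin R M P f" "y @: N"
  shows "lin R M (tensor R P N) (%x. pure_tensor R P N (f x) y)"
  using lin_compose[OF assms(3), of "tensor R P N" "%x. pure_tensor R P N x y"] bilin_pure[OF assms(1,2)] assms(4)
  by (simp add: bilin_def)

lemma lin_pure2 [lin_intros]:
  assumes "module R P" "module R N" "lin R M N f" "x @: P"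
  shows "lin R M (tensor R P N) (%y. pure_tensor R P N x (f y))"
  using lin_compose[OF assms(3), of "tensor R P N" "%y. pure_tensor R P N x y"] bilin_pure[OF assms(1,2)] assms(4)
  by (simp add: bilin_def)

lemma lin_tsum1 [lin_intros]:
  assumes "module R K" "module R L" "module R P" "lin R M (tensor R K L) f" "bilin R K L P b"
  shows "lin R M P (%x. tsum R K L P (f x) b)"
  using lin_compose[OF assms(4) tsum_lin[OF assms(1-3,5)]] .

lemma tsum_closed:
  "module R M ==> module R N ==> module R P ==> bilin R M N P b ==> t @: tensor R M N ==>
     tsum R M N P t b @: P"
  using lin_closed[OF tsum_lin] .

lemma tsum_add:
  "module R M ==> module R N ==> module R P ==> bilin R M N P b ==>
     s @: tensor R M N ==> t @: tensor R M N ==>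
     tsum R M N P (s +[tensor R M N] t) b = tsum R M N P s b +[P] tsum R M N P t b"
  using lin_add[OF tsum_lin] .

text \<open>The basic move of the Sweedler calculus, applying a linear map termwise: both sides are
  linear in \<open>t\<close> and coincide on pure tensors.\<close>

lemma tsum_push:
  assumes "module R M" "module R N" "module R P" "module R Q" "lin R P Q h" "bilin R M N P b"
    "t @: tensor R M N"
  shows "h (tsum R M N P t b) = tsum R M N Q t (%x y. h (b x y))"
proof -
  have b': "bilin R M N Q (%x y. h (b x y))"
    using assms(6) lin_compose[of R M P "%x. b x y" Q h for y] lin_compose[of R N P "%y. b x y" Q h for x] assms(5)
    unfolding bilin_def by blast
  show ?thesis
    using lin_ext[OF assms(1,2) lin_compose[OF tsum_lin[OF assms(1-3,6)] assms(5)] tsum_lin[OF assms(1,2,4) b'] _ assms(7)]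
    by (simp add: tsum_pure[OF assms(1-3,6)] tsum_pure[OF assms(1,2,4) b'])
qed

text \<open>The parameter sits in the summand rather than in the tensor. For fixed parameters, each
  side of additivity and of homogeneity is linear in \<open>t\<close>, so the comparison reduces to
  pure tensors, where \<open>l\<close> applies.\<close>

lemma lin_tsum2 [lin_intros]:
  assumes M: "right_module R M" and KL: "module R K" "module R L" and P: "module R P"
    and b: "\<And>x. x @: M ==> bilin R K L P (b x)"
    and l: "\<And>u v. u @: K ==> v @: L ==> lin R M P (%x. b x u v)"
    and t: "t @: tensor R K L"
  shows "lin R M P (%x. tsum R K L P t (b x))"
proof -
  interpret M: right_module R M by (rule M)
  note sl = tsum_lin[OF KL P b] and sp = tsum_pure[OF KL P b]
  show ?thesis
  proof (rule linI)
    show "tsum R K L P t (b (x +[M] y)) = tsum R K L P t (b x) +[P] tsum R K L P t (b y)"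
      if "x @: M" "y @: M" for x y
      using that by (intro lin_ext[OF KL sl lin_plus[OF P sl sl] _ t]) (simp_all add: sp lin_add[OF l])
    show "tsum R K L P t (b (r .[M] x)) = r .[P] tsum R K L P t (b x)"
      if "x @: M" "r @: R" for x r
      using that by (intro lin_ext[OF KL sl lin_scale[OF P sl] _ t]) (simp_all add: sp lin_smult[OF l] M.ract_closed)
  qed (auto intro: tsum_closed[OF KL P b t])
qed

lemma tsum_eta:
  "module R M ==> module R N ==> t @: tensor R M N ==>
     tsum R M N (tensor R M N) t (pure_tensor R M N) = t"
  by (rule lin_ext[where P = "tensor R M N" and g = "%t. t"])
    (auto intro: tsum_lin bilin_pure lin_id simp: tsum_pure bilin_pure)

definition tmap ::
  "('r, 'k) ring_scheme => ('r, 'm, 'x) module_scheme => ('r, 'n, 'y) module_scheme =>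
     ('r, 'w, 'z) module_scheme => ('m => 'n) => ('m, 'w) tens => ('n, 'w) tens" where
  "tmap R M N W f t = tsum R M W (tensor R N W) t (%x w. pure_tensor R N W (f x) w)"

context
  fixes R :: "('r, 'k) ring_scheme" and M :: "('r, 'm, 'x) module_scheme"
    and N :: "('r, 'n, 'y) module_scheme" and W :: "('r, 'w, 'z) module_scheme"
  assumes m: "module R M" "module R N" "module R W"
begin

lemma bilin_tmap: "lin R M N f ==> bilin R M W (tensor R N W) (%x w. pure_tensor R N W (f x) w)"
  by (intro lin_intros m) (auto simp: lin_closed)

lemma tmap_lin: "lin R M N f ==> lin R (tensor R M W) (tensor R N W) (tmap R M N W f)"
  unfolding tmap_def by (intro tsum_lin m module_tensor bilin_tmap)

lemma tmap_closed: "lin R M N f ==> t @: tensor R M W ==> tmap R M N W f t @: tensor R N W"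
  using tmap_lin by (rule lin_closed)

lemma tmap_pure: "lin R M N f ==> x @: M ==> w @: W ==>
    tmap R M N W f (pure_tensor R M W x w) = pure_tensor R N W (f x) w"
  unfolding tmap_def by (rule tsum_pure) (simp_all add: m bilin_tmap)

lemma tsum_tmap:
  assumes "module R P" "lin R M N f" "bilin R N W P b" "t @: tensor R M W"
  shows "tsum R N W P (tmap R M N W f t) b = tsum R M W P t (%x w. b (f x) w)"
proof -
  have "tsum R N W P (tmap R M N W f t) b =
      tsum R M W P t (%x w. tsum R N W P (pure_tensor R N W (f x) w) b)"
    unfolding tmap_def
    by (rule tsum_push) (simp_all add: m assms bilin_tmap tsum_lin)
  also have "\<dots> = tsum R M W P t (%x w. b (f x) w)"
    using assms(2) by (intro tsum_cong refl) (simp add: tsum_pure m assms lin_closed[OF assms(2)])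
  finally show ?thesis .
qed

lemma tmap_compose:
  assumes "module R P" "lin R M N f" "lin R N P g" "t @: tensor R M W"
  shows "tmap R N P W g (tmap R M N W f t) = tmap R M P W (%x. g (f x)) t"
  unfolding tmap_def[of R N P] unfolding tmap_def[of R M P]
  by (rule tsum_tmap) (simp_all add: m assms, intro lin_intros m assms, auto simp: lin_closed[OF assms(3)])

end

lemma tmap_cong:
  "(\<And>x. x @: M ==> f x = g x) ==> t = t' ==> tmap R M N W f t = tmap R M N W g t'"
  unfolding tmap_def by (auto intro!: tsum_cong)

lemma tmap_id:
  assumes "module R M" "module R W" "t @: tensor R M W" "\<And>x. x @: M ==> f x = x"
  shows "tmap R M M W f t = t"
proof -
  have "tmap R M M W f t = tsum R M W (tensor R M W) t (pure_tensor R M W)"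
    unfolding tmap_def using assms(4) by (intro tsum_cong) auto
  then show ?thesis by (simp add: tsum_eta assms)
qed

section \<open>Modules that agree on their carriers\<close>

text \<open>The same module occurs as several records: with or without a coaction, as a tensor
  product or as the base of a cofree module, with different values off the carrier. This is equality
  of everything that module theory sees.\<close>

definition agree ::
  "('s, 'k) ring_scheme => ('s, 'm, 'x) module_scheme => ('s, 'm, 'y) module_scheme => bool" where
  "agree S M M' \<longleftrightarrow> carrier M = carrier M' \<and> 0[M] = 0[M'] \<and>
     (\<forall>x \<in> carrier M. \<forall>y \<in> carrier M. x +[M] y = x +[M'] y) \<and>
     (\<forall>s \<in> carrier S. \<forall>x \<in> carrier M. s .[M] x = s .[M'] x)"

lemma agree_refl: "agree S M M"
  by (simp add: agree_def)

lemma agree_sym: "agree S M M' ==> agree S M' M"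
  by (simp add: agree_def)

lemma agree_carrier: "agree S M M' ==> carrier M' = carrier M"
  by (simp add: agree_def)

lemma agree_zero: "agree S M M' ==> 0[M'] = 0[M]"
  by (simp add: agree_def)

lemma agree_lin_imp: "agree S M M' ==> agree S N N' ==> lin S M N f ==> lin S M' N' f"
  by (fastforce simp: lin_def agree_def Pi_iff)

lemma agree_lin: "agree S M M' ==> agree S N N' ==> lin S M N f \<longleftrightarrow> lin S M' N' f"
  using agree_lin_imp[of S M M' N N' f] agree_lin_imp[of S M' M N' N f] by (auto dest: agree_sym)

lemma agree_lin_maps: "agree S M M' ==> agree S N N' ==> lin_maps S M N = lin_maps S M' N'"
  using agree_lin[of S M M' N N'] agree_carrier[of S M M'] by (auto simp: lin_maps_iff)

text \<open>The axioms are equations, with negatives supplied by images of negatives, so they pass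
  along a surjection that respects the operations. Quotients, copies and agreeing records are all
  instances.\<close>

lemma right_module_image:
  assumes M: "right_module S M" and p: "p ` carrier M = carrier Q"
    and add: "\<And>x y. x @: M ==> y @: M ==> p (x +[M] y) = p x +[Q] p y"
    and zero: "p 0[M] = 0[Q]"
    and smult: "\<And>s x. s @: S ==> x @: M ==> p (s .[M] x) = s .[Q] p x"
  shows "right_module S Q"
proof -
  interpret M: right_module S M by (rule M)
  have Q: "\<And>P. (\<forall>x \<in> carrier Q. P x) \<longleftrightarrow> (\<forall>x \<in> carrier M. P (p x))" unfolding p[symmetric] by blast
  have pc: "\<And>x. x @: M ==> p x @: Q" using p by blast
  have 1: "\<forall>x \<in> carrier Q. \<forall>y \<in> carrier Q. x +[Q] y @: Q \<and> x +[Q] y = y +[Q] x \<and>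
      (\<forall>z \<in> carrier Q. x +[Q] y +[Q] z = x +[Q] (y +[Q] z))"
    unfolding Q by (auto simp: pc M.M.add.m_ac simp flip: add)
  have 2: "\<forall>x \<in> carrier Q. 0[Q] +[Q] x = x \<and> (\<exists>y\<in>carrier Q. y +[Q] x = 0[Q])"
    unfolding Q by (auto simp flip: add zero intro!: bexI[of _ "p (\<ominus>\<^bsub>M\<^esub> x)" for x] pc simp: M.M.l_neg)
  have 3: "\<forall>x \<in> carrier Q. \<forall>s \<in> carrier S. s .[Q] x @: Q \<and>
      (\<forall>t \<in> carrier S. (s +[S] t) .[Q] x = s .[Q] x +[Q] t .[Q] x \<and> (s *[S] t) .[Q] x = t .[Q] (s .[Q] x)) \<and>
      (\<forall>y \<in> carrier Q. s .[Q] (x +[Q] y) = s .[Q] x +[Q] s .[Q] y)"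
    unfolding Q by (auto simp: pc M.ract_closed M.ract_l_distr M.ract_r_distr M.ract_assoc simp flip: add smult)
  have 4: "\<forall>x \<in> carrier Q. 1[S] .[Q] x = x"
    unfolding Q by (auto simp: M.ract_one simp flip: smult)
  have "abelian_group Q"
    using 1 2 pc[of "0[M]"] zero by (intro abelian_groupI; simp)
  then show ?thesis
    using 3 4 by (intro right_module.intro right_module_axioms.intro M.S.ring_axioms) auto
qed

lemma agree_right_module: "agree S M M' ==> right_module S M ==> right_module S M'"
  by (erule right_module_image[where p = "%x. x"]) (auto simp: agree_def)

lemma agree_module: "agree R M M' ==> module R M ==> module R M'"
  using agree_right_module module_of_right_module right_module_of_module module_cring by metis

context
  fixes R :: "('r, 'k) ring_scheme" and M :: "('r, 'm, 'x) module_scheme" and M' :: "('r, 'm, 'y) module_scheme"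
    and N :: "('r, 'n, 'z) module_scheme"
  assumes a: "agree R M M'"
begin

text \<open>The relators evaluate operations only on carriers. The two tensor products therefore
  have literally the same elements, and coactions can be compared without transport.\<close>

lemma agree_tensor_relations: "tensor_relations R M' N = tensor_relations R M N"
proof -
  have "{frag_of (x +[M'] x', y) - frag_of (x, y) - frag_of (x', y) | x x' y.
           x @: M' \<and> x' @: M' \<and> y @: N} =
      {frag_of (x +[M] x', y) - frag_of (x, y) - frag_of (x', y) | x x' y.
           x @: M \<and> x' @: M \<and> y @: N}"
    using a unfolding agree_def by (auto; metis)
  moreover have "{frag_of (r .[M'] x, y) - frag_of (x, r .[N] y) | r x y.
           r @: R \<and> x @: M' \<and> y @: N} =
      {frag_of (r .[M] x, y) - frag_of (x, r .[N] y) | r x y.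
           r @: R \<and> x @: M \<and> y @: N}"
    using a unfolding agree_def by (auto; metis)
  ultimately show ?thesis unfolding tensor_relations_def agree_carrier[OF a] by simp
qed

lemma agree_pure: "pure_tensor R M' N = pure_tensor R M N"
  by (intro ext) (simp add: pure_tensor_def tensor_class_def agree_tensor_relations agree_carrier[OF a])

lemma agree_tensor:
  assumes m: "module R M" "module R N"
  shows "agree R (tensor R M N) (tensor R M' N)"
proof -
  note m' = agree_module[OF a m(1)]
  have c: "carrier (tensor R M' N) = carrier (tensor R M N)"
    and p: "ring.add (tensor R M' N) = ring.add (tensor R M N)" "0[tensor R M' N] = 0[tensor R M N]"
    by (simp_all add: tensor_def tensor_group_def agree_tensor_relations agree_carrier[OF a])
  interpret T: module R "tensor R M N" by (simp add: m)
  interpret T': module R "tensor R M' N" by (simp add: m m')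
  have "r .[tensor R M' N] t = r .[tensor R M N] t" if r: "r @: R" and t: "t @: tensor R M N" for r t
    using m(1,2) t
  proof (induction rule: tensor_induct)
    case (pure x y)
    then show ?case
      using r a m m' smult_pure[of R M' N r x y] smult_pure[of R M N r x y] by (auto simp: agree_def agree_pure)
  next
    case (add s t)
    then show ?case
      using r T'.smult_r_distr[of r s t] T.smult_r_distr[of r s t] by (simp add: p c)
  qed
  then show ?thesis by (simp add: agree_def c p)
qed

lemma agree_tsum:
  assumes "module R M" "module R N" "agree R P P'"
  shows "tsum R M' N P' t b = tsum R M N P t b"
  unfolding tsum_def agree_pure agree_carrier[OF a]
  by (simp add: agree_lin_maps[OF agree_tensor[OF assms(1,2)] assms(3), symmetric])

end

section \<open>Submodules, quotients, direct sums and copies of right modules\<close>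

context right_module begin

lemma ract_zero_left: "x @: M ==> 0[S] .[M] x = 0[M]"
  using ract_l_distr[of "0[S]" "0[S]" x] ract_closed[of "0[S]" x]
  by (simp add: M.add.r_cancel_one')

lemma ract_zero_right: "s @: S ==> s .[M] 0[M] = 0[M]"
  using ract_r_distr[of s "0[M]" "0[M]"] ract_closed[of s "0[M]"]
  by (simp add: M.add.r_cancel_one')

lemma ract_minus_one: "x @: M ==> (\<ominus>\<^bsub>S\<^esub> 1[S]) .[M] x = \<ominus>\<^bsub>M\<^esub> x"
  using ract_l_distr[of "\<ominus>\<^bsub>S\<^esub> 1[S]" "1[S]" x] ract_closed[of "\<ominus>\<^bsub>S\<^esub> 1[S]" x]
  by (intro M.minus_equality[symmetric]) (simp_all add: S.l_neg ract_zero_left ract_one)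

text \<open>Negatives are obtained from the action of \<open>\<ominus> 1\<close>.\<close>

lemma submodule_of_closed:
  assumes "H \<subseteq> carrier M" "0[M] \<in> H" "\<And>x y. x \<in> H ==> y \<in> H ==> x +[M] y \<in> H"
    "\<And>s x. s @: S ==> x \<in> H ==> s .[M] x \<in> H"
  shows "submodule H S M"
proof (intro submodule.intro subgroup.intro submodule_axioms.intro)
  fix x assume "x \<in> H"
  then have "\<ominus>\<^bsub>M\<^esub> x \<in> H"
    using assms(4)[of "\<ominus>\<^bsub>S\<^esub> 1[S]" x] assms(1) by (auto simp: ract_minus_one)
  then show "inv\<^bsub>add_monoid M\<^esub> x \<in> H" by (simp add: a_inv_def)
qed (use assms in auto)

lemma submoduleD:
  assumes "submodule H S M"
  shows "H \<subseteq> carrier M" "0[M] \<in> H" "\<And>x y. x \<in> H ==> y \<in> H ==> x +[M] y \<in> H"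
    "\<And>s x. s @: S ==> x \<in> H ==> s .[M] x \<in> H" "\<And>x. x \<in> H ==> \<ominus>\<^bsub>M\<^esub> x \<in> H"
    "abelian_subgroup H M"
proof -
  interpret H: submodule H S M by fact
  show "H \<subseteq> carrier M" "0[M] \<in> H" using H.subset H.one_closed by auto
  show "x +[M] y \<in> H" if "x \<in> H" "y \<in> H" for x y using H.m_closed[OF that] by simp
  show "s .[M] x \<in> H" if "s @: S" "x \<in> H" for s x using H.smult_closed[OF that] .
  show "\<ominus>\<^bsub>M\<^esub> x \<in> H" if "x \<in> H" for x using H.m_inv_closed[OF that] by (simp add: a_inv_def)
  show "abelian_subgroup H M"
    by (intro abelian_subgroupI3 additive_subgroup.intro M.abelian_group_axioms) unfold_locales
qed

lemma right_module_submodule: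
  assumes "submodule H S M"
  shows "right_module S (M\<lparr>carrier := H\<rparr>)"
proof -
  note H = submoduleD[OF assms]
  have c: "\<And>x. x \<in> H ==> x @: M" using H(1) by blast
  have "abelian_group (M\<lparr>carrier := H\<rparr>)"
  proof (intro abelian_groupI)
    fix x assume "x @: M\<lparr>carrier := H\<rparr>"
    then show "\<exists>y\<in>carrier (M\<lparr>carrier := H\<rparr>). y +[M\<lparr>carrier := H\<rparr>] x = 0[M\<lparr>carrier := H\<rparr>]"
      by (intro bexI[of _ "\<ominus>\<^bsub>M\<^esub> x"]) (auto simp: H c M.l_neg)
  qed (simp_all add: H c M.add.m_ac)
  then show ?thesis
    by (intro right_module.intro right_module_axioms.intro S.ring_axioms)
      (auto simp: H c ract_l_distr ract_r_distr ract_assoc ract_one)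
qed

lemma coset_eq_iff:
  assumes H: "submodule H S M" and xy: "x @: M" "y @: M"
  shows "H +>\<^bsub>M\<^esub> x = H +>\<^bsub>M\<^esub> y \<longleftrightarrow> x \<ominus>\<^bsub>M\<^esub> y \<in> H"
proof -
  interpret H: abelian_subgroup H M by (rule submoduleD(6)[OF H])
  have sg: "subgroup H (add_monoid M)" by (rule H.a_subgroup)
  have "H +>\<^bsub>M\<^esub> x = H +>\<^bsub>M\<^esub> y \<longleftrightarrow> x \<in> H +>\<^bsub>M\<^esub> y"
    using H.a_rcos_self[OF xy(1)] M.a_repr_independence[OF _ xy(2) sg, of x] by auto
  also have "\<dots> \<longleftrightarrow> x \<ominus>\<^bsub>M\<^esub> y \<in> H"
  proof
    assume "x \<in> H +>\<^bsub>M\<^esub> y"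
    then obtain h where "h \<in> H" "x = h +[M] y" by (auto simp: a_r_coset_def')
    then show "x \<ominus>\<^bsub>M\<^esub> y \<in> H"
      using xy submoduleD(1)[OF H] by (auto simp: a_minus_def M.a_assoc M.r_neg)
  next
    assume "x \<ominus>\<^bsub>M\<^esub> y \<in> H"
    moreover have "x = (x \<ominus>\<^bsub>M\<^esub> y) +[M] y" using xy by (simp add: a_minus_def M.a_assoc M.l_neg)
    ultimately show "x \<in> H +>\<^bsub>M\<^esub> y" by (auto simp: a_r_coset_def')
  qed
  finally show ?thesis .
qed

lemma quotient_module_facts:
  assumes H: "submodule H S M"
  shows "right_module S (quotient_module M H)" (is ?A)
    and "lin S M (quotient_module M H) (%x. H +>\<^bsub>M\<^esub> x)" (is ?B)
    and "(%x. H +>\<^bsub>M\<^esub> x) ` carrier M = carrier (quotient_module M H)" (is ?C)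
    and "x @: M ==> H +>\<^bsub>M\<^esub> x = 0[quotient_module M H] \<longleftrightarrow> x \<in> H"
proof -
  interpret H: abelian_subgroup H M by (rule submoduleD(6)[OF H])
  have c: "H +>\<^bsub>M\<^esub> y \<subseteq> carrier M" if "y @: M" for y
    using that submoduleD(1)[OF H] by (auto simp: a_r_coset_def')
  \<comment> \<open>All cosets in the union defining the scalar action coincide: two representatives
    differ by an element of \<open>H\<close>, and \<open>s\<close> maps \<open>H\<close> into
    itself.\<close>
  have s: "(\<Union>y\<in>H +>\<^bsub>M\<^esub> x. H +>\<^bsub>M\<^esub> (s .[M] y)) = H +>\<^bsub>M\<^esub> (s .[M] x)"
    if s: "s @: S" and x: "x @: M" for s x
  proof -
    have "H +>\<^bsub>M\<^esub> (s .[M] y) = H +>\<^bsub>M\<^esub> (s .[M] x)" if y: "y \<in> H +>\<^bsub>M\<^esub> x" for y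
    proof -
      obtain h where h: "h \<in> H" "y = h +[M] x" using y by (auto simp: a_r_coset_def')
      then have "h @: M" using submoduleD(1)[OF H] by blast
      then have "s .[M] y \<ominus>\<^bsub>M\<^esub> s .[M] x = s .[M] h" "y @: M"
        using h s x by (simp_all add: ract_r_distr ract_closed a_minus_def M.a_assoc M.r_neg)
      then show ?thesis using submoduleD(4)[OF H s h(1)] s x by (simp add: coset_eq_iff[OF H] ract_closed)
    qed
    then show ?thesis using H.a_rcos_self[OF x] by blast
  qed
  have z: "H +>\<^bsub>M\<^esub> 0[M] = H" using M.a_coset_join2 H.a_subgroup submoduleD(2)[OF H] by simp
  show C: ?C
    by (auto simp: quotient_module_def A_RCOSETS_def')
  show A: ?A
    by (rule right_module_image[OF right_module_axioms C])
      (simp_all add: quotient_module_def H.a_rcos_sum z s)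
  show B: ?B
    using C by (intro linI) (auto simp: quotient_module_def H.a_rcos_sum s)
  show "H +>\<^bsub>M\<^esub> x = 0[quotient_module M H] \<longleftrightarrow> x \<in> H" if x: "x @: M"
  proof -
    have "\<ominus>\<^bsub>M\<^esub> 0[M] = 0[M]" by (rule M.minus_equality) auto
    then have "x \<ominus>\<^bsub>M\<^esub> 0[M] = x" unfolding a_minus_def using x by (simp only: M.r_zero)
    then show ?thesis
      using coset_eq_iff[OF H x M.zero_closed] by (simp add: quotient_module_def z)
  qed
qed

end

lemma lin_kernel_submodule:
  assumes "right_module S M" "right_module S N" "lin S M N f"
  shows "submodule {x \<in> carrier M. f x = 0[N]} S M"
proof -
  interpret M: right_module S M by fact
  interpret N: right_module S N by fact
  show ?thesis
    by (rule M.submodule_of_closed)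
      (auto simp: lin_add[OF assms(3)] lin_smult[OF assms(3)] M.ract_closed N.ract_zero_right
        lin_zero[OF M.M.abelian_group_axioms N.M.abelian_group_axioms assms(3)])
qed

lemma lin_image_submodule:
  assumes "right_module S M" "right_module S N" "lin S M N f"
  shows "submodule (f ` carrier M) S N"
proof -
  interpret M: right_module S M by fact
  interpret N: right_module S N by fact
  note z = lin_zero[OF M.M.abelian_group_axioms N.M.abelian_group_axioms assms(3)]
  show ?thesis
  proof (rule N.submodule_of_closed)
    show "f ` carrier M \<subseteq> carrier N" using lin_closed[OF assms(3)] by blast
    show "0[N] \<in> f ` carrier M" using z M.M.zero_closed by (metis imageI)
    show "x +[N] y \<in> f ` carrier M" if "x \<in> f ` carrier M" "y \<in> f ` carrier M" for x y
      using that by (auto simp flip: lin_add[OF assms(3)])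
    show "s .[N] x \<in> f ` carrier M" if "s @: S" "x \<in> f ` carrier M" for s x
      using that by (auto simp: M.ract_closed simp flip: lin_smult[OF assms(3)])
  qed
qed

subsection \<open>Direct sums\<close>

text \<open>Coproducts of entwined modules need families, of which \<open>direct_power\<close> is
  the constant case.\<close>

definition dsum :: "'i set => ('i => ('s, 'm, 'x) module_scheme) => ('s, 'i => 'm) module" where
  "dsum I X =
     \<lparr>carrier = {f \<in> \<Pi>\<^sub>E i\<in>I. carrier (X i). finite {i \<in> I. f i ~= 0[X i]}},
      monoid.mult = undefined, monoid.one = undefined,
      ring.zero = (\<lambda>i\<in>I. 0[X i]),
      ring.add = (%f g. \<lambda>i\<in>I. f i +[X i] g i),
      smult = (%s f. \<lambda>i\<in>I. s .[X i] f i)\<rparr>"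

lemma direct_power_eq_dsum: "direct_power I K = dsum I (%_. K)"
  by (simp add: direct_power_def dsum_def)

definition dinj :: "'i set => ('i => ('s, 'm, 'x) module_scheme) => 'i => 'm => 'i => 'm" where
  "dinj I X i x = (\<lambda>j\<in>I. if j = i then x else 0[X j])"

context
  fixes S :: "('s, 'k) ring_scheme" and I :: "'i set" and X :: "'i => ('s, 'm, 'x) module_scheme"
  assumes S: "ring S" and X: "\<And>i. i \<in> I ==> right_module S (X i)"
begin

lemma dsum_carrierD:
  "f @: dsum I X ==> i \<in> I ==> f i @: X i"
  "f @: dsum I X ==> finite {i \<in> I. f i ~= 0[X i]}"
  "f @: dsum I X ==> f \<in> extensional I"
  by (auto simp: dsum_def PiE_def)

lemma dsum_carrierI:
  "(\<And>i. i \<in> I ==> f i @: (X i)) ==> f \<in> extensional I ==> finite {i \<in> I. f i ~= 0[X i]} ==>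
    f @: dsum I X"
  by (auto simp: dsum_def PiE_def)

lemma dsum_add_app: "i \<in> I ==> (f +[dsum I X] g) i = f i +[X i] g i"
  and dsum_smult_app: "i \<in> I ==> (s .[dsum I X] f) i = s .[X i] f i"
  and dsum_zero_app: "i \<in> I ==> 0[dsum I X] i = 0[X i]"
  and dsum_ops_ext: "f +[dsum I X] g \<in> extensional I" "s .[dsum I X] f \<in> extensional I" "0[dsum I X] \<in> extensional I"
  by (simp_all add: dsum_def)

lemma right_module_dsum: "right_module S (dsum I X)"
proof -
  interpret S: ring S by (rule S)
  let ?D = "dsum I X"
  note app = dsum_add_app dsum_smult_app dsum_zero_app
  have ag: "abelian_group (X i)" if "i \<in> I" for i using X[OF that] by (rule right_module_abelian_group)
  have facts: "\<And>x y. x @: X i ==> y @: X i ==> x +[X i] y @: X i"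
    "\<And>x. x @: X i ==> \<ominus>\<^bsub>X i\<^esub> x @: X i"
    "\<And>x. x @: X i ==> \<ominus>\<^bsub>X i\<^esub> x +[X i] x = 0[X i]"
    "0[X i] @: X i" "\<And>x. x @: X i ==> 0[X i] +[X i] x = x"
    "\<ominus>\<^bsub>X i\<^esub> 0[X i] = 0[X i]" "0[X i] +[X i] 0[X i] = 0[X i]"
    "\<And>x y. x @: X i ==> y @: X i ==> x +[X i] y = y +[X i] x"
    "\<And>x y z. x @: X i ==> y @: X i ==> z @: X i ==> x +[X i] y +[X i] z = x +[X i] (y +[X i] z)"
    "\<And>s. s @: S ==> s .[X i] 0[X i] = 0[X i]"
    if "i \<in> I" for i
  proof -
    interpret abelian_group "X i" using that by (rule ag)
    show "\<And>x y. x @: X i ==> y @: X i ==> x +[X i] y @: X i"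
      "\<And>x. x @: X i ==> \<ominus>\<^bsub>X i\<^esub> x @: X i"
      "\<And>x. x @: X i ==> \<ominus>\<^bsub>X i\<^esub> x +[X i] x = 0[X i]"
      "0[X i] @: X i" "\<And>x. x @: X i ==> 0[X i] +[X i] x = x"
      "\<ominus>\<^bsub>X i\<^esub> 0[X i] = 0[X i]" "0[X i] +[X i] 0[X i] = 0[X i]"
      "\<And>x y. x @: X i ==> y @: X i ==> x +[X i] y = y +[X i] x"
      "\<And>x y z. x @: X i ==> y @: X i ==> z @: X i ==> x +[X i] y +[X i] z = x +[X i] (y +[X i] z)"
      by (auto simp: l_neg intro: a_comm a_assoc)
    show "\<And>s. s @: S ==> s .[X i] 0[X i] = 0[X i]"
      using right_module.ract_zero_right[OF X[OF that]] .
  qed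
  have sfacts: "\<And>s x. s @: S ==> x @: X i ==> s .[X i] x @: X i"
    "\<And>s t x. s @: S ==> t @: S ==> x @: X i ==> (s +[S] t) .[X i] x = s .[X i] x +[X i] t .[X i] x"
    "\<And>s x y. s @: S ==> x @: X i ==> y @: X i ==> s .[X i] (x +[X i] y) = s .[X i] x +[X i] s .[X i] y"
    "\<And>s t x. s @: S ==> t @: S ==> x @: X i ==> (s *[S] t) .[X i] x = t .[X i] (s .[X i] x)"
    "\<And>x. x @: X i ==> 1[S] .[X i] x = x"
    if "i \<in> I" for i
    using X[OF that] by (auto simp: right_module_def right_module_axioms_def)
  have addc: "f +[?D] g @: ?D" if f: "f @: ?D" and g: "g @: ?D" for f g
  proof (rule dsum_carrierI)
    show "finite {i \<in> I. (f +[?D] g) i ~= 0[X i]}"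
      by (rule finite_subset[OF _ finite_UnI[OF dsum_carrierD(2)[OF f] dsum_carrierD(2)[OF g]]])
        (auto simp: app facts)
  qed (auto simp: app facts dsum_carrierD f g dsum_ops_ext)
  have smc: "s .[?D] f @: ?D" if f: "f @: ?D" and s: "s @: S" for f s
  proof (rule dsum_carrierI)
    show "finite {i \<in> I. (s .[?D] f) i ~= 0[X i]}"
      by (rule finite_subset[OF _ dsum_carrierD(2)[OF f]]) (auto simp: app facts s)
  qed (auto simp: app sfacts dsum_carrierD f s dsum_ops_ext)
  have zc: "0[?D] @: ?D"
    by (rule dsum_carrierI) (auto simp: app facts dsum_ops_ext cong: conj_cong)
  have ext: "f = g" if "f \<in> extensional I" "g \<in> extensional I" "\<And>i. i \<in> I ==> f i = g i" for f g :: "'i => 'm"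
    using that by (rule extensionalityI)
  have inv: "\<exists>g \<in> carrier ?D. g +[?D] f = 0[?D]" if f: "f @: ?D" for f
  proof (rule bexI[of _ "\<lambda>i\<in>I. \<ominus>\<^bsub>X i\<^esub> f i"])
    show "(\<lambda>i\<in>I. \<ominus>\<^bsub>X i\<^esub> f i) @: ?D"
    proof (rule dsum_carrierI)
      show "finite {i \<in> I. (\<lambda>i\<in>I. \<ominus>\<^bsub>X i\<^esub> f i) i ~= 0[X i]}"
        by (rule finite_subset[OF _ dsum_carrierD(2)[OF f]]) (auto simp: facts)
    qed (auto simp: facts dsum_carrierD[OF f])
    show "(\<lambda>i\<in>I. \<ominus>\<^bsub>X i\<^esub> f i) +[?D] f = 0[?D]"
      by (rule ext) (auto simp: app dsum_ops_ext facts(1-3) dsum_carrierD[OF f])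
  qed
  have "abelian_group ?D"
  proof (rule abelian_groupI)
    fix f g h assume c: "f @: ?D" "g @: ?D" "h @: ?D"
    note c' = c[THEN dsum_carrierD(1)]
    show "f +[?D] g +[?D] h = f +[?D] (g +[?D] h)"
      by (rule ext) (simp_all add: dsum_ops_ext app facts(9) c')
  next
    fix f g assume c: "f @: ?D" "g @: ?D"
    note c' = c[THEN dsum_carrierD(1)]
    show "f +[?D] g = g +[?D] f"
    proof (rule ext)
      fix i assume "i \<in> I"
      then show "(f +[?D] g) i = (g +[?D] f) i" using facts(8) c' by (simp add: app)
    qed (simp_all add: dsum_ops_ext)
  next
    fix f assume c: "f @: ?D"
    show "0[?D] +[?D] f = f"
      by (rule ext) (simp_all add: dsum_ops_ext app facts(5) dsum_carrierD[OF c])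
  qed (auto intro: addc zc inv)
  then show ?thesis
  proof (intro right_module.intro right_module_axioms.intro S)
    fix s t f g assume s: "s @: S" "t @: S" and c: "f @: ?D" "g @: ?D"
    note c' = c[THEN dsum_carrierD(1)]
    show "(s +[S] t) .[?D] f = s .[?D] f +[?D] t .[?D] f"
      by (rule ext) (simp_all add: dsum_ops_ext app sfacts(2) c' s)
    show "s .[?D] (f +[?D] g) = s .[?D] f +[?D] s .[?D] g"
      by (rule ext) (simp_all add: dsum_ops_ext app sfacts(3) c' s)
    show "(s *[S] t) .[?D] f = t .[?D] (s .[?D] f)"
      by (rule ext) (simp_all add: dsum_ops_ext app sfacts(4) c' s)
  next
    fix f assume c: "f @: ?D"
    show "1[S] .[?D] f = f"
      by (rule ext) (simp_all add: dsum_ops_ext app sfacts(5) dsum_carrierD[OF c])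
  qed (auto intro: smc)
qed

lemma dinj_closed: "i \<in> I ==> x @: X i ==> dinj I X i x @: dsum I X"
proof (rule dsum_carrierI)
  show "finite {j \<in> I. dinj I X i x j ~= 0[X j]}"
    by (rule finite_subset[of _ "{i}"]) (auto simp: dinj_def)
  show "dinj I X i x j @: X j" if "i \<in> I" "x @: X i" "j \<in> I" for j
    using that abelian_group.a_group[OF right_module_abelian_group[OF X]]
      abelian_monoid.zero_closed[OF abelian_group.axioms(1)[OF right_module_abelian_group[OF X]]]
    by (auto simp: dinj_def)
qed (auto simp: dinj_def)

lemma dinj_lin: "i \<in> I ==> lin S (X i) (dsum I X) (dinj I X i)"
proof (rule linI)
  assume i: "i \<in> I"
  fix x assume x: "x @: X i"
  show "dinj I X i x @: dsum I X" using i x by (rule dinj_closed)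
  show "dinj I X i (x +[X i] y) = dinj I X i x +[dsum I X] dinj I X i y" for y
  proof (rule extensionalityI[of _ I])
    fix j assume j: "j \<in> I"
    interpret Xj: right_module S "X j" by (rule X[OF j])
    show "dinj I X i (x +[X i] y) j = (dinj I X i x +[dsum I X] dinj I X i y) j"
      using j by (simp add: dsum_add_app) (simp add: dinj_def)
  qed (simp_all add: dsum_ops_ext dinj_def)
  show "dinj I X i (s .[X i] x) = s .[dsum I X] dinj I X i x" if s: "s @: S" for s
  proof (rule extensionalityI[of _ I])
    fix j assume j: "j \<in> I"
    interpret Xj: right_module S "X j" by (rule X[OF j])
    show "dinj I X i (s .[X i] x) j = (s .[dsum I X] dinj I X i x) j"
      using j s by (simp add: dsum_smult_app) (simp add: dinj_def Xj.ract_zero_right)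
  qed (simp_all add: dsum_ops_ext dinj_def)
qed

lemma dsum_induct [consumes 1, case_names zero inj add]:
  assumes "f @: dsum I X"
    and z: "P 0[dsum I X]"
    and inj: "\<And>i x. i \<in> I ==> x @: X i ==> P (dinj I X i x)"
    and add: "\<And>f g. f @: dsum I X ==> g @: dsum I X ==> P f ==> P g ==> P (f +[dsum I X] g)"
  shows "P f"
proof -
  \<comment> \<open>The induction runs over a finite set containing the support rather than over the
    support itself, so the component at \<open>i\<close> may be split off whether or not it is
    zero.\<close>
  have "\<forall>f \<in> carrier (dsum I X). {i \<in> I. f i ~= 0[X i]} \<subseteq> A --> P f" if "finite A" for A
    using that
  proof (induction A)
    case empty
    show ?case
    proof (intro ballI impI)
      fix f assume f: "f @: dsum I X" "{i \<in> I. f i ~= 0[X i]} \<subseteq> {}"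
      then have "f = 0[dsum I X]"
        by (intro extensionalityI[of _ I]) (auto simp: dsum_zero_app dsum_ops_ext dsum_carrierD)
      then show "P f" using z by simp
    qed
  next
    case (insert i A)
    show ?case
    proof (intro ballI impI)
      fix f assume f: "f @: dsum I X" "{j \<in> I. f j ~= 0[X j]} \<subseteq> insert i A"
      show "P f"
      proof (cases "i \<in> I")
        case False
        then show ?thesis using insert.IH f by blast
      next
        case i: True
        interpret Xi: right_module S "X i" by (rule X[OF i])
        define g where "g = (\<lambda>j\<in>I. if j = i then 0[X j] else f j)"
        have g: "g @: dsum I X"
        proof (rule dsum_carrierI)
          show "finite {j \<in> I. g j ~= 0[X j]}"
            by (rule finite_subset[OF _ dsum_carrierD(2)[OF f(1)]]) (auto simp: g_def)
        qed (auto simp: g_def dsum_carrierD[OF f(1)])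
        moreover have "{j \<in> I. g j ~= 0[X j]} \<subseteq> A" using f(2) by (auto simp: g_def)
        ultimately have "P g" using insert.IH by blast
        have "f = dinj I X i (f i) +[dsum I X] g"
        proof (rule extensionalityI[of _ I])
          fix j assume j: "j \<in> I"
          interpret Xj: right_module S "X j" by (rule X[OF j])
          show "f j = (dinj I X i (f i) +[dsum I X] g) j"
            using j dsum_carrierD(1)[OF f(1) j] by (auto simp: dsum_add_app dinj_def g_def)
        qed (simp_all add: dsum_ops_ext dsum_carrierD[OF f(1)])
        moreover have "f i @: X i" by (rule dsum_carrierD(1)[OF f(1) i])
        ultimately show ?thesis using add[OF dinj_closed g inj \<open>P g\<close>] i by metis
      qed
    qed
  qed
  then show ?thesis using assms(1) dsum_carrierD(2)[OF assms(1)] by blast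
qed

lemma dsum_universal:
  assumes Q: "right_module S Q" and g: "\<And>i. i \<in> I ==> lin S (X i) Q (g i)"
  shows "\<exists>h. lin S (dsum I X) Q h \<and> (\<forall>i \<in> I. \<forall>x \<in> carrier (X i). h (dinj I X i x) = g i x)"
proof -
  interpret Q: right_module S Q by (rule Q)
  interpret D: right_module S "dsum I X" by (rule right_module_dsum)
  define h where "h f = finsum Q (%i. g i (f i)) {i \<in> I. f i ~= 0[X i]}" for f
  have g0: "g i 0[X i] = 0[Q]" if "i \<in> I" for i
    using lin_zero[OF right_module_abelian_group[OF X] Q.M.abelian_group_axioms g] that by blast
  have gc: "g i (f i) @: Q" if "f @: dsum I X" "i \<in> I" for f i
    using lin_closed[OF g] dsum_carrierD(1) that by blast
  \<comment> \<open>The supports of \<open>f\<close>, \<open>f'\<close> and their sum differ;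
    enlarging the range of summation to any finite set containing the support allows them to be
    compared.\<close>
  have h: "h f = finsum Q (%i. g i (f i)) A"
    if "f @: dsum I X" "finite A" "A \<subseteq> I" "{i \<in> I. f i ~= 0[X i]} \<subseteq> A" for f A
    unfolding h_def
  proof (rule Q.M.add.finprod_mono_neutral_cong_left)
    show "(%i. g i (f i)) \<in> A \<rightarrow> carrier Q"
      using that gc by blast
    show "g i (f i) = 0[Q]" if "i \<in> A - {i \<in> I. f i ~= 0[X i]}" for i
      using that \<open>A \<subseteq> I\<close> g0 by auto
  qed (use that in auto)
  have "lin S (dsum I X) Q h"
  proof (rule linI)
    fix f assume f: "f @: dsum I X"
    show "h f @: Q"
      unfolding h_def by (rule Q.M.finsum_closed) (use gc[OF f] in auto)
    fix f' assume f': "f' @: dsum I X"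
    let ?A = "{i \<in> I. f i ~= 0[X i]} \<union> {i \<in> I. f' i ~= 0[X i]}"
    have z: "0[X i] +[X i] 0[X i] = 0[X i]" if "i \<in> I" for i
    proof -
      interpret right_module S "X i" by (rule X[OF that])
      show ?thesis by simp
    qed
    have A: "finite ?A" "?A \<subseteq> I" using dsum_carrierD(2) f f' by auto
    have "h (f +[dsum I X] f') = finsum Q (%i. g i ((f +[dsum I X] f') i)) ?A"
      by (rule h) (use f f' A in \<open>auto simp: dsum_add_app z\<close>)
    also have "\<dots> = finsum Q (%i. g i (f i) +[Q] g i (f' i)) ?A"
      by (rule Q.M.finsum_cong') (auto simp: dsum_add_app lin_add[OF g] dsum_carrierD[OF f] dsum_carrierD[OF f'] gc f f')
    also have "\<dots> = finsum Q (%i. g i (f i)) ?A +[Q] finsum Q (%i. g i (f' i)) ?A"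
      by (rule Q.M.finsum_addf) (auto simp: gc f f')
    also have "\<dots> = h f +[Q] h f'"
      using h[OF f A] h[OF f' A] by simp
    finally show "h (f +[dsum I X] f') = h f +[Q] h f'" .
  next
    fix s f assume s: "s @: S" and f: "f @: dsum I X"
    let ?A = "{i \<in> I. f i ~= 0[X i]}"
    have A: "finite ?A" "?A \<subseteq> I" using dsum_carrierD(2) f by auto
    have fs: "s .[Q] finsum Q u B = finsum Q (%i. s .[Q] u i) B" if "finite B" "u \<in> B \<rightarrow> carrier Q" for u and B :: "'i set"
      using that by (induction B) (auto simp: Q.ract_zero_right Q.ract_r_distr s Q.ract_closed Pi_iff)
    have "h (s .[dsum I X] f) = finsum Q (%i. g i ((s .[dsum I X] f) i)) ?A"
      by (rule h) (use f s A in \<open>auto simp: dsum_smult_app D.ract_closed right_module.ract_zero_right[OF X]\<close>)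
    also have "\<dots> = finsum Q (%i. s .[Q] g i (f i)) ?A"
      by (rule Q.M.finsum_cong') (auto simp: dsum_smult_app lin_smult[OF g] dsum_carrierD[OF f] Q.ract_closed gc f s)
    also have "\<dots> = s .[Q] h f"
      unfolding h_def by (rule fs[symmetric, OF A(1)]) (use gc f in auto)
    finally show "h (s .[dsum I X] f) = s .[Q] h f" .
  qed
  moreover have "h (dinj I X i x) = g i x" if i: "i \<in> I" and x: "x @: X i" for i x
  proof -
    have "h (dinj I X i x) = finsum Q (%j. g j (dinj I X i x j)) {i}"
      by (rule h) (use i x in \<open>auto simp: dinj_closed, auto simp: dinj_def split: if_splits\<close>)
    also have "\<dots> = g i x"
      using i x lin_closed[OF g] by (subst Q.M.finsum_insert) (auto simp: dinj_def)
    finally show ?thesis .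
  qed
  ultimately show ?thesis by blast
qed

end

lemma dsum_proj_lin:
  assumes "i \<in> I" shows "lin S (dsum I X) (X i) (%f. f i)"
  using assms by (auto simp: lin_def dsum_def)

subsection \<open>Copies\<close>

text \<open>The operations are \<open>undefined\<close> off the carrier, which makes the copy a
  \<open>standard_module\<close> and thus eligible as an object of a category.\<close>

definition mcopy :: "('s, 'k) ring_scheme => ('s, 'm, 'x) module_scheme => ('m => 'n) => ('s, 'n) module" where
  "mcopy S M h = (let g = inv_into (carrier M) h; X = h ` carrier M in
     \<lparr>carrier = X, monoid.mult = undefined, monoid.one = undefined, ring.zero = h 0[M],
      ring.add = (%x y. if x \<in> X \<and> y \<in> X then h (g x +[M] g y) else undefined),
      smult = (%s x. if s @: S \<and> x \<in> X then h (s .[M] g x) else undefined)\<rparr>)"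

lemma mcopy_facts:
  assumes M: "right_module S M" and h: "inj_on h (carrier M)"
  shows "right_module S (mcopy S M h)" "lin S M (mcopy S M h) h" "bij_betw h (carrier M) (carrier (mcopy S M h))"
    "standard_module S (mcopy S M h)" "carrier (mcopy S M h) = h ` carrier M"
proof -
  interpret M: right_module S M by (rule M)
  have c: "carrier (mcopy S M h) = h ` carrier M" by (simp add: mcopy_def Let_def)
  have a: "h (x +[M] y) = h x +[mcopy S M h] h y" if "x @: M" "y @: M" for x y
    using that h by (simp add: mcopy_def Let_def)
  have s: "h (s .[M] x) = s .[mcopy S M h] h x" if "x @: M" "s @: S" for x s
    using that h by (simp add: mcopy_def Let_def)
  show "carrier (mcopy S M h) = h ` carrier M" by (rule c)
  show "right_module S (mcopy S M h)"
    by (rule right_module_image[OF M c[symmetric] a _ s]) (auto simp: mcopy_def Let_def)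
  show "lin S M (mcopy S M h) h" by (rule linI) (auto simp: c a s)
  show "bij_betw h (carrier M) (carrier (mcopy S M h))" using h by (simp add: bij_betw_def c)
  show "standard_module S (mcopy S M h)" by (auto simp: standard_module_def mcopy_def Let_def)
qed

section \<open>Exactness and associativity of the tensor product\<close>

text \<open>Right exactness: the inverse of \<open>(M \<otimes> W) / im (i \<otimes> W) \<rightarrow> N \<otimes> W\<close> is induced by choosing preimages.\<close>

lemma tmap_kernel:
  assumes m: "module R K" "module R M" "module R N" "module R W"
    and i: "lin R K M i" and f: "lin R M N f" and s: "f ` carrier M = carrier N"
    and ker: "\<And>x. x @: M ==> f x = 0[N] ==> x \<in> i ` carrier K"
    and fi: "\<And>k. k @: K ==> f (i k) = 0[N]"
    and t: "t @: tensor R M W" "tmap R M N W f t = 0[tensor R N W]"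
  shows "\<exists>u \<in> carrier (tensor R K W). tmap R K M W i u = t"
proof -
  note r = right_module_of_module
  let ?T = "tensor R M W" and ?J = "tmap R K M W i ` carrier (tensor R K W)"
  interpret M: module R M by (rule m)
  interpret N: module R N by (rule m)
  interpret T: right_module R ?T by (intro r module_tensor m)
  have iT: "lin R (tensor R K W) ?T (tmap R K M W i)" by (rule tmap_lin[OF m(1,2,4) i])
  have J: "submodule ?J R ?T"
    by (intro lin_image_submodule[OF r r iT] module_tensor m)
  let ?Q = "quotient_module ?T ?J" and ?p = "%t. ?J +>\<^bsub>?T\<^esub> t"
  note q = T.quotient_module_facts[OF J]
  have Q: "module R ?Q" by (rule module_of_right_module[OF module_cring[OF m(1)] q(1)])
  interpret Q: module R ?Q by (rule Q)
  note pure = pure_closed[OF m(2,4)]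
  define b where "b y w = ?p (pure_tensor R M W (inv_into (carrier M) f y) w)" for y w
  \<comment> \<open>Two preimages of one element differ by some \<open>i k\<close>, and
    \<open>i k \<otimes> w\<close> lies in \<open>?J\<close>. This is where exactness at
    \<open>M\<close> enters, and it makes the choice of preimages in \<open>b\<close>
    harmless.\<close>
  have 1: "?p (pure_tensor R M W x w) = ?p (pure_tensor R M W x' w)"
    if "x @: M" "x' @: M" "f x = f x'" and w: "w @: W" for x x' w
  proof -
    have "f (x \<ominus>\<^bsub>M\<^esub> x') = 0[N]"
      using that lin_closed[OF f] by (simp add: lin_diff[OF M.abelian_group_axioms N.abelian_group_axioms f]
          abelian_group_diff_eq_zero[OF N.abelian_group_axioms])
    moreover have "x \<ominus>\<^bsub>M\<^esub> x' @: M" using that by (simp add: a_minus_def)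
    ultimately obtain k where k: "k @: K" "x \<ominus>\<^bsub>M\<^esub> x' = i k" using ker[of "x \<ominus>\<^bsub>M\<^esub> x'"] by blast
    have ik: "pure_tensor R M W (i k) w \<in> ?J"
      using k w tmap_pure[OF m(1,2,4) i, of k w] pure_closed[OF m(1,4)] by (metis imageI)
    have "lin R M ?T (%x. pure_tensor R M W x w)" by (intro lin_intros m w)
    then have "pure_tensor R M W x w \<ominus>\<^bsub>?T\<^esub> pure_tensor R M W x' w = pure_tensor R M W (i k) w"
      using lin_diff[OF M.abelian_group_axioms T.M.abelian_group_axioms, of R "%x. pure_tensor R M W x w" x x'] that k by simp
    then show ?thesis using ik that by (simp add: T.coset_eq_iff[OF J] pure)
  qed
  have fx: "inv_into (carrier M) f y @: M" "f (inv_into (carrier M) f y) = y" if "y @: N" for y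
    using that s by (auto simp: f_inv_into_f inv_into_into)
  have b: "b (f x) w = ?p (pure_tensor R M W x w)" if "x @: M" "w @: W" for x w
    unfolding b_def using that fx[of "f x"] lin_closed[OF f] by (intro 1) auto
  have pl: "lin R M ?Q (%x. ?p (pure_tensor R M W x w))" if "w @: W" for w
    by (rule lin_compose[OF lin_pure1[OF m(2,4) lin_id that] q(2)])
  have pr: "lin R W ?Q (%w. ?p (pure_tensor R M W x w))" if "x @: M" for x
    by (rule lin_compose[OF lin_pure2[OF m(2,4) lin_id that] q(2)])
  have bb: "bilin R N W ?Q b"
  proof (rule bilinI)
    fix w assume w: "w @: W"
    show "lin R N ?Q (%y. b y w)"
    proof (rule linI)
      show "b y w @: ?Q" if "y @: N" for y
        unfolding b_def using lin_closed[OF pl[OF w]] fx that by blast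
      show "b (y +[N] y') w = b y w +[?Q] b y' w" if "y @: N" "y' @: N" for y y'
        using lin_add[OF pl[OF w] fx(1) fx(1), OF that] b[of "inv_into (carrier M) f y +[M] inv_into (carrier M) f y'" w]
          that w fx by (simp add: lin_add[OF f]) (simp add: b_def)
      show "b (s .[N] y) w = s .[?Q] b y w" if "s @: R" "y @: N" for s y
        using lin_smult[OF pl[OF w], OF that(1) fx(1), OF that(2)] b[of "s .[M] inv_into (carrier M) f y" w]
          that w fx by (simp add: lin_smult[OF f]) (simp add: b_def)
    qed
  next
    fix y assume "y @: N"
    then show "lin R W ?Q (b y)" unfolding b_def using pr fx by blast
  qed
  let ?\<theta> = "%s. tsum R N W ?Q s b"
  have \<theta>: "lin R (tensor R N W) ?Q ?\<theta>" by (intro tsum_lin m Q bb)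
  have "?\<theta> (tmap R M N W f t) = ?p t"
  proof (rule lin_ext[OF m(2,4) lin_compose[OF tmap_lin[OF m(2,3,4) f] \<theta>] q(2) _ t(1)])
    show "?\<theta> (tmap R M N W f (pure_tensor R M W x w)) = ?p (pure_tensor R M W x w)"
      if "x @: M" "w @: W" for x w
      using that lin_closed[OF f] by (simp add: tmap_pure[OF m(2,3,4) f] tsum_pure[OF m(3,4) Q bb] b)
  qed
  moreover have "?\<theta> 0[tensor R N W] = 0[?Q]"
    by (rule lin_zero[OF _ Q.abelian_group_axioms \<theta>]) (rule module_abelian_group[OF module_tensor[OF m(3,4)]])
  ultimately have "?p t = 0[?Q]" using t(2) by simp
  then have "t \<in> ?J" using q(4)[OF t(1)] by blast
  then show ?thesis by blast
qed

definition tassoc ::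
  "('r, 'k) ring_scheme => ('r, 'm, 'x) module_scheme => ('r, 'n, 'y) module_scheme =>
     ('r, 'w, 'z) module_scheme => ('m, ('n, 'w) tens) tens => (('m, 'n) tens, 'w) tens" where
  "tassoc R M N W t = tsum R M (tensor R N W) (tensor R (tensor R M N) W) t
     (%m u. tsum R N W (tensor R (tensor R M N) W) u
       (%n w. pure_tensor R (tensor R M N) W (pure_tensor R M N m n) w))"

definition tassoc_inv ::
  "('r, 'k) ring_scheme => ('r, 'm, 'x) module_scheme => ('r, 'n, 'y) module_scheme =>
     ('r, 'w, 'z) module_scheme => (('m, 'n) tens, 'w) tens => ('m, ('n, 'w) tens) tens" where
  "tassoc_inv R M N W t = tsum R (tensor R M N) W (tensor R M (tensor R N W)) t
     (%u w. tsum R M N (tensor R M (tensor R N W)) u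
       (%m n. pure_tensor R M (tensor R N W) m (pure_tensor R N W n w)))"

lemma lin_ext3:
  assumes m: "module R M" "module R N" "module R W" and P: "module R P"
    and fg: "lin R (tensor R M (tensor R N W)) P f" "lin R (tensor R M (tensor R N W)) P g"
    and eq: "\<And>x y w. x @: M ==> y @: N ==> w @: W ==>
      f (pure_tensor R M (tensor R N W) x (pure_tensor R N W y w)) =
      g (pure_tensor R M (tensor R N W) x (pure_tensor R N W y w))"
    and t: "t @: (tensor R M (tensor R N W))"
  shows "f t = g t"
proof (rule lin_ext[where R = R, OF m(1) module_tensor[OF m(2,3)] fg _ t])
  fix x u assume x: "x @: M" and u: "u @: tensor R N W"
  note p = lin_pure2[OF m(1) module_tensor[OF m(2,3)] lin_id x]
  show "f (pure_tensor R M (tensor R N W) x u) = g (pure_tensor R M (tensor R N W) x u)"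
    by (rule lin_ext[OF m(2,3) lin_compose[OF p fg(1)] lin_compose[OF p fg(2)] eq[OF x] u])
qed

context
  fixes R :: "('r, 'k) ring_scheme" and M :: "('r, 'm, 'x) module_scheme"
    and N :: "('r, 'n, 'y) module_scheme" and W :: "('r, 'w, 'z) module_scheme"
  assumes m: "module R M" "module R N" "module R W"
begin

lemma bilin_tassoc_inner:
  "x @: M ==> bilin R N W (tensor R (tensor R M N) W)
     (%n w. pure_tensor R (tensor R M N) W (pure_tensor R M N x n) w)"
  by (intro lin_intros m module_tensor pure_closed)

lemma bilin_tassoc:
  "bilin R M (tensor R N W) (tensor R (tensor R M N) W)
     (%m u. tsum R N W (tensor R (tensor R M N) W) u
       (%n w. pure_tensor R (tensor R M N) W (pure_tensor R M N m n) w))"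
  by (intro lin_intros m module_tensor pure_closed right_module_of_module[OF m(1)])

lemma tassoc_lin: "lin R (tensor R M (tensor R N W)) (tensor R (tensor R M N) W) (tassoc R M N W)"
  unfolding tassoc_def by (intro tsum_lin m module_tensor bilin_tassoc)

lemma tassoc_pure:
  "x @: M ==> n @: N ==> w @: W ==>
    tassoc R M N W (pure_tensor R M (tensor R N W) x (pure_tensor R N W n w)) =
    pure_tensor R (tensor R M N) W (pure_tensor R M N x n) w"
  unfolding tassoc_def
  by (simp add: tsum_pure[OF _ _ _ bilin_tassoc] tsum_pure[OF _ _ _ bilin_tassoc_inner] m pure_closed)

lemma bilin_tassoc_inv_inner:
  "w @: W ==> bilin R M N (tensor R M (tensor R N W))
     (%m n. pure_tensor R M (tensor R N W) m (pure_tensor R N W n w))"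
  by (intro lin_intros m module_tensor pure_closed)

lemma bilin_tassoc_inv:
  "bilin R (tensor R M N) W (tensor R M (tensor R N W))
     (%u w. tsum R M N (tensor R M (tensor R N W)) u
       (%m n. pure_tensor R M (tensor R N W) m (pure_tensor R N W n w)))"
  by (intro lin_intros m module_tensor pure_closed right_module_of_module[OF m(3)])

lemma tassoc_inv_lin: "lin R (tensor R (tensor R M N) W) (tensor R M (tensor R N W)) (tassoc_inv R M N W)"
  unfolding tassoc_inv_def by (intro tsum_lin m module_tensor bilin_tassoc_inv)

lemma tassoc_inv_pure:
  "x @: M ==> n @: N ==> w @: W ==>
    tassoc_inv R M N W (pure_tensor R (tensor R M N) W (pure_tensor R M N x n) w) =
    pure_tensor R M (tensor R N W) x (pure_tensor R N W n w)"
  unfolding tassoc_inv_def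
  by (simp add: tsum_pure[OF _ _ _ bilin_tassoc_inv] tsum_pure[OF _ _ _ bilin_tassoc_inv_inner] m pure_closed)

lemma tassoc_inv_tassoc:
  "t @: (tensor R M (tensor R N W)) ==> tassoc_inv R M N W (tassoc R M N W t) = t"
  by (rule lin_ext3[OF m _ lin_compose[OF tassoc_lin tassoc_inv_lin] lin_id])
    (simp_all add: m tassoc_pure tassoc_inv_pure)

end

lemma tassoc_tmap:
  assumes m: "module R M" "module R M'" "module R N" "module R W" and f: "lin R M M' f"
    and t: "t @: (tensor R M (tensor R N W))"
  shows "tassoc R M' N W (tmap R M M' (tensor R N W) f t) =
    tmap R (tensor R M N) (tensor R M' N) W (tmap R M M' N f) (tassoc R M N W t)"
proof (rule lin_ext3[where M = M and N = N and W = W, OF m(1,3,4) _ _ _ _ t])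
  note l = tmap_lin[OF m(1,2) module_tensor[OF m(3,4)] f] tmap_lin[OF m(1,2,3) f]
    tassoc_lin[OF m(2,3,4)] tassoc_lin[OF m(1,3,4)]
  show "lin R (tensor R M (tensor R N W)) (tensor R (tensor R M' N) W)
     (%t. tassoc R M' N W (tmap R M M' (tensor R N W) f t))"
    by (rule lin_compose[OF l(1,3)])
  show "lin R (tensor R M (tensor R N W)) (tensor R (tensor R M' N) W)
     (%t. tmap R (tensor R M N) (tensor R M' N) W (tmap R M M' N f) (tassoc R M N W t))"
    by (rule lin_compose[OF l(4) tmap_lin[OF _ _ m(4) l(2)]]) (simp_all add: m)
qed (simp_all add: m f tassoc_pure tmap_pure lin_closed[OF f] pure_closed tmap_lin)

text \<open>Keeps the second factors of some expression of \<open>t\<close> as a sum of pure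
  tensors. The set \<open>X\<close> is fixed before \<open>b\<close> and \<open>b'\<close>, so that
  a map of finite rank fixing \<open>X\<close> can be chosen in between and built into one of
  them.\<close>

lemma tensor_finite_support:
  fixes P :: "('r, 'p, 'e) module_scheme"
  assumes m: "module R M" "module R W" and P: "module R P" and t: "t @: tensor R M W"
  shows "\<exists>X. finite X \<and> X \<subseteq> carrier W \<and>
    (\<forall>b b'. bilin R M W P b --> bilin R M W P b' --> (\<forall>x \<in> carrier M. \<forall>w \<in> X. b x w = b' x w) -->
      tsum R M W P t b = tsum R M W P t b')"
proof -
  define E where "E X t \<longleftrightarrow>
    (\<forall>b b'. bilin R M W P b --> bilin R M W P b' --> (\<forall>x \<in> carrier M. \<forall>w \<in> X. b x w = b' x w) -->
      tsum R M W P t b = tsum R M W P t b')" for X t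
  have "\<exists>X. finite X \<and> X \<subseteq> carrier W \<and> E X t"
    using m t
  proof (induction rule: tensor_induct)
    case (pure x w)
    have "E {w} (pure_tensor R M W x w)"
      unfolding E_def
    proof (intro allI impI)
      fix b b' assume b: "bilin R M W P b" "bilin R M W P b'" and "\<forall>x \<in> carrier M. \<forall>w \<in> {w}. b x w = b' x w"
      then have "b x w = b' x w" using pure by blast
      then show "tsum R M W P (pure_tensor R M W x w) b = tsum R M W P (pure_tensor R M W x w) b'"
        unfolding tsum_pure[OF m P b(1) pure] tsum_pure[OF m P b(2) pure] .
    qed
    then show ?case using pure by blast
  next
    case (add s t)
    then obtain X Y where X: "finite X" "X \<subseteq> carrier W" "E X s" and Y: "finite Y" "Y \<subseteq> carrier W" "E Y t" by blast
    have "E (X \<union> Y) (s +[tensor R M W] t)"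
      unfolding E_def
    proof (intro allI impI)
      fix b b' assume b: "bilin R M W P b" "bilin R M W P b'" and eq: "\<forall>x \<in> carrier M. \<forall>w \<in> X \<union> Y. b x w = b' x w"
      have eq': "\<forall>x \<in> carrier M. \<forall>w \<in> X. b x w = b' x w" "\<forall>x \<in> carrier M. \<forall>w \<in> Y. b x w = b' x w"
        using eq by blast+
      have "tsum R M W P s b = tsum R M W P s b'" "tsum R M W P t b = tsum R M W P t b'"
        using X(3)[unfolded E_def, rule_format, OF b] Y(3)[unfolded E_def, rule_format, OF b] eq' by metis+
      then show "tsum R M W P (s +[tensor R M W] t) b = tsum R M W P (s +[tensor R M W] t) b'"
        unfolding tsum_add[OF m P b(1) add(1,2)] tsum_add[OF m P b(2) add(1,2)] by simp
    qed
    then show ?case using X Y by (intro exI[of _ "X \<union> Y"]) auto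
  qed
  then show ?thesis unfolding E_def .
qed

section \<open>Cardinalities and universes\<close>

lemma lepoll_Times:
  assumes Z: "infinite Z" and "S \<lesssim> Z" "T \<lesssim> Z"
  shows "S \<times> T \<lesssim> Z"
proof -
  have "Z \<times> Z \<approx> Z" using card_of_Times_same_infinite[OF Z] by (simp add: eqpoll_iff_card_of_ordIso)
  then show ?thesis using times_lepoll_mono[OF assms(2,3)] lepoll_trans2 by blast
qed

lemma lepoll_Fpow:
  assumes Z: "infinite Z" and S: "S \<lesssim> Z"
  shows "Fpow S \<lesssim> Z"
proof -
  obtain f where f: "inj_on f S" "f ` S \<subseteq> Z" using S by (auto simp: lepoll_def)
  have "inj_on (image f) (Fpow S)"
    by (rule inj_on_subset[OF inj_on_image_Pow[OF f(1)] Fpow_subset_Pow])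
  moreover have "image f ` Fpow S \<subseteq> Fpow Z" using f by (auto simp: Fpow_def)
  ultimately have "Fpow S \<lesssim> Fpow Z" by (auto simp: lepoll_def)
  then show ?thesis using eqpoll_Fpow[OF Z] lepoll_trans2 by blast
qed

lemma lepoll_int:
  assumes "infinite Z" shows "(UNIV :: int set) \<lesssim> Z"
proof -
  have "(UNIV :: int set) \<lesssim> (UNIV :: nat set)"
    unfolding lepoll_def by (intro exI[of _ to_nat]) simp
  then show ?thesis using assms lepoll_trans by (auto simp: infinite_le_lepoll)
qed

text \<open>An element of the free abelian group is determined by the finite graph of its
  coefficients, a finite subset of a set no larger than \<open>Z\<close>; the tensor product is an
  image of that group.\<close>

lemma lepoll_tensor:
  fixes M :: "('r, 'm, 'x) module_scheme" and N :: "('r, 'n, 'y) module_scheme"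
  assumes Z: "infinite Z" and "carrier M \<lesssim> Z" "carrier N \<lesssim> Z"
  shows "carrier (tensor R M N) \<lesssim> Z"
proof -
  let ?F = "{z :: ('m \<times> 'n) \<Rightarrow>\<^sub>0 int. Poly_Mapping.keys z \<subseteq> carrier M \<times> carrier N}"
  let ?g = "%z. (%p. (p, Poly_Mapping.lookup z p)) ` Poly_Mapping.keys z"
  have "carrier (tensor R M N) = tensor_class R M N ` ?F"
    by (auto simp: tensor_def tensor_group_def FactGroup_def RCOSETS_def tensor_class_def)
  then have 1: "carrier (tensor R M N) \<lesssim> ?F" by (simp add: image_lepoll)
  have "inj_on ?g ?F"
  proof (rule inj_onI)
    fix z z' assume eq: "?g z = ?g z'"
    have "Poly_Mapping.lookup z p = Poly_Mapping.lookup z' p" for p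
    proof (cases "p \<in> Poly_Mapping.keys z")
      case True
      then have "(p, Poly_Mapping.lookup z p) \<in> ?g z'" using eq by blast
      then show ?thesis by auto
    next
      case False
      have "p \<notin> Poly_Mapping.keys z'"
      proof
        assume "p \<in> Poly_Mapping.keys z'"
        then have "(p, Poly_Mapping.lookup z' p) \<in> ?g z" using eq by blast
        then show False using False by auto
      qed
      then show ?thesis using False by (simp add: in_keys_iff)
    qed
    then show "z = z'" by (rule poly_mapping_eqI)
  qed
  moreover have "?g ` ?F \<subseteq> Fpow ((carrier M \<times> carrier N) \<times> (UNIV :: int set))" by (auto simp: Fpow_def)
  ultimately have "?F \<lesssim> Fpow ((carrier M \<times> carrier N) \<times> (UNIV :: int set))"
    unfolding lepoll_def by (intro exI[of _ ?g] conjI)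
  also have "\<dots> \<lesssim> Z"
    by (intro lepoll_Fpow lepoll_Times Z assms lepoll_int)
  finally show ?thesis using 1 lepoll_trans by blast
qed

lemma lepoll_dsum:
  assumes Z: "infinite Z" and "(SIGMA i:I. carrier (X i)) \<lesssim> Z"
  shows "carrier (dsum I X) \<lesssim> Z"
proof -
  let ?g = "%f. (%i. (i, f i)) ` {i \<in> I. f i ~= 0[X i]}"
  have "inj_on ?g (carrier (dsum I X))"
  proof (rule inj_onI)
    fix f f' assume f: "f @: dsum I X" "f' @: dsum I X" and eq: "?g f = ?g f'"
    show "f = f'"
    proof (rule extensionalityI[of _ I])
      fix i assume i: "i \<in> I"
      show "f i = f' i"
      proof (cases "f i = 0[X i]")
        case True
        have "f' i = 0[X i]"
        proof (rule ccontr)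
          assume "f' i ~= 0[X i]"
          then have "(i, f' i) \<in> ?g f" using eq i by blast
          with True \<open>f' i ~= 0[X i]\<close> show False by auto
        qed
        then show ?thesis using True by simp
      next
        case False
        then have "(i, f i) \<in> ?g f'" using eq i by blast
        then show ?thesis by auto
      qed
    qed (use f in \<open>auto simp: dsum_def PiE_def\<close>)
  qed
  moreover have "?g ` carrier (dsum I X) \<subseteq> Fpow (SIGMA i:I. carrier (X i))" by (auto simp: Fpow_def dsum_def)
  ultimately have "carrier (dsum I X) \<lesssim> Fpow (SIGMA i:I. carrier (X i))"
    unfolding lepoll_def by (intro exI[of _ ?g] conjI)
  also have "\<dots> \<lesssim> Z" by (rule lepoll_Fpow[OF Z assms(2)])
  finally show ?thesis .
qed

section \<open>Small sets on arbitrary types\<close>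

locale universe =
  fixes B :: "'b set" and U :: "'u set set"
  assumes univ: "is_universe B U" and infinite_base: "infinite B"
begin

text \<open>Extends smallness from the single type over which \<open>U\<close> ranges to all types,
  so that tensor products and function spaces can be measured.\<close>

definition small :: "'s set => bool" where
  "small S \<longleftrightarrow> (\<exists>Y \<in> U. S \<lesssim> Y)"

lemma U_lepoll: "X \<in> U ==> Y \<lesssim> X ==> Y \<in> U"
  using univ by (auto simp: is_universe_def)

lemma U_UN: "I \<in> U ==> (\<And>i. i \<in> I ==> X i \<in> U) ==> (\<Union>i\<in>I. X i) \<in> U"
  using univ by (simp add: is_universe_def)

lemma small_U: "X \<in> U ==> small X"
  by (auto simp: small_def)

lemma small_lepoll: "small S ==> T \<lesssim> S ==> small T"
  unfolding small_def using lepoll_trans by blast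

lemma small_subset: "small S ==> T \<subseteq> S ==> small T"
  using small_lepoll subset_imp_lepoll by blast

lemma small_image: "small S ==> small (f ` S)"
  using small_lepoll image_lepoll by blast

lemma small_base: "S \<lesssim> B ==> small S"
  using univ small_lepoll unfolding is_universe_def small_def by blast

lemma small_copy:
  assumes "small S"
  obtains h :: "'s => 'u" where "inj_on h S" "h ` S \<in> U"
proof -
  obtain Y h where "Y \<in> U" "inj_on h S" "h ` S \<subseteq> Y" using assms by (auto simp: small_def lepoll_def)
  then show ?thesis using that U_lepoll subset_imp_lepoll by blast
qed

text \<open>Puts everything below one infinite member of \<open>U\<close>, where products, finite
  subsets and tensor products no longer increase the size.\<close>

lemma small_bound:
  assumes "small S" "small T"
  obtains Z where "Z \<in> U" "infinite Z" "B \<lesssim> Z" "S \<lesssim> Z" "T \<lesssim> Z"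
proof -
  obtain Y1 Y2 Y3 where Y: "Y1 \<in> U" "S \<lesssim> Y1" "Y2 \<in> U" "T \<lesssim> Y2" "Y3 \<in> U" "B \<lesssim> Y3"
    using assms small_base[OF lepoll_refl] by (auto simp: small_def)
  have 3: "infinite Y3" using Y infinite_base by (meson lepoll_trans infinite_le_lepoll)
  \<comment> \<open>\<open>U\<close> is closed under unions indexed by a member of \<open>U\<close>;
    a two-element index set is found inside the infinite set \<open>Y3\<close>.\<close>
  have un: "X \<union> X' \<in> U" if "X \<in> U" "X' \<in> U" for X X'
  proof -
    obtain u where u: "u \<in> Y3" using 3 by fastforce
    obtain v where v: "v \<in> Y3 - {u}" using 3 by (metis all_not_in_conv finite.emptyI infinite_remove)
    have "{u, v} \<in> U" using u v Y U_lepoll subset_imp_lepoll[of "{u, v}" Y3] by blast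
    then have "(\<Union>i\<in>{u, v}. if i = u then X else X') \<in> U"
      by (rule U_UN) (use that in auto)
    then show ?thesis using v by simp
  qed
  have "Y1 \<union> Y2 \<union> Y3 \<in> U" using un Y by blast
  moreover have "infinite (Y1 \<union> Y2 \<union> Y3)" using 3 by simp
  moreover have "Y1 \<lesssim> Y1 \<union> Y2 \<union> Y3" "Y2 \<lesssim> Y1 \<union> Y2 \<union> Y3" "Y3 \<lesssim> Y1 \<union> Y2 \<union> Y3"
    by (auto intro: subset_imp_lepoll)
  ultimately show ?thesis using that Y lepoll_trans by metis
qed

lemma small_Times: "small S ==> small T ==> small (S \<times> T)"
  by (metis lepoll_Times small_bound small_def)

lemma small_tensor: "small (carrier M) ==> small (carrier N) ==> small (carrier (tensor R M N))"
  by (metis lepoll_tensor small_bound small_def)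

text \<open>The fibres are embedded by unrelated maps \<open>k i\<close> whose images may overlap;
  pairing with \<open>h i\<close> keeps them apart.\<close>

lemma small_Sigma:
  fixes I :: "'i set" and X :: "'i => 's set"
  assumes I: "small I" and X: "\<And>i. i \<in> I ==> small (X i)"
  shows "small (Sigma I X)"
proof -
  obtain h :: "'i => 'u" where h: "inj_on h I" "h ` I \<in> U" by (rule small_copy[OF I])
  have "\<forall>i \<in> I. \<exists>k :: 's => 'u. inj_on k (X i) \<and> k ` X i \<in> U"
    using X by (metis small_copy)
  then obtain k :: "'i => 's => 'u" where k: "\<And>i. i \<in> I ==> inj_on (k i) (X i) \<and> k i ` X i \<in> U" by metis
  let ?W = "\<Union>j\<in>h ` I. k (inv_into I h j) ` X (inv_into I h j)"
  have "?W \<in> U" by (intro U_UN h) (use k in \<open>auto simp: inv_into_into\<close>)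
  then have "small (h ` I \<times> ?W)" by (intro small_Times small_U h)
  moreover have "inj_on (%(i, x). (h i, k i x)) (Sigma I X)"
    using h k by (auto simp: inj_on_def)
  then have "Sigma I X \<lesssim> h ` I \<times> ?W"
    unfolding lepoll_def using h by (intro exI conjI) (assumption, force)
  ultimately show ?thesis by (rule small_lepoll)
qed

lemma small_dsum:
  assumes "small I" "\<And>i. i \<in> I ==> small (carrier (X i))"
  shows "small (carrier (dsum I X))"
proof -
  have S: "small (SIGMA i:I. carrier (X i))" by (rule small_Sigma) (use assms in auto)
  obtain Z where "Z \<in> U" "infinite Z" "(SIGMA i:I. carrier (X i)) \<lesssim> Z" using small_bound[OF S S] by blast
  then show ?thesis using lepoll_dsum[of Z I X] by (auto simp: small_def)
qed

lemma small_funcset: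
  assumes "T \<lesssim> B" "small X" shows "small (T \<rightarrow>\<^sub>E X)"
proof -
  obtain Y where Y: "Y \<in> U" "X \<lesssim> Y" using assms by (auto simp: small_def)
  obtain Z where Z: "Z \<in> U" "infinite Z" "X \<lesssim> Z" using small_bound[OF assms(2) assms(2)] by blast
  have "(T \<rightarrow>\<^sub>E X) \<lesssim> (B \<rightarrow>\<^sub>E Z)"
    using lepoll_funcset_right[OF Z(3), of T] lepoll_funcset_left[OF _ assms(1), of Z] Z(2) lepoll_trans by fastforce
  moreover obtain W where "W \<in> U" "(B \<rightarrow>\<^sub>E Z) \<lesssim> W" using univ Z unfolding is_universe_def by blast
  ultimately show ?thesis using lepoll_trans unfolding small_def by blast
qed

text \<open>Characteristic functions reduce this to closure under \<open>B\<close>-th powers. It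
  bounds the number of subobjects from which the generator is assembled.\<close>

lemma small_Pow:
  assumes "T \<lesssim> B" shows "small (Pow T)"
proof -
  have "small (T \<rightarrow>\<^sub>E (UNIV :: bool set))"
    by (intro small_funcset assms small_base) (simp add: finite_lepoll_infinite infinite_base)
  moreover have "inj_on (%P. \<lambda>x\<in>T. x \<in> P) (Pow T)"
    by (rule inj_onI) (metis (mono_tags, lifting) PowD in_mono restrict_apply' subsetI subset_antisym)
  then have "Pow T \<lesssim> (T \<rightarrow>\<^sub>E (UNIV :: bool set))" unfolding lepoll_def by (intro exI conjI) auto
  ultimately show ?thesis by (rule small_lepoll)
qed

end

section \<open>Entwined modules\<close>

lemma base_module_simps [simp]:
  "carrier (base_module A M) = carrier M"
  "ring.zero (base_module A M) = ring.zero M"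
  "ring.add (base_module A M) = ring.add M"
  "r .[base_module A M] x = (r .[A] 1[A]) .[M] x"
  by (simp_all add: base_module_def restrict_scalars_def)

lemma abelian_group_cong:
  assumes "abelian_group M" "carrier N = carrier M" "ring.zero N = ring.zero M" "ring.add N = ring.add M"
  shows "abelian_group N"
proof -
  interpret abelian_group M by fact
  show ?thesis
  proof (rule abelian_groupI)
    fix x assume "x @: N"
    then show "\<exists>y\<in>carrier N. y +[N] x = 0[N]"
      using assms by (intro bexI[of _ "\<ominus>\<^bsub>M\<^esub> x"]) (simp_all add: l_neg)
  qed (simp_all add: assms add.m_ac)
qed

text \<open>\<open>cL\<close> is \<open>B \<otimes> \<Delta>\<close>, \<open>cR\<close> below is
  \<open>\<rho> \<otimes> C\<close> rebracketed to the right, and \<open>cE\<close> is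
  \<open>B \<otimes> \<epsilon>\<close>. Separating these maps from the element
  \<open>\<rho> m\<close> turns the comodule axioms into equalities of linear maps, which can be
  compared on generators and transported by naturality.\<close>

definition cL where
  "cL R C \<Delta> B t = tsum R B C (tensor R B (tensor R C C)) t (%x c. pure_tensor R B (tensor R C C) x (\<Delta> c))"

definition cR where
  "cR R C B \<rho> t = tsum R B C (tensor R B (tensor R C C)) t
     (%x c. tsum R B C (tensor R B (tensor R C C)) (\<rho> x)
       (%x' c'. pure_tensor R B (tensor R C C) x' (pure_tensor R C C c' c)))"

definition cE where
  "cE R C \<epsilon> B t = tsum R B C B t (%x c. \<epsilon> c .[B] x)"

text \<open>The right action of \<open>a\<close> on \<open>M \<otimes> C\<close>, namely
  \<open>(x \<otimes> c) a = \<Sum> x a_\<psi> \<otimes> c^\<psi>\<close>. Compatibility of an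
  entwined module says that the coaction is \<open>A\<close>-linear for it.\<close>

definition cP where
  "cP R A C \<psi> M a t = tsum R (base_module A M) C (tensor R (base_module A M) C) t
     (%x c. tsum R A C (tensor R (base_module A M) C) (\<psi> (pure_tensor R C A c a))
       (%b d. pure_tensor R (base_module A M) C (b .[M] x) d))"

context entwining
begin

lemma mA [simp]: "module R A"
  by unfold_locales

lemma mC [simp]: "module R C"
  by (rule R_coalgebra.axioms(1)[of R C \<Delta> \<epsilon>]) unfold_locales

lemma rA: "ring A"
  by unfold_locales

lemma cR: "cring R"
  by unfold_locales

lemma mself [simp]: "module R (self_module R)"
proof -
  interpret R: cring R by (rule cR)
  have "abelian_group (self_module R)"
    by (rule abelian_group_cong[of R]) (simp_all add: self_module_def R.abelian_group_axioms)
  then show ?thesis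
    by (intro moduleI cR) (simp_all add: self_module_def R.l_distr R.r_distr R.m_assoc)
qed

lemma lin_psi: "lin R (tensor R C A) (tensor R A C) \<psi>"
  and lin_Delta: "lin R C (tensor R C C) \<Delta>"
  and lin_eps: "lin R C (self_module R) \<epsilon>"
  using entwining_linear comult_linear counit_linear by (auto dest: lin_mapsD)

lemma eps_closed [simp]: "c @: C ==> \<epsilon> c @: R"
  using lin_closed[OF lin_eps] by (simp add: self_module_def)

lemma Delta_closed [simp]: "c @: C ==> \<Delta> c @: tensor R C C"
  by (rule lin_closed[OF lin_Delta])

lemma psi_closed [simp]: "t @: tensor R C A ==> \<psi> t @: tensor R A C"
  by (rule lin_closed[OF lin_psi])

lemma one_scaled [simp]: "r @: R ==> r .[A] 1[A] @: A"
proof -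
  interpret A: module R A by simp
  show "r @: R ==> ?thesis" by simp
qed

lemma scaled_central:
  assumes "r @: R" "a @: A"
  shows "(r .[A] 1[A]) *[A] a = r .[A] a" "a *[A] (r .[A] 1[A]) = r .[A] a"
proof -
  show "(r .[A] 1[A]) *[A] a = r .[A] a" "a *[A] (r .[A] 1[A]) = r .[A] a"
    using assms by (simp_all add: smult_mult_left smult_mult_right)
qed

lemma mB [simp]: "right_module A M ==> module R (base_module A M)"
proof -
  assume "right_module A M"
  then interpret M: right_module A M .
  have "abelian_group (base_module A M)"
    by (rule abelian_group_cong[OF M.M.abelian_group_axioms]) simp_all
  then show ?thesis
  proof (rule moduleI[OF cR])
    fix r s x assume rs: "r @: R" "s @: R" and x: "x @: base_module A M"
    have "(r *[R] s) .[A] 1[A] = (s .[A] 1[A]) *[A] (r .[A] 1[A])"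
      using rs by (simp add: scaled_central module.smult_assoc1[OF mA])
    then show "(r *[R] s) .[base_module A M] x = r .[base_module A M] (s .[base_module A M] x)"
      using rs x by (simp add: M.ract_assoc)
  qed (simp_all add: module.smult_l_distr[OF mA] M.ract_l_distr M.ract_r_distr M.ract_closed M.ract_one)
qed

lemma act_closed: "right_module A M ==> a @: A ==> x @: M ==> a .[M] x @: M"
  by (rule right_module.ract_closed)

lemma lin_base: "lin A M N f ==> lin R (base_module A M) (base_module A N) f"
  by (auto simp: lin_def)

text \<open>\<open>R\<close> acts through the elements \<open>r 1\<close>, which are central in
  \<open>A\<close>, so the action of \<open>a\<close> commutes with that of
  \<open>R\<close>.\<close>

lemma lin_act1 [lin_intros]:
  assumes M: "right_module A M" and f: "lin R K (base_module A M) f" and a: "a @: A"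
  shows "lin R K (base_module A M) (%x. a .[M] f x)"
proof -
  interpret M: right_module A M by (rule M)
  have c: "\<And>x. x @: K ==> f x @: M" using lin_closed[OF f] by simp
  have s: "a .[M] ((r .[A] 1[A]) .[M] y) = (r .[A] 1[A]) .[M] (a .[M] y)"
    if "r @: R" "y @: M" for r y
    using that a M.ract_assoc[of "r .[A] 1[A]" a y] M.ract_assoc[of a "r .[A] 1[A]" y]
    by (simp add: scaled_central)
  show ?thesis
    by (rule linI) (simp_all add: c a M.ract_closed lin_add[OF f] lin_smult[OF f] M.ract_r_distr s)
qed

lemma lin_act2 [lin_intros]:
  assumes M: "right_module A M" and f: "lin R K A f" and x: "x @: M"
  shows "lin R K (base_module A M) (%k. f k .[M] x)"
proof -
  interpret M: right_module A M by (rule M)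
  have c: "\<And>x. x @: K ==> f x @: A" using lin_closed[OF f] .
  have s: "(r .[A] a) .[M] x = (r .[A] 1[A]) .[M] (a .[M] x)"
    if "r @: R" "a @: A" for r a
    using that x M.ract_assoc[of a "r .[A] 1[A]" x] by (simp add: scaled_central)
  show ?thesis
    by (rule linI) (simp_all add: c x M.ract_closed lin_add[OF f] lin_smult[OF f] M.ract_l_distr s)
qed

lemma lin_mult1 [lin_intros]:
  assumes f: "lin R K A f" and a: "a @: A"
  shows "lin R K A (%x. f x *[A] a)"
proof -
  note c = lin_closed[OF f]
  show ?thesis
    by (rule linI) (simp_all add: c a lin_add[OF f] lin_smult[OF f] A.l_distr smult_mult_left)
qed

lemma lin_mult2 [lin_intros]:
  assumes f: "lin R K A f" and a: "a @: A"
  shows "lin R K A (%x. a *[A] f x)"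
proof -
  note c = lin_closed[OF f]
  show ?thesis
    by (rule linI) (simp_all add: c a lin_add[OF f] lin_smult[OF f] A.r_distr smult_mult_right)
qed

lemma lin_psi' [lin_intros]: "lin R K (tensor R C A) f ==> lin R K (tensor R A C) (%x. \<psi> (f x))"
  and lin_Delta' [lin_intros]: "lin R K C g ==> lin R K (tensor R C C) (%x. \<Delta> (g x))"
  and lin_eps' [lin_intros]: "lin R K C g ==> lin R K (self_module R) (%x. \<epsilon> (g x))"
  using lin_compose lin_psi lin_Delta lin_eps by fast+

lemma lin_scal1 [lin_intros]:
  assumes M: "module R M" and f: "lin R K (self_module R) f" and x: "x @: M"
  shows "lin R K M (%k. f k .[M] x)"
proof -
  interpret M: module R M by (rule M)
  have c: "\<And>x. x @: K ==> f x @: R" using lin_closed[OF f] by (simp add: self_module_def)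
  show ?thesis
    using lin_add[OF f] lin_smult[OF f]
    by (intro linI) (simp_all add: self_module_def c x M.smult_l_distr M.smult_assoc1)
qed

lemma lin_scal2 [lin_intros]:
  "module R M ==> lin R K M f ==> r @: R ==> lin R K M (%k. r .[M] f k)"
  by (rule lin_scale)

lemmas base_right = right_module_of_module

context
  fixes B :: "('r, 'b, 'z) module_scheme"
  assumes B: "module R B"
begin

lemma bilin_cL: "bilin R B C (tensor R B (tensor R C C)) (%x c. pure_tensor R B (tensor R C C) x (\<Delta> c))"
  using B by (auto intro!: lin_intros)

lemma bilin_cR_inner:
  "c @: C ==> bilin R B C (tensor R B (tensor R C C))
     (%x' c'. pure_tensor R B (tensor R C C) x' (pure_tensor R C C c' c))"
  using B by (auto intro!: lin_intros pure_closed)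

lemma bilin_cR:
  assumes \<rho>: "lin R B (tensor R B C) \<rho>"
  shows "bilin R B C (tensor R B (tensor R C C)) (%x c. tsum R B C (tensor R B (tensor R C C)) (\<rho> x)
       (%x' c'. pure_tensor R B (tensor R C C) x' (pure_tensor R C C c' c)))"
  using B lin_closed[OF \<rho>] by (auto intro!: bilinI lin_tsum1 lin_tsum2 lin_pure1 lin_pure2 lin_id \<rho> pure_closed base_right)

lemma bilin_cE: "bilin R B C B (%x c. \<epsilon> c .[B] x)"
  using B by (auto intro!: lin_intros)

lemma cL_lin: "lin R (tensor R B C) (tensor R B (tensor R C C)) (cL R C \<Delta> B)"
  unfolding cL_def by (intro tsum_lin bilin_cL B module_tensor mC)

lemma cL_pure: "x @: B ==> c @: C ==>
    cL R C \<Delta> B (pure_tensor R B C x c) = pure_tensor R B (tensor R C C) x (\<Delta> c)"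
  unfolding cL_def by (simp add: tsum_pure B bilin_cL)

lemma cR_lin: "lin R B (tensor R B C) \<rho> ==> lin R (tensor R B C) (tensor R B (tensor R C C)) (cR R C B \<rho>)"
  unfolding cR_def by (intro tsum_lin bilin_cR B module_tensor mC)

lemma cR_pure: "lin R B (tensor R B C) \<rho> ==> x @: B ==> c @: C ==>
    cR R C B \<rho> (pure_tensor R B C x c) = tsum R B C (tensor R B (tensor R C C)) (\<rho> x)
       (%x' c'. pure_tensor R B (tensor R C C) x' (pure_tensor R C C c' c))"
  unfolding cR_def by (simp add: tsum_pure B bilin_cR)

lemma cE_lin: "lin R (tensor R B C) B (cE R C \<epsilon> B)"
  unfolding cE_def by (intro tsum_lin bilin_cE B module_tensor mC)

lemma cE_pure: "x @: B ==> c @: C ==> cE R C \<epsilon> B (pure_tensor R B C x c) = \<epsilon> c .[B] x"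
  unfolding cE_def by (simp add: tsum_pure B bilin_cE)

end

lemma lin_psi_r [lin_intros]: "a @: A ==> lin R K C f ==> lin R K (tensor R A C) (%x. \<psi> (pure_tensor R C A (f x) a))"
  by (auto intro!: lin_intros)

context
  fixes M :: "('a, 'm, 'z) module_scheme"
  assumes M: "right_module A M"
begin

lemma bilin_act: "x @: M ==> bilin R A C (tensor R (base_module A M) C)
    (%b d. pure_tensor R (base_module A M) C (b .[M] x) d)"
  using M by (auto intro!: lin_intros act_closed)

lemma lin_act_tsum: "x @: M ==> lin R K (tensor R A C) f ==> lin R K (tensor R (base_module A M) C)
    (%k. tsum R A C (tensor R (base_module A M) C) (f k) (%b d. pure_tensor R (base_module A M) C (b .[M] x) d))"
  using M by (auto intro!: lin_tsum1 bilin_act)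

lemma lin_act_tsum2: "t @: tensor R A C ==> lin R (base_module A M) (tensor R (base_module A M) C)
    (%x. tsum R A C (tensor R (base_module A M) C) t (%b d. pure_tensor R (base_module A M) C (b .[M] x) d))"
  using M by (intro lin_tsum2) (auto intro!: bilin_act lin_pure1 lin_act1 lin_id base_right)

lemma bilin_cP: "a @: A ==> bilin R (base_module A M) C (tensor R (base_module A M) C)
    (%x c. tsum R A C (tensor R (base_module A M) C) (\<psi> (pure_tensor R C A c a))
       (%b d. pure_tensor R (base_module A M) C (b .[M] x) d))"
  by (intro bilinI lin_act_tsum lin_act_tsum2 lin_psi_r lin_id psi_closed pure_closed mA mC) simp_all

lemma cP_lin: "a @: A ==> lin R (tensor R (base_module A M) C) (tensor R (base_module A M) C) (cP R A C \<psi> M a)"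
  unfolding cP_def using M by (intro tsum_lin bilin_cP) simp_all

lemma cP_pure: "a @: A ==> x @: M ==> c @: C ==>
    cP R A C \<psi> M a (pure_tensor R (base_module A M) C x c) =
      tsum R A C (tensor R (base_module A M) C) (\<psi> (pure_tensor R C A c a))
       (%b d. pure_tensor R (base_module A M) C (b .[M] x) d)"
  unfolding cP_def using M by (simp add: tsum_pure bilin_cP)

lemma cP_lin2: "t @: (tensor R (base_module A M) C) ==>
    lin R A (tensor R (base_module A M) C) (%a. cP R A C \<psi> M a t)"
  unfolding cP_def
  using M by (intro lin_tsum2 bilin_cP lin_act_tsum lin_psi' lin_pure2 lin_id base_right) auto

end

end

context entwining
begin

text \<open>The data of an entwined module without its equations. Each construction first provides
  these data; the equations are then carried over from modules where they are known.\<close>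

definition pre_entwined :: "('a, 'm, 'c) coact_module => bool" where
  "pre_entwined M \<longleftrightarrow> right_module A M \<and> coact M \<in> lin_maps R (base_module A M) (tensor R (base_module A M) C)"

abbreviation "entwined \<equiv> entwined_module R A C \<Delta> \<epsilon> \<psi>"
abbreviation "\<B> \<equiv> base_module A"
abbreviation (input) "\<L> \<equiv> lin_maps R C A"
abbreviation (input) "cP' \<equiv> cP R A C \<psi>"
abbreviation (input) "\<T> M \<equiv> tensor R (base_module A M) C"
abbreviation (input) "\<H> \<equiv> entwined_maps R A C"
abbreviation (input) "pt M \<equiv> pure_tensor R (base_module A M) C"
abbreviation (input) "tm M N \<equiv> tmap R (base_module A M) (base_module A N) C"
abbreviation (input) "\<U> \<equiv> smash_unit_map A C \<epsilon>"

lemma entwined_iff: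
  "entwined M \<longleftrightarrow> pre_entwined M \<and>
     (\<forall>m \<in> carrier M. cL R C \<Delta> (\<B> M) (coact M m) = cR R C (\<B> M) (coact M) (coact M m) \<and>
       cE R C \<epsilon> (\<B> M) (coact M m) = m \<and>
       (\<forall>a \<in> carrier A. coact M (a .[M] m) = cP' M a (coact M m)))"
  unfolding entwined_module_def entwined_module_axioms_def pre_entwined_def cL_def cR_def cE_def cP_def
  by blast

lemma pre_entwinedD:
  assumes "pre_entwined M"
  shows "right_module A M" "lin R (\<B> M) (\<T> M) (coact M)" "coact M \<in> extensional (carrier M)"
  using assms by (auto simp: pre_entwined_def lin_maps_iff)

lemma entwinedD:
  assumes "entwined M"
  shows "right_module A M" "lin R (\<B> M) (\<T> M) (coact M)" "coact M \<in> extensional (carrier M)"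
    "\<And>m. m @: M ==> cL R C \<Delta> (\<B> M) (coact M m) = cR R C (\<B> M) (coact M) (coact M m)"
    "\<And>m. m @: M ==> cE R C \<epsilon> (\<B> M) (coact M m) = m"
    "\<And>m a. m @: M ==> a @: A ==> coact M (a .[M] m) = cP' M a (coact M m)"
    "\<And>m. m @: M ==> coact M m @: \<T> M" "module R (\<B> M)"
proof -
  note p = assms[unfolded entwined_iff]
  note q = pre_entwinedD[OF conjunct1[OF p]]
  show "right_module A M" "lin R (\<B> M) (\<T> M) (coact M)" "coact M \<in> extensional (carrier M)"
    using q by auto
  show "\<And>m. m @: M ==> cL R C \<Delta> (\<B> M) (coact M m) = cR R C (\<B> M) (coact M) (coact M m)"
    "\<And>m. m @: M ==> cE R C \<epsilon> (\<B> M) (coact M m) = m"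
    "\<And>m a. m @: M ==> a @: A ==> coact M (a .[M] m) = cP' M a (coact M m)"
    using p by auto
  show "\<And>m. m @: M ==> coact M m @: \<T> M" using lin_closed[OF q(2)] by simp
  show "module R (\<B> M)" using q by simp
qed

lemma entwined_maps_iff:
  "f \<in> \<H> M N \<longleftrightarrow> f \<in> lin_maps A M N \<and>
     (\<forall>m \<in> carrier M. coact N (f m) = tm M N f (coact M m))"
  by (simp add: entwined_maps_def tmap_def)

subsection \<open>Naturality\<close>

lemma cL_nat:
  assumes m: "module R B" "module R B'" and f: "lin R B B' f" and t: "t @: tensor R B C"
  shows "cL R C \<Delta> B' (tmap R B B' C f t) = tmap R B B' (tensor R C C) f (cL R C \<Delta> B t)"
  by (rule lin_ext[OF m(1) mC lin_compose[OF tmap_lin[OF m mC f] cL_lin[OF m(2)]]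
        lin_compose[OF cL_lin[OF m(1)] tmap_lin[OF m module_tensor[OF mC mC] f]] _ t])
    (simp add: tmap_pure m f cL_pure lin_closed[OF f])

lemma cR_nat:
  assumes m: "module R B" "module R B'" and f: "lin R B B' f" and t: "t @: tensor R B C"
    and \<rho>: "lin R B (tensor R B C) \<rho>" and \<rho>': "lin R B' (tensor R B' C) \<rho>'"
    and eq: "\<And>x. x @: B ==> \<rho>' (f x) = tmap R B B' C f (\<rho> x)"
  shows "cR R C B' \<rho>' (tmap R B B' C f t) = tmap R B B' (tensor R C C) f (cR R C B \<rho> t)"
proof (rule lin_ext[OF m(1) mC lin_compose[OF tmap_lin[OF m mC f] cR_lin[OF m(2) \<rho>']]
        lin_compose[OF cR_lin[OF m(1) \<rho>] tmap_lin[OF m module_tensor[OF mC mC] f]] _ t])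
  fix x c assume x: "x @: B" and c: "c @: C"
  note cc = module_tensor[OF mC mC]
  have "cR R C B' \<rho>' (tmap R B B' C f (pure_tensor R B C x c)) =
      tsum R B' C (tensor R B' (tensor R C C)) (tmap R B B' C f (\<rho> x))
       (%x' c'. pure_tensor R B' (tensor R C C) x' (pure_tensor R C C c' c))"
    using x c by (simp add: tmap_pure m f cR_pure \<rho>' lin_closed[OF f] eq)
  also have "\<dots> = tsum R B C (tensor R B' (tensor R C C)) (\<rho> x)
       (%x' c'. pure_tensor R B' (tensor R C C) (f x') (pure_tensor R C C c' c))"
    using x c by (intro tsum_tmap m f bilin_cR_inner lin_closed[OF \<rho>] mC module_tensor)
  also have "\<dots> = tmap R B B' (tensor R C C) f (cR R C B \<rho> (pure_tensor R B C x c))"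
    unfolding cR_pure[OF m(1) \<rho> x c]
    by (subst tsum_push[OF m(1) mC _ _ tmap_lin[OF m cc f] bilin_cR_inner[OF m(1) c] lin_closed[OF \<rho> x]])
      (use c in \<open>auto simp: m tmap_pure f pure_closed intro!: tsum_cong\<close>)
  finally show "cR R C B' \<rho>' (tmap R B B' C f (pure_tensor R B C x c)) =
    tmap R B B' (tensor R C C) f (cR R C B \<rho> (pure_tensor R B C x c))" .
qed

lemma cE_nat:
  assumes m: "module R B" "module R B'" and f: "lin R B B' f" and t: "t @: tensor R B C"
  shows "cE R C \<epsilon> B' (tmap R B B' C f t) = f (cE R C \<epsilon> B t)"
  by (rule lin_ext[OF m(1) mC lin_compose[OF tmap_lin[OF m mC f] cE_lin[OF m(2)]]
        lin_compose[OF cE_lin[OF m(1)] f] _ t])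
    (simp add: tmap_pure m f cE_pure lin_closed[OF f] lin_smult[OF f])

lemma cP_nat:
  assumes m: "right_module A M" "right_module A N" and f: "lin A M N f" and a: "a @: A"
    and t: "t @: \<T> M"
  shows "cP' N a (tm M N f t) = tm M N f (cP' M a t)"
proof (rule lin_ext[OF mB[OF m(1)] mC
    lin_compose[OF tmap_lin[OF mB[OF m(1)] mB[OF m(2)] mC lin_base[OF f]] cP_lin[OF m(2) a]]
    lin_compose[OF cP_lin[OF m(1) a] tmap_lin[OF mB[OF m(1)] mB[OF m(2)] mC lin_base[OF f]]] _ t])
  fix x c assume x: "x @: \<B> M" and c: "c @: C"
  note f' = lin_base[OF f]
  have "cP' N a (tm M N f (pt M x c)) =
    tsum R A C (\<T> N) (\<psi> (pure_tensor R C A c a)) (%b d. pt N (b .[N] f x) d)"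
    using x c a lin_closed[OF f] by (simp add: tmap_pure m f' cP_pure)
  also have "\<dots> = tm M N f (cP' M a (pt M x c))"
    using x c a
    by (simp add: cP_pure m, subst tsum_push[OF mA mC _ _ tmap_lin[OF mB[OF m(1)] mB[OF m(2)] mC f'] bilin_act[OF m(1)]])
      (auto simp: m pure_closed tmap_pure f' act_closed lin_smult[OF f] intro!: tsum_cong)
  finally show "cP' N a (tm M N f (pt M x c)) =
    tm M N f (cP' M a (pt M x c))" .
qed

text \<open>Each axiom is an equality of linear maps in \<open>q\<close>, hence may be checked on
  the images of the \<open>p i\<close>, where naturality brings it back to \<open>X i\<close>.
  Generation is phrased as an induction rule so that it fits both surjections and direct
  sums.\<close>

lemma entwined_generated:
  fixes Q :: "('a, 'q, 'c) coact_module" and X :: "'i => ('a, 'm, 'c) coact_module"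
  assumes Q: "pre_entwined Q"
    and X: "\<And>i. i \<in> I ==> entwined (X i)"
    and p: "\<And>i. i \<in> I ==> lin A (X i) Q (p i)"
    and c: "\<And>i m. i \<in> I ==> m @: X i ==> coact Q (p i m) = tm (X i) Q (p i) (coact (X i) m)"
    and gen: "\<And>P q. q @: Q ==> P 0[Q] ==> (\<And>i m. i \<in> I ==> m @: X i ==> P (p i m)) ==>
      (\<And>x y. x @: Q ==> y @: Q ==> P x ==> P y ==> P (x +[Q] y)) ==> P q"
  shows "entwined Q"
proof -
  note q = pre_entwinedD[OF Q]
  note mQ = mB[OF q(1)]
  interpret Q: right_module A Q by (rule q(1))
  have ind: "f q = g q"
    if "lin R (\<B> Q) P f" "lin R (\<B> Q) P g" "module R P" "q @: Q"
      "\<And>i m. i \<in> I ==> m @: X i ==> f (p i m) = g (p i m)"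
    for f g q and P :: "('r, 'p) module"
  proof -
    have ab: "abelian_group (\<B> Q)" "abelian_group P" using mQ that(3) module_abelian_group by auto
    show ?thesis
      using lin_zero[OF ab that(1)] lin_zero[OF ab that(2)] lin_add[OF that(1)] lin_add[OF that(2)] that(5)
      by (intro gen[OF that(4), of "%q. f q = g q"]) auto
  qed
  have ind1: "cL R C \<Delta> (\<B> Q) (coact Q q) = cR R C (\<B> Q) (coact Q) (coact Q q)" if "q @: Q" for q
  proof (rule ind[OF lin_compose[OF q(2) cL_lin[OF mQ]] lin_compose[OF q(2) cR_lin[OF mQ q(2)]] _ that])
    fix i m assume i: "i \<in> I" and m: "m @: X i"
    note e = entwinedD[OF X[OF i]]
    have "cR R C (\<B> Q) (coact Q) (tm (X i) Q (p i) (coact (X i) m)) =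
        tmap R (\<B> (X i)) (\<B> Q) (tensor R C C) (p i) (cR R C (\<B> (X i)) (coact (X i)) (coact (X i) m))"
      by (rule cR_nat[OF e(8) mQ lin_base[OF p[OF i]] e(7)[OF m] e(2) q(2)]) (simp add: c[OF i])
    then show "cL R C \<Delta> (\<B> Q) (coact Q (p i m)) = cR R C (\<B> Q) (coact Q) (coact Q (p i m))"
      unfolding c[OF i m] by (simp add: cL_nat[OF e(8) mQ lin_base[OF p[OF i]] e(7)[OF m]] e(4)[OF m])
  qed (simp add: mQ)
  have ind2: "cE R C \<epsilon> (\<B> Q) (coact Q q) = q" if "q @: Q" for q
  proof (rule ind[OF lin_compose[OF q(2) cE_lin[OF mQ]] lin_id _ that])
    fix i m assume i: "i \<in> I" and m: "m @: X i"
    note e = entwinedD[OF X[OF i]]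
    show "cE R C \<epsilon> (\<B> Q) (coact Q (p i m)) = p i m"
      unfolding c[OF i m] by (simp add: cE_nat[OF e(8) mQ lin_base[OF p[OF i]] e(7)[OF m]] e(5)[OF m])
  qed (simp add: mQ)
  have ind3: "coact Q (a .[Q] q) = cP' Q a (coact Q q)" if "q @: Q" and a: "a @: A" for q a
  proof (rule ind[OF lin_compose[OF lin_act1[OF q(1) lin_id a] q(2)] lin_compose[OF q(2) cP_lin[OF q(1) a]] _ that(1)])
    fix i m assume i: "i \<in> I" and m: "m @: X i"
    note e = entwinedD[OF X[OF i]]
    have "coact Q (a .[Q] p i m) = coact Q (p i (a .[X i] m))"
      using lin_smult[OF p[OF i] a m] by simp
    also have "\<dots> = tm (X i) Q (p i) (cP' (X i) a (coact (X i) m))"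
      using m a by (simp add: c[OF i] act_closed[OF e(1)] e(6))
    also have "\<dots> = cP' Q a (coact Q (p i m))"
      by (simp add: c[OF i m] cP_nat[OF e(1) q(1) p[OF i] a e(7)[OF m]])
    finally show "coact Q (a .[Q] p i m) = cP' Q a (coact Q (p i m))" .
  qed (simp add: mQ)
  show ?thesis unfolding entwined_iff using Q ind1 ind2 ind3 by blast
qed

text \<open>Axioms are reflected along injections, one injectivity for each: \<open>i\<close> itself
  for the counit, \<open>i \<otimes> C\<close> for the compatibility with \<open>A\<close>, and
  \<open>i \<otimes> (C \<otimes> C)\<close> for coassociativity.\<close>

lemma entwined_of_inj:
  assumes K: "pre_entwined K" and M: "entwined M" and i: "lin A K M i"
    and c: "\<And>k. k @: K ==> coact M (i k) = tm K M i (coact K k)"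
    and inj: "inj_on i (carrier K)" "inj_on (tm K M i) (carrier (\<T> K))"
      "inj_on (tmap R (\<B> K) (\<B> M) (tensor R C C) i) (carrier (tensor R (\<B> K) (tensor R C C)))"
  shows "entwined K"
proof -
  note k = pre_entwinedD[OF K] and e = entwinedD[OF M]
  note mK = mB[OF k(1)] and i' = lin_base[OF i]
  have kc: "coact K x @: \<T> K" if "x @: K" for x
    using lin_closed[OF k(2)] that by simp
  have ic: "i x @: M" if "x @: K" for x using lin_closed[OF i that] .
  have 1: "cL R C \<Delta> (\<B> K) (coact K x) = cR R C (\<B> K) (coact K) (coact K x)" if x: "x @: K" for x
  proof (rule inj_onD[OF inj(3)])
    have "cR R C (\<B> M) (coact M) (tm K M i (coact K x)) =
        tmap R (\<B> K) (\<B> M) (tensor R C C) i (cR R C (\<B> K) (coact K) (coact K x))"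
      by (rule cR_nat[OF mK e(8) i' kc[OF x] k(2) e(2)]) (simp add: c)
    then show "tmap R (\<B> K) (\<B> M) (tensor R C C) i (cL R C \<Delta> (\<B> K) (coact K x)) =
      tmap R (\<B> K) (\<B> M) (tensor R C C) i (cR R C (\<B> K) (coact K) (coact K x))"
      using e(4)[OF ic[OF x]] by (simp add: c x cL_nat[OF mK e(8) i' kc[OF x]])
    show "cL R C \<Delta> (\<B> K) (coact K x) @: (tensor R (\<B> K) (tensor R C C))"
      by (rule lin_closed[OF cL_lin[OF mK] kc[OF x]])
    show "cR R C (\<B> K) (coact K) (coact K x) @: (tensor R (\<B> K) (tensor R C C))"
      by (rule lin_closed[OF cR_lin[OF mK k(2)] kc[OF x]])
  qed
  have 2: "cE R C \<epsilon> (\<B> K) (coact K x) = x" if x: "x @: K" for x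
  proof (rule inj_onD[OF inj(1)])
    show "i (cE R C \<epsilon> (\<B> K) (coact K x)) = i x"
      using e(5)[OF ic[OF x]] by (simp add: c x cE_nat[OF mK e(8) i' kc[OF x]])
    show "cE R C \<epsilon> (\<B> K) (coact K x) @: K" using lin_closed[OF cE_lin[OF mK] kc[OF x]] by simp
  qed (rule x)
  have 3: "coact K (a .[K] x) = cP' K a (coact K x)" if x: "x @: K" and a: "a @: A" for x a
  proof (rule inj_onD[OF inj(2)])
    show "tm K M i (coact K (a .[K] x)) = tm K M i (cP' K a (coact K x))"
      using e(6)[OF ic[OF x] a]
      by (simp add: cP_nat[OF k(1) e(1) i a kc[OF x], symmetric] x a act_closed[OF k(1)] lin_smult[OF i] flip: c)
  qed (use x a in \<open>auto intro: kc act_closed[OF k(1)] lin_closed[OF cP_lin[OF k(1)]]\<close>)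
  show ?thesis unfolding entwined_iff using K 1 2 3 by blast
qed

subsection \<open>Cofree entwined modules\<close>

definition cofree_mod :: "('a, 'n, 'z) module_scheme => ('a, ('n, 'c) tens) module" where
  "cofree_mod N = \<lparr>carrier = carrier (\<T> N), monoid.mult = undefined, monoid.one = undefined,
     ring.zero = 0[\<T> N], ring.add = ring.add (\<T> N),
     smult = (%a t. cP' N a t)\<rparr>"

text \<open>The coaction is \<open>N \<otimes> \<Delta>\<close>. It has to land in
  \<open>(N \<otimes> C) \<otimes> C\<close>, while iterated tensor products are bracketed to the
  right, whence \<open>tassoc\<close>. For \<open>N = A\<close> this is the coring
  \<open>A \<otimes> C\<close>.\<close>

definition cofree :: "('a, 'n, 'z) module_scheme => ('a, ('n, 'c) tens, 'c) coact_module" where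
  "cofree N = module.extend (cofree_mod N)
     \<lparr>coact = restrict (%t. tassoc R (\<B> N) C C (cL R C \<Delta> (\<B> N) t)) (carrier (\<T> N))\<rparr>"

lemma cofree_simps [simp]:
  "carrier (cofree N) = carrier (\<T> N)"
  "0[cofree N] = 0[\<T> N]"
  "ring.add (cofree N) = ring.add (\<T> N)"
  "a .[cofree N] t = cP' N a t"
  "coact (cofree N) = restrict (%t. tassoc R (\<B> N) C C (cL R C \<Delta> (\<B> N) t)) (carrier (\<T> N))"
  by (simp_all add: cofree_def cofree_mod_def module.defs coact_module.defs)

context
  fixes N :: "('a, 'n, 'z) module_scheme"
  assumes N: "right_module A N"
begin

interpretation N: right_module A N by (rule N)

private abbreviation (input) "TN \<equiv> \<T> N"

lemma mTN [simp]: "module R TN"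
  using N by simp

text \<open>Multiplicativity of \<open>\<psi>\<close>, pushed forward along the map
  \<open>?\<Phi>\<close> that sends \<open>b \<otimes> d\<close> to
  \<open>x b \<otimes> d\<close>.\<close>

lemma cP_compose:
  assumes a: "a @: A" "a' @: A" and t: "t @: TN"
  shows "cP' N (a *[A] a') t = cP' N a' (cP' N a t)"
proof (rule lin_ext[OF mB[OF N] mC cP_lin[OF N] lin_compose[OF cP_lin[OF N a(1)] cP_lin[OF N a(2)]] _ t])
  show "a *[A] a' @: A" using a by simp
  fix x c assume x: "x @: \<B> N" and c: "c @: C"
  then have x': "x @: N" by simp
  let ?\<Phi> = "%s. tsum R A C TN s (%b d. pt N (b .[N] x) d)"
  have \<Phi>: "lin R (tensor R A C) TN ?\<Phi>" by (rule lin_act_tsum[OF N x' lin_id])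
  have pa: "\<psi> (pure_tensor R C A d b) @: tensor R A C" if "d @: C" "b @: A" for d b
    using that by (simp add: pure_closed)
  have bl: "bilin R A C (tensor R A C) (%b' d'. pure_tensor R A C (b *[A] b') d')" if "b @: A" for b
    using that by (intro lin_intros) auto
  have bl2: "bilin R A C (tensor R A C) (%b d. tsum R A C (tensor R A C) (\<psi> (pure_tensor R C A d a'))
          (%b' d'. pure_tensor R A C (b *[A] b') d'))"
  proof (rule bilinI)
    fix d assume d: "d @: C"
    show "lin R A (tensor R A C) (%b. tsum R A C (tensor R A C) (\<psi> (pure_tensor R C A d a'))
          (%b' d'. pure_tensor R A C (b *[A] b') d'))"
      by (intro lin_tsum2 bl pa d a lin_pure1 lin_mult1 lin_id base_right) simp_all
  next
    fix b assume b: "b @: A"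
    show "lin R C (tensor R A C) (%d. tsum R A C (tensor R A C) (\<psi> (pure_tensor R C A d a'))
          (%b' d'. pure_tensor R A C (b *[A] b') d'))"
      by (intro lin_tsum1 bl b lin_psi_r a lin_id) simp_all
  qed
  have "cP' N (a *[A] a') (pt N x c) = ?\<Phi> (\<psi> (pure_tensor R C A c (a *[A] a')))"
    using a by (simp add: cP_pure[OF N _ x' c])
  also have "\<dots> = tsum R A C TN (\<psi> (pure_tensor R C A c a))
        (%b d. ?\<Phi> (tsum R A C (tensor R A C) (\<psi> (pure_tensor R C A d a'))
          (%b' d'. pure_tensor R A C (b *[A] b') d')))"
    unfolding entwining_mult[OF c a]
    by (rule tsum_push[OF mA mC _ mTN \<Phi> bl2 pa[OF c a(1)]]) simp
  also have "\<dots> = tsum R A C TN (\<psi> (pure_tensor R C A c a))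
        (%b d. tsum R A C TN (\<psi> (pure_tensor R C A d a')) (%b' d'. pt N (b' .[N] (b .[N] x)) d'))"
  proof (rule tsum_cong[OF refl])
    fix b d assume b: "b @: A" and d: "d @: C"
    have "?\<Phi> (tsum R A C (tensor R A C) (\<psi> (pure_tensor R C A d a')) (%b' d'. pure_tensor R A C (b *[A] b') d')) =
        tsum R A C TN (\<psi> (pure_tensor R C A d a')) (%b' d'. ?\<Phi> (pure_tensor R A C (b *[A] b') d'))"
      by (rule tsum_push[OF mA mC _ mTN \<Phi> bl[OF b] pa[OF d a(2)]]) simp
    also have "\<dots> = tsum R A C TN (\<psi> (pure_tensor R C A d a')) (%b' d'. pt N (b' .[N] (b .[N] x)) d')"
      using b by (intro tsum_cong refl) (simp add: tsum_pure[OF mA mC mTN bilin_act[OF N x']] N.ract_assoc x')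
    finally show "?\<Phi> (tsum R A C (tensor R A C) (\<psi> (pure_tensor R C A d a')) (%b' d'. pure_tensor R A C (b *[A] b') d')) =
      tsum R A C TN (\<psi> (pure_tensor R C A d a')) (%b' d'. pt N (b' .[N] (b .[N] x)) d')" .
  qed
  also have "\<dots> = tsum R A C TN (\<psi> (pure_tensor R C A c a))
        (%b d. cP' N a' (pt N (b .[N] x) d))"
    by (intro tsum_cong refl) (simp add: cP_pure[OF N a(2)] N.ract_closed x')
  also have "\<dots> = cP' N a' (cP' N a (pt N x c))"
    unfolding cP_pure[OF N a(1) x' c]
    by (rule tsum_push[symmetric, OF mA mC mTN mTN cP_lin[OF N a(2)] bilin_act[OF N x'] pa[OF c a(1)]])
  finally show "cP' N (a *[A] a') (pt N x c) =
    cP' N a' (cP' N a (pt N x c))" .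
qed

text \<open>\<open>\<psi>\<close> is linear and fixes \<open>1\<close>, so \<open>r 1\<close> passes
  through it unchanged. Hence the \<open>R\<close>-module underlying the cofree module is the tensor
  product itself, up to \<open>agree\<close>.\<close>

lemma cP_scaled:
  assumes r: "r @: R" and t: "t @: TN"
  shows "cP' N (r .[A] 1[A]) t = r .[TN] t"
proof (rule lin_ext[OF mB[OF N] mC cP_lin[OF N one_scaled[OF r]] lin_scale[OF mTN lin_id r] _ t])
  fix x c assume x: "x @: \<B> N" and c: "c @: C"
  then have x': "x @: N" by simp
  have "\<psi> (pure_tensor R C A c (r .[A] 1[A])) = pure_tensor R A C (r .[A] 1[A]) c"
    using r c lin_smult[OF lin_psi' [OF lin_pure2[OF mC mA lin_id c]] r A.one_closed]
    by (simp add: entwining_one smult_pure)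
  then show "cP' N (r .[A] 1[A]) (pt N x c) = r .[TN] pt N x c"
    using r x' c N by (simp add: cP_pure[OF N] tsum_pure[OF mA mC mTN bilin_act[OF N x']] smult_pure)
qed

lemma right_module_cofree: "right_module A (cofree N)"
proof (intro right_module.intro right_module_axioms.intro rA)
  interpret T: module R TN by simp
  show "abelian_group (cofree N)"
    by (rule abelian_group_cong[OF T.abelian_group_axioms]) simp_all
  fix x assume x: "x @: cofree N"
  show "1[A] .[cofree N] x = x"
    using cP_scaled[of "1[R]" x] x by simp
  fix s assume s: "s @: A"
  show "s .[cofree N] x @: cofree N" using lin_closed[OF cP_lin[OF N s]] x by simp
  show "(s +[A] t) .[cofree N] x = s .[cofree N] x +[cofree N] t .[cofree N] x" if "t @: A" for t
    using lin_add[OF cP_lin2[OF N] s that] x by simp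
  show "s .[cofree N] (x +[cofree N] y) = s .[cofree N] x +[cofree N] s .[cofree N] y" if "y @: cofree N" for y
    using lin_add[OF cP_lin[OF N s]] x that by simp
  show "(s *[A] t) .[cofree N] x = t .[cofree N] (s .[cofree N] x)" if "t @: A" for t
    using cP_compose[OF s that] x by simp
qed

lemma cofree_agree: "agree R TN (\<B> (cofree N))"
  by (simp add: agree_def cP_scaled)

end

end

context entwining
begin

section \<open>The entwined structure of cofree modules and the adjunction\<close>

lemma cL_agree: "agree R B B' ==> module R B ==> cL R C \<Delta> B' t = cL R C \<Delta> B t"
  unfolding cL_def by (simp add: agree_tsum[OF _ _ mC agree_tensor] agree_pure)

lemma cE_agree: "agree R B B' ==> module R B ==> cE R C \<epsilon> B' t = cE R C \<epsilon> B t"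
  unfolding cE_def by (auto simp: agree_tsum[of R B B' C B B'] agree_def intro!: tsum_cong)

lemma cR_agree:
  assumes a: "agree R B B'" and B: "module R B" and eq: "\<And>x. x @: B ==> \<rho>' x = \<rho> x"
  shows "cR R C B' \<rho>' t = cR R C B \<rho> t"
proof -
  have cc: "module R (tensor R C C)" by simp
  show ?thesis
    unfolding cR_def agree_tsum[OF a B mC agree_tensor[OF a B cc]] agree_pure[OF a]
    by (intro tsum_cong refl) (simp add: eq)
qed

lemma tmap_agree:
  assumes a: "agree R B B'" and "module R B" "module R W" "module R M" and f: "lin R M B f"
  shows "tmap R M B' W f t = tmap R M B W f t"
  unfolding tmap_def agree_pure[OF a]
  using agree_tsum[OF agree_refl assms(4,3) agree_tensor[OF a assms(2,3)]] .

lemma tmap_agree_left: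
  assumes a: "agree R M M'" and "module R B" "module R W" "module R M"
  shows "tmap R M' B W f t = tmap R M B W f t"
  unfolding tmap_def using agree_tsum[OF a assms(4,3) agree_refl] .

text \<open>\<open>N \<mapsto> N \<otimes> C\<close> is right adjoint to the functor that forgets coactions; \<open>hat\<close> is one direction of the adjunction.\<close>

definition hat :: "('a, 'n, 'z) module_scheme => ('a, 'm, 'c) coact_module => ('m => 'n) => 'm => ('n, 'c) tens" where
  "hat N M u m = tm M N u (coact M m)"

context
  fixes N :: "('a, 'n, 'z) module_scheme"
  assumes N: "right_module A N"
begin

interpretation N: right_module A N by (rule N)

private abbreviation (input) "TC \<equiv> \<T> N"

lemma mTN' [simp]: "module R TC"
  using N by simp

private abbreviation (input) "\<rho> \<equiv> (%t. tassoc R (\<B> N) C C (cL R C \<Delta> (\<B> N) t))"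

lemma cofree_coact_lin: "lin R TC (tensor R TC C) \<rho>"
  by (rule lin_compose[OF cL_lin[OF mB[OF N]] tassoc_lin[OF mB[OF N] mC mC]])

lemma pre_entwined_cofree: "pre_entwined (cofree N)"
proof -
  note a = cofree_agree[OF N]
  have "restrict \<rho> (carrier TC) \<in> lin_maps R TC (tensor R TC C)"
    by (rule lin_restrict[OF right_module_of_module[OF mTN'] cofree_coact_lin])
  also have "lin_maps R TC (tensor R TC C) = lin_maps R (\<B> (cofree N)) (\<T> (cofree N))"
    by (rule agree_lin_maps[OF a agree_tensor[OF a mTN' mC]])
  finally show ?thesis
    unfolding pre_entwined_def cofree_simps by (intro conjI right_module_cofree[OF N])
qed

lemma lin_pure_const: "n @: N ==> lin R C TC (%c. pt N n c)"
  using lin_pure2[OF mB[OF N] mC lin_id] by simp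

text \<open>On \<open>n \<otimes> C\<close> the coaction is \<open>\<Delta>\<close> carried along
  \<open>c \<mapsto> n \<otimes> c\<close>. Coassociativity and the counit law are thereby inherited
  from \<open>C\<close> by naturality.\<close>

lemma cofree_coact_pure:
  assumes n: "n @: N" and c: "c @: C"
  shows "\<rho> (pt N n c) = tmap R C TC C (%c. pt N n c) (\<Delta> c)"
  using assms
  by (simp add: cL_pure[OF mB[OF N]] tassoc_def tsum_pure[OF mB[OF N] module_tensor _ bilin_tassoc[OF mB[OF N]]] tmap_def)

lemma cofree_coassoc:
  assumes t: "t @: TC"
  shows "cL R C \<Delta> TC (\<rho> t) = cR R C TC \<rho> (\<rho> t)"
proof (rule lin_ext[OF mB[OF N] mC lin_compose[OF cofree_coact_lin cL_lin[OF mTN']]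
    lin_compose[OF cofree_coact_lin cR_lin[OF mTN' cofree_coact_lin]] _ t])
  fix n c assume n: "n @: \<B> N" and c: "c @: C"
  then have n': "n @: N" by simp
  note f = lin_pure_const[OF n']
  have "cL R C \<Delta> C (\<Delta> c) = cR R C C \<Delta> (\<Delta> c)"
    using coassoc[OF c] by (simp add: cL_def cR_def)
  moreover have "cR R C TC \<rho> (tmap R C TC C (%c. pt N n c) (\<Delta> c)) =
      tmap R C TC (tensor R C C) (%c. pt N n c) (cR R C C \<Delta> (\<Delta> c))"
    by (rule cR_nat[OF mC mTN' f Delta_closed[OF c] lin_Delta cofree_coact_lin cofree_coact_pure[OF n']])
  ultimately show "cL R C \<Delta> TC (\<rho> (pt N n c)) = cR R C TC \<rho> (\<rho> (pt N n c))"
    unfolding cofree_coact_pure[OF n' c] by (simp add: cL_nat[OF mC mTN' f] c)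
qed

lemma cofree_counit:
  assumes t: "t @: TC"
  shows "cE R C \<epsilon> TC (\<rho> t) = t"
proof (rule lin_ext[OF mB[OF N] mC lin_compose[OF cofree_coact_lin cE_lin[OF mTN']] lin_id _ t])
  fix n c assume n: "n @: \<B> N" and c: "c @: C"
  then have n': "n @: N" by simp
  have "cE R C \<epsilon> C (\<Delta> c) = c" using counit_right[OF c] by (simp add: cE_def)
  then show "cE R C \<epsilon> TC (\<rho> (pt N n c)) = pt N n c"
    unfolding cofree_coact_pure[OF n' c] by (simp add: cE_nat[OF mC mTN' lin_pure_const[OF n']] c)
qed

text \<open>Compatibility of \<open>\<psi>\<close> with \<open>\<Delta>\<close>, pushed forward
  along \<open>\<Phi>\<close>, which sends \<open>b \<otimes> (d \<otimes> d')\<close> to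
  \<open>(n b \<otimes> d) \<otimes> d'\<close>. One side of \<open>entwining_comult\<close> becomes
  the coaction of \<open>(n \<otimes> c) a\<close>; the other moves \<open>a\<close> past
  \<open>c2\<close> and the result past \<open>c1\<close>, which is the action of \<open>a\<close>
  on the coaction of \<open>n \<otimes> c\<close>.\<close>

lemma cofree_entwined_axiom:
  assumes t: "t @: TC" and a: "a @: A"
  shows "\<rho> (cP' N a t) = cP' (cofree N) a (\<rho> t)"
proof -
  note ag = cofree_agree[OF N]
  let ?D = "cofree N" and ?TT = "tensor R TC C" and ?AA = "tensor R A (tensor R C C)"
  have D: "right_module A ?D" by (rule right_module_cofree[OF N])
  have agT: "agree R ?TT (\<T> ?D)" by (rule agree_tensor[OF ag mTN' mC])
  have cPl: "lin R ?TT ?TT (cP' ?D a)"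
    using cP_lin[OF D a] agree_lin[OF agT agT] by blast
  show ?thesis
  proof (rule lin_ext[OF mB[OF N] mC lin_compose[OF cP_lin[OF N a] cofree_coact_lin] lin_compose[OF cofree_coact_lin cPl] _ t])
    fix n c assume "n @: \<B> N" and c: "c @: C"
    then have n: "n @: N" by simp
    have pa: "\<psi> (pure_tensor R C A d b) @: tensor R A C" if "d @: C" "b @: A" for d b
      using that by (simp add: pure_closed)
    have cc: "module R (tensor R C C)" by simp
    have un: "lin R A (\<B> N) (%b. b .[N] n)" by (rule lin_act2[OF N lin_id n])
    define \<Phi> where "\<Phi> s = tassoc R (\<B> N) C C (tmap R A (\<B> N) (tensor R C C) (%b. b .[N] n) s)" for s
    have \<Phi>: "lin R ?AA ?TT \<Phi>"
      unfolding \<Phi>_def by (rule lin_compose[OF tmap_lin[OF mA mB[OF N] cc un] tassoc_lin[OF mB[OF N] mC mC]])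
    have \<Phi>1: "\<Phi> (pure_tensor R A (tensor R C C) b (\<Delta> d)) = \<rho> (pt N (b .[N] n) d)"
      if "b @: A" "d @: C" for b d
      unfolding \<Phi>_def using that n by (simp add: tmap_pure[OF mA mB[OF N] cc un] cL_pure[OF mB[OF N]] N.ract_closed)
    have \<Phi>2: "\<Phi> (pure_tensor R A (tensor R C C) b (pure_tensor R C C d d')) =
        pure_tensor R TC C (pt N (b .[N] n) d) d'"
      if "b @: A" "d @: C" "d' @: C" for b d d'
      unfolding \<Phi>_def using that n
      by (simp add: tmap_pure[OF mA mB[OF N] cc un] tassoc_pure[OF mB[OF N] mC mC] N.ract_closed pure_closed)
    have bA: "bilin R A C ?AA (%b' d1. pure_tensor R A (tensor R C C) b' (pure_tensor R C C d1 d2))" if "d2 @: C" for d2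
      using that by (auto intro!: lin_intros pure_closed)
    let ?i = "%c1 b d2. tsum R A C ?AA (\<psi> (pure_tensor R C A c1 b))
      (%b' d1. pure_tensor R A (tensor R C C) b' (pure_tensor R C C d1 d2))"
    have i: "bilin R A C ?AA (%b d2. ?i c1 b d2)" if c1: "c1 @: C" for c1
    proof (rule bilinI)
      show "lin R A ?AA (%b. ?i c1 b d2)" if "d2 @: C" for d2
        by (intro lin_tsum1 bA that lin_psi' lin_pure2 lin_id c1) simp_all
      show "lin R C ?AA (%d2. ?i c1 b d2)" if "b @: A" for b
        by (intro lin_tsum2 bA pa that c1 lin_pure2 lin_id right_module_of_module) (simp_all add: that)
    qed
    have o: "bilin R C C ?AA (%c1 c2. tsum R A C ?AA (\<psi> (pure_tensor R C A c2 a)) (%b d2. ?i c1 b d2))"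
    proof (rule bilinI)
      show "lin R C ?AA (%c1. tsum R A C ?AA (\<psi> (pure_tensor R C A c2 a)) (%b d2. ?i c1 b d2))" if "c2 @: C" for c2
      proof (rule lin_tsum2[OF right_module_of_module[OF mC] mA mC _ i _ pa[OF that a]])
        show "lin R C ?AA (%c1. ?i c1 b d2)" if "b @: A" "d2 @: C" for b d2
          by (intro lin_tsum1 bA that lin_psi_r lin_id) simp_all
      qed simp_all
      show "lin R C ?AA (%c2. tsum R A C ?AA (\<psi> (pure_tensor R C A c2 a)) (%b d2. ?i c1 b d2))" if "c1 @: C" for c1
        by (intro lin_tsum1 i that lin_psi_r a lin_id) simp_all
    qed
    have "\<rho> (cP' N a (pt N n c)) =
        tsum R A C ?TT (\<psi> (pure_tensor R C A c a)) (%b d. \<rho> (pt N (b .[N] n) d))"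
      unfolding cP_pure[OF N a n c]
      by (rule tsum_push[OF mA mC mTN' _ cofree_coact_lin bilin_act[OF N n] pa[OF c a]]) simp
    also have "\<dots> = tsum R A C ?TT (\<psi> (pure_tensor R C A c a)) (%b d. \<Phi> (pure_tensor R A (tensor R C C) b (\<Delta> d)))"
      by (intro tsum_cong refl) (simp add: \<Phi>1)
    also have "\<dots> = \<Phi> (tsum R A C ?AA (\<psi> (pure_tensor R C A c a)) (%b d. pure_tensor R A (tensor R C C) b (\<Delta> d)))"
      by (rule tsum_push[symmetric, OF mA mC _ _ \<Phi> bilin_cL[OF mA] pa[OF c a]]) simp_all
    also have "\<dots> = tsum R C C ?TT (\<Delta> c) (%c1 c2. \<Phi> (tsum R A C ?AA (\<psi> (pure_tensor R C A c2 a)) (%b d2. ?i c1 b d2)))"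
      unfolding entwining_comult[OF c a] by (rule tsum_push[OF mC mC _ _ \<Phi> o Delta_closed[OF c]]) simp_all
    also have "\<dots> = tsum R C C ?TT (\<Delta> c) (%c1 c2. cP' ?D a (pure_tensor R TC C (pt N n c1) c2))"
    proof (rule tsum_cong[OF refl])
      fix c1 c2 assume c1: "c1 @: C" and c2: "c2 @: C"
      have nc: "pt N n c1 @: TC" using n c1 N by (simp add: pure_closed)
      have "\<Phi> (tsum R A C ?AA (\<psi> (pure_tensor R C A c2 a)) (%b d2. ?i c1 b d2)) =
          tsum R A C ?TT (\<psi> (pure_tensor R C A c2 a)) (%b d2. \<Phi> (?i c1 b d2))"
        by (rule tsum_push[OF mA mC _ _ \<Phi> i[OF c1] pa[OF c2 a]]) simp_all
      also have "\<dots> = tsum R A C ?TT (\<psi> (pure_tensor R C A c2 a))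
          (%b d2. pure_tensor R TC C (cP' N b (pt N n c1)) d2)"
      proof (rule tsum_cong[OF refl])
        fix b d2 assume b: "b @: A" and d2: "d2 @: C"
        have "\<Phi> (?i c1 b d2) = tsum R A C ?TT (\<psi> (pure_tensor R C A c1 b))
            (%b' d1. \<Phi> (pure_tensor R A (tensor R C C) b' (pure_tensor R C C d1 d2)))"
          by (rule tsum_push[OF mA mC _ _ \<Phi> bA[OF d2] pa[OF c1 b]]) simp_all
        also have "\<dots> = tsum R A C ?TT (\<psi> (pure_tensor R C A c1 b))
            (%b' d1. pure_tensor R TC C (pt N (b' .[N] n) d1) d2)"
          using d2 by (intro tsum_cong refl) (simp add: \<Phi>2)
        also have "\<dots> = pure_tensor R TC C (cP' N b (pt N n c1)) d2"
          unfolding cP_pure[OF N b n c1]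
          by (rule tsum_push[symmetric, OF mA mC mTN' _ lin_pure1[OF mTN' mC lin_id d2] bilin_act[OF N n] pa[OF c1 b]]) simp
        finally show "\<Phi> (?i c1 b d2) = pure_tensor R TC C (cP' N b (pt N n c1)) d2" .
      qed
      also have "\<dots> = cP' ?D a (pure_tensor R TC C (pt N n c1) c2)"
        using cP_pure[OF D a, of "pt N n c1" c2] nc c2
        by (simp add: agree_pure[OF ag] agree_tsum[OF agree_refl mA mC agT])
      finally show "\<Phi> (tsum R A C ?AA (\<psi> (pure_tensor R C A c2 a)) (%b d2. ?i c1 b d2)) =
          cP' ?D a (pure_tensor R TC C (pt N n c1) c2)" .
    qed
    also have "\<dots> = cP' ?D a (\<rho> (pt N n c))"
      unfolding cofree_coact_pure[OF n c] tmap_def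
      by (rule tsum_push[symmetric, OF mC mC _ _ cPl bilin_tmap[OF mC mTN' mC lin_pure_const[OF n]] Delta_closed[OF c]]) simp_all
    finally show "\<rho> (cP' N a (pt N n c)) = cP' ?D a (\<rho> (pt N n c))" .
  qed
qed

lemma entwined_cofree: "entwined (cofree N)"
proof -
  note ag = cofree_agree[OF N]
  let ?r = "restrict \<rho> (carrier TC)"
  have 1: "?r t = \<rho> t" if "t @: TC" for t using that by simp
  have "cL R C \<Delta> (\<B> (cofree N)) (?r t) = cR R C (\<B> (cofree N)) ?r (?r t)" if t: "t @: TC" for t
    unfolding 1[OF t] cL_agree[OF ag mTN'] cofree_coassoc[OF t] by (rule cR_agree[symmetric, OF ag mTN']) simp
  moreover have "cE R C \<epsilon> (\<B> (cofree N)) (?r t) = t" if t: "t @: TC" for t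
    unfolding 1[OF t] cE_agree[OF ag mTN'] cofree_counit[OF t] ..
  moreover have "?r (cP' N a t) = cP' (cofree N) a (?r t)" if t: "t @: TC" and a: "a @: A" for t a
    unfolding 1[OF t] 1[OF lin_closed[OF cP_lin[OF N a] t]] by (rule cofree_entwined_axiom[OF t a])
  ultimately show ?thesis
    unfolding entwined_iff using pre_entwined_cofree by simp
qed

text \<open>The counit \<open>N \<otimes> \<epsilon>\<close> of the adjunction; that it respects
  \<open>A\<close> is the counit axiom of \<open>\<psi>\<close>.\<close>

lemma cE_cofree_lin: "lin A (cofree N) N (cE R C \<epsilon> (\<B> N))"
proof (rule linI)
  note l = cE_lin[OF mB[OF N]]
  show "cE R C \<epsilon> (\<B> N) x @: N" if "x @: cofree N" for x using lin_closed[OF l] that by simp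
  show "cE R C \<epsilon> (\<B> N) (x +[cofree N] y) = cE R C \<epsilon> (\<B> N) x +[N] cE R C \<epsilon> (\<B> N) y"
    if "x @: cofree N" "y @: cofree N" for x y using lin_add[OF l] that by simp
  fix a t assume a: "a @: A" and "t @: cofree N"
  then have t: "t @: TC" by simp
  have "cE R C \<epsilon> (\<B> N) (cP' N a t) = a .[N] cE R C \<epsilon> (\<B> N) t"
  proof (rule lin_ext[OF mB[OF N] mC lin_compose[OF cP_lin[OF N a] l] lin_act1[OF N l a] _ t])
    fix n c assume "n @: \<B> N" and c: "c @: C"
    then have n: "n @: N" by simp
    have pa: "\<psi> (pure_tensor R C A c a) @: tensor R A C" using c a by (simp add: pure_closed)
    have un: "lin R A (\<B> N) (%b. b .[N] n)" by (rule lin_act2[OF N lin_id n])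
    have s: "(r .[A] 1[A]) .[N] (b .[N] n) = (r .[A] b) .[N] n" if "r @: R" "b @: A" for r b
      using lin_smult[OF un that] by simp
    have "cE R C \<epsilon> (\<B> N) (cP' N a (pt N n c)) =
        tsum R A C (\<B> N) (\<psi> (pure_tensor R C A c a)) (%b d. cE R C \<epsilon> (\<B> N) (pt N (b .[N] n) d))"
      unfolding cP_pure[OF N a n c]
      by (rule tsum_push[OF mA mC mTN' mB[OF N] l bilin_act[OF N n] pa])
    also have "\<dots> = tsum R A C (\<B> N) (\<psi> (pure_tensor R C A c a)) (%b d. (\<epsilon> d .[A] b) .[N] n)"
      using n by (intro tsum_cong refl) (simp add: cE_pure[OF mB[OF N]] N.ract_closed s)
    also have "\<dots> = (tsum R A C A (\<psi> (pure_tensor R C A c a)) (%b d. \<epsilon> d .[A] b)) .[N] n"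
      by (rule tsum_push[symmetric, OF mA mC mA mB[OF N] un bilin_cE[OF mA] pa])
    also have "\<dots> = a .[N] cE R C \<epsilon> (\<B> N) (pt N n c)"
      unfolding entwining_counit[OF c a]
      using lin_smult[OF lin_act1[OF N lin_id a] eps_closed[OF c], of n] n c a s[OF eps_closed[OF c] a]
      by (simp add: cE_pure[OF mB[OF N]])
    finally show "cE R C \<epsilon> (\<B> N) (cP' N a (pt N n c)) =
      a .[N] cE R C \<epsilon> (\<B> N) (pt N n c)" .
  qed
  then show "cE R C \<epsilon> (\<B> N) (a .[cofree N] t) = a .[N] cE R C \<epsilon> (\<B> N) t" by simp
qed

text \<open>A triangle identity of the adjunction. It rests on the left counit law of
  \<open>C\<close>, whereas \<open>cofree_counit\<close> rests on the right one.\<close>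

lemma tmap_cE_coact:
  assumes t: "t @: TC"
  shows "tmap R TC (\<B> N) C (cE R C \<epsilon> (\<B> N)) (\<rho> t) = t"
proof (rule lin_ext[OF mB[OF N] mC lin_compose[OF cofree_coact_lin tmap_lin[OF mTN' mB[OF N] mC cE_lin[OF mB[OF N]]]] lin_id _ t])
  fix n c assume n0: "n @: \<B> N" and c: "c @: C"
  then have n: "n @: N" by simp
  have "tmap R TC (\<B> N) C (cE R C \<epsilon> (\<B> N)) (\<rho> (pt N n c)) =
      tmap R C (\<B> N) C (%c. cE R C \<epsilon> (\<B> N) (pt N n c)) (\<Delta> c)"
    unfolding cofree_coact_pure[OF n c]
    by (rule tmap_compose[OF mC mTN' mC mB[OF N] lin_pure_const[OF n] cE_lin[OF mB[OF N]] Delta_closed[OF c]])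
  also have "\<dots> = tsum R C C TC (\<Delta> c) (%c1 c2. pt N n (\<epsilon> c1 .[C] c2))"
    unfolding tmap_def using n0
    by (intro tsum_cong refl) (simp add: cE_pure[OF mB[OF N]] pure_balanced[OF mB[OF N] mC, symmetric])
  also have "\<dots> = pt N n (tsum R C C C (\<Delta> c) (%c1 c2. \<epsilon> c1 .[C] c2))"
    by (rule tsum_push[symmetric, OF mC mC mC mTN' lin_pure_const[OF n] _ Delta_closed[OF c]])
      (auto intro!: lin_intros)
  finally show "tmap R TC (\<B> N) C (cE R C \<epsilon> (\<B> N)) (\<rho> (pt N n c)) = pt N n c"
    unfolding counit_left[OF c] .
qed

lemma hat_lin:
  assumes M: "entwined M" and u: "lin A M N u"
  shows "lin A M (cofree N) (hat N M u)"
proof -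
  note e = entwinedD[OF M]
  note l = lin_compose[OF e(2) tmap_lin[OF e(8) mB[OF N] mC lin_base[OF u]]]
  show ?thesis
    using lin_closed[OF l] lin_add[OF l]
    by (intro linI) (simp_all add: hat_def e(6) e(7) cP_nat[OF e(1) N u])
qed

text \<open>Coassociativity of \<open>M\<close>, carried along \<open>u\<close> and rebracketed: its
  left side becomes the coaction of \<open>N \<otimes> C\<close> at \<open>hat N M u m\<close>, its
  right side the coaction of \<open>m\<close> with \<open>hat N M u\<close> applied to the first
  factor.\<close>

lemma hat_coact:
  assumes M: "entwined M" and u: "lin A M N u" and m: "m @: M"
  shows "coact (cofree N) (hat N M u m) = tm M (cofree N) (hat N M u) (coact M m)"
proof -
  note e = entwinedD[OF M] and ag = cofree_agree[OF N] and u' = lin_base[OF u]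
  have cc: "module R (tensor R C C)" by simp
  have hl: "lin R (\<B> M) TC (hat N M u)"
    unfolding hat_def by (rule lin_compose[OF e(2) tmap_lin[OF e(8) mB[OF N] mC u']])
  let ?g = "%s. tassoc R (\<B> N) C C (tmap R (\<B> M) (\<B> N) (tensor R C C) u s)"
  have g: "lin R (tensor R (\<B> M) (tensor R C C)) (tensor R TC C) ?g"
    by (rule lin_compose[OF tmap_lin[OF e(8) mB[OF N] cc u'] tassoc_lin[OF mB[OF N] mC mC]])
  have key: "?g (cR R C (\<B> M) (coact M) t) = tmap R (\<B> M) TC C (hat N M u) t" if t: "t @: \<T> M" for t
  proof (rule lin_ext[OF e(8) mC lin_compose[OF cR_lin[OF e(8) e(2)] g] tmap_lin[OF e(8) mTN' mC hl] _ t])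
    fix x c assume x0: "x @: \<B> M" and c: "c @: C"
    then have x: "x @: M" by simp
    have "?g (cR R C (\<B> M) (coact M) (pt M x c)) =
        tsum R (\<B> M) C (tensor R TC C) (coact M x) (%x' c'. ?g (pure_tensor R (\<B> M) (tensor R C C) x' (pure_tensor R C C c' c)))"
      unfolding cR_pure[OF e(8) e(2) x0 c]
      by (rule tsum_push[OF e(8) mC _ _ g bilin_cR_inner[OF e(8) c] e(7)[OF x]]) (simp_all add: e(8))
    also have "\<dots> = tsum R (\<B> M) C (tensor R TC C) (coact M x) (%x' c'. pure_tensor R TC C (pt N (u x') c') c)"
      using c lin_closed[OF u]
      by (intro tsum_cong refl) (simp add: tmap_pure[OF e(8) mB[OF N] cc u'] pure_closed tassoc_pure[OF mB[OF N] mC mC])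
    also have "\<dots> = pure_tensor R TC C (hat N M u x) c"
      unfolding hat_def tmap_def
      by (rule tsum_push[symmetric, OF e(8) mC mTN' _ lin_pure1[OF mTN' mC lin_id c] bilin_tmap[OF e(8) mB[OF N] mC u'] e(7)[OF x]]) simp
    also have "\<dots> = tmap R (\<B> M) TC C (hat N M u) (pt M x c)"
      by (simp add: tmap_pure[OF e(8) mTN' mC hl x0 c])
    finally show "?g (cR R C (\<B> M) (coact M) (pt M x c)) = tmap R (\<B> M) TC C (hat N M u) (pt M x c)" .
  qed
  have "hat N M u m @: TC" using lin_closed[OF hl] m by simp
  then have "coact (cofree N) (hat N M u m) = tassoc R (\<B> N) C C (cL R C \<Delta> (\<B> N) (hat N M u m))" by simp
  also have "\<dots> = ?g (cL R C \<Delta> (\<B> M) (coact M m))"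
    unfolding hat_def cL_nat[OF e(8) mB[OF N] u' e(7)[OF m]] ..
  also have "\<dots> = tmap R (\<B> M) TC C (hat N M u) (coact M m)"
    unfolding e(4)[OF m] by (rule key[OF e(7)[OF m]])
  also have "\<dots> = tm M (cofree N) (hat N M u) (coact M m)"
    by (rule tmap_agree[symmetric, OF ag mTN' mC e(8) hl])
  finally show ?thesis .
qed

text \<open>The counit recovers \<open>u\<close>. In particular \<open>hat\<close> keeps injective
  maps injective, which is used to embed modules into cofree ones.\<close>

lemma cE_hat:
  assumes M: "entwined M" and u: "lin A M N u" and m: "m @: M"
  shows "cE R C \<epsilon> (\<B> N) (hat N M u m) = u m"
  unfolding hat_def
  using entwinedD(5,7,8)[OF M] m by (simp add: cE_nat[OF _ mB[OF N] lin_base[OF u]])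

text \<open>The other half of the adjunction: a colinear map into a cofree module is determined by
  its composite with the counit.\<close>

lemma hat_cE:
  assumes M: "entwined M" and f: "lin A M (cofree N) f" and m: "m @: M"
    and c: "coact (cofree N) (f m) = tm M (cofree N) f (coact M m)"
  shows "hat N M (%x. cE R C \<epsilon> (\<B> N) (f x)) m = f m"
proof -
  note e = entwinedD[OF M] and ag = cofree_agree[OF N]
  have f': "lin R (\<B> M) TC f" using lin_base[OF f] agree_lin[OF agree_refl ag] by blast
  have fm: "f m @: TC" using lin_closed[OF f m] by simp
  have "hat N M (%x. cE R C \<epsilon> (\<B> N) (f x)) m =
      tmap R TC (\<B> N) C (cE R C \<epsilon> (\<B> N)) (tmap R (\<B> M) TC C f (coact M m))"
    unfolding hat_def
    by (rule tmap_compose[symmetric, OF e(8) mTN' mC mB[OF N] f' cE_lin[OF mB[OF N]] e(7)[OF m]])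
  also have "tmap R (\<B> M) TC C f (coact M m) = \<rho> (f m)"
    using c fm tmap_agree[OF ag mTN' mC e(8) f'] by simp
  finally show ?thesis by (simp add: tmap_cE_coact[OF fm])
qed

end

end

section \<open>Constructions with entwined modules\<close>

definition with_coact :: "('a, 'm) module => ('m => ('m, 'c) tens) => ('a, 'm, 'c) coact_module" where
  "with_coact Q \<rho> = module.extend Q \<lparr>coact = \<rho>\<rparr>"

lemma with_coact_simps [simp]:
  "carrier (with_coact Q \<rho>) = carrier Q" "ring.zero (with_coact Q \<rho>) = ring.zero Q"
  "ring.add (with_coact Q \<rho>) = ring.add Q" "smult (with_coact Q \<rho>) = smult Q"
  "monoid.mult (with_coact Q \<rho>) = monoid.mult Q" "monoid.one (with_coact Q \<rho>) = monoid.one Q"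
  "coact (with_coact Q \<rho>) = \<rho>" "base_module A (with_coact Q \<rho>) = base_module A Q"
  by (simp_all add: with_coact_def module.defs coact_module.defs base_module_def restrict_scalars_def)

lemma right_module_with_coact: "right_module A Q ==> right_module A (with_coact Q \<rho>)"
  by (rule agree_right_module) (simp_all add: agree_def)

lemma lin_to_with_coact [simp]: "lin A M (with_coact Q \<rho>) f = lin A M Q f"
  by (simp add: lin_def)

lemma lin_from_with_coact [simp]: "lin A (with_coact Q \<rho>) M f = lin A Q M f"
  by (simp add: lin_def)

lemma lin_surj_factor:
  assumes M: "right_module S M" and Q: "right_module S Q" and W: "right_module S W"
    and q: "lin S M Q q" "q ` carrier M = carrier Q" and g: "lin S M W g"
    and ker: "\<And>x. x @: M ==> q x = 0[Q] ==> g x = 0[W]"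
  obtains u where "lin S Q W u" "\<And>x. x @: M ==> u (q x) = g x"
proof -
  interpret M: right_module S M by (rule M)
  note ab = M[THEN right_module_abelian_group] Q[THEN right_module_abelian_group] W[THEN right_module_abelian_group]
  define u where "u y = g (inv_into (carrier M) q y)" for y
  have u: "u (q x) = g x" if x: "x @: M" for x
  proof -
    let ?x = "inv_into (carrier M) q (q x)"
    have x': "?x @: M" "q ?x = q x" using x by (auto simp: f_inv_into_f inv_into_into)
    have "x \<ominus>\<^bsub>M\<^esub> ?x @: M" using x x' by (simp add: a_minus_def)
    moreover have "q (x \<ominus>\<^bsub>M\<^esub> ?x) = 0[Q]"
      using x x' lin_closed[OF q(1)] by (simp add: lin_diff[OF ab(1,2) q(1)] abelian_group_diff_eq_zero[OF ab(2)])
    ultimately have "g (x \<ominus>\<^bsub>M\<^esub> ?x) = 0[W]" by (rule ker)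
    then show ?thesis
      using x x' lin_closed[OF g] by (simp add: u_def lin_diff[OF ab(1,3) g] abelian_group_diff_eq_zero[OF ab(3)])
  qed
  have Q': "\<And>y. y @: Q ==> \<exists>x \<in> carrier M. y = q x" using q(2) by blast
  have "lin S Q W u"
  proof (rule linI)
    fix y assume "y @: Q"
    then obtain x where x: "x @: M" "y = q x" using Q' by blast
    then show "u y @: W" using lin_closed[OF g] by (simp add: u)
    show "u (s .[Q] y) = s .[W] u y" if "s @: S" for s
      using x that u[of "s .[M] x"] by (simp add: u M.ract_closed lin_smult[OF q(1)] lin_smult[OF g])
    fix y' assume "y' @: Q"
    then obtain x' where x': "x' @: M" "y' = q x'" using Q' by blast
    show "u (y +[Q] y') = u y +[W] u y'"
      using x x' u[of "x +[M] x'"] by (simp add: u lin_add[OF q(1)] lin_add[OF g])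
  qed
  then show ?thesis using u that by blast
qed

context entwining
begin

text \<open>By \<open>k\<close>, the coaction followed by \<open>p \<otimes> C\<close> vanishes on
  the kernel of \<open>p\<close> and hence factors through \<open>p\<close>; the axioms follow
  because \<open>Q\<close> is generated by the image of \<open>M\<close>.\<close>

lemma entwined_push:
  fixes Q :: "('a, 'q) module" and M :: "('a, 'm, 'c) coact_module"
  assumes M: "entwined M" and Q: "right_module A Q" and p: "lin A M Q p" and s: "p ` carrier M = carrier Q"
    and k: "\<And>x. x @: M ==> p x = 0[Q] ==>
      tm M Q p (coact M x) = 0[\<T> Q]"
  obtains \<rho> where "entwined (with_coact Q \<rho>)"
    "\<And>x. x @: M ==> \<rho> (p x) = tm M Q p (coact M x)"
proof -
  note e = entwinedD[OF M] and p' = lin_base[OF p] and r = right_module_of_module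
  have TQ: "module R (\<T> Q)" using Q by simp
  obtain \<rho> where \<rho>: "lin R (\<B> Q) (\<T> Q) \<rho>"
    "\<And>x. x @: \<B> M ==> \<rho> (p x) = tm M Q p (coact M x)"
  proof (rule lin_surj_factor[OF r[OF e(8)] r[OF mB[OF Q]] r[OF TQ] p' _
        lin_compose[OF e(2) tmap_lin[OF e(8) mB[OF Q] mC p']]])
    show "p ` carrier (\<B> M) = carrier (\<B> Q)" using s by simp
    show "tm M Q p (coact M x) = 0[\<T> Q]"
      if "x @: \<B> M" "p x = 0[\<B> Q]" for x using that k by simp
  qed (rule that)
  let ?\<rho> = "restrict \<rho> (carrier (\<B> Q))" let ?Q = "with_coact Q ?\<rho>"
  have \<rho>p: "?\<rho> (p x) = tm M Q p (coact M x)" if "x @: M" for x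
    using that \<rho>(2) lin_closed[OF p] by simp
  have "pre_entwined ?Q"
    using lin_restrict[OF r[OF mB[OF Q]] \<rho>(1)] Q by (simp add: pre_entwined_def right_module_with_coact)
  then have "entwined ?Q"
  proof (rule entwined_generated[where I = "{()}" and X = "%_. M" and p = "%_. p"])
    fix P q assume "q @: ?Q" and P: "\<And>i m. i \<in> {()} ==> m @: M ==> P (p m)"
    then obtain m where "m @: M" "q = p m" using s by auto
    then show "P q" using P[of "()" m] by simp
  next
    fix m assume "m @: M"
    then show "coact ?Q (p m) = tm M ?Q p (coact M m)" using \<rho>p by (simp del: restrict_apply)
  qed (use M p in simp_all)
  then show ?thesis using \<rho>p by (rule that)
qed

lemma base_dsum: "\<B> (dsum I X) = dsum I (%i. \<B> (X i))"
  by (simp add: base_module_def restrict_scalars_def dsum_def)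

lemma base_dinj: "dinj I (%i. \<B> (X i)) = dinj I X"
  by (intro ext) (simp add: dinj_def)

lemma entwined_dsum:
  fixes X :: "'i => ('a, 'm, 'c) coact_module"
  assumes X: "\<And>i. i \<in> I ==> entwined (X i)"
  shows "\<exists>\<rho>. entwined (with_coact (dsum I X) \<rho>) \<and> (\<forall>i \<in> I. \<forall>x \<in> carrier (X i).
      \<rho> (dinj I X i x) = tm (X i) (dsum I X) (dinj I X i) (coact (X i) x))"
proof -
  have XA: "\<And>i. i \<in> I ==> right_module A (X i)" using X entwinedD(1) by blast
  have XR: "\<And>i. i \<in> I ==> right_module R (\<B> (X i))" using X entwinedD(8) right_module_of_module by blast
  have rR: "ring R" using cR by (rule cring.axioms)
  let ?D = "dsum I X"
  have D: "right_module A ?D" by (rule right_module_dsum[OF rA XA])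
  have l: "lin A (X i) ?D (dinj I X i)" if "i \<in> I" for i using dinj_lin[OF rA XA that] .
  have T: "right_module R (\<T> ?D)" using D by (intro right_module_of_module) simp
  have "\<exists>h. lin R (dsum I (%i. \<B> (X i))) (\<T> ?D) h \<and>
      (\<forall>i \<in> I. \<forall>x \<in> carrier (\<B> (X i)). h (dinj I (%i. \<B> (X i)) i x) =
         tm (X i) ?D (dinj I X i) (coact (X i) x))"
    by (rule dsum_universal[OF rR XR T])
      (auto intro!: lin_compose[OF entwinedD(2)[OF X] tmap_lin[OF entwinedD(8)[OF X] mB[OF D] mC lin_base[OF l]]])
  then obtain h where h: "lin R (\<B> ?D) (\<T> ?D) h"
    "\<And>i x. i \<in> I ==> x @: X i ==> h (dinj I X i x) = tm (X i) ?D (dinj I X i) (coact (X i) x)"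
    unfolding base_dsum[symmetric] base_dinj by auto
  let ?\<rho> = "restrict h (carrier (\<B> ?D))"
  have \<rho>: "?\<rho> (dinj I X i x) = tm (X i) ?D (dinj I X i) (coact (X i) x)"
    if "i \<in> I" "x @: X i" for i x
    using that h(2) lin_closed[OF l] by simp
  have "pre_entwined (with_coact ?D ?\<rho>)"
    using lin_restrict[OF right_module_of_module[OF mB[OF D]] h(1)] D by (simp add: pre_entwined_def right_module_with_coact)
  then have "entwined (with_coact ?D ?\<rho>)"
  proof (rule entwined_generated[where I = I and X = X and p = "dinj I X"])
    show "P q" if "q @: with_coact ?D ?\<rho>" "P 0[with_coact ?D ?\<rho>]"
      "\<And>i m. i \<in> I ==> m @: X i ==> P (dinj I X i m)"
      "\<And>x y. x @: with_coact ?D ?\<rho> ==> y @: with_coact ?D ?\<rho> ==> P x ==> P y ==>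
         P (x +[with_coact ?D ?\<rho>] y)" for P q
      using dsum_induct[OF rA XA, where f = q and P = P] that by simp
  qed (use X l \<rho> in \<open>auto simp del: restrict_apply\<close>)
  then show ?thesis using \<rho> by blast
qed

subsection \<open>Maps of entwined modules\<close>

lemma ent_mapsD:
  assumes "f \<in> \<H> M N"
  shows "lin A M N f" "f \<in> extensional (carrier M)"
    "\<And>m. m @: M ==> coact N (f m) = tm M N f (coact M m)"
    "\<And>m. m @: M ==> f m @: N"
  using assms lin_closed by (auto simp: entwined_maps_iff lin_maps_iff)

lemma ent_mapsI:
  assumes M: "right_module A M" and f: "lin A M N f"
    and c: "\<And>m. m @: M ==> coact N (f m) = tm M N f (coact M m)"
  shows "restrict f (carrier M) \<in> \<H> M N"
  unfolding entwined_maps_iff using lin_restrict[OF M f] c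
  by (auto intro!: tmap_cong)

lemma ent_maps_eqI:
  assumes "f \<in> \<H> M N" "g \<in> \<H> M N'" "\<And>x. x @: M ==> f x = g x"
  shows "f = g"
  using ent_mapsD(2)[OF assms(1)] ent_mapsD(2)[OF assms(2)] assms(3) by (rule extensionalityI)

lemma ent_id: "entwined M ==> (\<lambda>x\<in>carrier M. x) \<in> \<H> M M"
  by (rule ent_mapsI) (auto simp: lin_id entwinedD tmap_id)

lemma ent_compose:
  assumes L: "entwined L" and M: "entwined M" and N: "entwined N"
    and f: "f \<in> \<H> L M" and g: "g \<in> \<H> M N"
  shows "compose (carrier L) g f \<in> \<H> L N"
proof -
  note f = ent_mapsD[OF f] and g = ent_mapsD[OF g]
  have "restrict (%x. g (f x)) (carrier L) \<in> \<H> L N"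
    by (rule ent_mapsI[OF entwinedD(1)[OF L] lin_compose[OF f(1) g(1)]])
      (simp add: f g tmap_compose[OF entwinedD(8)[OF L] entwinedD(8)[OF M] mC entwinedD(8)[OF N] lin_base[OF f(1)] lin_base[OF g(1)]] entwinedD[OF L])
  then show ?thesis by (simp add: compose_def)
qed

lemma tmap_add:
  assumes m: "module R M" "module R N" "module R W" and f: "lin R M N f" "lin R M N g"
    and t: "t @: tensor R M W"
  shows "tmap R M N W (%x. f x +[N] g x) t = tmap R M N W f t +[tensor R N W] tmap R M N W g t"
proof (rule lin_ext[OF m(1,3) tmap_lin[OF m lin_plus[OF m(2) f]]
      lin_plus[OF module_tensor[OF m(2,3)] tmap_lin[OF m f(1)] tmap_lin[OF m f(2)]] _ t])
  fix x w assume x: "x @: M" and w: "w @: W"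
  show "tmap R M N W (%x. f x +[N] g x) (pure_tensor R M W x w) =
      tmap R M N W f (pure_tensor R M W x w) +[tensor R N W] tmap R M N W g (pure_tensor R M W x w)"
    unfolding tmap_pure[OF m lin_plus[OF m(2) f] x w] tmap_pure[OF m f(1) x w] tmap_pure[OF m f(2) x w]
    using lin_add[OF lin_pure1[OF m(2,3) lin_id w]] lin_closed[OF f(1) x] lin_closed[OF f(2) x] .
qed

lemma tmap_zero:
  assumes m: "module R M" "module R N" "module R W" and t: "t @: tensor R M W"
    and f: "\<And>x. x @: M ==> f x = 0[N]"
  shows "tmap R M N W f t = 0[tensor R N W]"
proof -
  have "tmap R M N W f t = tmap R M N W (%_. 0[N]) t" by (rule tmap_cong) (simp_all add: f)
  also have "\<dots> = 0[tensor R N W]"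
  proof (rule lin_ext[OF m(1,3) tmap_lin[OF m lin_zero_map[OF m(2)]] lin_zero_map[OF module_tensor[OF m(2,3)]] _ t])
    fix x w assume x: "x @: M" and w: "w @: W"
    show "tmap R M N W (%_. 0[N]) (pure_tensor R M W x w) = 0[tensor R N W]"
      unfolding tmap_pure[OF m lin_zero_map[OF m(2)] x w]
      by (rule lin_zero[OF m(2)[THEN module_abelian_group] module_tensor[OF m(2,3), THEN module_abelian_group] lin_pure1[OF m(2,3) lin_id w]])
  qed
  finally show ?thesis .
qed

lemma lin_zero_A: "right_module A N ==> lin A M N (%_. 0[N])"
proof -
  assume "right_module A N"
  then interpret N: right_module A N .
  show ?thesis by (rule linI) (auto simp: N.ract_zero_right)
qed

lemma lin_add_A:
  assumes "right_module A N" "lin A M N f" "lin A M N g"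
  shows "lin A M N (%x. f x +[N] g x)"
proof -
  interpret N: right_module A N by fact
  show ?thesis
    using lin_closed[OF assms(2)] lin_closed[OF assms(3)]
    by (intro linI) (simp_all add: lin_add[OF assms(2)] lin_add[OF assms(3)] lin_smult[OF assms(2)]
        lin_smult[OF assms(3)] N.ract_r_distr N.M.add.m_ac)
qed

lemma ent_zero:
  assumes M: "entwined M" and N: "entwined N"
  shows "(\<lambda>x\<in>carrier M. 0[N]) \<in> \<H> M N"
proof (rule ent_mapsI[OF entwinedD(1)[OF M] lin_zero_A[OF entwinedD(1)[OF N]]])
  note n = entwinedD[OF N]
  fix m assume m: "m @: M"
  have "coact N 0[N] = 0[\<T> N]"
    using lin_zero[OF n(8)[THEN module_abelian_group] module_tensor[OF n(8) mC, THEN module_abelian_group] n(2)] by simp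
  then show "coact N 0[N] = tm M N (%_. 0[N]) (coact M m)"
    by (simp add: tmap_zero entwinedD[OF M] n m)
qed

lemma ent_add:
  assumes M: "entwined M" and N: "entwined N"
    and f: "f \<in> \<H> M N" and g: "g \<in> \<H> M N"
  shows "(\<lambda>x\<in>carrier M. f x +[N] g x) \<in> \<H> M N"
proof (rule ent_mapsI[OF entwinedD(1)[OF M] lin_add_A[OF entwinedD(1)[OF N] ent_mapsD(1)[OF f] ent_mapsD(1)[OF g]]])
  note n = entwinedD[OF N] and e = entwinedD[OF M]
  fix m assume m: "m @: M"
  show "coact N (f m +[N] g m) = tm M N (%x. f x +[N] g x) (coact M m)"
    using tmap_add[OF e(8) n(8) mC lin_base[OF ent_mapsD(1)[OF f]] lin_base[OF ent_mapsD(1)[OF g]] e(7)[OF m]]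
      lin_add[OF n(2), of "f m" "g m"] ent_mapsD(3,4)[OF f m] ent_mapsD(3,4)[OF g m] by simp
qed

lemma ent_generated:
  assumes D: "entwined D" and W: "entwined W" and X: "\<And>i. i \<in> I ==> entwined (X i)" and u: "lin A D W u"
    and p: "\<And>i. i \<in> I ==> lin A (X i) D (p i)"
    and c: "\<And>i m. i \<in> I ==> m @: X i ==> coact D (p i m) = tm (X i) D (p i) (coact (X i) m)"
    and uc: "\<And>i m. i \<in> I ==> m @: X i ==>
      coact W (u (p i m)) = tm (X i) W (%x. u (p i x)) (coact (X i) m)"
    and gen: "\<And>P q. q @: D ==> P 0[D] ==> (\<And>i m. i \<in> I ==> m @: X i ==> P (p i m)) ==>
      (\<And>x y. x @: D ==> y @: D ==> P x ==> P y ==> P (x +[D] y)) ==> P q"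
  shows "restrict u (carrier D) \<in> \<H> D W"
proof (rule ent_mapsI[OF entwinedD(1)[OF D] u])
  note d = entwinedD[OF D] and w = entwinedD[OF W]
  have l: "lin R (\<B> D) (\<T> W) (%m. coact W (u m))"
    "lin R (\<B> D) (\<T> W) (%m. tm D W u (coact D m))"
    using lin_compose[OF lin_base[OF u] w(2)] lin_compose[OF d(2) tmap_lin[OF d(8) w(8) mC lin_base[OF u]]] by auto
  have ab: "abelian_group (\<B> D)" "abelian_group (\<T> W)"
    by (rule module_abelian_group[OF d(8)], rule module_abelian_group[OF module_tensor[OF w(8) mC]])
  have g: "coact W (u (p i m)) = tm D W u (coact D (p i m))" if i: "i \<in> I" and m: "m @: X i" for i m
    unfolding uc[OF that] c[OF that]
    by (rule tmap_compose[symmetric, OF entwinedD(8)[OF X[OF i]] d(8) mC w(8) lin_base[OF p[OF i]] lin_base[OF u] entwinedD(7)[OF X[OF i] m]])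
  fix m assume "m @: D"
  then show "coact W (u m) = tm D W u (coact D m)"
    using lin_zero[OF ab l(1)] lin_zero[OF ab l(2)] lin_add[OF l(1)] lin_add[OF l(2)] g
    by (intro gen[of m "%m. coact W (u m) = tm D W u (coact D m)"]) auto
qed

lemma ent_surj_factor:
  assumes Y: "entwined Y" and Q: "entwined Q" and W: "entwined W"
    and q: "q \<in> \<H> Y Q" "q ` carrier Y = carrier Q" and g: "g \<in> \<H> Y W"
    and ker: "\<And>x. x @: Y ==> q x = 0[Q] ==> g x = 0[W]"
  shows "\<exists>u \<in> \<H> Q W. \<forall>x \<in> carrier Y. u (q x) = g x"
proof -
  note y = entwinedD[OF Y] and qd = ent_mapsD[OF q(1)] and gd = ent_mapsD[OF g]
  obtain u where u: "lin A Q W u" "\<And>x. x @: Y ==> u (q x) = g x"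
    using lin_surj_factor[OF y(1) entwinedD(1)[OF Q] entwinedD(1)[OF W] qd(1) q(2) gd(1) ker] by blast
  have "restrict u (carrier Q) \<in> \<H> Q W"
  proof (rule ent_mapsI[OF entwinedD(1)[OF Q] u(1)])
    fix m assume "m @: Q"
    then obtain x where x: "x @: Y" "m = q x" using q(2) by blast
    have "tm Q W u (tm Y Q q (coact Y x)) = tm Y W (%x. u (q x)) (coact Y x)"
      by (rule tmap_compose[OF y(8) entwinedD(8)[OF Q] mC entwinedD(8)[OF W] lin_base[OF qd(1)] lin_base[OF u(1)] y(7)[OF x(1)]])
    also have "\<dots> = tm Y W g (coact Y x)" by (rule tmap_cong) (simp_all add: u)
    finally show "coact W (u m) = tm Q W u (coact Q m)"
      using x by (simp add: u qd(3) gd(3))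
  qed
  then show ?thesis using u(2) qd(4) by (intro bexI) auto
qed

text \<open>Factoring the identity of \<open>M\<close> through the surjection \<open>h\<close>
  yields an inverse that is already colinear.\<close>

lemma ent_inverse:
  assumes M: "entwined M" and N: "entwined N" and h: "h \<in> \<H> M N" "bij_betw h (carrier M) (carrier N)"
  shows "\<exists>k \<in> \<H> N M. (\<forall>x \<in> carrier M. k (h x) = x) \<and> (\<forall>y \<in> carrier N. h (k y) = y)"
proof -
  interpret M: right_module A M by (rule entwinedD(1)[OF M])
  have im: "h ` carrier M = carrier N" and inj: "inj_on h (carrier M)" using h(2) by (auto simp: bij_betw_def)
  note z = lin_zero[OF right_module_abelian_group[OF entwinedD(1)[OF M]] right_module_abelian_group[OF entwinedD(1)[OF N]] ent_mapsD(1)[OF h(1)]]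
  obtain k where k: "k \<in> \<H> N M" "\<forall>x \<in> carrier M. k (h x) = (\<lambda>x\<in>carrier M. x) x"
    using ent_surj_factor[OF M N M h(1) im ent_id[OF M]] inj_onD[OF inj, of _ "0[M]"] z by auto
  then have "\<forall>x \<in> carrier M. k (h x) = x" by simp
  moreover have "\<forall>y \<in> carrier N. h (k y) = y" unfolding im[symmetric] using calculation by simp
  ultimately show ?thesis using k by blast
qed

end

section \<open>The category of entwined modules\<close>

locale entwining_universe = entwining R A C \<Delta> \<epsilon> \<psi>
  for R :: "'r ring" and A :: "('r, 'a) module" and C :: "('r, 'c) module"
    and \<Delta> :: "'c => ('c, 'c) tens" and \<epsilon> :: "'c => 'r" and \<psi> :: "('c, 'a) tens => ('a, 'c) tens" +
  fixes U :: "'u set set"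
  assumes is_univ: "is_universe (carrier R <+> carrier A <+> carrier C <+> (UNIV :: nat set)) U"

text \<open>The summand of natural numbers makes the base infinite.\<close>

sublocale entwining_universe \<subseteq> universe "carrier R <+> carrier A <+> carrier C <+> (UNIV :: nat set)" U
  by unfold_locales (simp_all add: is_univ finite_Plus_iff)

context entwining_universe
begin

abbreviation "\<E> \<equiv> entwined_cat U R A C \<Delta> \<epsilon> \<psi>"

lemma cat_simps [simp]:
  "X \<in> Obj \<E> \<longleftrightarrow> entwined X \<and> standard_module A X \<and> carrier X \<in> U"
  "Hom \<E> X Y = \<H> X Y"
  "Ident \<E> X = (\<lambda>x\<in>carrier X. x)"
  "Comp \<E> X Y Z g f = compose (carrier X) g f"
  by (auto simp: entwined_cat_def)

lemma small_A: "small (carrier A)" and small_C: "small (carrier C)" and small_R: "small (carrier R)"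
proof -
  show "small (carrier A)" by (rule small_base) (auto simp: lepoll_def intro!: exI[of _ "%x. Inr (Inl x)"] inj_onI)
  show "small (carrier C)" by (rule small_base) (auto simp: lepoll_def intro!: exI[of _ "%x. Inr (Inr (Inl x))"] inj_onI)
  show "small (carrier R)" by (rule small_base) (auto simp: lepoll_def intro!: exI[of _ "%x. Inl x"] inj_onI)
qed

lemma category_entwined: "category \<E>"
proof
  show "Comp \<E> W Y Z h (Comp \<E> W X Y g f) = Comp \<E> W X Z (Comp \<E> X Y Z h g) f"
    if "f \<in> Hom \<E> W X" for W X Y Z f g h
    using ent_mapsD(4)[of f W X] that by (auto simp: compose_def restrict_def fun_eq_iff)
  show "Comp \<E> X X Y f (Ident \<E> X) = f" if "f \<in> Hom \<E> X Y" for X Y f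
    using ent_mapsD(2)[of f X Y] that by (auto simp: compose_def restrict_def fun_eq_iff extensional_def)
  show "Comp \<E> X Y Y (Ident \<E> Y) f = f" if "f \<in> Hom \<E> X Y" for X Y f
    using ent_mapsD(2,4)[of f X Y] that by (auto simp: compose_def restrict_def fun_eq_iff extensional_def)
qed (auto intro: ent_id ent_compose)

text \<open>The way back from auxiliary types: whatever entwined module is built on a small carrier
  is isomorphic to an object of the category.\<close>

lemma entwined_copy:
  fixes M :: "('a, 'm, 'c) coact_module"
  assumes M: "entwined M" and s: "small (carrier M)"
  obtains M' h where "M' \<in> Obj \<E>" "h \<in> \<H> M M'" "bij_betw h (carrier M) (carrier M')"
proof -
  note e = entwinedD[OF M]
  obtain h :: "'m => 'u" where h: "inj_on h (carrier M)" "h ` carrier M \<in> U" by (rule small_copy[OF s])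
  let ?Q = "mcopy A M h"
  note q = mcopy_facts[OF e(1) h(1)]
  interpret M: right_module A M by (rule e(1))
  have im: "h ` carrier M = carrier ?Q" by (rule q(5)[symmetric])
  have z: "h 0[M] = 0[?Q]" by (simp add: mcopy_def Let_def)
  obtain \<rho> where \<rho>: "entwined (with_coact ?Q \<rho>)"
    "\<And>x. x @: M ==> \<rho> (h x) = tm M ?Q h (coact M x)"
  proof (rule entwined_push[OF M q(1,2) im])
    fix x assume "x @: M" "h x = 0[?Q]"
    then have x: "x = 0[M]" using inj_onD[OF h(1), of x "0[M]"] z by simp
    have ab: "abelian_group (\<B> M)" "abelian_group (\<T> ?Q)"
      by (rule module_abelian_group[OF e(8)], rule module_abelian_group[OF module_tensor[OF mB[OF q(1)] mC]])
    show "tm M ?Q h (coact M x) = 0[\<T> ?Q]"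
      using lin_zero[OF ab lin_compose[OF e(2) tmap_lin[OF e(8) mB[OF q(1)] mC lin_base[OF q(2)]]]] x by simp
  qed (rule that)
  let ?M = "with_coact ?Q \<rho>"
  have "standard_module A ?M" using q(4) by (simp add: standard_module_def)
  then have "?M \<in> Obj \<E>" using \<rho>(1) h(2) im by simp
  moreover have "restrict h (carrier M) \<in> \<H> M ?M"
    by (rule ent_mapsI[OF e(1)]) (simp_all add: q(2) \<rho>(2))
  moreover have "bij_betw (restrict h (carrier M)) (carrier M) (carrier ?M)"
    by (subst bij_betw_cong[of _ _ h]) (simp_all add: q(3))
  ultimately show ?thesis by (rule that)
qed

text \<open>The index set may have any type because it is taken empty for the zero object, of truth
  values for biproducts, and of subsets of a carrier for the generator.\<close>

lemma coproduct_exists: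
  fixes I :: "'i set"
  assumes I: "small I" and X: "\<And>i. i \<in> I ==> X i \<in> Obj \<E>"
  obtains P e where "is_coproduct \<E> I X P e"
proof -
  have Xe: "\<And>i. i \<in> I ==> entwined (X i)" using X by simp
  have XA: "\<And>i. i \<in> I ==> right_module A (X i)" using Xe entwinedD(1) by blast
  let ?DS = "dsum I X"
  from entwined_dsum[OF Xe] obtain \<rho> where \<rho>0: "entwined (with_coact ?DS \<rho>) \<and> (\<forall>i \<in> I. \<forall>x \<in> carrier (X i).
      \<rho> (dinj I X i x) = tm (X i) ?DS (dinj I X i) (coact (X i) x))" ..
  then have \<rho>: "entwined (with_coact ?DS \<rho>)"
    "\<And>i x. i \<in> I ==> x @: X i ==>
      \<rho> (dinj I X i x) = tm (X i) ?DS (dinj I X i) (coact (X i) x)" by simp_all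
  let ?D = "with_coact ?DS \<rho>"
  have "small (carrier (X i))" if "i \<in> I" for i using X[OF that] small_U by simp
  then have sm: "small (carrier ?DS)" by (rule small_dsum[OF I])
  have smD: "small (carrier ?D)" unfolding with_coact_simps by (rule sm)
  obtain P h where P: "P \<in> Obj \<E>" and h: "h \<in> \<H> ?D P" "bij_betw h (carrier ?D) (carrier P)"
    by (rule entwined_copy[OF \<rho>(1) smD])
  have Pe: "entwined P" using P by simp
  obtain k where k: "k \<in> \<H> P ?D" "\<forall>x \<in> carrier ?D. k (h x) = x" "\<forall>y \<in> carrier P. h (k y) = y"
    using ent_inverse[OF \<rho>(1) Pe h] by blast
  have l: "lin A (X i) ?DS (dinj I X i)" if "i \<in> I" for i using dinj_lin[OF rA XA that] .
  have j: "restrict (dinj I X i) (carrier (X i)) \<in> \<H> (X i) ?D" if "i \<in> I" for i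
    by (rule ent_mapsI[OF XA[OF that]]) (simp_all add: l \<rho>(2) that)
  define e where "e i = compose (carrier (X i)) h (restrict (dinj I X i) (carrier (X i)))" for i
  have e: "e i \<in> \<H> (X i) P" if "i \<in> I" for i
    unfolding e_def using ent_compose[OF Xe[OF that] \<rho>(1) Pe j[OF that] h(1)] .
  have ea: "e i x = h (dinj I X i x)" if "x @: X i" for i x using that by (simp add: e_def compose_def)
  have gen: "Q q" if "q @: ?D" "Q 0[?D]" "\<And>i m. i \<in> I ==> m @: X i ==> Q (dinj I X i m)"
      "\<And>x y. x @: ?D ==> y @: ?D ==> Q x ==> Q y ==> Q (x +[?D] y)" for Q q
    using dsum_induct[OF rA XA, where f = q and P = Q] that by simp
  have "is_coproduct \<E> I X P e"
    unfolding is_coproduct_def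
  proof (intro conjI ballI allI impI)
    show "P \<in> Obj \<E>" by (rule P)
    show "e i \<in> Hom \<E> (X i) P" if "i \<in> I" for i using e that by simp
    fix W f assume W0: "W \<in> Obj \<E>" and f: "\<forall>i \<in> I. f i \<in> Hom \<E> (X i) W"
    have W: "entwined W" using W0 by simp
    have fl: "\<And>i. i \<in> I ==> lin A (X i) W (f i)" by (rule ent_mapsD(1)) (use f in simp)
    have "\<exists>v. lin A ?DS W v \<and> (\<forall>i \<in> I. \<forall>x \<in> carrier (X i). v (dinj I X i x) = f i x)"
      by (rule dsum_universal[OF rA XA entwinedD(1)[OF W] fl])
    then obtain v where "lin A ?DS W v \<and> (\<forall>i \<in> I. \<forall>x \<in> carrier (X i). v (dinj I X i x) = f i x)" ..
    then have v: "lin A ?DS W v" "\<And>i x. i \<in> I ==> x @: X i ==> v (dinj I X i x) = f i x" by simp_all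
    have vh: "restrict v (carrier ?D) \<in> \<H> ?D W"
    proof (rule ent_generated[where X = X and I = I and p = "dinj I X", OF \<rho>(1) W Xe])
      show "Q q" if "q @: ?D" "Q 0[?D]" "\<And>i m. i \<in> I ==> m @: X i ==> Q (dinj I X i m)"
        "\<And>x y. x @: ?D ==> y @: ?D ==> Q x ==> Q y ==> Q (x +[?D] y)" for Q q
        using that by (rule gen)
      fix i m assume i: "i \<in> I" and m: "m @: X i"
      have "f i \<in> \<H> (X i) W" using f i by simp
      then show "coact W (v (dinj I X i m)) = tm (X i) W (%x. v (dinj I X i x)) (coact (X i) m)"
        using ent_mapsD(3)[OF _ m, of "f i" W] i m by (simp add: v(2)) (rule tmap_cong, simp_all add: v(2))
    qed (simp_all add: v l \<rho>(2))
    let ?u = "compose (carrier P) (restrict v (carrier ?D)) k"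
    have u: "?u \<in> \<H> P W" by (rule ent_compose[OF Pe \<rho>(1) W k(1) vh])
    have ue: "?u (e i x) = f i x" if "i \<in> I" "x @: X i" for i x
    proof -
      have d: "dinj I X i x @: ?D" using lin_closed[OF l] that by simp
      then have "h (dinj I X i x) @: P" using ent_mapsD(4)[OF h(1)] by blast
      then show ?thesis using that d k(2) by (simp add: compose_def ea v(2))
    qed
    show "\<exists>!u. u \<in> Hom \<E> P W \<and> (\<forall>i\<in>I. Comp \<E> (X i) P W u (e i) = f i)"
    proof (rule ex1I[of _ ?u])
      show "?u \<in> Hom \<E> P W \<and> (\<forall>i\<in>I. Comp \<E> (X i) P W ?u (e i) = f i)"
      proof (intro conjI ballI)
        fix i assume i: "i \<in> I"
        have "f i \<in> extensional (carrier (X i))" by (rule ent_mapsD(2)[of _ _ W]) (use f i in simp)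
        then show "Comp \<E> (X i) P W ?u (e i) = f i"
          by (intro extensionalityI[of _ "carrier (X i)"]) (use ue i in \<open>auto simp: compose_eq\<close>)
      qed (use u in simp)
      fix w assume w: "w \<in> Hom \<E> P W \<and> (\<forall>i\<in>I. Comp \<E> (X i) P W w (e i) = f i)"
      then have wh: "w \<in> \<H> P W" by simp
      have we: "w (e i x) = f i x" if "i \<in> I" "x @: X i" for i x
        using w that by (metis cat_simps(4) compose_eq)
      show "w = ?u"
      proof (rule ent_maps_eqI[OF wh u])
        fix y assume y: "y @: P"
        have ky: "k y @: ?D" using ent_mapsD(4)[OF k(1) y] .
        have l2: "lin A ?D W (%d. w (h d))" "lin A ?D W (%d. ?u (h d))"
          using lin_compose[OF ent_mapsD(1)[OF h(1)] ent_mapsD(1)[OF wh]]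
            lin_compose[OF ent_mapsD(1)[OF h(1)] ent_mapsD(1)[OF u]] .
        have ab: "abelian_group ?D" "abelian_group W"
          using entwinedD(1)[OF \<rho>(1)] entwinedD(1)[OF W] right_module_abelian_group by blast+
        have "w (h (k y)) = ?u (h (k y))"
        proof (rule gen[OF ky, of "%d. w (h d) = ?u (h d)"])
          show "w (h 0[?D]) = ?u (h 0[?D])" using lin_zero[OF ab l2(1)] lin_zero[OF ab l2(2)] by simp
          show "w (h (dinj I X i m)) = ?u (h (dinj I X i m))" if "i \<in> I" "m @: X i" for i m
            using we[OF that] ue[OF that] that by (simp add: ea)
          show "w (h (x +[?D] y)) = ?u (h (x +[?D] y))"
            if "x @: ?D" "y @: ?D" "w (h x) = ?u (h x)" "w (h y) = ?u (h y)" for x y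
            using lin_add[OF l2(1) that(1,2)] lin_add[OF l2(2) that(1,2)] that(3,4) by simp
        qed
        then show "w y = ?u y" using k(3) y by simp
      qed
    qed
  qed
  then show ?thesis by (rule that)
qed

end

section \<open>Flatness and abelian categories\<close>

text \<open>Copying along the identity makes the operations \<open>undefined\<close> off
  \<open>H\<close>, so that a subobject is a standard module like every other object.\<close>

definition subm :: "('s, 'k) ring_scheme => ('s, 'm, 'x) module_scheme => 'm set => ('s, 'm) module" where
  "subm S M H = mcopy S (M\<lparr>carrier := H\<rparr>) (%x. x)"

lemma subm_facts:
  assumes M: "right_module S M" and H: "submodule H S M"
  shows "right_module S (subm S M H)" "carrier (subm S M H) = H" "standard_module S (subm S M H)"
    "lin S (subm S M H) M (%x. x)" "0[subm S M H] = 0[M]"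
    "\<And>X f. lin S X M f ==> f ` carrier X \<subseteq> H ==> lin S X (subm S M H) f"
proof -
  interpret M: right_module S M by (rule M)
  have HM: "H \<subseteq> carrier M" by (rule M.submoduleD(1)[OF H])
  have r: "right_module S (M\<lparr>carrier := H\<rparr>)" by (rule M.right_module_submodule[OF H])
  note f = mcopy_facts[OF r inj_on_id2, folded subm_def]
  show "right_module S (subm S M H)" "standard_module S (subm S M H)" using f by auto
  show c: "carrier (subm S M H) = H" using f(5) by simp
  show z: "0[subm S M H] = 0[M]" by (simp add: subm_def mcopy_def Let_def)
  have a: "x +[subm S M H] y = x +[M] y" if "x \<in> H" "y \<in> H" for x y
    using lin_add[OF f(2), of x y] that by simp
  have s: "s .[subm S M H] x = s .[M] x" if "s @: S" "x \<in> H" for s x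
    using lin_smult[OF f(2), of s x] that by simp
  show "lin S (subm S M H) M (%x. x)" using HM by (intro linI) (auto simp: c a s)
  show "lin S X (subm S M H) f" if X: "lin S X M f" "f ` carrier X \<subseteq> H" for X :: "('a, 'e, 'f) module_scheme" and f
    using X(2) by (intro linI) (auto simp: c a s lin_add[OF X(1)] lin_smult[OF X(1)] image_subset_iff)
qed

context entwining_universe
begin

text \<open>\<open>flat_module\<close> speaks of modules on the type of \<open>U\<close>. Small
  modules on other types are copied there, and injectivity is brought back along the isomorphisms
  induced on tensor products.\<close>

lemma flat_inj:
  fixes L :: "('r, 'l, 'x) module_scheme" and N :: "('r, 'n, 'y) module_scheme"
  assumes flat: "flat_module U R C" and m: "module R L" "module R N"
    and s: "small (carrier L)" "small (carrier N)" and f: "lin R L N f" "inj_on f (carrier L)"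
  shows "inj_on (tmap R L N C f) (carrier (tensor R L C))"
proof -
  note r = right_module_of_module
  obtain h :: "'l => 'u" where h: "inj_on h (carrier L)" "h ` carrier L \<in> U" by (rule small_copy[OF s(1)])
  obtain k :: "'n => 'u" where k: "inj_on k (carrier N)" "k ` carrier N \<in> U" by (rule small_copy[OF s(2)])
  let ?L = "mcopy R L h" and ?N = "mcopy R N k"
  note hL = mcopy_facts[OF r[OF m(1)] h(1)] and kN = mcopy_facts[OF r[OF m(2)] k(1)]
  have m': "module R ?L" "module R ?N" using hL(1) kN(1) cR module_of_right_module by blast+
  let ?i = "inv_into (carrier L) h"
  have i: "lin R ?L L ?i" by (rule lin_inv[OF r[OF m(1)] hL(2,3)])
  have ih: "?i (h x) = x" if "x @: L" for x using that h(1) by simp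
  define g where "g x = k (f (?i x))" for x
  have g: "lin R ?L ?N g" unfolding g_def by (rule lin_compose[OF lin_compose[OF i f(1)] kN(2)])
  have "inj_on g (carrier ?L)"
    unfolding hL(5) using k(1) f(2) lin_closed[OF f(1)] by (simp add: inj_on_def g_def ih) metis
  then have "inj_on (restrict g (carrier ?L)) (carrier ?L)" by (simp add: inj_on_def)
  then have "inj_on (%t. tsum R ?L C (tensor R ?N C) t (%x w. pure_tensor R ?N C (restrict g (carrier ?L) x) w)) (carrier (tensor R ?L C))"
    using flat[unfolded flat_module_def, rule_format, OF m' _ _ lin_restrict[OF hL(1) g]] h(2) k(2) hL(5) kN(5) by simp
  moreover have "tmap R ?L ?N C (restrict g (carrier ?L)) = tmap R ?L ?N C g"
    by (intro ext tmap_cong) simp_all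
  ultimately have inj: "inj_on (tmap R ?L ?N C g) (carrier (tensor R ?L C))"
    unfolding tmap_def[symmetric] by (simp only:)
  show ?thesis
  proof (rule inj_onI)
    fix t t' assume t: "t @: tensor R L C" "t' @: tensor R L C" and eq: "tmap R L N C f t = tmap R L N C f t'"
    have g1: "tmap R ?L ?N C g (tmap R L ?L C h t) = tmap R N ?N C k (tmap R L N C f t)" if t: "t @: tensor R L C" for t
      unfolding tmap_compose[OF m(1) m'(1) mC m'(2) hL(2) g t] tmap_compose[OF m mC m'(2) f(1) kN(2) t]
      by (rule tmap_cong) (simp_all add: g_def ih)
    have "tmap R L ?L C h t = tmap R L ?L C h t'"
      by (rule inj_onD[OF inj]) (simp_all add: g1 t eq tmap_closed[OF m(1) m'(1) mC hL(2)])
    moreover have "tmap R ?L L C ?i (tmap R L ?L C h t) = t" if t: "t @: tensor R L C" for t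
      unfolding tmap_compose[OF m(1) m'(1) mC m(1) hL(2) i t] by (rule tmap_id[OF m(1) mC t ih])
    ultimately show "t = t'" using t by metis
  qed
qed

text \<open>Flatness applied twice, after rebracketing to
  \<open>(L \<otimes> C) \<otimes> C\<close>.\<close>

lemma flat_inj2:
  assumes flat: "flat_module U R C" and m: "module R L" "module R N"
    and s: "small (carrier L)" "small (carrier N)" and f: "lin R L N f" "inj_on f (carrier L)"
  shows "inj_on (tmap R L N (tensor R C C) f) (carrier (tensor R L (tensor R C C)))"
proof (rule inj_onI)
  fix t t' assume t: "t @: (tensor R L (tensor R C C))" "t' @: (tensor R L (tensor R C C))"
    and eq: "tmap R L N (tensor R C C) f t = tmap R L N (tensor R C C) f t'"
  have mt: "module R (tensor R L C)" "module R (tensor R N C)" using m by simp_all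
  have "inj_on (tmap R (tensor R L C) (tensor R N C) C (tmap R L N C f)) (carrier (tensor R (tensor R L C) C))"
    by (rule flat_inj[OF flat mt small_tensor[OF s(1) small_C] small_tensor[OF s(2) small_C] tmap_lin[OF m mC f(1)] flat_inj[OF flat m s f]])
  moreover have "tmap R (tensor R L C) (tensor R N C) C (tmap R L N C f) (tassoc R L C C t) =
      tmap R (tensor R L C) (tensor R N C) C (tmap R L N C f) (tassoc R L C C t')"
    using eq tassoc_tmap[OF m mC mC f(1) t(1)] tassoc_tmap[OF m mC mC f(1) t(2)] by simp
  ultimately have "tassoc R L C C t = tassoc R L C C t'"
    using lin_closed[OF tassoc_lin[OF m(1) mC mC]] t by (auto dest: inj_onD)
  then show "t = t'" using tassoc_inv_tassoc[OF m(1) mC mC] t by metis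
qed

text \<open>Flatness makes \<open>H \<otimes> C \<rightarrow> M \<otimes> C\<close> injective. So
  the coaction of an element of \<open>H\<close> has a unique preimage, uniqueness makes the
  restricted coaction linear, and injectivity reflects the axioms from \<open>M\<close>.\<close>

lemma subobject:
  assumes flat: "flat_module U R C" and M: "M \<in> Obj \<E>" and H: "submodule H A M"
    and c: "\<And>x. x \<in> H ==> \<exists>u \<in> carrier (\<T> (subm A M H)). tm (subm A M H) M (%x. x) u = coact M x"
  obtains K where "K \<in> Obj \<E>" "carrier K = H" "(\<lambda>x\<in>H. x) \<in> \<H> K M"
proof -
  have Me: "entwined M" and MU: "carrier M \<in> U" using M by auto
  note e = entwinedD[OF Me]
  let ?K = "subm A M H" and ?i = "%x. x"
  note k = subm_facts[OF e(1) H]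
  interpret M: right_module A M by (rule e(1))
  interpret K: right_module A ?K by (rule k(1))
  note mK = mB[OF k(1)]
  have HM: "H \<subseteq> carrier M" by (rule M.submoduleD(1)[OF H])
  have HU: "H \<in> U" using U_lepoll[OF MU subset_imp_lepoll[OF HM]] .
  have sm: "small (carrier (\<B> ?K))" "small (carrier (\<B> M))" using HU MU k(2) small_U by simp_all
  note i = lin_base[OF k(4)]
  have inj: "inj_on ?i (carrier (\<B> ?K))" by simp
  let ?t = "tm ?K M ?i"
  note t1 = flat_inj[OF flat mK e(8) sm i inj] and t2 = flat_inj2[OF flat mK e(8) sm i inj]
  note tl = tmap_lin[OF mK e(8) mC i]
  interpret T: module R "\<T> ?K" using mK by simp
  define \<rho> where "\<rho> = (\<lambda>x\<in>H. SOME u. u @: \<T> ?K \<and> ?t u = coact M x)"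
  have \<rho>: "\<rho> x @: \<T> ?K" "?t (\<rho> x) = coact M x" if "x \<in> H" for x
    using someI_ex[of "%u. u @: \<T> ?K \<and> ?t u = coact M x"] c[OF that] that
    by (auto simp: \<rho>_def)
  have "lin R (\<B> ?K) (\<T> ?K) \<rho>"
  proof (rule linI)
    show "\<rho> x @: \<T> ?K" if "x @: \<B> ?K" for x using \<rho> that k(2) by simp
    show "\<rho> (x +[\<B> ?K] y) = \<rho> x +[\<T> ?K] \<rho> y" if "x @: \<B> ?K" "y @: \<B> ?K" for x y
    proof (rule inj_onD[OF t1])
      have xy: "x \<in> H" "y \<in> H" using that k(2) by auto
      then have "x +[?K] y \<in> H" using K.M.a_closed k(2) by metis
      moreover have "x +[?K] y = x +[M] y" using lin_add[OF k(4)] xy k(2) by simp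
      ultimately show "?t (\<rho> (x +[\<B> ?K] y)) = ?t (\<rho> x +[\<T> ?K] \<rho> y)"
        "\<rho> (x +[\<B> ?K] y) @: \<T> ?K"
        using \<rho> xy HM lin_add[OF e(2), of x y] by (auto simp: lin_add[OF tl])
      show "\<rho> x +[\<T> ?K] \<rho> y @: \<T> ?K" using \<rho> xy by simp
    qed
    show "\<rho> (s .[\<B> ?K] x) = s .[\<T> ?K] \<rho> x" if "s @: R" "x @: \<B> ?K" for s x
    proof (rule inj_onD[OF t1])
      have x: "x \<in> H" using that k(2) by auto
      then have "s .[\<B> ?K] x \<in> H" using K.ract_closed[OF one_scaled[OF that(1)]] k(2) by simp
      moreover have "s .[\<B> ?K] x = s .[\<B> M] x" using lin_smult[OF i that(1)] x k(2) by simp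
      ultimately show "?t (\<rho> (s .[\<B> ?K] x)) = ?t (s .[\<T> ?K] \<rho> x)"
        "\<rho> (s .[\<B> ?K] x) @: \<T> ?K"
        using \<rho> x HM lin_smult[OF e(2) that(1), of x] that by (auto simp: lin_smult[OF tl])
      show "s .[\<T> ?K] \<rho> x @: \<T> ?K" using \<rho> x that by simp
    qed
  qed
  then have "pre_entwined (with_coact ?K \<rho>)"
    using k(1,2) by (simp add: pre_entwined_def right_module_with_coact lin_maps_iff) (simp add: \<rho>_def)
  then have ent: "entwined (with_coact ?K \<rho>)"
    by (rule entwined_of_inj[OF _ Me, where i = ?i]) (use k t1 t2 \<rho> in auto)
  have "standard_module A (with_coact ?K \<rho>)" using k(3) by (simp add: standard_module_def)
  then have "with_coact ?K \<rho> \<in> Obj \<E>" using ent HU k(2) by simp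
  moreover have "(\<lambda>x\<in>H. x) \<in> \<H> (with_coact ?K \<rho>) M"
    using ent_mapsI[OF entwinedD(1)[OF ent], of M ?i] k(2,4) \<rho>(2) by simp
  moreover have "carrier (with_coact ?K \<rho>) = H" using k(2) by simp
  ultimately show ?thesis by (intro that)
qed

text \<open>Let \<open>m\<close> be in the kernel. Its coaction becomes zero in
  \<open>Y \<otimes> C\<close>, by flatness already in \<open>f(X) \<otimes> C\<close>, and by right
  exactness it then comes from the kernel tensored with \<open>C\<close>. The detour through the
  image \<open>?Z\<close> makes \<open>f\<close> surjective, as right exactness demands.\<close>

lemma kernel_obj:
  assumes flat: "flat_module U R C" and X: "X \<in> Obj \<E>" and Y: "Y \<in> Obj \<E>" and f: "f \<in> \<H> X Y"
  obtains K where "K \<in> Obj \<E>" "carrier K = {x \<in> carrier X. f x = 0[Y]}"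
    "(\<lambda>x\<in>carrier K. x) \<in> \<H> K X"
proof -
  have Xe: "entwined X" "carrier X \<in> U" and Ye: "entwined Y" "carrier Y \<in> U" using X Y by auto
  note x = entwinedD[OF Xe(1)] and y = entwinedD[OF Ye(1)] and fd = ent_mapsD[OF f]
  let ?H = "{x \<in> carrier X. f x = 0[Y]}" and ?J = "f ` carrier X"
  have H: "submodule ?H A X" by (rule lin_kernel_submodule[OF x(1) y(1) fd(1)])
  have J: "submodule ?J A Y" by (rule lin_image_submodule[OF x(1) y(1) fd(1)])
  let ?K = "subm A X ?H" and ?Z = "subm A Y ?J"
  note k = subm_facts[OF x(1) H] and z = subm_facts[OF y(1) J]
  interpret Z: right_module A ?Z by (rule z(1))
  have JY: "?J \<subseteq> carrier Y" using fd(4) by blast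
  have fZ: "lin A X ?Z f" by (rule z(6)[OF fd(1)]) simp
  have sm: "small (carrier (\<B> ?Z))" "small (carrier (\<B> Y))"
    using small_U[OF Ye(2)] small_subset[OF small_U[OF Ye(2)] JY] z(2) by simp_all
  have tinj: "inj_on (tm ?Z Y (%x. x)) (carrier (\<T> ?Z))"
    by (rule flat_inj[OF flat mB[OF z(1)] y(8) sm lin_base[OF z(4)]]) simp
  have abT: "abelian_group (\<T> ?Z)" "abelian_group (\<T> Y)"
    by (rule module_abelian_group[OF module_tensor[OF mB[OF z(1)] mC]], rule module_abelian_group[OF module_tensor[OF y(8) mC]])
  have "\<exists>u \<in> carrier (\<T> ?K). tm ?K X (%x. x) u = coact X m" if m: "m \<in> ?H" for m
  proof (rule tmap_kernel[OF mB[OF k(1)] x(8) mB[OF z(1)] mC lin_base[OF k(4)] lin_base[OF fZ]])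
    show "coact X m @: \<T> X" using x(7) m by simp
    show "tm X ?Z f (coact X m) = 0[\<T> ?Z]"
    proof (rule inj_onD[OF tinj])
      have "tm ?Z Y (%x. x) (tm X ?Z f (coact X m)) = tm X Y f (coact X m)"
        by (rule tmap_compose[OF x(8) mB[OF z(1)] mC y(8) lin_base[OF fZ] lin_base[OF z(4)]]) (use x(7) m in simp)
      also have "\<dots> = coact Y 0[Y]" using fd(3)[of m] m by simp
      also have "\<dots> = 0[\<T> Y]" using lin_zero[OF module_abelian_group[OF y(8)] abT(2) y(2)] by simp
      also have "\<dots> = tm ?Z Y (%x. x) 0[\<T> ?Z]"
        by (rule lin_zero[symmetric, OF abT tmap_lin[OF mB[OF z(1)] y(8) mC lin_base[OF z(4)]]])
      finally show "tm ?Z Y (%x. x) (tm X ?Z f (coact X m)) =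
        tm ?Z Y (%x. x) 0[\<T> ?Z]" .
      show "tm X ?Z f (coact X m) @: \<T> ?Z"
        by (rule tmap_closed[OF x(8) mB[OF z(1)] mC lin_base[OF fZ]]) (use x(7) m in simp)
      show "0[\<T> ?Z] @: \<T> ?Z"
        using abT(1) by (simp add: abelian_group.axioms(1) abelian_monoid.zero_closed)
    qed
  qed (use k(2,5) z(2,5) in auto)
  then obtain K where K: "K \<in> Obj \<E>" "carrier K = ?H" "(\<lambda>x\<in>?H. x) \<in> \<H> K X"
    by (rule subobject[OF flat X H])
  then show ?thesis by (intro that) auto
qed

text \<open>Hypothesis \<open>im\<close> expresses that \<open>J\<close> is a union of images of
  entwined maps, so that coactions of elements of \<open>J\<close> die in the quotient tensored with
  \<open>C\<close>. It covers the image of a single map as well as the union of the images of a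
  direct system.\<close>

lemma quotient_obj:
  assumes Y: "Y \<in> Obj \<E>" and J: "submodule J A Y"
    and im: "\<And>y. y \<in> J ==> \<exists>(X :: ('a, 'u, 'c) coact_module) f. entwined X \<and> f \<in> \<H> X Y \<and>
      f ` carrier X \<subseteq> J \<and> y \<in> f ` carrier X"
  obtains Q q where "Q \<in> Obj \<E>" "q \<in> \<H> Y Q" "q ` carrier Y = carrier Q"
    "{y \<in> carrier Y. q y = 0[Q]} = J"
proof -
  have Ye: "entwined Y" "carrier Y \<in> U" using Y by auto
  note y = entwinedD[OF Ye(1)]
  interpret Y: right_module A Y by (rule y(1))
  let ?Q = "quotient_module Y J" and ?p = "%y. J +>\<^bsub>Y\<^esub> y"
  note q = Y.quotient_module_facts[OF J]
  obtain \<rho> where \<rho>: "entwined (with_coact ?Q \<rho>)"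
    "\<And>x. x @: Y ==> \<rho> (?p x) = tm Y ?Q ?p (coact Y x)"
  proof (rule entwined_push[OF Ye(1) q(1,2,3)])
    fix m assume m: "m @: Y" "?p m = 0[?Q]"
    then have "m \<in> J" using q(4) by blast
    then obtain X :: "('a, 'u, 'c) coact_module" and f m'
      where Xe: "entwined X" and f: "f \<in> \<H> X Y" "f ` carrier X \<subseteq> J"
        and m': "m' @: X" "m = f m'" using im by blast
    note x = entwinedD[OF Xe] and fd = ent_mapsD[OF f(1)]
    have "tm Y ?Q ?p (coact Y m) = tm X ?Q (%x. ?p (f x)) (coact X m')"
      unfolding m'(2) fd(3)[OF m'(1)]
      by (rule tmap_compose[OF x(8) y(8) mC mB[OF q(1)] lin_base[OF fd(1)] lin_base[OF q(2)] x(7)[OF m'(1)]])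
    also have "\<dots> = 0[\<T> ?Q]"
    proof (rule tmap_zero[OF x(8) mB[OF q(1)] mC x(7)[OF m'(1)]])
      fix x assume "x @: \<B> X"
      then have "f x \<in> J" "f x @: Y" using f(2) fd(4) by auto
      then show "?p (f x) = 0[\<B> ?Q]" using q(4) by simp
    qed
    finally show "tm Y ?Q ?p (coact Y m) = 0[\<T> ?Q]" .
  qed (rule that)
  let ?Q' = "with_coact ?Q \<rho>"
  have sm: "small (carrier ?Q')" unfolding with_coact_simps q(3)[symmetric] by (rule small_image[OF small_U[OF Ye(2)]])
  obtain Q h where Q: "Q \<in> Obj \<E>" and h: "h \<in> \<H> ?Q' Q" "bij_betw h (carrier ?Q') (carrier Q)"
    by (rule entwined_copy[OF \<rho>(1) sm])
  have Qe: "entwined Q" using Q by simp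
  have p: "restrict ?p (carrier Y) \<in> \<H> Y ?Q'"
    by (rule ent_mapsI[OF y(1)]) (simp_all add: q(2) \<rho>(2))
  let ?q = "compose (carrier Y) h (restrict ?p (carrier Y))"
  have qa: "?q y = h (?p y)" if "y @: Y" for y using that by (simp add: compose_def)
  note ab = right_module_abelian_group[OF entwinedD(1)[OF \<rho>(1)]] right_module_abelian_group[OF entwinedD(1)[OF Qe]]
  have z: "h 0[?Q'] = 0[Q]" by (rule lin_zero[OF ab ent_mapsD(1)[OF h(1)]])
  have zc: "0[?Q'] @: ?Q'"
    using abelian_monoid.zero_closed[OF abelian_group.axioms(1)[OF right_module_abelian_group[OF q(1)]]] by simp
  show ?thesis
  proof (rule that[OF Q])
    show "?q \<in> \<H> Y Q" by (rule ent_compose[OF Ye(1) \<rho>(1) Qe p h(1)])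
    have "?q ` carrier Y = h ` (?p ` carrier Y)" by (auto simp: qa image_image cong: image_cong)
    then show "?q ` carrier Y = carrier Q" using q(3) h(2) by (simp add: bij_betw_def)
    have "?q m = 0[Q] \<longleftrightarrow> m \<in> J" if m: "m @: Y" for m
    proof -
      have "?p m @: ?Q'" using lin_closed[OF q(2) m] by simp
      then have "h (?p m) = h 0[?Q'] \<longleftrightarrow> ?p m = 0[?Q']"
        using h(2) zc by (metis bij_betw_def inj_on_eq_iff)
      then show ?thesis using q(4)[OF m] z by (simp add: qa m)
    qed
    then show "{y \<in> carrier Y. ?q y = 0[Q]} = J" using Y.submoduleD(1)[OF J] by auto
  qed
qed

lemma cokernel_obj:
  assumes X: "X \<in> Obj \<E>" and Y: "Y \<in> Obj \<E>" and f: "f \<in> \<H> X Y"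
  obtains Q q where "Q \<in> Obj \<E>" "q \<in> \<H> Y Q" "q ` carrier Y = carrier Q"
    "\<And>y. y @: Y ==> q y = 0[Q] \<longleftrightarrow> y \<in> f ` carrier X"
proof -
  have E: "entwined X" "entwined Y" using X Y by auto
  have J: "submodule (f ` carrier X) A Y" by (rule lin_image_submodule[OF entwinedD(1)[OF E(1)] entwinedD(1)[OF E(2)] ent_mapsD(1)[OF f]])
  have im: "\<exists>(V :: ('a, 'u, 'c) coact_module) f'. entwined V \<and> f' \<in> \<H> V Y \<and>
      f' ` carrier V \<subseteq> f ` carrier X \<and> y \<in> f' ` carrier V" if "y \<in> f ` carrier X" for y
    using E f that by blast
  obtain Q q where Q: "Q \<in> Obj \<E>" "q \<in> \<H> Y Q" "q ` carrier Y = carrier Q"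
    "{y \<in> carrier Y. q y = 0[Q]} = f ` carrier X"
    by (rule quotient_obj[OF Y J im])
  show ?thesis by (rule that[OF Q(1,2,3)]) (use Q(4) in blast)
qed

subsection \<open>Categorical notions on elements\<close>

text \<open>The empty coproduct has only one endomorphism, so its identity is zero.\<close>

lemma zero_obj_exists: obtains Z where "Z \<in> Obj \<E>" "carrier Z = {0[Z]}"
proof -
  have "small ({} :: 'u set)" by (rule small_base) simp
  then obtain Z e where Z: "is_coproduct \<E> ({} :: 'u set) (%_. undefined) Z e"
    by (rule coproduct_exists) auto
  then have ZO: "Z \<in> Obj \<E>" by (simp add: is_coproduct_def)
  then have Ze: "entwined Z" by simp
  interpret right_module A Z by (rule entwinedD(1)[OF Ze])
  have "\<exists>!u. u \<in> \<H> Z Z" using Z ZO by (simp add: is_coproduct_def)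
  then have eq: "(\<lambda>x\<in>carrier Z. x) = (\<lambda>x\<in>carrier Z. 0[Z])" using ent_id[OF Ze] ent_zero[OF Ze Ze] by blast
  have "x = 0[Z]" if "x @: Z" for x using fun_cong[OF eq, of x] that by simp
  then have "carrier Z = {0[Z]}" by auto
  then show ?thesis using that ZO by blast
qed

lemma ent_maps_zero: "entwined X ==> entwined Y ==> f \<in> \<H> X Y ==> f 0[X] = 0[Y]"
  by (rule lin_zero[OF right_module_abelian_group[OF entwinedD(1)] right_module_abelian_group[OF entwinedD(1)] ent_mapsD(1)])

lemma ent_zero_closed: "entwined X ==> 0[X] @: X"
  using right_module_abelian_group[OF entwinedD(1)] abelian_group.axioms(1) abelian_monoid.zero_closed by blast

lemma zero_obj_iff: "is_zero_obj \<E> Z \<longleftrightarrow> Z \<in> Obj \<E> \<and> carrier Z = {0[Z]}"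
proof
  assume z: "is_zero_obj \<E> Z"
  then have ZO: "Z \<in> Obj \<E>" and u: "\<exists>!u. u \<in> \<H> Z Z" by (auto simp: is_zero_obj_def)
  then have Ze: "entwined Z" by simp
  have eq: "(\<lambda>x\<in>carrier Z. x) = (\<lambda>x\<in>carrier Z. 0[Z])" using ent_id[OF Ze] ent_zero[OF Ze Ze] u by blast
  have "x = 0[Z]" if "x @: Z" for x using fun_cong[OF eq, of x] that by simp
  then show "Z \<in> Obj \<E> \<and> carrier Z = {0[Z]}" using ZO ent_zero_closed[OF Ze] by blast
next
  assume Z: "Z \<in> Obj \<E> \<and> carrier Z = {0[Z]}"
  then have Ze: "entwined Z" by simp
  show "is_zero_obj \<E> Z"
    unfolding is_zero_obj_def
  proof (intro conjI ballI)
    fix X assume "X \<in> Obj \<E>"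
    then have Xe: "entwined X" by simp
    show "\<exists>!f. f \<in> Hom \<E> Z X"
    proof (rule ex1I)
      show "(\<lambda>x\<in>carrier Z. 0[X]) \<in> Hom \<E> Z X" using ent_zero[OF Ze Xe] by simp
      show "f = (\<lambda>x\<in>carrier Z. 0[X])" if "f \<in> Hom \<E> Z X" for f
        by (rule ent_maps_eqI[OF _ ent_zero[OF Ze Xe]]) (use that Z ent_maps_zero[OF Ze Xe, of f] in auto)
    qed
    show "\<exists>!f. f \<in> Hom \<E> X Z"
    proof (rule ex1I)
      show "(\<lambda>x\<in>carrier X. 0[Z]) \<in> Hom \<E> X Z" using ent_zero[OF Xe Ze] by simp
      show "f = (\<lambda>x\<in>carrier X. 0[Z])" if "f \<in> Hom \<E> X Z" for f
        by (rule ent_maps_eqI[OF _ ent_zero[OF Xe Ze]]) (use that Z ent_mapsD(4)[of f X Z] in auto)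
    qed
  qed (use Z in blast)
qed

lemma zero_mor_iff:
  assumes X: "X \<in> Obj \<E>" and Y: "Y \<in> Obj \<E>"
  shows "is_zero_mor \<E> X Y f \<longleftrightarrow> f = (\<lambda>x\<in>carrier X. 0[Y])"
proof
  assume "is_zero_mor \<E> X Y f"
  then obtain Z g h where Z: "is_zero_obj \<E> Z" and g: "g \<in> \<H> X Z" and h: "h \<in> \<H> Z Y"
    and f: "f = compose (carrier X) h g" by (auto simp: is_zero_mor_def)
  have Z': "Z \<in> Obj \<E>" "carrier Z = {0[Z]}" using Z zero_obj_iff by auto
  have "h (g x) = 0[Y]" if "x @: X" for x
    using ent_mapsD(4)[OF g that] Z' ent_maps_zero[OF _ _ h] Y by simp
  then show "f = (\<lambda>x\<in>carrier X. 0[Y])" by (auto simp: f compose_def)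
next
  assume f: "f = (\<lambda>x\<in>carrier X. 0[Y])"
  obtain Z where Z: "Z \<in> Obj \<E>" "carrier Z = {0[Z]}" by (rule zero_obj_exists)
  then have Ze: "entwined Z" and Xe: "entwined X" and Ye: "entwined Y" using X Y by auto
  show "is_zero_mor \<E> X Y f"
    unfolding is_zero_mor_def
  proof (intro exI conjI bexI)
    show "is_zero_obj \<E> Z" using Z zero_obj_iff by blast
    show "(\<lambda>x\<in>carrier X. 0[Z]) \<in> Hom \<E> X Z" using ent_zero[OF Xe Ze] by simp
    show "(\<lambda>x\<in>carrier Z. 0[Y]) \<in> Hom \<E> Z Y" using ent_zero[OF Ze Ye] by simp
    show "f = Comp \<E> X Z Y (\<lambda>x\<in>carrier Z. 0[Y]) (\<lambda>x\<in>carrier X. 0[Z])"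
      using ent_zero_closed[OF Ze] by (auto simp: f compose_def restrict_def)
  qed
qed

lemma comp_zero_iff:
  assumes "X \<in> Obj \<E>" "Z \<in> Obj \<E>"
  shows "is_zero_mor \<E> X Z (Comp \<E> X Y Z g f) \<longleftrightarrow> (\<forall>x \<in> carrier X. g (f x) = 0[Z])"
  unfolding zero_mor_iff[OF assms] by (auto simp: compose_def restrict_def fun_eq_iff)

lemma comp_eq_iff:
  assumes "h \<in> \<H> X Z"
  shows "Comp \<E> X Y Z g f = h \<longleftrightarrow> (\<forall>x \<in> carrier X. g (f x) = h x)"
  using ent_mapsD(2)[OF assms] by (auto simp: compose_def restrict_def fun_eq_iff extensional_def)

text \<open>The factorization through the image is \<open>A\<close>-linear, and its colinearity may
  be tested after \<open>k \<otimes> C\<close>, which is injective by flatness.\<close>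

lemma ent_inj_factor:
  assumes flat: "flat_module U R C" and K: "K \<in> Obj \<E>" and X: "X \<in> Obj \<E>" and W: "W \<in> Obj \<E>"
    and k: "k \<in> \<H> K X" "inj_on k (carrier K)" and g: "g \<in> \<H> W X"
    and im: "g ` carrier W \<subseteq> k ` carrier K"
  shows "\<exists>u \<in> \<H> W K. \<forall>w \<in> carrier W. k (u w) = g w"
proof -
  have e: "entwined K" "entwined X" "entwined W" and s: "small (carrier K)" "small (carrier X)"
    using K X W small_U by auto
  note kd = ent_mapsD[OF k(1)] and gd = ent_mapsD[OF g] and xk = entwinedD[OF e(1)] and xx = entwinedD[OF e(2)] and xw = entwinedD[OF e(3)]
  let ?H = "k ` carrier K"
  have H: "submodule ?H A X" by (rule lin_image_submodule[OF xk(1) xx(1) kd(1)])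
  note sm = subm_facts[OF xx(1) H]
  have kl: "lin A K (subm A X ?H) k" by (rule sm(6)[OF kd(1)]) simp
  have bij: "bij_betw k (carrier K) (carrier (subm A X ?H))" using k(2) sm(2) by (simp add: bij_betw_def)
  have gl: "lin A W (subm A X ?H) g" by (rule sm(6)[OF gd(1) im])
  let ?i = "inv_into (carrier K) k" let ?u = "%w. ?i (g w)"
  have u: "lin A W K ?u" by (rule lin_compose[OF gl lin_inv[OF xk(1) kl bij]])
  have ku: "k (?u w) = g w" if "w @: W" for w using im that by (auto simp: f_inv_into_f)
  have inj: "inj_on (tm K X k) (carrier (\<T> K))"
    by (rule flat_inj[OF flat xk(8) xx(8)]) (use s k(2) lin_base[OF kd(1)] in simp_all)
  have "restrict ?u (carrier W) \<in> \<H> W K"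
  proof (rule ent_mapsI[OF xw(1) u], rule inj_onD[OF inj])
    fix w assume w: "w @: W"
    note uw = lin_closed[OF u w]
    have "tm K X k (tm W K ?u (coact W w)) = tm W X (%w. k (?u w)) (coact W w)"
      by (rule tmap_compose[OF xw(8) xk(8) mC xx(8) lin_base[OF u] lin_base[OF kd(1)] xw(7)[OF w]])
    also have "\<dots> = tm W X g (coact W w)" by (rule tmap_cong) (simp_all add: ku)
    also have "\<dots> = tm K X k (coact K (?u w))"
      using kd(3)[OF uw] gd(3)[OF w] ku[OF w] by simp
    finally show "tm K X k (coact K (?u w)) = tm K X k (tm W K ?u (coact W w))" ..
    show "coact K (?u w) @: \<T> K" by (rule xk(7)[OF uw])
    show "tm W K ?u (coact W w) @: \<T> K"
      by (rule tmap_closed[OF xw(8) xk(8) mC lin_base[OF u] xw(7)[OF w]])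
  qed
  then show ?thesis using ku by (intro bexI) auto
qed

text \<open>The inclusion of the kernel and the zero map have the same composite with
  \<open>f\<close>. Dually, \<open>epi_imp_surj\<close> compares the cokernel map with zero.\<close>

lemma mono_imp_inj:
  assumes flat: "flat_module U R C" and X: "X \<in> Obj \<E>" and Y: "Y \<in> Obj \<E>" and f: "is_mono \<E> X Y f"
  shows "f \<in> \<H> X Y" "inj_on f (carrier X)"
proof -
  have e: "entwined X" "entwined Y" using X Y by auto
  show fh: "f \<in> \<H> X Y" using f by (simp add: is_mono_def)
  obtain K where K: "K \<in> Obj \<E>" "carrier K = {x \<in> carrier X. f x = 0[Y]}"
    "(\<lambda>x\<in>carrier K. x) \<in> \<H> K X" by (rule kernel_obj[OF flat X Y fh])
  have Ke: "entwined K" using K by simp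
  have z: "(\<lambda>x\<in>carrier K. 0[X]) \<in> \<H> K X" by (rule ent_zero[OF Ke e(1)])
  have "Comp \<E> K X Y f (\<lambda>x\<in>carrier K. x) = Comp \<E> K X Y f (\<lambda>x\<in>carrier K. 0[X])"
    using K(2) ent_maps_zero[OF e fh] by (auto simp: compose_def restrict_def fun_eq_iff)
  then have "(\<lambda>x\<in>carrier K. x) = (\<lambda>x\<in>carrier K. 0[X])" using f K(1,3) z unfolding is_mono_def cat_simps(2) by blast
  then have "x = 0[X]" if "x @: X" "f x = 0[Y]" for x
    using that K(2) by (auto dest: fun_cong[where x = x])
  then show "inj_on f (carrier X)"
    by (intro lin_inj_onI[OF right_module_abelian_group[OF entwinedD(1)[OF e(1)]]
          right_module_abelian_group[OF entwinedD(1)[OF e(2)]] ent_mapsD(1)[OF fh]])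
qed

lemma epi_imp_surj:
  assumes X: "X \<in> Obj \<E>" and Y: "Y \<in> Obj \<E>" and f: "is_epi \<E> X Y f"
  shows "f \<in> \<H> X Y" "f ` carrier X = carrier Y"
proof -
  have e: "entwined X" "entwined Y" using X Y by auto
  show fh: "f \<in> \<H> X Y" using f by (simp add: is_epi_def)
  obtain Q q where Q: "Q \<in> Obj \<E>" "q \<in> \<H> Y Q"
    "\<And>y. y @: Y ==> q y = 0[Q] \<longleftrightarrow> y \<in> f ` carrier X"
    by (rule cokernel_obj[OF X Y fh]) (rule that)
  have Qe: "entwined Q" using Q by simp
  have z: "(\<lambda>x\<in>carrier Y. 0[Q]) \<in> \<H> Y Q" by (rule ent_zero[OF e(2) Qe])
  have "Comp \<E> X Y Q q f = Comp \<E> X Y Q (\<lambda>x\<in>carrier Y. 0[Q]) f"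
    using Q(3) ent_mapsD(4)[OF fh] by (auto simp: compose_def restrict_def fun_eq_iff)
  then have "q = (\<lambda>x\<in>carrier Y. 0[Q])" using f Q(1,2) z unfolding is_epi_def cat_simps(2) by blast
  then show "f ` carrier X = carrier Y" using Q(3) ent_mapsD(4)[OF fh] by auto
qed

text \<open>A categorical kernel is monic, hence injective; the concrete kernel factors through it,
  so its image is everything that \<open>f\<close> kills.\<close>

lemma kernel_iff:
  assumes flat: "flat_module U R C" and X: "X \<in> Obj \<E>" and Y: "Y \<in> Obj \<E>" and f: "f \<in> \<H> X Y"
  shows "is_kernel \<E> X Y f K k \<longleftrightarrow> K \<in> Obj \<E> \<and> k \<in> \<H> K X \<and> inj_on k (carrier K) \<and>
    k ` carrier K = {x \<in> carrier X. f x = 0[Y]}" (is "?L \<longleftrightarrow> ?R")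
proof
  assume ?R
  then have K: "K \<in> Obj \<E>" and k: "k \<in> \<H> K X" "inj_on k (carrier K)"
    "k ` carrier K = {x \<in> carrier X. f x = 0[Y]}" by auto
  show ?L
    unfolding is_kernel_def
  proof (intro conjI ballI impI)
    show "is_zero_mor \<E> K Y (Comp \<E> K X Y f k)" unfolding comp_zero_iff[OF K Y] using k(3) by blast
    fix W g assume W: "W \<in> Obj \<E>" and g0: "g \<in> Hom \<E> W X" and "is_zero_mor \<E> W Y (Comp \<E> W X Y f g)"
    then have fg: "\<forall>w \<in> carrier W. f (g w) = 0[Y]" using comp_zero_iff[OF W Y] by blast
    have g: "g \<in> \<H> W X" using g0 by simp
    have "g ` carrier W \<subseteq> k ` carrier K" unfolding k(3) using fg ent_mapsD(4)[OF g] by blast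
    then obtain u where u: "u \<in> \<H> W K" "\<forall>w \<in> carrier W. k (u w) = g w"
      using ent_inj_factor[OF flat K X W k(1,2) g] by blast
    show "\<exists>!u. u \<in> Hom \<E> W K \<and> Comp \<E> W K X k u = g"
      unfolding comp_eq_iff[OF g]
    proof (rule ex1I[of _ u])
      fix u' assume u': "u' \<in> Hom \<E> W K \<and> (\<forall>w \<in> carrier W. k (u' w) = g w)"
      then have "u' \<in> \<H> W K" by simp
      then show "u' = u"
        by (rule ent_maps_eqI[OF _ u(1)]) (use u' u ent_mapsD(4)[of _ W K] in \<open>auto intro: inj_onD[OF k(2)]\<close>)
    qed (use u in simp)
  qed (use K k in simp_all)
next
  assume L: ?L
  then have K: "K \<in> Obj \<E>" and k: "k \<in> \<H> K X" and "is_zero_mor \<E> K Y (Comp \<E> K X Y f k)"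
    and un: "\<And>W g. W \<in> Obj \<E> ==> g \<in> \<H> W X ==> is_zero_mor \<E> W Y (Comp \<E> W X Y f g) ==>
        \<exists>!u. u \<in> \<H> W K \<and> Comp \<E> W K X k u = g"
    unfolding is_kernel_def cat_simps(2) by blast+
  then have fk: "\<forall>x \<in> carrier K. f (k x) = 0[Y]" using comp_zero_iff[OF K Y] by blast
  have Ke: "entwined K" and Xe: "entwined X" using K X by auto
  have "is_mono \<E> K X k"
    unfolding is_mono_def
  proof (intro conjI ballI impI)
    fix W g h assume W: "W \<in> Obj \<E>" and g: "g \<in> Hom \<E> W K" and h: "h \<in> Hom \<E> W K" and eq: "Comp \<E> W K X k g = Comp \<E> W K X k h"
    have g': "g \<in> \<H> W K" and We: "entwined W" using g W by auto
    have kg: "Comp \<E> W K X k g \<in> \<H> W X" using ent_compose[OF We Ke Xe g' k] by simp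
    have "is_zero_mor \<E> W Y (Comp \<E> W X Y f (Comp \<E> W K X k g))"
      unfolding comp_zero_iff[OF W Y] using fk ent_mapsD(4)[OF g'] by (simp add: compose_eq)
    then show "g = h" using un[OF W kg] g h eq by auto
  qed (use k in simp)
  then have inj: "inj_on k (carrier K)" by (rule mono_imp_inj[OF flat K X])
  obtain K0 where K0: "K0 \<in> Obj \<E>" "carrier K0 = {x \<in> carrier X. f x = 0[Y]}"
    "(\<lambda>x\<in>carrier K0. x) \<in> \<H> K0 X" by (rule kernel_obj[OF flat X Y f])
  have "is_zero_mor \<E> K0 Y (Comp \<E> K0 X Y f (\<lambda>x\<in>carrier K0. x))" unfolding comp_zero_iff[OF K0(1) Y] using K0(2) by auto
  then obtain u where u: "u \<in> \<H> K0 K" "Comp \<E> K0 K X k u = (\<lambda>x\<in>carrier K0. x)" using un[OF K0(1,3)] by blast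
  then have ku: "\<forall>x \<in> carrier K0. k (u x) = x" using comp_eq_iff[OF K0(3)] by simp
  have "x \<in> k ` carrier K" if "x @: K0" for x
    using ku[rule_format, OF that, symmetric] ent_mapsD(4)[OF u(1) that] by (rule image_eqI)
  then have "{x \<in> carrier X. f x = 0[Y]} \<subseteq> k ` carrier K" unfolding K0(2)[symmetric] by blast
  moreover have "k ` carrier K \<subseteq> {x \<in> carrier X. f x = 0[Y]}" using fk ent_mapsD(4)[OF k] by blast
  ultimately show ?R using K k inj by blast
qed

text \<open>Dual to the case of kernels: a categorical cokernel is epic, hence onto, and the
  concrete cokernel factors through it, which bounds what \<open>q\<close> kills.\<close>

lemma cokernel_iff:
  assumes X: "X \<in> Obj \<E>" and Y: "Y \<in> Obj \<E>" and f: "f \<in> \<H> X Y"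
  shows "is_cokernel \<E> X Y f Q q \<longleftrightarrow> Q \<in> Obj \<E> \<and> q \<in> \<H> Y Q \<and> q ` carrier Y = carrier Q \<and>
    {y \<in> carrier Y. q y = 0[Q]} = f ` carrier X" (is "?L \<longleftrightarrow> ?R")
proof
  assume ?R
  then have Q: "Q \<in> Obj \<E>" and q: "q \<in> \<H> Y Q" "q ` carrier Y = carrier Q"
    "{y \<in> carrier Y. q y = 0[Q]} = f ` carrier X" by auto
  have e: "entwined Y" "entwined Q" using Y Q by auto
  show ?L
    unfolding is_cokernel_def
  proof (intro conjI ballI impI)
    show "is_zero_mor \<E> X Q (Comp \<E> X Y Q q f)" unfolding comp_zero_iff[OF X Q] using q(3) by blast
    fix W g assume W: "W \<in> Obj \<E>" and g0: "g \<in> Hom \<E> Y W" and "is_zero_mor \<E> X W (Comp \<E> X Y W g f)"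
    then have gf: "\<forall>x \<in> carrier X. g (f x) = 0[W]" using comp_zero_iff[OF X W] by blast
    have g: "g \<in> \<H> Y W" and We: "entwined W" using g0 W by auto
    have "g x = 0[W]" if "x @: Y" "q x = 0[Q]" for x
    proof -
      have "x \<in> f ` carrier X" unfolding q(3)[symmetric] using that by simp
      then show ?thesis using gf by blast
    qed
    then obtain u where u: "u \<in> \<H> Q W" "\<forall>x \<in> carrier Y. u (q x) = g x"
      using ent_surj_factor[OF e We q(1,2) g] by blast
    show "\<exists>!u. u \<in> Hom \<E> Q W \<and> Comp \<E> Y Q W u q = g"
      unfolding comp_eq_iff[OF g]
    proof (rule ex1I[of _ u])
      fix u' assume u': "u' \<in> Hom \<E> Q W \<and> (\<forall>x \<in> carrier Y. u' (q x) = g x)"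
      then have "u' \<in> \<H> Q W" by simp
      then show "u' = u"
      proof (rule ent_maps_eqI[OF _ u(1)])
        fix x assume "x @: Q"
        then obtain y where "y @: Y" "x = q y" using q(2) by blast
        then show "u' x = u x" using u u' by simp
      qed
    qed (use u in simp)
  qed (use Q q in simp_all)
next
  assume L: ?L
  then have Q: "Q \<in> Obj \<E>" and q: "q \<in> \<H> Y Q" and "is_zero_mor \<E> X Q (Comp \<E> X Y Q q f)"
    and un: "\<And>W g. W \<in> Obj \<E> ==> g \<in> \<H> Y W ==> is_zero_mor \<E> X W (Comp \<E> X Y W g f) ==>
        \<exists>!u. u \<in> \<H> Q W \<and> Comp \<E> Y Q W u q = g"
    unfolding is_cokernel_def cat_simps(2) by blast+
  then have qf: "\<forall>x \<in> carrier X. q (f x) = 0[Q]" using comp_zero_iff[OF X Q] by blast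
  have e: "entwined Y" "entwined Q" using Y Q by auto
  have "is_epi \<E> Y Q q"
    unfolding is_epi_def
  proof (intro conjI ballI impI)
    fix W g h assume W: "W \<in> Obj \<E>" and g: "g \<in> Hom \<E> Q W" and h: "h \<in> Hom \<E> Q W" and eq: "Comp \<E> Y Q W g q = Comp \<E> Y Q W h q"
    have g': "g \<in> \<H> Q W" and We: "entwined W" using g W by auto
    have gq: "Comp \<E> Y Q W g q \<in> \<H> Y W" using ent_compose[OF e We q g'] by simp
    have "is_zero_mor \<E> X W (Comp \<E> X Y W (Comp \<E> Y Q W g q) f)"
      unfolding comp_zero_iff[OF X W] using qf ent_mapsD(4)[OF f] ent_maps_zero[OF e(2) We g'] by (simp add: compose_eq)
    then show "g = h" using un[OF W gq] g h eq by auto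
  qed (use q in simp)
  then have surj: "q ` carrier Y = carrier Q" by (rule epi_imp_surj[OF Y Q])
  obtain Q0 q0 where Q0: "Q0 \<in> Obj \<E>" "q0 \<in> \<H> Y Q0" "\<And>y. y @: Y ==> q0 y = 0[Q0] \<longleftrightarrow> y \<in> f ` carrier X"
    by (rule cokernel_obj[OF X Y f]) (rule that)
  have "is_zero_mor \<E> X Q0 (Comp \<E> X Y Q0 q0 f)" unfolding comp_zero_iff[OF X Q0(1)] using Q0(3) ent_mapsD(4)[OF f] by auto
  then obtain u where u: "u \<in> \<H> Q Q0" "Comp \<E> Y Q Q0 u q = q0" using un[OF Q0(1,2)] by blast
  then have uq: "\<forall>y \<in> carrier Y. u (q y) = q0 y" using comp_eq_iff[OF Q0(2)] by blast
  have "y \<in> f ` carrier X" if "y @: Y" "q y = 0[Q]" for y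
    using uq that Q0(1,3) ent_maps_zero[OF e(2) _ u(1)] by (metis cat_simps(1))
  then show ?R using Q q surj qf ent_mapsD(4)[OF f] by blast
qed

lemma short_exact_iff:
  assumes flat: "flat_module U R C" and X: "X \<in> Obj \<E>" and Y: "Y \<in> Obj \<E>" and Z: "Z \<in> Obj \<E>"
    and f: "f \<in> \<H> X Y" and g: "g \<in> \<H> Y Z"
  shows "is_short_exact \<E> X Y Z f g \<longleftrightarrow> inj_on f (carrier X) \<and> f ` carrier X = {y \<in> carrier Y. g y = 0[Z]} \<and> g ` carrier Y = carrier Z"
  unfolding is_short_exact_def kernel_iff[OF flat Y Z g] cokernel_iff[OF X Y f] using assms by blast

text \<open>Projections \<open>p\<close> and \<open>q\<close> come from the universal property of
  the coproduct. By its uniqueness part, \<open>i p + j q\<close> with the injections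
  \<open>i\<close> and \<open>j\<close> is the identity, and this equation makes the same object a
  product.\<close>

lemma biproduct_exists:
  assumes X: "X \<in> Obj \<E>" and Y: "Y \<in> Obj \<E>"
  obtains P i j p q where "is_binary_coproduct \<E> X Y P i j" "is_binary_product \<E> X Y P p q"
proof -
  let ?X = "%b. if b then Y else X"
  have "small (UNIV :: bool set)" by (rule small_base) (simp add: finite_lepoll_infinite infinite_base)
  moreover have "?X b \<in> Obj \<E>" for b using X Y by simp
  ultimately obtain P e where co: "is_coproduct \<E> (UNIV :: bool set) ?X P e"
    by (rule coproduct_exists)
  have P: "P \<in> Obj \<E>" and i: "e False \<in> \<H> X P" and j: "e True \<in> \<H> Y P"
    using co unfolding is_coproduct_def cat_simps(2) by (metis UNIV_I)+
  have E: "entwined X" "entwined Y" "entwined P" using X Y P by auto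
  have un: "\<exists>!u. u \<in> \<H> P W \<and> (\<forall>x \<in> carrier X. u (e False x) = f x) \<and> (\<forall>y \<in> carrier Y. u (e True y) = g y)"
    if W: "W \<in> Obj \<E>" and f: "f \<in> \<H> X W" and g: "g \<in> \<H> Y W" for W f g
  proof -
    have "\<exists>!u. u \<in> Hom \<E> P W \<and> (\<forall>b\<in>UNIV. Comp \<E> (?X b) P W u (e b) = (if b then g else f))"
      using co W f g unfolding is_coproduct_def by (auto simp del: cat_simps(4))
    moreover have "(\<forall>b\<in>UNIV. Comp \<E> (?X b) P W u (e b) = (if b then g else f)) \<longleftrightarrow>
        (\<forall>x \<in> carrier X. u (e False x) = f x) \<and> (\<forall>y \<in> carrier Y. u (e True y) = g y)" for u
    proof -
      have "(\<forall>b\<in>UNIV. Comp \<E> (?X b) P W u (e b) = (if b then g else f)) \<longleftrightarrow>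
          Comp \<E> X P W u (e False) = f \<and> Comp \<E> Y P W u (e True) = g"
        by (simp add: all_bool_eq conj_commute del: cat_simps)
      then show ?thesis unfolding comp_eq_iff[OF f] comp_eq_iff[OF g] .
    qed
    ultimately show ?thesis by (simp del: cat_simps(4))
  qed
  have "is_binary_coproduct \<E> X Y P (e False) (e True)"
    unfolding is_binary_coproduct_def
  proof (intro conjI ballI)
    fix W f g assume W: "W \<in> Obj \<E>" and "f \<in> Hom \<E> X W" "g \<in> Hom \<E> Y W"
    then have f: "f \<in> \<H> X W" and g: "g \<in> \<H> Y W" by auto
    show "\<exists>!u. u \<in> Hom \<E> P W \<and> Comp \<E> X P W u (e False) = f \<and> Comp \<E> Y P W u (e True) = g"
      unfolding comp_eq_iff[OF f] comp_eq_iff[OF g] using un[OF W f g] by simp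
  qed (use P i j in auto)
  moreover
  obtain p where p: "p \<in> \<H> P X" "\<forall>x \<in> carrier X. p (e False x) = x" "\<forall>y \<in> carrier Y. p (e True y) = 0[X]"
    using un[OF X ent_id[OF E(1)] ent_zero[OF E(2,1)]] by auto
  obtain q where q: "q \<in> \<H> P Y" "\<forall>x \<in> carrier X. q (e False x) = 0[Y]" "\<forall>y \<in> carrier Y. q (e True y) = y"
    using un[OF Y ent_zero[OF E(1,2)] ent_id[OF E(2)]] by auto
  note P' = right_module_abelian_group[OF entwinedD(1)[OF E(3)]]
  interpret PA: abelian_group P by (rule P')
  note ic = ent_mapsD(4)[OF i] and jc = ent_mapsD(4)[OF j] and pc = ent_mapsD(4)[OF p(1)] and qc = ent_mapsD(4)[OF q(1)]
  note iz = ent_maps_zero[OF E(1,3) i] and jz = ent_maps_zero[OF E(2,3) j]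
  let ?s = "\<lambda>z\<in>carrier P. compose (carrier P) (e False) p z +[P] compose (carrier P) (e True) q z"
  have s: "?s \<in> \<H> P P"
    by (rule ent_add[OF E(3,3) ent_compose[OF E(3,1,3) p(1) i] ent_compose[OF E(3,2,3) q(1) j]])
  have eqs: "?s = (\<lambda>z\<in>carrier P. z)"
    using un[OF P i j] s ent_id[OF E(3)] p q ic jc iz jz by (auto simp: compose_eq)
  have sum: "e False (p z) +[P] e True (q z) = z" if "z @: P" for z
    using that fun_cong[OF eqs, of z] by (simp add: compose_eq)
  have "is_binary_product \<E> X Y P p q"
    unfolding is_binary_product_def
  proof (intro conjI ballI)
    fix W f g assume W: "W \<in> Obj \<E>" and "f \<in> Hom \<E> W X" "g \<in> Hom \<E> W Y"
    then have f: "f \<in> \<H> W X" and g: "g \<in> \<H> W Y" and We: "entwined W" by auto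
    note fc = ent_mapsD(4)[OF f] and gc = ent_mapsD(4)[OF g]
    let ?u = "\<lambda>z\<in>carrier W. compose (carrier W) (e False) f z +[P] compose (carrier W) (e True) g z"
    have u: "?u \<in> \<H> W P"
      by (rule ent_add[OF We E(3) ent_compose[OF We E(1,3) f i] ent_compose[OF We E(2,3) g j]])
    interpret XA: abelian_group X by (rule right_module_abelian_group[OF entwinedD(1)[OF E(1)]])
    interpret YA: abelian_group Y by (rule right_module_abelian_group[OF entwinedD(1)[OF E(2)]])
    show "\<exists>!u. u \<in> Hom \<E> W P \<and> Comp \<E> W P X p u = f \<and> Comp \<E> W P Y q u = g"
      unfolding comp_eq_iff[OF f] comp_eq_iff[OF g]
    proof (rule ex1I[of _ ?u])
      show "?u \<in> Hom \<E> W P \<and> (\<forall>x\<in>carrier W. p (?u x) = f x) \<and> (\<forall>x\<in>carrier W. q (?u x) = g x)"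
        using u p q fc gc ic jc by (simp add: compose_eq lin_add[OF ent_mapsD(1)[OF p(1)]] lin_add[OF ent_mapsD(1)[OF q(1)]])
      fix v assume v: "v \<in> Hom \<E> W P \<and> (\<forall>x\<in>carrier W. p (v x) = f x) \<and> (\<forall>x\<in>carrier W. q (v x) = g x)"
      then have v': "v \<in> \<H> W P" by simp
      show "v = ?u"
        by (rule ent_maps_eqI[OF v' u]) (use v sum[OF ent_mapsD(4)[OF v']] in \<open>auto simp: compose_eq\<close>)
    qed
  qed (use P p q in auto)
  ultimately show ?thesis by (rule that)
qed

lemma abelian_entwined:
  assumes flat: "flat_module U R C"
  shows "is_abelian \<E>"
  unfolding is_abelian_def
proof (intro conjI ballI allI impI)
  show "category \<E>" by (rule category_entwined)
  show "\<exists>Z. is_zero_obj \<E> Z" using zero_obj_exists zero_obj_iff by metis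
  fix X Y assume X: "X \<in> Obj \<E>" and Y: "Y \<in> Obj \<E>"
  then have E: "entwined X" "entwined Y" by auto
  show "\<exists>P p q. is_binary_product \<E> X Y P p q" using biproduct_exists[OF X Y] by metis
  show "\<exists>P i j. is_binary_coproduct \<E> X Y P i j" using biproduct_exists[OF X Y] by metis
  show "\<exists>K k. is_kernel \<E> X Y f K k" if "f \<in> Hom \<E> X Y" for f
  proof -
    have f: "f \<in> \<H> X Y" using that by simp
    obtain K where "K \<in> Obj \<E>" "carrier K = {x \<in> carrier X. f x = 0[Y]}"
      "(\<lambda>x\<in>carrier K. x) \<in> \<H> K X" by (rule kernel_obj[OF flat X Y f])
    then have "is_kernel \<E> X Y f K (\<lambda>x\<in>carrier K. x)"
      unfolding kernel_iff[OF flat X Y f] by (auto simp: inj_on_def)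
    then show ?thesis by blast
  qed
  show "\<exists>Q q. is_cokernel \<E> X Y f Q q" if "f \<in> Hom \<E> X Y" for f
  proof -
    have f: "f \<in> \<H> X Y" using that by simp
    obtain Q q where "Q \<in> Obj \<E>" "q \<in> \<H> Y Q" "q ` carrier Y = carrier Q"
      "\<And>y. y @: Y ==> q y = 0[Q] \<longleftrightarrow> y \<in> f ` carrier X" by (rule cokernel_obj[OF X Y f]) (rule that)
    then have "is_cokernel \<E> X Y f Q q"
      unfolding cokernel_iff[OF X Y f] using ent_mapsD(4)[OF f] by auto
    then show ?thesis by blast
  qed
  show "\<exists>Z\<in>Obj \<E>. \<exists>g\<in>Hom \<E> Y Z. is_kernel \<E> Y Z g X f" if "is_mono \<E> X Y f" for f
  proof -
    note f = mono_imp_inj[OF flat X Y that]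
    obtain Q q where Q: "Q \<in> Obj \<E>" "q \<in> \<H> Y Q"
      "\<And>y. y @: Y ==> q y = 0[Q] \<longleftrightarrow> y \<in> f ` carrier X"
      by (rule cokernel_obj[OF X Y f(1)]) (rule that)
    then have "is_kernel \<E> Y Q q X f"
      unfolding kernel_iff[OF flat Y Q(1,2)] using X f ent_mapsD(4)[OF f(1)] by auto
    then show ?thesis using Q by (intro bexI) auto
  qed
  show "\<exists>W\<in>Obj \<E>. \<exists>g\<in>Hom \<E> W X. is_cokernel \<E> W X g Y f" if "is_epi \<E> X Y f" for f
  proof -
    note f = epi_imp_surj[OF X Y that]
    obtain K where K: "K \<in> Obj \<E>" "carrier K = {x \<in> carrier X. f x = 0[Y]}"
      "(\<lambda>x\<in>carrier K. x) \<in> \<H> K X" by (rule kernel_obj[OF flat X Y f(1)])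
    then have "is_cokernel \<E> K X (\<lambda>x\<in>carrier K. x) Y f"
      unfolding cokernel_iff[OF K(1) X K(3)] using Y f by auto
    then show ?thesis using K by (intro bexI) auto
  qed
qed

end

section \<open>The Grothendieck property\<close>

context entwining_universe
begin

lemma cofree_obj:
  fixes N :: "('a, 'n, 'z) module_scheme"
  assumes N: "right_module A N" and s: "small (carrier N)"
  obtains F h k where "F \<in> Obj \<E>" "h \<in> \<H> (cofree N) F" "k \<in> \<H> F (cofree N)"
    "\<And>x. x @: cofree N ==> k (h x) = x" "\<And>y. y @: F ==> h (k y) = y"
proof -
  have sm: "small (carrier (cofree N))" using small_tensor[of "\<B> N" C R] s small_C by simp
  obtain F h where F: "F \<in> Obj \<E>" and h: "h \<in> \<H> (cofree N) F" "bij_betw h (carrier (cofree N)) (carrier F)"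
    by (rule entwined_copy[OF entwined_cofree[OF N] sm])
  have "entwined F" using F by simp
  then obtain k where k: "k \<in> \<H> F (cofree N)" "\<forall>x \<in> carrier (cofree N). k (h x) = x" "\<forall>y \<in> carrier F. h (k y) = y"
    using ent_inverse[OF entwined_cofree[OF N] _ h] by blast
  show ?thesis by (rule that[OF F h(1) k(1)]) (use k(2,3) in blast)+
qed

lemma hat_map:
  assumes N: "right_module A N" and M: "entwined M" and u: "lin A M N u"
  shows "restrict (hat N M u) (carrier M) \<in> \<H> M (cofree N)"
  by (rule ent_mapsI[OF entwinedD(1)[OF M] hat_lin[OF N M u] hat_coact[OF N M u]])

subsection \<open>Direct limits\<close>

text \<open>A map into the cofree module on the direct limit of the underlying \<open>A\<close>-modules detects the elements that do not
  become zero in the limit.\<close>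

lemma cocone_detects:
  assumes I: "small I" and dir: "directed_set I lq" and sys: "is_direct_system \<E> I lq X t"
    and i0: "i0 \<in> I" and x0: "x0 @: X i0" and nz: "\<And>j. j \<in> I ==> lq i0 j ==> t i0 j x0 ~= 0[X j]"
  obtains W w where "W \<in> Obj \<E>" "\<And>i. i \<in> I ==> w i \<in> \<H> (X i) W"
    "\<And>i j x. i \<in> I ==> j \<in> I ==> lq i j ==> x @: X i ==> w j (t i j x) = w i x" "w i0 x0 ~= 0[W]"
proof -
  have XO: "X i \<in> Obj \<E>" if "i \<in> I" for i using sys that unfolding is_direct_system_def by blast
  have Xe: "entwined (X i)" and Xs: "small (carrier (X i))" if "i \<in> I" for i using XO[OF that] small_U by simp_all
  have XA: "right_module A (X i)" if "i \<in> I" for i using entwinedD(1)[OF Xe[OF that]] .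
  have t: "t i j \<in> \<H> (X i) (X j)" if "i \<in> I" "j \<in> I" "lq i j" for i j
    using sys that unfolding is_direct_system_def cat_simps(2) by blast
  have tt: "t i k x = t j k (t i j x)" if "i \<in> I" "j \<in> I" "k \<in> I" "lq i j" "lq j k" "x @: X i" for i j k x
  proof -
    have "t i k = Comp \<E> (X i) (X j) (X k) (t j k) (t i j)" using sys that unfolding is_direct_system_def by blast
    then show ?thesis using that by (simp add: compose_eq)
  qed
  have tr: "lq i k" if "i \<in> I" "j \<in> I" "k \<in> I" "lq i j" "lq j k" for i j k using dir that unfolding directed_set_def by blast
  have ub: "\<exists>k \<in> I. lq i k \<and> lq j k" if "i \<in> I" "j \<in> I" for i j using dir that unfolding directed_set_def by blast
  let ?D = "dsum I X"
  have D: "right_module A ?D" by (rule right_module_dsum[OF rA XA])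
  interpret D: right_module A ?D by (rule D)
  \<comment> \<open>\<open>s k\<close> pushes the components with index below \<open>k\<close> into
    \<open>X k\<close> and drops the others. The families all of whose images \<open>s k\<close>
    vanish from some index on form the submodule \<open>H\<close> below, and the quotient by
    \<open>H\<close> is the direct limit of the underlying \<open>A\<close>-modules.\<close>
  have "\<forall>k \<in> I. \<exists>s. lin A ?D (X k) s \<and> (\<forall>i \<in> I. \<forall>x \<in> carrier (X i). s (dinj I X i x) = (if lq i k then t i k x else 0[X k]))"
  proof
    fix k assume k: "k \<in> I"
    show "\<exists>s. lin A ?D (X k) s \<and> (\<forall>i \<in> I. \<forall>x \<in> carrier (X i). s (dinj I X i x) = (if lq i k then t i k x else 0[X k]))"
    proof (rule dsum_universal[OF rA XA XA[OF k]])
      fix i assume i: "i \<in> I"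
      show "lin A (X i) (X k) (%x. if lq i k then t i k x else 0[X k])"
        using ent_mapsD(1)[OF t[OF i k]] lin_zero_A[OF XA[OF k]] by (cases "lq i k") simp_all
    qed
  qed
  from bchoice[OF this] obtain s where s: "\<And>k. k \<in> I ==> lin A ?D (X k) (s k)"
    "\<And>k i x. k \<in> I ==> i \<in> I ==> x @: X i ==> s k (dinj I X i x) = (if lq i k then t i k x else 0[X k])" by blast
  have abD: "abelian_group ?D" by (rule D.M.abelian_group_axioms)
  have abX: "abelian_group (X k)" if "k \<in> I" for k by (rule right_module_abelian_group[OF XA[OF that]])
  define H where "H = {f \<in> carrier ?D. \<exists>k0 \<in> I. \<forall>k \<in> I. lq k0 k --> s k f = 0[X k]}"
  have H: "submodule H A ?D"
  proof (rule D.submodule_of_closed)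
    show "H \<subseteq> carrier ?D" by (auto simp: H_def)
    show "0[?D] \<in> H" using i0 lin_zero[OF abD abX s(1)] by (auto simp: H_def)
    show "a .[?D] f \<in> H" if a: "a @: A" and f: "f \<in> H" for a f
    proof -
      obtain k0 where k0: "k0 \<in> I" "\<forall>k \<in> I. lq k0 k --> s k f = 0[X k]" and fD: "f @: ?D" using f by (auto simp: H_def)
      have "s k (a .[?D] f) = 0[X k]" if "k \<in> I" "lq k0 k" for k
        using k0 that fD a by (simp add: lin_smult[OF s(1)] right_module.ract_zero_right[OF XA])
      then show ?thesis using k0 fD a D.ract_closed by (auto simp: H_def)
    qed
    show "f +[?D] g \<in> H" if f: "f \<in> H" and g: "g \<in> H" for f g
    proof -
      obtain k0 k1 where k: "k0 \<in> I" "\<forall>k \<in> I. lq k0 k --> s k f = 0[X k]" "k1 \<in> I" "\<forall>k \<in> I. lq k1 k --> s k g = 0[X k]"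
        and fD: "f @: ?D" "g @: ?D" using f g by (auto simp: H_def)
      obtain k2 where k2: "k2 \<in> I" "lq k0 k2" "lq k1 k2" using ub k by blast
      have "s k (f +[?D] g) = 0[X k]" if kk: "k \<in> I" "lq k2 k" for k
      proof -
        interpret Xk: abelian_group "X k" by (rule abX[OF kk(1)])
        have "lq k0 k" "lq k1 k" using tr k k2 kk by blast+
        then show ?thesis using k kk fD by (simp add: lin_add[OF s(1)])
      qed
      then show ?thesis using k2 fD by (auto simp: H_def)
    qed
  qed
  let ?W = "quotient_module ?D H" and ?p = "%f. H +>\<^bsub>?D\<^esub> f"
  note q = D.quotient_module_facts[OF H]
  define v where "v i x = ?p (dinj I X i x)" for i x
  have dl: "lin A (X i) ?D (dinj I X i)" if "i \<in> I" for i using dinj_lin[OF rA XA that] .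
  have v: "lin A (X i) ?W (v i)" if "i \<in> I" for i unfolding v_def by (rule lin_compose[OF dl[OF that] q(2)])
  have vt: "v j (t i j x) = v i x" if ij: "i \<in> I" "j \<in> I" "lq i j" and x: "x @: X i" for i j x
  proof -
    have tx: "t i j x @: X j" by (rule ent_mapsD(4)[OF t[OF ij] x])
    have d: "dinj I X j (t i j x) @: ?D" "dinj I X i x @: ?D"
      using lin_closed[OF dl[OF ij(2)] tx] lin_closed[OF dl[OF ij(1)] x] .
    have "s k (dinj I X j (t i j x) \<ominus>\<^bsub>?D\<^esub> dinj I X i x) = 0[X k]" if k: "k \<in> I" "lq j k" for k
    proof -
      have ik: "lq i k" by (rule tr[OF ij(1,2) k(1) ij(3) k(2)])
      have "t i k x @: X k" by (rule ent_mapsD(4)[OF t[OF ij(1) k(1) ik] x])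
      then show ?thesis
        using tt[OF ij(1,2) k(1) ij(3) k(2) x] ik k
        by (simp add: lin_diff[OF abD abX[OF k(1)] s(1)[OF k(1)] d] s(2) ij x tx abelian_group_diff_eq_zero[OF abX[OF k(1)]])
    qed
    moreover have "dinj I X j (t i j x) \<ominus>\<^bsub>?D\<^esub> dinj I X i x @: ?D" using d by (simp add: a_minus_def)
    ultimately have "dinj I X j (t i j x) \<ominus>\<^bsub>?D\<^esub> dinj I X i x \<in> H" using ij by (auto simp: H_def)
    then show ?thesis unfolding v_def by (simp add: D.coset_eq_iff[OF H] d)
  qed
  have v0: "v i0 x0 ~= 0[?W]"
  proof
    assume "v i0 x0 = 0[?W]"
    then have "dinj I X i0 x0 \<in> H" using q(4) lin_closed[OF dl[OF i0] x0] by (simp add: v_def)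
    then obtain k0 where k0: "k0 \<in> I" "\<forall>k \<in> I. lq k0 k --> s k (dinj I X i0 x0) = 0[X k]" by (auto simp: H_def)
    obtain k where k: "k \<in> I" "lq k0 k" "lq i0 k" using ub k0 i0 by blast
    then show False using k0(2) s(2)[OF k(1) i0 x0] nz[OF k(1,3)] by auto
  qed
  have "small (carrier ?D)" by (rule small_dsum[OF I Xs])
  then have sW: "small (carrier ?W)" unfolding q(3)[symmetric] by (rule small_image)
  obtain F h k where F: "F \<in> Obj \<E>" and h: "h \<in> \<H> (cofree ?W) F" and k: "k \<in> \<H> F (cofree ?W)"
    "\<And>x. x @: cofree ?W ==> k (h x) = x" by (rule cofree_obj[OF q(1) sW]) (rule that)
  have Fe: "entwined F" and We: "entwined (cofree ?W)" using F entwined_cofree[OF q(1)] by simp_all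
  define w where "w i = compose (carrier (X i)) h (restrict (hat ?W (X i) (v i)) (carrier (X i)))" for i
  have w: "w i \<in> \<H> (X i) F" if "i \<in> I" for i
    unfolding w_def by (rule ent_compose[OF Xe[OF that] We Fe hat_map[OF q(1) Xe[OF that] v[OF that]] h])
  have wa: "w i x = h (hat ?W (X i) (v i) x)" if "x @: X i" for i x using that by (simp add: w_def compose_eq)
  show ?thesis
  proof (rule that[OF F w])
    show "w j (t i j x) = w i x" if ij: "i \<in> I" "j \<in> I" "lq i j" and x: "x @: X i" for i j x
    proof -
      note ti = ent_mapsD[OF t[OF ij]] and e = entwinedD[OF Xe[OF ij(1)]] and e' = entwinedD[OF Xe[OF ij(2)]]
      have "hat ?W (X j) (v j) (t i j x) = tm (X i) ?W (%x. v j (t i j x)) (coact (X i) x)"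
        unfolding hat_def ti(3)[OF x]
        by (rule tmap_compose[OF e(8) e'(8) mC mB[OF q(1)] lin_base[OF ti(1)] lin_base[OF v[OF ij(2)]] e(7)[OF x]])
      also have "\<dots> = hat ?W (X i) (v i) x"
        unfolding hat_def by (rule tmap_cong) (simp_all add: vt ij)
      finally show ?thesis using ti(4)[OF x] x by (simp add: wa)
    qed
    show "w i0 x0 ~= 0[F]"
    proof
      assume "w i0 x0 = 0[F]"
      then have "k (h (hat ?W (X i0) (v i0) x0)) = 0[cofree ?W]"
        using ent_maps_zero[OF Fe We k(1)] wa[OF x0] by simp
      then have "hat ?W (X i0) (v i0) x0 = 0[cofree ?W]"
        using k(2)[OF lin_closed[OF hat_lin[OF q(1) Xe[OF i0] v[OF i0]] x0]] by simp
      then have "v i0 x0 = cE R C \<epsilon> (\<B> ?W) 0[cofree ?W]"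
        using cE_hat[OF q(1) Xe[OF i0] v[OF i0] x0] by simp
      also have "\<dots> = 0[?W]"
        by (rule lin_zero[OF right_module_abelian_group[OF right_module_cofree[OF q(1)]] right_module_abelian_group[OF q(1)] cE_cofree_lin[OF q(1)]])
      finally show False using v0 by blast
    qed
  qed
qed

text \<open>Limits are given only by their universal property, so test objects are needed: the
  quotient of \<open>L\<close> by the union of the images shows that every element comes from some
  stage, and the cocone of \<open>cocone_detects\<close> shows that an element vanishing in
  \<open>L\<close> vanishes at a later stage.\<close>

lemma direct_limit_elements:
  assumes I: "I \<in> U" and dir: "directed_set I lq" and sys: "is_direct_system \<E> I lq X t"
    and lim: "is_direct_limit \<E> I lq X t L l"
  shows "\<And>y. y @: L ==> \<exists>i \<in> I. \<exists>x \<in> carrier (X i). y = l i x"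
    and "\<And>i x. i \<in> I ==> x @: X i ==> l i x = 0[L] ==> \<exists>j \<in> I. lq i j \<and> t i j x = 0[X j]"
proof -
  have XO: "X i \<in> Obj \<E>" if "i \<in> I" for i using sys that unfolding is_direct_system_def by blast
  have Xe: "entwined (X i)" if "i \<in> I" for i using XO[OF that] by simp
  have t: "t i j \<in> \<H> (X i) (X j)" if "i \<in> I" "j \<in> I" "lq i j" for i j
    using sys that unfolding is_direct_system_def cat_simps(2) by blast
  have LO: "L \<in> Obj \<E>" using lim unfolding is_direct_limit_def by blast
  then have Le: "entwined L" by simp
  have l: "l i \<in> \<H> (X i) L" if "i \<in> I" for i
    using lim that unfolding is_direct_limit_def cat_simps(2) by blast
  have lt: "l j (t i j x) = l i x" if "i \<in> I" "j \<in> I" "lq i j" "x @: X i" for i j x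
  proof -
    have "Comp \<E> (X i) (X j) L (l j) (t i j) = l i" using lim that unfolding is_direct_limit_def by blast
    then show ?thesis using that comp_eq_iff[OF l[OF that(1)]] by blast
  qed
  have ub: "\<exists>k \<in> I. lq i k \<and> lq j k" if "i \<in> I" "j \<in> I" for i j using dir that unfolding directed_set_def by blast
  obtain i1 where i1: "i1 \<in> I" using dir unfolding directed_set_def by blast
  have univ: "\<exists>!u. u \<in> \<H> L W \<and> (\<forall>i \<in> I. \<forall>x \<in> carrier (X i). u (l i x) = w i x)"
    if W: "W \<in> Obj \<E>" and w: "\<And>i. i \<in> I ==> w i \<in> \<H> (X i) W"
      and wt: "\<And>i j x. i \<in> I ==> j \<in> I ==> lq i j ==> x @: X i ==> w j (t i j x) = w i x" for W w
  proof -
    have "(\<forall>i \<in> I. w i \<in> Hom \<E> (X i) W) \<and> (\<forall>i \<in> I. \<forall>j \<in> I. lq i j --> Comp \<E> (X i) (X j) W (w j) (t i j) = w i)"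
      using w wt comp_eq_iff[OF w] by simp
    then have "\<exists>!u. u \<in> Hom \<E> L W \<and> (\<forall>i \<in> I. Comp \<E> (X i) L W u (l i) = w i)"
      using lim W unfolding is_direct_limit_def by blast
    then show ?thesis using comp_eq_iff[OF w] by simp
  qed
  interpret L: right_module A L by (rule entwinedD(1)[OF Le])
  define H where "H = {y. \<exists>i \<in> I. \<exists>x \<in> carrier (X i). y = l i x}"
  have lH: "l i ` carrier (X i) \<subseteq> H" if "i \<in> I" for i using that by (auto simp: H_def)
  have H: "submodule H A L"
  proof (rule L.submodule_of_closed)
    show "H \<subseteq> carrier L" using ent_mapsD(4)[OF l] by (auto simp: H_def)
    have "l i1 0[X i1] = 0[L]" by (rule ent_maps_zero[OF Xe[OF i1] Le l[OF i1]])
    then show "0[L] \<in> H" using i1 ent_zero_closed[OF Xe[OF i1]] unfolding H_def by force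
    show "a .[L] y \<in> H" if a: "a @: A" and y: "y \<in> H" for a y
    proof -
      obtain i x where ix: "i \<in> I" "x @: X i" "y = l i x" using y by (auto simp: H_def)
      then have "a .[L] y = l i (a .[X i] x)" using lin_smult[OF ent_mapsD(1)[OF l] a] by simp
      then show ?thesis using ix act_closed[OF entwinedD(1)[OF Xe[OF ix(1)]] a ix(2)] by (auto simp: H_def)
    qed
    show "y +[L] y' \<in> H" if y: "y \<in> H" "y' \<in> H" for y y'
    proof -
      obtain i x i' x' where ix: "i \<in> I" "x @: X i" "y = l i x" "i' \<in> I" "x' @: X i'" "y' = l i' x'"
        using y by (auto simp: H_def)
      obtain k where k: "k \<in> I" "lq i k" "lq i' k" using ub ix by blast
      interpret Xk: right_module A "X k" by (rule entwinedD(1)[OF Xe[OF k(1)]])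
      have tx: "t i k x @: X k" "t i' k x' @: X k" using ent_mapsD(4)[OF t] ix k by blast+
      have "y +[L] y' = l k (t i k x +[X k] t i' k x')"
        using ix k lt tx by (simp add: lin_add[OF ent_mapsD(1)[OF l]])
      then show ?thesis using k(1) tx unfolding H_def by blast
    qed
  qed
  have im: "\<exists>(X :: ('a, 'u, 'c) coact_module) f. entwined X \<and> f \<in> \<H> X L \<and>
      f ` carrier X \<subseteq> H \<and> y \<in> f ` carrier X" if y: "y \<in> H" for y
  proof -
    obtain i x where ix: "i \<in> I" "x @: X i" "y = l i x" using y by (auto simp: H_def)
    then show ?thesis using Xe[OF ix(1)] l[OF ix(1)] lH[OF ix(1)] by blast
  qed
  obtain Q q where Q: "Q \<in> Obj \<E>" "q \<in> \<H> L Q" "q ` carrier L = carrier Q"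
    "{y \<in> carrier L. q y = 0[Q]} = H"
    by (rule quotient_obj[OF LO H im])
  have Qe: "entwined Q" using Q by simp
  have "q = (\<lambda>x\<in>carrier L. 0[Q])"
  proof -
    let ?w = "%i. \<lambda>x\<in>carrier (X i). 0[Q]"
    have "\<exists>!u. u \<in> \<H> L Q \<and> (\<forall>i \<in> I. \<forall>x \<in> carrier (X i). u (l i x) = ?w i x)"
    proof (rule univ[OF Q(1)])
      show "?w i \<in> \<H> (X i) Q" if "i \<in> I" for i by (rule ent_zero[OF Xe[OF that] Qe])
      show "?w j (t i j x) = ?w i x" if "i \<in> I" "j \<in> I" "lq i j" "x @: X i" for i j x
        using ent_mapsD(4)[OF t[OF that(1-3)] that(4)] that(4) by simp
    qed
    moreover have "\<forall>i \<in> I. \<forall>x \<in> carrier (X i). q (l i x) = ?w i x" using lH Q(4) by auto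
    moreover have "\<forall>i \<in> I. \<forall>x \<in> carrier (X i). (\<lambda>x\<in>carrier L. 0[Q]) (l i x) = ?w i x" using ent_mapsD(4)[OF l] by simp
    ultimately show ?thesis using Q(2) ent_zero[OF Le Qe] by blast
  qed
  then have "carrier L \<subseteq> H" using Q(4) by auto
  then show "\<And>y. y @: L ==> \<exists>i \<in> I. \<exists>x \<in> carrier (X i). y = l i x" by (auto simp: H_def)
  show "\<exists>j \<in> I. lq i j \<and> t i j x = 0[X j]" if i: "i \<in> I" and x: "x @: X i" and z: "l i x = 0[L]" for i x
  proof (rule ccontr)
    assume "\<not> ?thesis"
    then have nz: "\<And>j. j \<in> I ==> lq i j ==> t i j x ~= 0[X j]" by blast
    obtain W w where W: "W \<in> Obj \<E>" "\<And>i. i \<in> I ==> w i \<in> \<H> (X i) W"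
      "\<And>i j x. i \<in> I ==> j \<in> I ==> lq i j ==> x @: X i ==> w j (t i j x) = w i x" "w i x ~= 0[W]"
    proof (rule cocone_detects[OF small_U[OF I] dir sys i x nz], goal_cases)
      case 3
      show ?thesis using 3(2-) by (rule 3(1))
    qed
    from ex1_implies_ex[OF univ[OF W(1,2,3)]] obtain u where u: "u \<in> \<H> L W \<and> (\<forall>i \<in> I. \<forall>x \<in> carrier (X i). u (l i x) = w i x)" ..
    have "entwined W" using W(1) by simp
    then have "w i x = 0[W]" using u i x z ent_maps_zero[OF Le, of W u] by metis
    then show False using W(4) by blast
  qed
qed

text \<open>With elements and relations of the limits represented at stages of the systems, each
  part of exactness is a chase at one sufficiently late stage.\<close>

lemma exact_direct_limits:
  assumes flat: "flat_module U R C"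
  shows "has_exact_direct_limits U \<E>"
  unfolding has_exact_direct_limits_def
proof (intro ballI allI impI)
  fix I lq X t Y s Z r f g L l M m N n \<phi> \<gamma>
  assume I: "I \<in> U" and dir: "directed_set I lq"
    and sX: "is_direct_system \<E> I lq X t" and sY: "is_direct_system \<E> I lq Y s" and sZ: "is_direct_system \<E> I lq Z r"
    and mf: "is_system_map \<E> I lq X t Y s f" and mg: "is_system_map \<E> I lq Y s Z r g"
    and ex: "\<forall>i\<in>I. is_short_exact \<E> (X i) (Y i) (Z i) (f i) (g i)"
    and lX: "is_direct_limit \<E> I lq X t L l" and lY: "is_direct_limit \<E> I lq Y s M m" and lZ: "is_direct_limit \<E> I lq Z r N n"
    and \<phi>: "\<phi> \<in> Hom \<E> L M" and \<phi>c: "\<forall>i\<in>I. Comp \<E> (X i) L M \<phi> (l i) = Comp \<E> (X i) (Y i) M (m i) (f i)"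
    and \<gamma>: "\<gamma> \<in> Hom \<E> M N" and \<gamma>c: "\<forall>i\<in>I. Comp \<E> (Y i) M N \<gamma> (m i) = Comp \<E> (Y i) (Z i) N (n i) (g i)"
  note eX = direct_limit_elements[OF I dir sX lX] and eY = direct_limit_elements[OF I dir sY lY] and eZ = direct_limit_elements[OF I dir sZ lZ]
  have O: "X i \<in> Obj \<E>" "Y i \<in> Obj \<E>" "Z i \<in> Obj \<E>" if "i \<in> I" for i
    using sX sY sZ that unfolding is_direct_system_def by blast+
  have E: "entwined (X i)" "entwined (Y i)" "entwined (Z i)" if "i \<in> I" for i using O[OF that] by simp_all
  have LO: "L \<in> Obj \<E>" "M \<in> Obj \<E>" "N \<in> Obj \<E>" using lX lY lZ unfolding is_direct_limit_def by blast+
  have LE: "entwined L" "entwined M" "entwined N" using LO by simp_all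
  have l: "l i \<in> \<H> (X i) L" if "i \<in> I" for i
    using lX that unfolding is_direct_limit_def cat_simps(2) by blast
  have m: "m i \<in> \<H> (Y i) M" if "i \<in> I" for i
    using lY that unfolding is_direct_limit_def cat_simps(2) by blast
  have n: "n i \<in> \<H> (Z i) N" if "i \<in> I" for i
    using lZ that unfolding is_direct_limit_def cat_simps(2) by blast
  have t: "t i j \<in> \<H> (X i) (X j)" if "i \<in> I" "j \<in> I" "lq i j" for i j
    using sX that unfolding is_direct_system_def cat_simps(2) by blast
  have s: "s i j \<in> \<H> (Y i) (Y j)" if "i \<in> I" "j \<in> I" "lq i j" for i j
    using sY that unfolding is_direct_system_def cat_simps(2) by blast
  have f: "f i \<in> \<H> (X i) (Y i)" if "i \<in> I" for i
    using mf that unfolding is_system_map_def cat_simps(2) by blast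
  have g: "g i \<in> \<H> (Y i) (Z i)" if "i \<in> I" for i
    using mg that unfolding is_system_map_def cat_simps(2) by blast
  have ft: "f j (t i j x) = s i j (f i x)" if "i \<in> I" "j \<in> I" "lq i j" "x @: X i" for i j x
  proof -
    have "Comp \<E> (X i) (X j) (Y j) (f j) (t i j) = Comp \<E> (X i) (Y i) (Y j) (s i j) (f i)"
      using mf that unfolding is_system_map_def by blast
    from fun_cong[OF this, of x] show ?thesis using that by (simp add: compose_eq)
  qed
  have gs: "g j (s i j x) = r i j (g i x)" if "i \<in> I" "j \<in> I" "lq i j" "x @: Y i" for i j x
  proof -
    have "Comp \<E> (Y i) (Y j) (Z j) (g j) (s i j) = Comp \<E> (Y i) (Z i) (Z j) (r i j) (g i)"
      using mg that unfolding is_system_map_def by blast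
    from fun_cong[OF this, of x] show ?thesis using that by (simp add: compose_eq)
  qed
  have lt: "l j (t i j x) = l i x" if "i \<in> I" "j \<in> I" "lq i j" "x @: X i" for i j x
  proof -
    have "Comp \<E> (X i) (X j) L (l j) (t i j) = l i" using lX that unfolding is_direct_limit_def by blast
    from fun_cong[OF this, of x] show ?thesis using that by (simp add: compose_eq)
  qed
  have ms: "m j (s i j x) = m i x" if "i \<in> I" "j \<in> I" "lq i j" "x @: Y i" for i j x
  proof -
    have "Comp \<E> (Y i) (Y j) M (m j) (s i j) = m i" using lY that unfolding is_direct_limit_def by blast
    from fun_cong[OF this, of x] show ?thesis using that by (simp add: compose_eq)
  qed
  have \<phi>l: "\<phi> (l i x) = m i (f i x)" if "i \<in> I" "x @: X i" for i x
    using fun_cong[OF bspec[OF \<phi>c that(1)], of x] that by (simp add: compose_eq)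
  have \<gamma>m: "\<gamma> (m i x) = n i (g i x)" if "i \<in> I" "x @: Y i" for i x
    using fun_cong[OF bspec[OF \<gamma>c that(1)], of x] that by (simp add: compose_eq)
  have ex': "inj_on (f i) (carrier (X i))" "f i ` carrier (X i) = {y \<in> carrier (Y i). g i y = 0[Z i]}" "g i ` carrier (Y i) = carrier (Z i)"
    if "i \<in> I" for i
    using ex that short_exact_iff[OF flat O[OF that] f[OF that] g[OF that]] by blast+
  have \<phi>': "\<phi> \<in> \<H> L M" and \<gamma>': "\<gamma> \<in> \<H> M N" using \<phi> \<gamma> by simp_all
  have "inj_on \<phi> (carrier L)"
  proof (rule lin_inj_onI[OF right_module_abelian_group[OF entwinedD(1)[OF LE(1)]] right_module_abelian_group[OF entwinedD(1)[OF LE(2)]] ent_mapsD(1)[OF \<phi>']])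
    fix y assume y: "y @: L" and z: "\<phi> y = 0[M]"
    obtain i x where ix: "i \<in> I" "x @: X i" "y = l i x" using eX(1)[OF y] by blast
    have fx: "f i x @: Y i" by (rule ent_mapsD(4)[OF f[OF ix(1)] ix(2)])
    have "m i (f i x) = 0[M]" using z \<phi>l ix by simp
    then obtain j where j: "j \<in> I" "lq i j" "s i j (f i x) = 0[Y j]" using eY(2)[OF ix(1) fx] by blast
    have tx: "t i j x @: X j" by (rule ent_mapsD(4)[OF t[OF ix(1) j(1,2)] ix(2)])
    have "f j (t i j x) = f j 0[X j]" using ft[OF ix(1) j(1,2) ix(2)] j(3) ent_maps_zero[OF E(1,2) f] j(1) by simp
    then have "t i j x = 0[X j]" using inj_onD[OF ex'(1)[OF j(1)] _ tx ent_zero_closed[OF E(1)[OF j(1)]]] by blast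
    then show "y = 0[L]" using lt[OF ix(1) j(1,2) ix(2)] ent_maps_zero[OF E(1) LE(1) l] j(1) ix by simp
  qed
  moreover have "y \<in> \<phi> ` carrier L" if y: "y @: M" and z: "\<gamma> y = 0[N]" for y
  proof -
    obtain i x where ix: "i \<in> I" "x @: Y i" "y = m i x" using eY(1)[OF y] by blast
    have gx: "g i x @: Z i" by (rule ent_mapsD(4)[OF g[OF ix(1)] ix(2)])
    have "n i (g i x) = 0[N]" using z \<gamma>m ix by simp
    then obtain j where j: "j \<in> I" "lq i j" "r i j (g i x) = 0[Z j]" using eZ(2)[OF ix(1) gx] by blast
    have sx: "s i j x @: Y j" by (rule ent_mapsD(4)[OF s[OF ix(1) j(1,2)] ix(2)])
    have "s i j x \<in> f j ` carrier (X j)" unfolding ex'(2)[OF j(1)] using sx gs[OF ix(1) j(1,2) ix(2)] j(3) by simp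
    then obtain u where u: "u @: X j" "s i j x = f j u" by blast
    then have "y = \<phi> (l j u)" using \<phi>l[OF j(1) u(1)] ms[OF ix(1) j(1,2) ix(2)] ix by simp
    then show ?thesis using ent_mapsD(4)[OF l[OF j(1)] u(1)] by blast
  qed
  moreover have "\<phi> y @: M \<and> \<gamma> (\<phi> y) = 0[N]" if y: "y @: L" for y
  proof -
    obtain i x where ix: "i \<in> I" "x @: X i" "y = l i x" using eX(1)[OF y] by blast
    have "f i x \<in> {y \<in> carrier (Y i). g i y = 0[Z i]}" unfolding ex'(2)[OF ix(1), symmetric] using ix by blast
    then show ?thesis using ix \<phi>l \<gamma>m ent_maps_zero[OF E(3) LE(3) n] ent_mapsD(4)[OF \<phi>' y] by simp
  qed
  moreover have "z \<in> \<gamma> ` carrier M" if z: "z @: N" for z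
  proof -
    obtain i x where ix: "i \<in> I" "x @: Z i" "z = n i x" using eZ(1)[OF z] by blast
    obtain y where y: "y @: Y i" "x = g i y" using ex'(3)[OF ix(1)] ix(2) by blast
    then have "z = \<gamma> (m i y)" using \<gamma>m ix by simp
    then show ?thesis using ent_mapsD(4)[OF m[OF ix(1)] y(1)] by blast
  qed
  ultimately show "is_short_exact \<E> L M N \<phi> \<gamma>"
    unfolding short_exact_iff[OF flat LO \<phi>' \<gamma>'] using ent_mapsD(4)[OF \<gamma>'] by blast
qed

end

section \<open>The generator\<close>

context entwining
begin

text \<open>Differs from \<open>self_module\<close> in that scalars multiply from the right.\<close>

definition rself :: "('a, 'a) module" where
  "rself = \<lparr>carrier = carrier A, monoid.mult = undefined, monoid.one = undefined, ring.zero = ring.zero A,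
     ring.add = ring.add A, smult = (%s x. x *[A] s)\<rparr>"

lemma rself_simps [simp]:
  "carrier rself = carrier A" "0[rself] = 0[A]" "ring.add rself = ring.add A" "s .[rself] x = x *[A] s"
  by (simp_all add: rself_def)

lemma right_module_rself: "right_module A rself"
proof (intro right_module.intro right_module_axioms.intro rA)
  show "abelian_group rself" by (rule abelian_group_cong[OF module_abelian_group[OF mA]]) simp_all
qed (simp_all add: A.l_distr A.r_distr A.m_assoc)

lemma lin_rself: "right_module A M ==> y @: M ==> lin A rself M (%a. a .[M] y)"
proof -
  assume "right_module A M" and y: "y @: M"
  then interpret M: right_module A M by simp
  show ?thesis using y by (intro linI) (simp_all add: M.ract_closed M.ract_l_distr M.ract_assoc)
qed

text \<open>The free module \<open>A^(\<nat>)\<close>. Finitely many elements of any module lie in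
  the image of one map from it, and a single tensor involves only finitely many.\<close>

definition rfree :: "('a, nat => 'a) module" where
  "rfree = dsum UNIV (%_. rself)"

lemma right_module_rfree: "right_module A rfree"
  unfolding rfree_def by (rule right_module_dsum[OF rA right_module_rself])

lemma rfree_onto:
  assumes M: "right_module A M" and Y: "finite Y" "Y \<subseteq> carrier M"
  obtains \<phi> where "lin A rfree M \<phi>" "Y \<subseteq> \<phi> ` carrier rfree"
proof -
  interpret M: right_module A M by (rule M)
  obtain n and g :: "nat => 'b" where g: "Y = g ` {i. i < n}" using finite_imp_nat_seg_image_inj_on[OF Y(1)] by blast
  define y where "y i = (if i < n then g i else 0[M])" for i
  have yM: "y i @: M" for i using g Y(2) by (auto simp: y_def)
  have "\<exists>\<phi>. lin A (dsum UNIV (%_ :: nat. rself)) M \<phi> \<and>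
      (\<forall>i \<in> UNIV. \<forall>a \<in> carrier rself. \<phi> (dinj UNIV (%_. rself) i a) = a .[M] y i)"
    by (rule dsum_universal[OF rA right_module_rself M lin_rself[OF M yM]])
  then obtain \<phi> where \<phi>: "lin A rfree M \<phi>" "\<And>i a. a @: A ==> \<phi> (dinj UNIV (%_. rself) i a) = a .[M] y i"
    unfolding rfree_def by auto
  have "z \<in> \<phi> ` carrier rfree" if zY: "z \<in> Y" for z
  proof -
    obtain i where i: "i < n" "z = g i" using zY g by auto
    have "\<phi> (dinj UNIV (%_. rself) i 1[A]) = z" using \<phi>(2)[of "1[A]" i] i yM[of i] by (simp add: y_def M.ract_one)
    moreover have "dinj UNIV (%_. rself) i 1[A] @: rfree"
      unfolding rfree_def using dinj_closed[OF rA right_module_rself, of i UNIV "1[A]"] by simp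
    ultimately show ?thesis by blast
  qed
  then show ?thesis using that \<phi>(1) by blast
qed

text \<open>The finite set \<open>Y\<close> of first factors is found before \<open>\<phi>\<close>:
  every \<open>\<phi>\<close> whose image contains \<open>Y\<close> lifts \<open>t\<close>. In this
  form the claim survives sums of tensors, since one \<open>\<phi>\<close> can serve both
  summands.\<close>

lemma tensor_from_rfree:
  assumes M: "right_module A M" and t: "t @: \<T> M"
  obtains \<phi> s where "lin A rfree M \<phi>" "s @: \<T> rfree" "tm rfree M \<phi> s = t"
proof -
  note mF = mB[OF right_module_rfree] and mM = mB[OF M]
  interpret F: module R "\<T> rfree" using mF by simp
  have "\<exists>Y. finite Y \<and> Y \<subseteq> carrier M \<and> (\<forall>\<phi>. lin A rfree M \<phi> --> Y \<subseteq> \<phi> ` carrier rfree -->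
      t \<in> tm rfree M \<phi> ` carrier (\<T> rfree))"
    using mM mC t
  proof (induction rule: tensor_induct)
    case (pure x c)
    have "pt M x c \<in> tm rfree M \<phi> ` carrier (\<T> rfree)"
      if \<phi>: "lin A rfree M \<phi>" and xY: "{x} \<subseteq> \<phi> ` carrier rfree" for \<phi>
    proof -
      from xY have "x \<in> \<phi> ` carrier rfree" by simp
      then obtain z where z: "x = \<phi> z" "z @: rfree" by (rule imageE)
      show ?thesis
      proof (rule image_eqI)
        show "pt M x c = tm rfree M \<phi> (pt rfree z c)"
          using z pure(2) by (simp add: tmap_pure[OF mF mM mC lin_base[OF \<phi>]])
        show "pt rfree z c @: \<T> rfree"
          using z pure(2) mF by (simp add: pure_closed)
      qed
    qed
    moreover have "finite {x}" "{x} \<subseteq> carrier M" using pure(1) by simp_all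
    ultimately show ?case by blast
  next
    case (add t t')
    obtain Y where Y: "finite Y" "Y \<subseteq> carrier M" "\<forall>\<phi>. lin A rfree M \<phi> --> Y \<subseteq> \<phi> ` carrier rfree -->
      t \<in> tm rfree M \<phi> ` carrier (\<T> rfree)" using add(3) by (elim exE conjE)
    obtain Y' where Y': "finite Y'" "Y' \<subseteq> carrier M" "\<forall>\<phi>. lin A rfree M \<phi> --> Y' \<subseteq> \<phi> ` carrier rfree -->
      t' \<in> tm rfree M \<phi> ` carrier (\<T> rfree)" using add(4) by (elim exE conjE)
    have "t +[\<T> M] t' \<in> tm rfree M \<phi> ` carrier (\<T> rfree)"
      if \<phi>: "lin A rfree M \<phi>" and YY: "Y \<union> Y' \<subseteq> \<phi> ` carrier rfree" for \<phi>
    proof -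
      obtain s s' where s: "s @: \<T> rfree" "t = tm rfree M \<phi> s"
        "s' @: \<T> rfree" "t' = tm rfree M \<phi> s'"
        using Y(3)[rule_format, OF \<phi>] Y'(3)[rule_format, OF \<phi>] YY by blast
      then have "t +[\<T> M] t' = tm rfree M \<phi> (s +[\<T> rfree] s')"
        by (simp add: lin_add[OF tmap_lin[OF mF mM mC lin_base[OF \<phi>]]])
      then show ?thesis using s(1,3) F.a_closed by (metis image_eqI)
    qed
    moreover have "finite (Y \<union> Y')" "Y \<union> Y' \<subseteq> carrier M" using Y(1,2) Y'(1,2) by simp_all
    ultimately show ?case by blast
  qed
  then obtain Y where Y: "finite Y" "Y \<subseteq> carrier M" "\<forall>\<phi>. lin A rfree M \<phi> --> Y \<subseteq> \<phi> ` carrier rfree -->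
      t \<in> tm rfree M \<phi> ` carrier (\<T> rfree)" by (elim exE conjE)
  obtain \<phi> where \<phi>: "lin A rfree M \<phi>" "Y \<subseteq> \<phi> ` carrier rfree" by (rule rfree_onto[OF M Y(1,2)])
  have "t \<in> tm rfree M \<phi> ` carrier (\<T> rfree)" using Y(3) \<phi> by blast
  then show ?thesis using that[OF \<phi>(1)] by blast
qed

text \<open>\<open>\<phi> \<otimes> C\<close> is \<open>hat\<close> of \<open>\<phi>\<close>
  composed with the counit, by the triangle identity, and is colinear for that reason.\<close>

lemma cofree_map:
  assumes M: "right_module A M" and N: "right_module A N" and \<phi>: "lin A M N \<phi>"
  shows "restrict (tm M N \<phi>) (carrier (cofree M)) \<in> \<H> (cofree M) (cofree N)"
proof -
  note e = entwined_cofree[OF M] and ag = cofree_agree[OF M]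
  let ?T = "\<T> M"
  have T: "module R ?T" using M by simp
  have ce: "lin A (cofree M) N (%t. \<phi> (cE R C \<epsilon> (\<B> M) t))" by (rule lin_compose[OF cE_cofree_lin[OF M] \<phi>])
  have "hat N (cofree M) (%t. \<phi> (cE R C \<epsilon> (\<B> M) t)) t = tm M N \<phi> t" if t: "t @: ?T" for t
  proof -
    let ?r = "tassoc R (\<B> M) C C (cL R C \<Delta> (\<B> M) t)"
    have r: "?r @: tensor R ?T C" by (rule lin_closed[OF cofree_coact_lin[OF M] t])
    have l: "lin R ?T (\<B> N) (%t. \<phi> (cE R C \<epsilon> (\<B> M) t))" by (rule lin_compose[OF cE_lin[OF mB[OF M]] lin_base[OF \<phi>]])
    have "hat N (cofree M) (%t. \<phi> (cE R C \<epsilon> (\<B> M) t)) t = tmap R ?T (\<B> N) C (%t. \<phi> (cE R C \<epsilon> (\<B> M) t)) ?r"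
      unfolding hat_def using t tmap_agree_left[OF ag mB[OF N] mC T] by simp
    also have "\<dots> = tm M N \<phi> (tmap R ?T (\<B> M) C (cE R C \<epsilon> (\<B> M)) ?r)"
      by (rule tmap_compose[symmetric, OF T mB[OF M] mC mB[OF N] cE_lin[OF mB[OF M]] lin_base[OF \<phi>] r])
    finally show ?thesis by (simp add: tmap_cE_coact[OF M t])
  qed
  then have "restrict (tm M N \<phi>) (carrier (cofree M)) =
      restrict (hat N (cofree M) (%t. \<phi> (cE R C \<epsilon> (\<B> M) t))) (carrier (cofree M))"
    unfolding cofree_simps(1) by (intro restrict_ext) (rule sym)
  also have "\<dots> \<in> \<H> (cofree M) (cofree N)"
    by (rule ent_mapsI[OF entwinedD(1)[OF e] hat_lin[OF N e ce] hat_coact[OF N e ce]])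
  finally show ?thesis .
qed

lemma hat_id: "hat M M (%x. x) m = coact M m" if "entwined M" "m @: M"
  unfolding hat_def by (rule tmap_id[OF entwinedD(8)[OF that(1)] mC entwinedD(7)[OF that]]) simp

end

context entwining_universe
begin

lemma base_lepoll:
  "carrier A \<lesssim> carrier R <+> carrier A <+> carrier C <+> (UNIV :: nat set)"
  "carrier C \<lesssim> carrier R <+> carrier A <+> carrier C <+> (UNIV :: nat set)"
  "(UNIV :: nat set) \<lesssim> carrier R <+> carrier A <+> carrier C <+> (UNIV :: nat set)"
proof -
  show "carrier A \<lesssim> carrier R <+> carrier A <+> carrier C <+> (UNIV :: nat set)"
    by (auto simp: lepoll_def intro!: exI[of _ "%x. Inr (Inl x)"] inj_onI)
  show "carrier C \<lesssim> carrier R <+> carrier A <+> carrier C <+> (UNIV :: nat set)"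
    by (auto simp: lepoll_def intro!: exI[of _ "%x. Inr (Inr (Inl x))"] inj_onI)
  show "(UNIV :: nat set) \<lesssim> carrier R <+> carrier A <+> carrier C <+> (UNIV :: nat set)"
    by (auto simp: lepoll_def intro!: exI[of _ "%x. Inr (Inr (Inr x))"] inj_onI)
qed

lemma cofree_rfree_lepoll: "carrier (cofree rfree) \<lesssim> carrier R <+> carrier A <+> carrier C <+> (UNIV :: nat set)"
proof -
  note b = infinite_base base_lepoll
  have "carrier rfree \<lesssim> carrier R <+> carrier A <+> carrier C <+> (UNIV :: nat set)"
    unfolding rfree_def by (rule lepoll_dsum[OF b(1)]) (use lepoll_Times[OF b(1) b(4) b(2)] in simp)
  then show ?thesis using lepoll_tensor[OF b(1) _ b(3), of "\<B> rfree" R] by simp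
qed

text \<open>Every element of an entwined module is hit by a subobject of \<open>A\<^sup>(\<nat>) \<otimes> C\<close>: write its coaction as the image of an
  element of \<open>A\<^sup>(\<nat>) \<otimes> C\<close>, and pull the coaction back.\<close>

lemma generator_hits:
  assumes flat: "flat_module U R C" and K: "K \<in> Obj \<E>" and h: "h \<in> \<H> (cofree rfree) K"
    and k: "k \<in> \<H> K (cofree rfree)" "\<And>x. x @: cofree rfree ==> k (h x) = x"
    and X: "X \<in> Obj \<E>" and m: "m @: X"
  obtains P z where "P \<in> Obj \<E>" "carrier P \<subseteq> carrier K" "(\<lambda>x\<in>carrier P. x) \<in> \<H> P K"
    "z @: P"
    "\<And>P'. P' \<in> Obj \<E> ==> carrier P' = carrier P ==> (\<lambda>x\<in>carrier P'. x) \<in> \<H> P' K ==>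
      \<exists>\<theta> \<in> \<H> P' X. \<theta> z = m"
proof -
  have Xe: "entwined X" "carrier X \<in> U" and Ke: "entwined K" using X K by auto
  note x = entwinedD[OF Xe(1)] and F = right_module_rfree
  have Fe: "entwined (cofree rfree)" and CXe: "entwined (cofree X)" using entwined_cofree[OF F] entwined_cofree[OF x(1)] by auto
  obtain \<phi> s where \<phi>: "lin A rfree X \<phi>" and s: "s @: \<T> rfree" "tm rfree X \<phi> s = coact X m"
    by (rule tensor_from_rfree[OF x(1) x(7)[OF m]])
  obtain W hW kW where W: "W \<in> Obj \<E>" and hW: "hW \<in> \<H> (cofree X) W" and kW: "kW \<in> \<H> W (cofree X)"
    "\<And>x. x @: cofree X ==> kW (hW x) = x" by (rule cofree_obj[OF x(1) small_U[OF Xe(2)]]) (rule that)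
  have We: "entwined W" using W by simp
  let ?\<rho> = "restrict (hat X X (%x. x)) (carrier X)"
  have \<rho>: "?\<rho> \<in> \<H> X (cofree X)" by (rule hat_map[OF x(1) Xe(1) lin_id])
  have \<rho>a: "?\<rho> y = coact X y" if "y @: X" for y using that hat_id[OF Xe(1)] by simp
  let ?r = "compose (carrier X) hW ?\<rho>"
  have r: "?r \<in> \<H> X W" by (rule ent_compose[OF Xe(1) CXe We \<rho> hW])
  have ra: "?r y = hW (coact X y)" if "y @: X" for y using that \<rho>a[OF that] by (simp add: compose_eq)
  have rinj: "inj_on ?r (carrier X)"
  proof (rule inj_onI)
    fix y y' assume y: "y @: X" "y' @: X" "?r y = ?r y'"
    then have "kW (hW (coact X y)) = kW (hW (coact X y'))" by (simp only: ra)
    then have "coact X y = coact X y'" using kW(2) x(7) y by simp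
    then show "y = y'" using x(5)[OF y(1)] x(5)[OF y(2)] by metis
  qed
  let ?t = "restrict (tm rfree X \<phi>) (carrier (cofree rfree))"
  have t: "?t \<in> \<H> (cofree rfree) (cofree X)" by (rule cofree_map[OF F x(1) \<phi>])
  let ?\<Phi> = "compose (carrier K) hW (compose (carrier K) ?t k)"
  have \<Phi>: "?\<Phi> \<in> \<H> K W" by (rule ent_compose[OF Ke CXe We ent_compose[OF Ke Fe CXe k(1) t] hW])
  \<comment> \<open>\<open>P\<close> is the pullback of \<open>?r\<close> along
    \<open>?\<Phi>\<close>, formed as the kernel of \<open>?\<Phi>\<close> followed by the cokernel
    of \<open>?r\<close>. As \<open>?r\<close> is injective, the projection of the pullback to
    \<open>X\<close> is obtained by factoring through it.\<close>
  obtain Q q where Q: "Q \<in> Obj \<E>" "q \<in> \<H> W Q" "\<And>y. y @: W ==> q y = 0[Q] \<longleftrightarrow> y \<in> ?r ` carrier X"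
    by (rule cokernel_obj[OF X W r]) (rule that)
  have Qe: "entwined Q" using Q by simp
  have q\<Phi>: "compose (carrier K) q ?\<Phi> \<in> \<H> K Q" by (rule ent_compose[OF Ke We Qe \<Phi> Q(2)])
  obtain P where P: "P \<in> Obj \<E>" "carrier P = {y \<in> carrier K. compose (carrier K) q ?\<Phi> y = 0[Q]}"
    "(\<lambda>x\<in>carrier P. x) \<in> \<H> P K" by (rule kernel_obj[OF flat K Q(1) q\<Phi>])
  have P2: "carrier P = {y \<in> carrier K. ?\<Phi> y \<in> ?r ` carrier X}"
  proof -
    have "compose (carrier K) q ?\<Phi> y = 0[Q] \<longleftrightarrow> ?\<Phi> y \<in> ?r ` carrier X" if y: "y @: K" for y
      using Q(3)[OF ent_mapsD(4)[OF \<Phi> y]] y by (simp only: compose_eq)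
    then show ?thesis unfolding P(2) by blast
  qed
  let ?z = "h s"
  have hs: "?z @: K" using ent_mapsD(4)[OF h] s(1) by simp
  have \<Phi>z: "?\<Phi> ?z = ?r m" using hs s k(2) ra[OF m] by (simp add: compose_eq)
  have z: "?z @: P" unfolding P2 using hs \<Phi>z m by blast
  \<comment> \<open>Asserted for every object \<open>P'\<close> on the carrier of \<open>P\<close>,
    because the generator contains just one chosen structure for each subset of
    \<open>K\<close>.\<close>
  have ex: "\<exists>\<theta> \<in> \<H> P' X. \<theta> ?z = m"
    if P': "P' \<in> Obj \<E>" "carrier P' = carrier P" "(\<lambda>x\<in>carrier P'. x) \<in> \<H> P' K" for P'
  proof -
    have P'e: "entwined P'" using P' by simp
    let ?g = "compose (carrier P') ?\<Phi> (\<lambda>x\<in>carrier P'. x)"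
    have g: "?g \<in> \<H> P' W" by (rule ent_compose[OF P'e Ke We P'(3) \<Phi>])
    have ga: "?g y = ?\<Phi> y" if "y @: P'" for y using that by (simp add: compose_eq)
    have "?g y \<in> ?r ` carrier X" if "y @: P'" for y using that ga[OF that] P2 P'(2) by auto
    then have "?g ` carrier P' \<subseteq> ?r ` carrier X" by blast
    then obtain \<theta> where \<theta>: "\<theta> \<in> \<H> P' X" "\<forall>w \<in> carrier P'. ?r (\<theta> w) = ?g w"
      using ent_inj_factor[OF flat X W P'(1) r rinj g] by blast
    have zP: "?z @: P'" using z P'(2) by simp
    have "?r (\<theta> ?z) = ?r m" using \<theta>(2)[rule_format, OF zP] ga[OF zP] \<Phi>z by simp
    then have "\<theta> ?z = m" by (rule inj_onD[OF rinj _ ent_mapsD(4)[OF \<theta>(1) zP] m])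
    then show ?thesis using \<theta>(1) by blast
  qed
  have PK: "carrier P \<subseteq> carrier K" unfolding P2 by blast
  show ?thesis by (rule that[OF P(1) PK P(3) z ex])
qed

text \<open>The coproduct of one chosen subobject for each subset of \<open>K\<close> that carries
  one. \<open>K\<close> is no larger than the base of the universe, so its subsets form a small set.
  A map on a single summand is extended to the coproduct by zero.\<close>

lemma generator_exists:
  assumes flat: "flat_module U R C"
  shows "\<exists>G. is_generator \<E> G"
proof -
  have sF: "small (carrier rfree)"
    unfolding rfree_def by (rule small_dsum) (use small_base[OF base_lepoll(3)] small_A in simp_all)
  obtain K h k where K: "K \<in> Obj \<E>" and h: "h \<in> \<H> (cofree rfree) K" and k: "k \<in> \<H> K (cofree rfree)"
    "\<And>x. x @: cofree rfree ==> k (h x) = x" and hk: "\<And>y. y @: K ==> h (k y) = y"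
    by (rule cofree_obj[OF right_module_rfree sF]) (rule that)
  have "carrier K \<subseteq> h ` carrier (cofree rfree)" using hk ent_mapsD(4)[OF k(1)] by (metis image_eqI subsetI)
  then have KB: "carrier K \<lesssim> carrier R <+> carrier A <+> carrier C <+> (UNIV :: nat set)"
    using subset_image_lepoll cofree_rfree_lepoll lepoll_trans by blast
  define good where "good P V \<longleftrightarrow> V \<in> Obj \<E> \<and> carrier V = P \<and> (\<lambda>x\<in>carrier V. x) \<in> \<H> V K" for P V
  define S where "S = {P \<in> Pow (carrier K). \<exists>V. good P V}"
  define ob where "ob P = (SOME V. good P V)" for P
  have ob: "good P (ob P)" if "P \<in> S" for P using that someI_ex[of "good P"] by (auto simp: S_def ob_def)
  have "small S" by (rule small_subset[OF small_Pow[OF KB]]) (auto simp: S_def)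
  moreover have "ob P \<in> Obj \<E>" if "P \<in> S" for P using ob[OF that] unfolding good_def by blast
  ultimately obtain G e where G: "is_coproduct \<E> S ob G e" by (rule coproduct_exists)
  have e: "e P \<in> \<H> (ob P) G" if "P \<in> S" for P
    using G that unfolding is_coproduct_def cat_simps(2) by blast
  have GO: "G \<in> Obj \<E>" using G unfolding is_coproduct_def by blast
  have Ge: "entwined G" using GO by simp
  have "is_generator \<E> G"
    unfolding is_generator_def
  proof (intro conjI ballI impI GO)
    fix X Y f g assume X: "X \<in> Obj \<E>" and Y: "Y \<in> Obj \<E>" and f0: "f \<in> Hom \<E> X Y" and g0: "g \<in> Hom \<E> X Y" and ne: "f ~= g"
    have Xe: "entwined X" using X by simp
    have f: "f \<in> \<H> X Y" and g: "g \<in> \<H> X Y" using f0 g0 by simp_all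
    obtain m where m: "m @: X" "f m ~= g m" using ne ent_maps_eqI[OF f g] by blast
    obtain P z where P: "P \<in> Obj \<E>" "carrier P \<subseteq> carrier K" "(\<lambda>x\<in>carrier P. x) \<in> \<H> P K"
      and z: "z @: P"
      and ex: "\<And>P'. P' \<in> Obj \<E> ==> carrier P' = carrier P ==> (\<lambda>x\<in>carrier P'. x) \<in> \<H> P' K ==>
        \<exists>\<theta> \<in> \<H> P' X. \<theta> z = m"
      by (rule generator_hits[OF flat K h k X m(1)]) (assumption, rule that)
    let ?c = "carrier P"
    have "good ?c P" unfolding good_def using P by blast
    then have S: "?c \<in> S" using P(2) by (auto simp: S_def)
    note OP = ob[OF S, unfolded good_def]
    obtain \<theta> where \<theta>: "\<theta> \<in> \<H> (ob ?c) X" "\<theta> z = m" using ex[of "ob ?c"] OP by blast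
    let ?F = "%P'. if P' = ?c then \<theta> else (\<lambda>x\<in>carrier (ob P'). 0[X])"
    have F: "\<forall>P' \<in> S. ?F P' \<in> Hom \<E> (ob P') X"
    proof
      fix P' assume P': "P' \<in> S"
      have "entwined (ob P')" using ob[OF P'] unfolding good_def by simp
      note e0 = ent_zero[OF this Xe]
      show "?F P' \<in> Hom \<E> (ob P') X"
      proof (cases "P' = ?c")
        case True
        then show ?thesis using \<theta>(1) by simp
      next
        case False
        then have "?F P' = (\<lambda>x\<in>carrier (ob P'). 0[X])" by (rule if_not_P)
        then show ?thesis unfolding cat_simps(2) using e0 by (simp only:)
      qed
    qed
    have "\<exists>!u. u \<in> Hom \<E> G X \<and> (\<forall>P'\<in>S. Comp \<E> (ob P') G X u (e P') = ?F P')"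
      by (rule G[unfolded is_coproduct_def, THEN conjunct2, THEN conjunct2, rule_format, OF X F[rule_format]])
    from this[THEN ex1_implies_ex] obtain u where u1: "u \<in> Hom \<E> G X \<and> (\<forall>P'\<in>S. Comp \<E> (ob P') G X u (e P') = ?F P')" ..
    have u: "u \<in> Hom \<E> G X" "Comp \<E> (ob ?c) G X u (e ?c) = \<theta>"
      using u1[THEN conjunct1] u1[THEN conjunct2, rule_format, OF S] by simp_all
    have zO: "z @: ob ?c" using z OP by simp
    have uz: "u (e ?c z) = m" using fun_cong[OF u(2), of z] zO \<theta>(2) by (simp add: compose_eq)
    have ez: "e ?c z @: G" by (rule ent_mapsD(4)[OF e[OF S] zO])
    have "Comp \<E> G X Y f u ~= Comp \<E> G X Y g u"
    proof
      assume eq: "Comp \<E> G X Y f u = Comp \<E> G X Y g u"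
      have "f m = g m" using fun_cong[OF eq, of "e ?c z"] ez uz by (simp add: compose_eq)
      then show False using m(2) by blast
    qed
    then show "\<exists>h \<in> Hom \<E> G X. Comp \<E> G X Y f h ~= Comp \<E> G X Y g h" using u(1) by blast
  qed
  then show ?thesis by blast
qed

theorem Grothendieck_entwined:
  assumes "flat_module U R C"
  shows "is_Grothendieck U \<E>"
  unfolding is_Grothendieck_def has_small_coproducts_def
  using abelian_entwined[OF assms] exact_direct_limits[OF assms] generator_exists[OF assms] coproduct_exists small_U
  by (metis (no_types, lifting))

end

section \<open>Injective objects\<close>

definition int_ring :: "int ring" where
  "int_ring = \<lparr>carrier = UNIV, monoid.mult = (*), monoid.one = 1, ring.zero = 0, ring.add = (+)\<rparr>"

lemma int_ring_simps [simp]: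
  "carrier int_ring = UNIV" "x *[int_ring] y = x * y" "1[int_ring] = 1" "0[int_ring] = 0" "x +[int_ring] y = x + y"
  by (simp_all add: int_ring_def)

lemma cring_int_ring: "cring int_ring"
proof (intro cringI abelian_groupI comm_monoidI)
  fix x :: int
  show "\<exists>y \<in> carrier int_ring. y +[int_ring] x = 0[int_ring]" by (rule bexI[of _ "- x"]) simp_all
qed (simp_all add: algebra_simps)

definition zmod :: "('s, 'm, 'x) module_scheme => (int, 'm) module" where
  "zmod M = \<lparr>carrier = carrier M, monoid.mult = undefined, monoid.one = undefined, ring.zero = ring.zero M,
     ring.add = ring.add M, smult = (%n x. x [^]\<^bsub>add_monoid M\<^esub> n)\<rparr>"

lemma zmod_simps [simp]:
  "carrier (zmod M) = carrier M" "0[zmod M] = 0[M]" "ring.add (zmod M) = ring.add M"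
  "n .[zmod M] x = x [^]\<^bsub>add_monoid M\<^esub> n"
  by (simp_all add: zmod_def)

lemma right_module_zmod:
  assumes "abelian_group M" shows "right_module int_ring (zmod M)"
proof (intro right_module.intro right_module_axioms.intro)
  interpret G: comm_group "add_monoid M" using assms by (rule abelian_group.a_comm_group)
  show "ring int_ring" by (rule cring.axioms(1)[OF cring_int_ring])
  show "abelian_group (zmod M)" by (rule abelian_group_cong[OF assms]) simp_all
  fix s t x y
  show "x @: zmod M ==> s .[zmod M] x @: zmod M"
    using G.int_pow_closed[of x s] by simp
  show "x @: zmod M ==> (s +[int_ring] t) .[zmod M] x = s .[zmod M] x +[zmod M] t .[zmod M] x"
    using G.int_pow_mult[of x s t] by simp
  show "x @: zmod M ==> y @: zmod M ==>
      s .[zmod M] (x +[zmod M] y) = s .[zmod M] x +[zmod M] s .[zmod M] y"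
    using G.int_pow_distrib[of x y s] by simp
  show "x @: zmod M ==> (s *[int_ring] t) .[zmod M] x = t .[zmod M] (s .[zmod M] x)"
    using G.int_pow_pow[of x s t] by simp
  show "x @: zmod M ==> 1[int_ring] .[zmod M] x = x"
    using G.int_pow_1[of x] by simp
qed

lemma lin_zmodI:
  assumes "abelian_group M" "abelian_group N" and f: "\<And>x. x @: M ==> f x @: N"
    "\<And>x y. x @: M ==> y @: M ==> f (x +[M] y) = f x +[N] f y"
  shows "lin int_ring (zmod M) (zmod N) f"
proof (rule linI)
  interpret M: comm_group "add_monoid M" using assms(1) by (rule abelian_group.a_comm_group)
  interpret N: comm_group "add_monoid N" using assms(2) by (rule abelian_group.a_comm_group)
  have "f \<in> hom (add_monoid M) (add_monoid N)"
    unfolding hom_def using f by simp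
  then show "f (s .[zmod M] x) = s .[zmod N] f x" if "x @: zmod M" for s x
    using hom_int_pow[of f "add_monoid M" "add_monoid N" x s] that M.is_group N.is_group by simp
qed (use f in simp_all)

lemma lin_zmod:
  assumes "abelian_group M" "abelian_group N" and f: "lin S M N f"
  shows "lin int_ring (zmod M) (zmod N) f"
  by (rule lin_zmodI[OF assms(1,2) lin_closed[OF f] lin_add[OF f]])

definition divisible :: "(int, 'm, 'x) module_scheme => bool" where
  "divisible D \<longleftrightarrow> (\<forall>n. n ~= 0 --> (\<forall>d \<in> carrier D. \<exists>e \<in> carrier D. n .[D] e = d))"

text \<open>A maximal partial extension, as a graph, is total: to extend it to \<open>y\<close>, let \<open>k > 0\<close> be least such that it is
  defined at \<open>k y\<close>, and divide its value there by \<open>k\<close>.\<close>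

lemma divisible_injective:
  fixes D :: "(int, 'd, 'x) module_scheme" and X :: "(int, 'm, 'y) module_scheme" and Y :: "(int, 'n, 'z) module_scheme"
  assumes D: "right_module int_ring D" "divisible D" and X: "right_module int_ring X" and Y: "right_module int_ring Y"
    and i: "lin int_ring X Y i" "inj_on i (carrier X)" and f: "lin int_ring X D f"
  obtains g where "lin int_ring Y D g" "\<And>x. x @: X ==> g (i x) = f x"
proof -
  interpret D: right_module int_ring D by (rule D(1))
  interpret X: right_module int_ring X by (rule X)
  interpret Y: right_module int_ring Y by (rule Y)
  note ag = right_module_abelian_group[OF X] right_module_abelian_group[OF Y] right_module_abelian_group[OF D(1)]
  have act [simp]: "n .[D] d @: D" "m .[Y] y @: Y" if "d @: D" "y @: Y" for n m d y
    using that D.ract_closed Y.ract_closed by simp_all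
  \<comment> \<open>Graphs of partial extensions of \<open>f\<close>: closed under the operations,
    containing the pairs \<open>(i x, f x)\<close>, and single-valued at zero. Subtraction then
    makes them single-valued everywhere, as \<open>uniq\<close> shows.\<close>
  define P where "P G \<longleftrightarrow> G \<subseteq> carrier Y \<times> carrier D \<and> (\<forall>x \<in> carrier X. (i x, f x) \<in> G) \<and>
    (\<forall>x c x' c'. (x, c) \<in> G --> (x', c') \<in> G --> (x +[Y] x', c +[D] c') \<in> G) \<and>
    (\<forall>n x c. (x, c) \<in> G --> (n .[Y] x, n .[D] c) \<in> G) \<and> (\<forall>c. (0[Y], c) \<in> G --> c = 0[D])" for G
  have PD: "G \<subseteq> carrier Y \<times> carrier D" "\<And>x. x @: X ==> (i x, f x) \<in> G"
    "\<And>x c x' c'. (x, c) \<in> G ==> (x', c') \<in> G ==> (x +[Y] x', c +[D] c') \<in> G"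
    "\<And>n x c. (x, c) \<in> G ==> (n .[Y] x, n .[D] c) \<in> G" "\<And>c. (0[Y], c) \<in> G ==> c = 0[D]" if "P G" for G
    using that unfolding P_def by blast+
  have neg: "x +[M] (- 1 :: int) .[M] x = 0[M]" if "right_module int_ring M" "x @: M"
    for M :: "(int, 'q, 'w) module_scheme" and x
  proof -
    interpret M: right_module int_ring M by (rule that(1))
    have "(1 + (- 1)) .[M] x = 0[M]" using M.ract_zero_left[OF that(2)] by simp
    moreover have "(1 + (- 1)) .[M] x = 1 .[M] x +[M] (- 1 :: int) .[M] x"
      using M.ract_l_distr[of 1 "- 1" x] that(2) by simp
    ultimately show ?thesis using M.ract_one[OF that(2)] by simp
  qed
  have uniq: "c = c'" if G: "P G" and c: "(x, c) \<in> G" "(x, c') \<in> G" for G x c c'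
  proof -
    have xc: "x @: Y" "c @: D" "c' @: D" using PD(1)[OF G] c by blast+
    have "(x +[Y] (- 1) .[Y] x, c +[D] (- 1) .[D] c') \<in> G" by (rule PD(3)[OF G c(1) PD(4)[OF G c(2)]])
    then have "c +[D] (- 1) .[D] c' = c' +[D] (- 1) .[D] c'"
      using PD(5)[OF G] neg[OF Y xc(1)] neg[OF D(1) xc(3)] by simp
    then show ?thesis using xc D.M.add.right_cancel[of "(- 1) .[D] c'" c c'] D.ract_closed[of "- 1" c'] by simp
  qed
  have base: "P ((%x. (i x, f x)) ` carrier X)"
    unfolding P_def
  proof (intro conjI allI impI ballI)
    show "(%x. (i x, f x)) ` carrier X \<subseteq> carrier Y \<times> carrier D" using lin_closed[OF i(1)] lin_closed[OF f] by auto
  next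
    fix x c x' c' assume "(x, c) \<in> (%x. (i x, f x)) ` carrier X" "(x', c') \<in> (%x. (i x, f x)) ` carrier X"
    then obtain z z' where "z @: X" "z' @: X" "x = i z" "c = f z" "x' = i z'" "c' = f z'" by auto
    then show "(x +[Y] x', c +[D] c') \<in> (%x. (i x, f x)) ` carrier X"
      by (intro image_eqI[of _ _ "z +[X] z'"]) (simp_all add: lin_add[OF i(1)] lin_add[OF f])
  next
    fix n x c assume "(x, c) \<in> (%x. (i x, f x)) ` carrier X"
    then obtain z where "z @: X" "x = i z" "c = f z" by auto
    then show "(n .[Y] x, n .[D] c) \<in> (%x. (i x, f x)) ` carrier X"
      by (intro image_eqI[of _ _ "n .[X] z"]) (simp_all add: lin_smult[OF i(1)] lin_smult[OF f] X.ract_closed)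
  next
    fix c assume "(0[Y], c) \<in> (%x. (i x, f x)) ` carrier X"
    then obtain z where z: "z @: X" "i z = 0[Y]" "c = f z" by auto
    have "i z = i 0[X]" using z(2) lin_zero[OF ag(1,2) i(1)] by simp
    then have "z = 0[X]" using inj_onD[OF i(2) _ z(1)] by simp
    then show "c = 0[D]" using z(3) lin_zero[OF ag(1,3) f] by simp
  qed blast
  have chain: "P (\<Union>\<C>)" if ne: "\<C> ~= {}" and ch: "subset.chain {G. P G} \<C>" for \<C>
  proof -
    have PC: "P G" if "G \<in> \<C>" for G using ch that unfolding subset_chain_def by blast
    have two: "\<exists>G \<in> \<C>. p \<in> G \<and> q \<in> G" if "p \<in> \<Union>\<C>" "q \<in> \<Union>\<C>" for p q
      using that ch unfolding subset_chain_def by blast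
    show ?thesis
      unfolding P_def
    proof (intro conjI allI impI ballI)
      show "\<Union>\<C> \<subseteq> carrier Y \<times> carrier D" using PD(1)[OF PC] by blast
      show "(i x, f x) \<in> \<Union>\<C>" if "x @: X" for x using PD(2)[OF PC that] ne by blast
      show "(x +[Y] x', c +[D] c') \<in> \<Union>\<C>" if "(x, c) \<in> \<Union>\<C>" "(x', c') \<in> \<Union>\<C>" for x c x' c'
        using two[OF that] PD(3)[OF PC] by blast
      show "(n .[Y] x, n .[D] c) \<in> \<Union>\<C>" if "(x, c) \<in> \<Union>\<C>" for n x c
        using that PD(4)[OF PC] by blast
      show "c = 0[D]" if "(0[Y], c) \<in> \<Union>\<C>" for c
        using that PD(5)[OF PC] by blast
    qed
  qed
  have "\<exists>G \<in> {G. P G}. \<forall>H \<in> {G. P G}. G \<subseteq> H --> H = G"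
    by (rule subset_Zorn_nonempty) (use base chain in auto)
  then obtain G where G: "P G" and max: "\<And>H. P H ==> G \<subseteq> H ==> H = G" by blast
  have total: "\<exists>c. (y, c) \<in> G" if y: "y @: Y" for y
  proof -
    define K where "K = {k :: nat. 0 < k \<and> (\<exists>c. (int k .[Y] y, c) \<in> G)}"
    \<comment> \<open>The condition for adjoining \<open>(y, d)\<close>: wherever \<open>G\<close>
      is already defined at a multiple \<open>n y\<close>, its value has to be \<open>n d\<close>.
      If \<open>G\<close> is defined at no positive multiple of \<open>y\<close>, then
      \<open>d = 0\<close> serves.\<close>
    have "\<exists>d \<in> carrier D. \<forall>n c. (n .[Y] y, c) \<in> G --> c = n .[D] d"
    proof (cases "K = {}")
      case True
      have "c = n .[D] 0[D]" if nc: "(n .[Y] y, c) \<in> G" for n c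
      proof -
        have "n = 0"
        proof (rule ccontr)
          assume n: "n ~= 0"
          have "(sgn n .[Y] (n .[Y] y), sgn n .[D] c) \<in> G" by (rule PD(4)[OF G nc])
          moreover have "sgn n .[Y] (n .[Y] y) = (n * sgn n) .[Y] y" using Y.ract_assoc[of n "sgn n" y] y by simp
          moreover have "n * sgn n = int (nat \<bar>n\<bar>)" by (simp add: abs_sgn[symmetric])
          ultimately have "nat \<bar>n\<bar> \<in> K" using n unfolding K_def by auto
          then show False using True by blast
        qed
        then show ?thesis using nc Y.ract_zero_left[OF y] D.ract_zero_left[OF D.M.zero_closed] PD(5)[OF G, of c] by simp
      qed
      then show ?thesis using D.M.zero_closed by blast
    next
      case False
      define k where "k = (LEAST k. k \<in> K)"
      have kK: "k \<in> K"
      proof -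
        from False obtain m where "m \<in> K" by blast
        then show ?thesis unfolding k_def by (rule LeastI[of "%k. k \<in> K"])
      qed
      have least: "k \<le> m" if "m \<in> K" for m unfolding k_def using that by (rule Least_le[of "%k. k \<in> K"])
      have k0: "0 < k" using kK unfolding K_def by simp
      obtain e where e: "(int k .[Y] y, e) \<in> G" using kK unfolding K_def by blast
      have eD: "e @: D" using PD(1)[OF G] e by blast
      obtain d where d: "d @: D" "int k .[D] d = e" using D(2) eD k0 unfolding divisible_def by (metis of_nat_0_eq_iff less_numeral_extra(3))
      have "c = n .[D] d" if nc: "(n .[Y] y, c) \<in> G" for n c
      proof -
        \<comment> \<open>Division with remainder: \<open>G\<close> is defined at
          \<open>r y\<close>, so minimality of \<open>k\<close> forces \<open>r = 0\<close>.\<close>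
        define q r where "q = n div int k" and "r = n mod int k"
        have n: "n = int k * q + r" unfolding q_def r_def by simp
        have qG: "((int k * q) .[Y] y, q .[D] e) \<in> G" using PD(4)[OF G e, of q] Y.ract_assoc[of "int k" q y] y by simp
        have "r = 0"
        proof (rule ccontr)
          assume r0: "r ~= 0"
          have "(n .[Y] y +[Y] (- q) .[Y] (int k .[Y] y), c +[D] (- q) .[D] e) \<in> G"
            by (rule PD(3)[OF G nc PD(4)[OF G e]])
          moreover have "n .[Y] y +[Y] (- q) .[Y] (int k .[Y] y) = r .[Y] y"
            using Y.ract_assoc[of "int k" "- q" y] Y.ract_l_distr[of n "int k * - q" y] y n by simp
          moreover have "0 < r" "r < int k" using pos_mod_bound[of "int k" n] pos_mod_sign[of "int k" n] r0 k0 unfolding r_def by linarith+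
          ultimately have r: "(r .[Y] y, c +[D] (- q) .[D] e) \<in> G" "0 < nat r" "nat r < k" "int (nat r) = r" by (simp_all only:)
          then have "nat r \<in> K" unfolding K_def by (metis (mono_tags, lifting) mem_Collect_eq)
          then show False using least[of "nat r"] r(3) by simp
        qed
        then have "c = q .[D] e" using uniq[OF G nc] qG n by simp
        also have "\<dots> = n .[D] d" using D.ract_assoc[of "int k" q d] d \<open>r = 0\<close> n by simp
        finally show ?thesis .
      qed
      then show ?thesis using d(1) by blast
    qed
    then obtain d where d: "d @: D" "\<And>n c. (n .[Y] y, c) \<in> G ==> c = n .[D] d" by blast
    \<comment> \<open>The subgroup generated by \<open>G\<close> and \<open>(y, d)\<close>.\<close>
    define H where "H = {(x +[Y] n .[Y] y, c +[D] n .[D] d) | x c n. (x, c) \<in> G}"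
    have HI: "(x +[Y] n .[Y] y, c +[D] n .[D] d) \<in> H" if "(x, c) \<in> G" for x c n using that unfolding H_def by blast
    have HE: "\<exists>x c n. p = (x +[Y] n .[Y] y, c +[D] n .[D] d) \<and> (x, c) \<in> G \<and> x @: Y \<and> c @: D" if "p \<in> H" for p
      using that PD(1)[OF G] unfolding H_def by blast
    have yc: "n .[Y] y @: Y" "n .[D] d @: D" for n using Y.ract_closed D.ract_closed y d(1) by simp_all
    have y0: "0 .[Y] y = 0[Y]" "0 .[D] d = 0[D]" using Y.ract_zero_left[OF y] D.ract_zero_left[OF d(1)] by simp_all
    have GH: "G \<subseteq> H"
    proof (rule subrelI)
      fix x c assume xc: "(x, c) \<in> G"
      then have "x @: Y" "c @: D" using PD(1)[OF G] by blast+
      then show "(x, c) \<in> H" using HI[OF xc, of 0] y0 by simp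
    qed
    have "P H"
      unfolding P_def
    proof (intro conjI allI impI ballI)
      show "H \<subseteq> carrier Y \<times> carrier D"
      proof
        fix p assume "p \<in> H"
        from HE[OF this] show "p \<in> carrier Y \<times> carrier D" using yc by auto
      qed
      show "(i x, f x) \<in> H" if "x @: X" for x using PD(2)[OF G that] GH by blast
    next
      fix x c x' c' assume h: "(x, c) \<in> H" "(x', c') \<in> H"
      obtain u b n where u: "x = u +[Y] n .[Y] y" "c = b +[D] n .[D] d" "(u, b) \<in> G" "u @: Y" "b @: D"
        using HE[OF h(1)] by blast
      obtain u' b' n' where u': "x' = u' +[Y] n' .[Y] y" "c' = b' +[D] n' .[D] d" "(u', b') \<in> G" "u' @: Y" "b' @: D"
        using HE[OF h(2)] by blast
      have "x +[Y] x' = (u +[Y] u') +[Y] (n + n') .[Y] y"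
        using Y.ract_l_distr[of n n' y] u(4) u'(4) y yc unfolding u(1) u'(1) by (simp add: Y.M.a_ac)
      moreover have "c +[D] c' = (b +[D] b') +[D] (n + n') .[D] d"
        using D.ract_l_distr[of n n' d] u(5) u'(5) d(1) yc unfolding u(2) u'(2) by (simp add: D.M.a_ac)
      ultimately show "(x +[Y] x', c +[D] c') \<in> H" using HI[OF PD(3)[OF G u(3) u'(3)], of "n + n'"] by simp
    next
      fix m x c assume h: "(x, c) \<in> H"
      obtain u b n where u: "x = u +[Y] n .[Y] y" "c = b +[D] n .[D] d" "(u, b) \<in> G" "u @: Y" "b @: D"
        using HE[OF h] by blast
      have "m .[Y] x = m .[Y] u +[Y] (n * m) .[Y] y"
        using Y.ract_assoc[of n m y] Y.ract_r_distr[of m u "n .[Y] y"] u(1,4) y yc by simp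
      moreover have "m .[D] c = m .[D] b +[D] (n * m) .[D] d"
        using D.ract_assoc[of n m d] D.ract_r_distr[of m b "n .[D] d"] u(2,5) d(1) yc by simp
      ultimately show "(m .[Y] x, m .[D] c) \<in> H" using HI[OF PD(4)[OF G u(3), of m], of "n * m"] by simp
    next
      fix c assume "(0[Y], c) \<in> H"
      from HE[OF this] obtain u b n where u: "0[Y] = u +[Y] n .[Y] y" "c = b +[D] n .[D] d" "(u, b) \<in> G" "u @: Y" "b @: D"
        by blast
      have "u +[Y] n .[Y] y = u +[Y] (- 1) .[Y] u" using u(1) neg[OF Y u(4)] by simp
      then have "n .[Y] y = (- 1) .[Y] u" using Y.M.add.right_cancel[of u "n .[Y] y" "(- 1) .[Y] u"] u(4) yc Y.ract_closed[of "- 1" u] by (simp add: Y.M.a_comm)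
      then have "(- 1) .[D] b = n .[D] d" using d(2)[of n] PD(4)[OF G u(3), of "- 1"] by simp
      then show "c = 0[D]" using u(2) neg[OF D(1) u(5)] by simp
    qed
    then have "H = G" using max GH by blast
    moreover have "(i 0[X] +[Y] 1 .[Y] y, f 0[X] +[D] 1 .[D] d) \<in> H" using HI[OF PD(2)[OF G X.M.zero_closed]] .
    moreover have "i 0[X] +[Y] 1 .[Y] y = y" using lin_zero[OF ag(1,2) i(1)] Y.ract_one[OF y] y by simp
    ultimately show ?thesis by auto
  qed
  define g where "g y = (SOME c. (y, c) \<in> G)" for y
  have g: "(y, g y) \<in> G" if "y @: Y" for y unfolding g_def by (rule someI_ex[OF total[OF that]])
  show ?thesis
  proof (rule that)
    show "lin int_ring Y D g"
    proof (rule linI)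
      show "g y @: D" if "y @: Y" for y using g[OF that] PD(1)[OF G] by blast
      show "g (x +[Y] y) = g x +[D] g y" if "x @: Y" "y @: Y" for x y
        using uniq[OF G g PD(3)[OF G g[OF that(1)] g[OF that(2)]]] that by simp
      show "g (n .[Y] y) = n .[D] g y" if "y @: Y" for n y
        using uniq[OF G g PD(4)[OF G g[OF that], of n]] that Y.ract_closed[of n y] by simp
    qed
    show "g (i x) = f x" if "x @: X" for x
      by (rule uniq[OF G g[OF lin_closed[OF i(1) that]] PD(2)[OF G that]])
  qed
qed

definition rat_module :: "(int, rat) module" where
  "rat_module = \<lparr>carrier = UNIV, monoid.mult = undefined, monoid.one = undefined, ring.zero = 0, ring.add = (+),
     smult = (%n q. of_int n * q)\<rparr>"

lemma rat_module_simps [simp]: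
  "carrier rat_module = UNIV" "0[rat_module] = 0" "x +[rat_module] y = x + y" "n .[rat_module] x = of_int n * x"
  by (simp_all add: rat_module_def)

lemma right_module_rat_module: "right_module int_ring rat_module"
proof (intro right_module.intro right_module_axioms.intro abelian_groupI)
  show "ring int_ring" by (rule cring.axioms(1)[OF cring_int_ring])
  fix x :: rat
  show "\<exists>y \<in> carrier rat_module. y +[rat_module] x = 0[rat_module]" by (rule bexI[of _ "- x"]) simp_all
qed (simp_all add: algebra_simps)

lemma self_module_simps [simp]:
  "carrier (self_module S) = carrier S" "0[self_module S] = 0[S]" "ring.add (self_module S) = ring.add S"
  "s .[self_module S] x = s *[S] x"
  by (simp_all add: self_module_def)

text \<open>\<open>X\<close> is the free abelian group on its own carrier modulo a subgroup.
  Dividing the rational vector space on the same basis by that subgroup gives a divisible group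
  containing \<open>X\<close>. The last conclusion presents \<open>D\<close> as an image of a direct
  sum in order to bound its size.\<close>

lemma divisible_hull:
  fixes X :: "(int, 'm, 'x) module_scheme"
  assumes X: "right_module int_ring X"
  obtains D :: "(int, ('m => rat) set) module" and j r where "right_module int_ring D" "divisible D" "lin int_ring X D j"
    "inj_on j (carrier X)" "carrier D = r ` carrier (dsum (carrier X) (%_. rat_module))"
proof -
  interpret X: right_module int_ring X by (rule X)
  have rI: "ring int_ring" by (rule cring.axioms(1)[OF cring_int_ring])
  let ?Z = "self_module int_ring" let ?FZ = "dsum (carrier X) (%_. ?Z)" and ?FQ = "dsum (carrier X) (%_. rat_module)"
  have Z: "right_module int_ring ?Z"
  proof (intro right_module.intro right_module_axioms.intro abelian_groupI rI)
    fix x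
    show "\<exists>y \<in> carrier ?Z. y +[?Z] x = 0[?Z]" by (rule bexI[of _ "- x"]) simp_all
  qed (simp_all add: algebra_simps)
  note Q = right_module_rat_module
  have FZ: "right_module int_ring ?FZ" by (rule right_module_dsum[OF rI Z])
  have FQ: "right_module int_ring ?FQ" by (rule right_module_dsum[OF rI Q])
  interpret FZ: right_module int_ring ?FZ by (rule FZ)
  interpret FQ: right_module int_ring ?FQ by (rule FQ)
  have "\<exists>p. lin int_ring ?FZ X p \<and> (\<forall>m \<in> carrier X. \<forall>n \<in> carrier ?Z. p (dinj (carrier X) (%_. ?Z) m n) = n .[X] m)"
    by (rule dsum_universal[OF rI Z X]) (auto intro!: linI simp: X.ract_closed X.ract_l_distr[simplified] X.ract_assoc[simplified, symmetric] mult.commute)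
  then obtain p where p: "lin int_ring ?FZ X p" "\<And>m. m @: X ==> p (dinj (carrier X) (%_. ?Z) m 1) = m"
    using X.ract_one by auto
  have psurj: "p ` carrier ?FZ = carrier X"
  proof
    show "p ` carrier ?FZ \<subseteq> carrier X" using lin_closed[OF p(1)] by blast
    show "carrier X \<subseteq> p ` carrier ?FZ"
    proof
      fix m assume m: "m @: X"
      have "dinj (carrier X) (%_. ?Z) m 1 @: ?FZ" by (rule dinj_closed[OF rI Z m]) simp
      then show "m \<in> p ` carrier ?FZ" using p(2)[OF m] by (metis image_eqI)
    qed
  qed
  define \<iota> where "\<iota> f = (\<lambda>m\<in>carrier X. rat_of_int (f m))" for f
  have \<iota>: "lin int_ring ?FZ ?FQ \<iota>"
  proof (rule linI)
    show "\<iota> f @: ?FQ" if f: "f @: ?FZ" for f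
    proof (rule dsum_carrierI[OF rI Q])
      have "{m \<in> carrier X. \<iota> f m ~= 0[rat_module]} = {m \<in> carrier X. f m ~= 0[?Z]}" by (auto simp: \<iota>_def)
      then show "finite {m \<in> carrier X. \<iota> f m ~= 0[rat_module]}" using dsum_carrierD(2)[OF rI Z f] by simp
    qed (simp_all add: \<iota>_def)
    show "\<iota> (f +[?FZ] g) = \<iota> f +[?FQ] \<iota> g" for f g by (auto simp: \<iota>_def dsum_def restrict_def fun_eq_iff)
    show "\<iota> (n .[?FZ] f) = n .[?FQ] \<iota> f" for n f by (auto simp: \<iota>_def dsum_def restrict_def fun_eq_iff)
  qed
  have \<iota>inj: "f = g" if "f @: ?FZ" "g @: ?FZ" "\<iota> f = \<iota> g" for f g
  proof (rule extensionalityI[OF dsum_carrierD(3)[OF rI Z that(1)] dsum_carrierD(3)[OF rI Z that(2)]])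
    fix m assume "m @: X"
    then show "f m = g m" using fun_cong[OF that(3), of m] by (simp add: \<iota>_def)
  qed
  let ?N = "\<iota> ` {f \<in> carrier ?FZ. p f = 0[X]}"
  have N: "submodule ?N int_ring ?FQ"
  proof -
    note K = lin_kernel_submodule[OF FZ X p(1)]
    have "lin int_ring (subm int_ring ?FZ {f \<in> carrier ?FZ. p f = 0[X]}) ?FQ \<iota>"
      by (rule lin_compose[OF subm_facts(4)[OF FZ K] \<iota>])
    from lin_image_submodule[OF subm_facts(1)[OF FZ K] FQ this] show ?thesis unfolding subm_facts(2)[OF FZ K] .
  qed
  let ?D = "quotient_module ?FQ ?N" let ?q = "%x. ?N +>\<^bsub>?FQ\<^esub> x"
  note D = FQ.quotient_module_facts[OF N]
  have ker: "?q (\<iota> f) = 0[?D]" if "f @: ?FZ" "p f = 0[X]" for f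
    using D(4)[OF lin_closed[OF \<iota> that(1)]] that by blast
  obtain j where j: "lin int_ring X ?D j" and jp: "\<And>f. f @: ?FZ ==> j (p f) = ?q (\<iota> f)"
    by (rule lin_surj_factor[OF FZ X D(1) p(1) psurj lin_compose[OF \<iota> D(2)] ker]) (assumption, assumption, rule that)
  have "inj_on j (carrier X)"
  proof (rule lin_inj_onI[OF right_module_abelian_group[OF X] right_module_abelian_group[OF D(1)] j(1)])
    fix x assume x: "x @: X" and jx: "j x = 0[?D]"
    from x have "x \<in> p ` carrier ?FZ" unfolding psurj .
    then obtain f where f: "x = p f" "f @: ?FZ" by (rule imageE)
    then have "?q (\<iota> f) = 0[?D]" using jx jp[OF f(2)] f(1) by simp
    then have "\<iota> f \<in> ?N" using D(4)[OF lin_closed[OF \<iota> f(2)]] by blast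
    then obtain f' where f': "f' @: ?FZ" "p f' = 0[X]" "\<iota> f = \<iota> f'" by blast
    then show "x = 0[X]" using \<iota>inj[OF f(2) f'(1)] f(1) by simp
  qed
  moreover have "divisible ?D"
    unfolding divisible_def
  proof (intro allI impI ballI)
    fix n :: int and d assume n: "n ~= 0" and d: "d @: ?D"
    from d have "d \<in> ?q ` carrier ?FQ" unfolding D(3) .
    then obtain f where f: "f @: ?FQ" "d = ?q f" by (elim imageE)
    define e where "e = (\<lambda>m\<in>carrier X. f m / of_int n)"
    have e: "e @: ?FQ"
    proof (rule dsum_carrierI[OF rI Q])
      have "{m \<in> carrier X. e m ~= 0[rat_module]} = {m \<in> carrier X. f m ~= 0[rat_module]}" using n by (auto simp: e_def)
      then show "finite {m \<in> carrier X. e m ~= 0[rat_module]}" using dsum_carrierD(2)[OF rI Q f(1)] by simp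
    qed (simp_all add: e_def)
    have "n .[?FQ] e = f"
    proof (rule extensionalityI[OF _ dsum_carrierD(3)[OF rI Q f(1)]])
      show "n .[?FQ] e \<in> extensional (carrier X)" by (simp add: dsum_def)
      show "(n .[?FQ] e) m = f m" if "m @: X" for m using that n by (simp add: dsum_def e_def)
    qed
    then have "n .[?D] ?q e = d" using lin_smult[OF D(2) _ e, of n] f(2) by simp
    then show "\<exists>e \<in> carrier ?D. n .[?D] e = d" using lin_closed[OF D(2) e] by blast
  qed
  ultimately show ?thesis using that D(1) j(1) D(3)[symmetric] by blast
qed

section \<open>Coinduced modules\<close>

definition zring :: "('s, 'k) ring_scheme => (int, 's) module" where
  "zring S = zmod (self_module S)"

text \<open>Additive maps from \<open>S\<close> to \<open>D\<close> with
  \<open>(f s)(a) = f(s a)\<close>: the coinduced module, right adjoint to forgetting the action of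
  \<open>S\<close>. Linearity over \<open>int_ring\<close> encodes additivity.\<close>

definition hom_module :: "('s, 'k) ring_scheme => (int, 'd, 'x) module_scheme => ('s, 's => 'd) module" where
  "hom_module S D = \<lparr>carrier = lin_maps int_ring (zring S) D,
     monoid.mult = undefined, monoid.one = undefined, ring.zero = (\<lambda>a\<in>carrier S. 0[D]),
     ring.add = (%f g. \<lambda>a\<in>carrier S. f a +[D] g a), smult = (%s f. \<lambda>a\<in>carrier S. f (s *[S] a))\<rparr>"

lemma hom_module_simps [simp]:
  "carrier (hom_module S D) = lin_maps int_ring (zring S) D" "0[hom_module S D] = (\<lambda>a\<in>carrier S. 0[D])"
  "f +[hom_module S D] g = (\<lambda>a\<in>carrier S. f a +[D] g a)" "s .[hom_module S D] f = (\<lambda>a\<in>carrier S. f (s *[S] a))"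
  by (simp_all add: hom_module_def)

lemma abelian_group_self_module: "ring S ==> abelian_group (self_module S)"
  by (rule abelian_group_cong[OF ring.is_abelian_group]) simp_all

lemma carrier_zring [simp]: "carrier (zring S) = carrier S" "ring.add (zring S) = ring.add S"
  by (simp_all add: zring_def)

lemma right_module_zring: "ring S ==> right_module int_ring (zring S)"
  unfolding zring_def by (intro right_module_zmod abelian_group_self_module)

lemma lin_from_zring:
  assumes S: "ring S" and M: "abelian_group M" and f: "\<And>a. a @: S ==> f a @: M"
    "\<And>a b. a @: S ==> b @: S ==> f (a +[S] b) = f a +[M] f b"
  shows "lin int_ring (zring S) (zmod M) f"
  unfolding zring_def by (rule lin_zmodI[OF abelian_group_self_module[OF S] M]) (use f in simp_all)

lemma right_module_hom_module:
  assumes S: "ring S" and D: "right_module int_ring D"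
  shows "right_module S (hom_module S D)"
proof -
  interpret S: ring S by (rule S)
  interpret D: right_module int_ring D by (rule D)
  have mD: "module int_ring D" by (rule module_of_right_module[OF cring_int_ring D])
  note Z = right_module_zring[OF S]
  have E: "f @: hom_module S D \<longleftrightarrow> lin int_ring (zring S) D f \<and> f \<in> extensional (carrier S)" for f
    by (simp add: lin_maps_iff)
  have c: "f a @: D" if "f @: hom_module S D" "a @: S" for f a
    using that lin_closed[of int_ring "zring S" D f a] by (simp add: lin_maps_iff)
  have r: "restrict f (carrier S) @: hom_module S D" if "lin int_ring (zring S) D f" for f
    using lin_restrict[OF Z that] by simp
  have ext: "f = g" if "f @: hom_module S D" "g @: hom_module S D" "\<And>a. a @: S ==> f a = g a" for f g
    using that(1,2) extensionalityI[of f "carrier S" g] that(3) by (simp add: lin_maps_iff)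
  have add: "f +[hom_module S D] g @: hom_module S D"
    if "f @: hom_module S D" "g @: hom_module S D" for f g
    unfolding hom_module_simps(3) by (rule r[OF lin_plus[OF mD]]) (use that in \<open>simp_all add: lin_maps_iff\<close>)
  have zero: "0[hom_module S D] @: hom_module S D"
    unfolding hom_module_simps(2) by (rule r[OF lin_zero_map[OF mD]])
  have lmult: "lin int_ring (zring S) (zring S) (%a. s *[S] a)" if "s @: S" for s
  proof -
    have "lin int_ring (zring S) (zmod (self_module S)) (%a. s *[S] a)"
      using that by (intro lin_from_zring[OF S abelian_group_self_module[OF S]]) (simp_all add: S.r_distr)
    then show ?thesis unfolding zring_def .
  qed
  have act: "s .[hom_module S D] f @: hom_module S D"
    if "s @: S" "f @: hom_module S D" for s f
    unfolding hom_module_simps(4) by (rule r[OF lin_compose[OF lmult[OF that(1)]]]) (use that in \<open>simp add: lin_maps_iff\<close>)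
  show ?thesis
  proof (intro right_module.intro right_module_axioms.intro S abelian_groupI)
    fix f g h assume f: "f @: hom_module S D" and g: "g @: hom_module S D"
    show "f +[hom_module S D] g @: hom_module S D" by (rule add[OF f g])
    show "f +[hom_module S D] g = g +[hom_module S D] f"
      using c[OF f] c[OF g] by (auto simp: fun_eq_iff restrict_def D.M.a_comm)
    show "(f +[hom_module S D] g) +[hom_module S D] h = f +[hom_module S D] (g +[hom_module S D] h)"
      if h: "h @: hom_module S D"
      using c[OF f] c[OF g] c[OF h] by (auto simp: fun_eq_iff restrict_def D.M.a_assoc)
  next
    fix f assume f: "f @: hom_module S D"
    show "0[hom_module S D] +[hom_module S D] f = f"
      by (rule ext[OF add[OF zero f] f]) (use c[OF f] in simp)
    let ?g = "restrict (%a. (- 1 :: int) .[D] f a) (carrier S)"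
    have g: "?g @: hom_module S D" by (rule r[OF lin_scale[OF mD]]) (use f in \<open>simp_all add: lin_maps_iff\<close>)
    have "?g +[hom_module S D] f = 0[hom_module S D]"
    proof (rule ext[OF add[OF g f] zero])
      fix a assume a: "a @: S"
      have "(- 1 + 1) .[D] f a = 0[D]" using D.ract_zero_left[OF c[OF f a]] by simp
      then show "(?g +[hom_module S D] f) a = 0[hom_module S D] a"
        using D.ract_l_distr[of "- 1" 1 "f a"] D.ract_one[OF c[OF f a]] c[OF f a] a by simp
    qed
    then show "\<exists>g \<in> carrier (hom_module S D). g +[hom_module S D] f = 0[hom_module S D]" using g by blast
  next
    show "0[hom_module S D] @: hom_module S D" by (rule zero)
  next
    fix s f assume s: "s @: S" and f: "f @: hom_module S D"
    show "s .[hom_module S D] f @: hom_module S D" by (rule act[OF s f])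
    show "(s +[S] t) .[hom_module S D] f = s .[hom_module S D] f +[hom_module S D] t .[hom_module S D] f"
      if t: "t @: S" for t
      using s t f lin_add[of int_ring "zring S" D f] by (auto simp: fun_eq_iff restrict_def S.l_distr lin_maps_iff)
    show "(s *[S] t) .[hom_module S D] f = t .[hom_module S D] (s .[hom_module S D] f)"
      if t: "t @: S" for t
      using s t by (auto simp: fun_eq_iff restrict_def S.m_assoc)
    show "s .[hom_module S D] (f +[hom_module S D] g) = s .[hom_module S D] f +[hom_module S D] s .[hom_module S D] g" for g
      using s by (auto simp: fun_eq_iff restrict_def)
  next
    fix f assume f: "f @: hom_module S D"
    show "1[S] .[hom_module S D] f = f" by (rule ext[OF act[OF S.one_closed f] f]) simp
  qed
qed

text \<open>An \<open>S\<close>-linear map into \<open>hom_module S D\<close> is determined by its value at \<open>1\<close>, an additive map into \<open>D\<close>.\<close>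

lemma lin_to_hom_module:
  assumes S: "ring S" and D: "right_module int_ring D" and M: "right_module S M" and v: "lin int_ring (zmod M) D v"
  shows "lin S M (hom_module S D) (%x. \<lambda>a\<in>carrier S. v (a .[M] x))"
proof (rule linI)
  interpret S: ring S by (rule S)
  interpret M: right_module S M by (rule M)
  fix x assume x: "x @: M"
  have "lin int_ring (zring S) (zmod M) (%a. a .[M] x)"
    by (rule lin_from_zring[OF S right_module_abelian_group[OF M]]) (use x M.ract_closed M.ract_l_distr in auto)
  from lin_restrict[OF right_module_zring[OF S] lin_compose[OF this v]]
  show "(\<lambda>a\<in>carrier S. v (a .[M] x)) @: hom_module S D" by simp
  show "(\<lambda>a\<in>carrier S. v (a .[M] (x +[M] y))) = (\<lambda>a\<in>carrier S. v (a .[M] x)) +[hom_module S D] (\<lambda>a\<in>carrier S. v (a .[M] y))"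
    if y: "y @: M" for y
    using x y lin_add[OF v] by (auto simp: fun_eq_iff restrict_def M.ract_r_distr M.ract_closed)
  show "(\<lambda>a\<in>carrier S. v (a .[M] (s .[M] x))) = s .[hom_module S D] (\<lambda>a\<in>carrier S. v (a .[M] x))"
    if s: "s @: S" for s
    using x s by (auto simp: fun_eq_iff restrict_def M.ract_assoc)
qed

text \<open>By the adjunction, extending \<open>u\<close> along \<open>i\<close> amounts to
  extending the additive map \<open>x \<mapsto> u x 1\<close> into the divisible group
  \<open>D\<close>.\<close>

lemma hom_module_injective:
  assumes S: "ring S" and D: "right_module int_ring D" "divisible D" and X: "right_module S X" and Y: "right_module S Y"
    and i: "lin S X Y i" "inj_on i (carrier X)" and u: "lin S X (hom_module S D) u"
  obtains v where "lin S Y (hom_module S D) v" "\<And>x. x @: X ==> v (i x) = u x"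
proof -
  interpret S: ring S by (rule S)
  interpret X: right_module S X by (rule X)
  note ag = right_module_abelian_group[OF X] right_module_abelian_group[OF Y]
  have uD: "u x \<in> lin_maps int_ring (zring S) D" if "x @: X" for x using lin_closed[OF u that] by simp
  have l: "lin int_ring (zmod X) D (%x. u x 1[S])"
  proof (rule lin_compose[OF lin_zmod[OF ag(1) right_module_abelian_group[OF right_module_hom_module[OF S D(1)]] u]])
    interpret E: right_module S "hom_module S D" by (rule right_module_hom_module[OF S D(1)])
    interpret D: right_module int_ring D by (rule D(1))
    have D': "abelian_group D" by (rule right_module_abelian_group[OF D(1)])
    show "lin int_ring (zmod (hom_module S D)) D (%f. f 1[S])"
    proof (rule linI)
      fix f assume f: "f @: (zmod (hom_module S D))"
      then show "f 1[S] @: D" using lin_closed[of int_ring "zring S" D f] by (simp add: lin_maps_iff)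
      show "(f +[zmod (hom_module S D)] g) 1[S] = f 1[S] +[D] g 1[S]" for g by simp
      have "(%f. f 1[S]) \<in> hom (add_monoid (hom_module S D)) (add_monoid D)"
        unfolding hom_def using lin_closed[of int_ring "zring S" D] by (auto simp: lin_maps_iff)
      then have "(f [^]\<^bsub>add_monoid (hom_module S D)\<^esub> n) 1[S] = f 1[S] [^]\<^bsub>add_monoid D\<^esub> n" for n :: int
        using hom_int_pow[of "%f. f 1[S]" "add_monoid (hom_module S D)" "add_monoid D" f n] f E.M.a_group D.M.a_group by simp
      \<comment> \<open>\<open>D\<close> carries its own integer action. It agrees with iterated
        addition, since \<open>n \<mapsto> n d\<close> is a homomorphism from the integers, which
        are generated by \<open>1\<close>.\<close>
      moreover have "d [^]\<^bsub>add_monoid D\<^esub> n = n .[D] d" if d: "d @: D" for d and n :: int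
      proof -
        have "(%n. n .[D] d) \<in> hom (add_monoid int_ring) (add_monoid D)"
          unfolding hom_def using D.ract_closed D.ract_l_distr d by (simp add: int_ring_def)
        then have "(1 [^]\<^bsub>add_monoid int_ring\<^esub> n) .[D] d = (1 .[D] d) [^]\<^bsub>add_monoid D\<^esub> n"
          using hom_int_pow[of "%n. n .[D] d" "add_monoid int_ring" "add_monoid D" 1 n] D.M.a_group D.S.a_group by simp
        moreover have "(1 :: int) [^]\<^bsub>add_monoid int_ring\<^esub> n = n"
        proof -
          have nat: "(1 :: int) [^]\<^bsub>add_monoid int_ring\<^esub> k = int k" for k :: nat by (induction k) simp_all
          have inv: "inv\<^bsub>add_monoid int_ring\<^esub> k = - k" for k :: int
            by (rule group.inv_equality[OF D.S.a_group]) simp_all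
          show ?thesis unfolding int_pow_def2 nat inv by simp
        qed
        ultimately show ?thesis using D.ract_one[OF d] by simp
      qed
      moreover have "f 1[S] @: D" using f lin_closed[of int_ring "zring S" D f] by (simp add: lin_maps_iff)
      ultimately show "(n .[zmod (hom_module S D)] f) 1[S] = n .[D] f 1[S]" for n by simp
    qed
  qed
  have i': "inj_on i (carrier (zmod X))" using i(2) by simp
  obtain w where w: "lin int_ring (zmod Y) D w" "\<And>x. x @: zmod X ==> w (i x) = u x 1[S]"
    by (rule divisible_injective[OF D right_module_zmod[OF ag(1)] right_module_zmod[OF ag(2)] lin_zmod[OF ag i(1)] i' l]) (rule that)
  show ?thesis
  proof (rule that[OF lin_to_hom_module[OF S D(1) Y w(1)]])
    fix x assume x: "x @: X"
    show "(\<lambda>a\<in>carrier S. w (a .[Y] i x)) = u x"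
    proof (rule extensionalityI)
      show "u x \<in> extensional (carrier S)" using uD[OF x] by (simp add: lin_maps_iff)
      fix a assume a: "a @: S"
      have "w (a .[Y] i x) = w (i (a .[X] x))" using lin_smult[OF i(1) a x] by simp
      also have "\<dots> = u (a .[X] x) 1[S]" using w(2) X.ract_closed[OF a x] by simp
      also have "\<dots> = u x a" using lin_smult[OF u a x] a by simp
      finally show "(\<lambda>a\<in>carrier S. w (a .[Y] i x)) a = u x a" using a by simp
    qed simp
  qed
qed

context entwining_universe
begin

section \<open>Injective entwined modules\<close>

lemma inj_imp_mono:
  assumes X: "X \<in> Obj \<E>" and Y: "Y \<in> Obj \<E>" and f: "f \<in> \<H> X Y" "inj_on f (carrier X)"
  shows "is_mono \<E> X Y f"
  unfolding is_mono_def
proof (intro conjI ballI impI)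
  show "f \<in> Hom \<E> X Y" using f(1) by simp
  fix W g h assume g0: "g \<in> Hom \<E> W X" and h0: "h \<in> Hom \<E> W X" and eq: "Comp \<E> W X Y f g = Comp \<E> W X Y f h"
  have g: "g \<in> \<H> W X" and h: "h \<in> \<H> W X" using g0 h0 by simp_all
  show "g = h"
  proof (rule ent_maps_eqI[OF g h])
    fix x assume x: "x @: W"
    then have "f (g x) = f (h x)" using fun_cong[OF eq, of x] by (simp add: compose_eq)
    then show "g x = h x" by (rule inj_onD[OF f(2) _ ent_mapsD(4)[OF g x] ent_mapsD(4)[OF h x]])
  qed
qed

text \<open>Forgetting coactions turns monomorphisms into injections, by flatness, so its right
  adjoint preserves injectives: the composite of the given map with the counit is extended as an
  \<open>A\<close>-linear map, and \<open>hat\<close> of the extension restricts correctly by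
  \<open>hat_cE\<close>.\<close>

lemma injective_cofree:
  fixes D :: "(int, 'd, 'x) module_scheme"
  assumes flat: "flat_module U R C" and D: "right_module int_ring D" "divisible D"
    and F: "F \<in> Obj \<E>" and h: "h \<in> \<H> (cofree (hom_module A D)) F"
    and k: "k \<in> \<H> F (cofree (hom_module A D))" and hk: "\<And>y. y @: F ==> h (k y) = y"
  shows "is_injective_obj \<E> F"
  unfolding is_injective_obj_def
proof (intro conjI ballI allI impI F)
  let ?E = "hom_module A D"
  note E = right_module_hom_module[OF rA D(1)]
  have Fe: "entwined F" and Ce: "entwined (cofree ?E)" using F entwined_cofree[OF E] by auto
  fix X Y i f assume X: "X \<in> Obj \<E>" and Y: "Y \<in> Obj \<E>" and mono: "is_mono \<E> X Y i" and f0: "f \<in> Hom \<E> X F"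
  have Xe: "entwined X" and Ye: "entwined Y" using X Y by simp_all
  have f: "f \<in> \<H> X F" using f0 by simp
  note i = mono_imp_inj[OF flat X Y mono]
  note kf = ent_compose[OF Xe Fe Ce f k]
  let ?u = "%x. cE R C \<epsilon> (\<B> ?E) (compose (carrier X) k f x)"
  have u: "lin A X ?E ?u" by (rule lin_compose[OF ent_mapsD(1)[OF kf] cE_cofree_lin[OF E]])
  obtain v where v: "lin A Y ?E v" "\<And>x. x @: X ==> v (i x) = ?u x"
    by (rule hom_module_injective[OF rA D entwinedD(1)[OF Xe] entwinedD(1)[OF Ye] ent_mapsD(1)[OF i(1)] i(2) u]) (rule that)
  let ?v = "restrict (hat ?E Y v) (carrier Y)"
  have v': "?v \<in> \<H> Y (cofree ?E)" by (rule hat_map[OF E Ye v(1)])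
  note g = ent_compose[OF Ye Ce Fe v' h] and vi = ent_compose[OF Xe Ye Ce i(1) v']
  have same: "hat ?E X (%x. cE R C \<epsilon> (\<B> ?E) (w x)) x = w x" if "w \<in> \<H> X (cofree ?E)" "x @: X" for w x
    by (rule hat_cE[OF E Xe ent_mapsD(1)[OF that(1)] that(2) ent_mapsD(3)[OF that]])
  have eq: "h (?v (i x)) = f x" if x: "x @: X" for x
  proof -
    have "cE R C \<epsilon> (\<B> ?E) (compose (carrier X) ?v i y) = ?u y" if y: "y @: X" for y
      using cE_hat[OF E Ye v(1) ent_mapsD(4)[OF i(1) y]] v(2)[OF y] ent_mapsD(4)[OF i(1) y] y by (simp add: compose_eq)
    then have "hat ?E X (%x. cE R C \<epsilon> (\<B> ?E) (compose (carrier X) ?v i x)) x = hat ?E X ?u x"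
      unfolding hat_def by (intro tmap_cong) simp_all
    then have "?v (i x) = k (f x)" using same[OF vi x] same[OF kf x] x by (simp add: compose_eq)
    then show ?thesis using hk[OF ent_mapsD(4)[OF f x]] by simp
  qed
  have "Comp \<E> X Y F (compose (carrier Y) h ?v) i = f"
    unfolding comp_eq_iff[OF f] using eq ent_mapsD(4)[OF i(1)] by (simp add: compose_eq)
  then show "\<exists>g \<in> Hom \<E> Y F. Comp \<E> X Y F g i = f" using g unfolding cat_simps(2) by blast
qed

text \<open>The underlying \<open>A\<close>-module embeds into \<open>Hom(A, D)\<close> by sending
  \<open>x\<close> to \<open>a \<mapsto> j (x a)\<close>, from which \<open>a = 1\<close> recovers
  \<open>j x\<close>; \<open>hat\<close> of this embedding is still injective because the counit
  recovers it.\<close>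

theorem enough_injectives:
  assumes flat: "flat_module U R C"
  shows "has_enough_injectives \<E>"
  unfolding has_enough_injectives_def
proof
  fix X assume X: "X \<in> Obj \<E>"
  then have Xe: "entwined X" and XU: "carrier X \<in> U" by simp_all
  note rX = entwinedD(1)[OF Xe]
  interpret X: right_module A X by (rule rX)
  have Z: "right_module int_ring (zmod X)" by (rule right_module_zmod[OF right_module_abelian_group[OF rX]])
  obtain D :: "(int, ('u => rat) set) module" and j r where D: "right_module int_ring D" "divisible D"
    and j: "lin int_ring (zmod X) D j" "inj_on j (carrier (zmod X))"
    and cD: "carrier D = r ` carrier (dsum (carrier (zmod X)) (%_. rat_module))"
    by (rule divisible_hull[OF Z]) (rule that)
  let ?E = "hom_module A D"
  note E = right_module_hom_module[OF rA D(1)]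
  have "(UNIV :: rat set) \<lesssim> (UNIV :: nat set)" unfolding lepoll_def by (intro exI[of _ to_nat]) simp
  then have "small (UNIV :: rat set)" by (rule small_base[OF lepoll_trans[OF _ base_lepoll(3)]])
  then have "small (carrier D)"
    unfolding cD using small_U[OF XU] by (intro small_image small_dsum) simp_all
  \<comment> \<open>\<open>A\<close> embeds in the base of the universe, so closure under powers of
    the base bounds the functions on \<open>A\<close>.\<close>
  then have "small (carrier A \<rightarrow>\<^sub>E carrier D)" by (rule small_funcset[OF base_lepoll(1)])
  then have sE: "small (carrier ?E)" by (rule small_subset) (auto simp: lin_maps_def)
  obtain F h k where F: "F \<in> Obj \<E>" and h: "h \<in> \<H> (cofree ?E) F" and k: "k \<in> \<H> F (cofree ?E)"
    and kh: "\<And>x. x @: cofree ?E ==> k (h x) = x" and hk: "\<And>y. y @: F ==> h (k y) = y"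
    by (rule cofree_obj[OF E sE]) (rule that)
  have Fe: "entwined F" and Ce: "entwined (cofree ?E)" using F entwined_cofree[OF E] by auto
  let ?u = "%x. \<lambda>a\<in>carrier A. j (a .[X] x)"
  have u: "lin A X ?E ?u" by (rule lin_to_hom_module[OF rA D(1) rX j(1)])
  let ?v = "restrict (hat ?E X ?u) (carrier X)"
  have v: "?v \<in> \<H> X (cofree ?E)" by (rule hat_map[OF E Xe u])
  have f: "compose (carrier X) h ?v \<in> \<H> X F" by (rule ent_compose[OF Xe Ce Fe v h])
  have "inj_on (compose (carrier X) h ?v) (carrier X)"
  proof (rule inj_onI)
    fix x y assume xy: "x @: X" "y @: X" "compose (carrier X) h ?v x = compose (carrier X) h ?v y"
    then have "h (?v x) = h (?v y)" by (simp only: compose_eq)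
    then have "?v x = ?v y" using kh[OF ent_mapsD(4)[OF v xy(1)]] kh[OF ent_mapsD(4)[OF v xy(2)]] by metis
    then have "hat ?E X ?u x = hat ?E X ?u y" using xy(1,2) by simp
    then have "?u x = ?u y" using cE_hat[OF E Xe u xy(1)] cE_hat[OF E Xe u xy(2)] by metis
    from fun_cong[OF this, of "1[A]"] have "j x = j y" using xy(1,2) by (simp add: X.ract_one)
    then show "x = y" using inj_onD[OF j(2)] xy(1,2) by simp
  qed
  then have "is_mono \<E> X F (compose (carrier X) h ?v)" by (rule inj_imp_mono[OF X F f])
  then show "\<exists>E i. is_injective_obj \<E> E \<and> is_mono \<E> X E i" using injective_cofree[OF flat D F h k hk] by blast
qed

end

section \<open>The ring \<open>#\<close> and its action on entwined modules\<close>

context entwining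
begin

abbreviation "\<S> \<equiv> smash_op R A C \<Delta> \<epsilon> \<psi>"

lemma smash_simps [simp]:
  "carrier \<S> = \<L>" "1[\<S>] = (\<lambda>c\<in>carrier C. \<epsilon> c .[A] 1[A])" "0[\<S>] = (\<lambda>c\<in>carrier C. 0[A])"
  "f +[\<S>] g = (\<lambda>c\<in>carrier C. f c +[A] g c)"
  by (simp_all add: smash_op_def)

definition ev :: "('a, 'm, 'z) module_scheme => ('c => 'a) => ('m, 'c) tens => 'm" where
  "ev M f t = tsum R (\<B> M) C (\<B> M) t (%x c. f c .[M] x)"

text \<open>The product of \<open>#\<close> before comultiplication: \<open>(f g)(c)\<close> is the
  Sweedler sum of \<open>twist f g\<close> over \<open>\<Delta> c\<close>. Isolating it allows a
  pairing with arbitrary elements of \<open>C \<otimes> C\<close>.\<close>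

definition twist :: "('c => 'a) => ('c => 'a) => 'c => 'c => 'a" where
  "twist f g c1 c2 = tsum R A C A (\<psi> (pure_tensor R C A c1 (f c2))) (%b d. b *[A] g d)"

lemma smash_mult: "f *[\<S>] g = (\<lambda>c\<in>carrier C. tsum R C C A (\<Delta> c) (twist f g))"
  by (simp add: smash_op_def twist_def[abs_def])

lemma bilin_mult: "lin R C A g ==> bilin R A C A (%b d. b *[A] g d)"
  by (intro bilinI lin_mult1[OF lin_id] lin_mult2) (simp_all add: lin_closed)

lemma bilin_twist:
  assumes f: "lin R C A f" and g: "lin R C A g"
  shows "bilin R C C A (twist f g)"
proof (rule bilinI)
  fix y assume y: "y @: C"
  show "lin R C A (%x. twist f g x y)" unfolding twist_def
    by (rule lin_tsum1[OF mA mC mA lin_psi'[OF lin_pure1[OF mC mA lin_id lin_closed[OF f y]]] bilin_mult[OF g]])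
  show "lin R C A (%x. twist f g y x)" unfolding twist_def
    by (rule lin_tsum1[OF mA mC mA lin_psi'[OF lin_pure2[OF mC mA f y]] bilin_mult[OF g]])
qed

lemma lin_maps_restrict: "lin R C A f ==> restrict f (carrier C) \<in> \<L>"
  by (rule lin_restrict[OF right_module_of_module[OF mC]])

lemma mCC [simp]: "module R (tensor R C C)"
  by (rule module_tensor[OF mC mC])

lemma smash_mult_closed: "f \<in> \<L> ==> g \<in> \<L> ==> f *[\<S>] g \<in> \<L>"
  unfolding smash_mult
  by (rule lin_maps_restrict[OF lin_tsum1[OF mC mC mA lin_Delta bilin_twist]]) (simp_all add: lin_mapsD)

lemma lin_counit_scaled: "a @: A ==> lin R C A (%c. \<epsilon> c .[A] a)"
  by (rule lin_scal1[OF mA lin_eps])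

lemma smash_one_closed: "1[\<S>] \<in> \<L>"
  unfolding smash_simps by (rule lin_maps_restrict[OF lin_counit_scaled[OF A.one_closed]])

lemma smash_zero_closed: "0[\<S>] \<in> \<L>"
  unfolding smash_simps by (rule lin_maps_restrict[OF lin_zero_map[OF mA]])

lemma smash_add_closed: "f \<in> \<L> ==> g \<in> \<L> ==> f +[\<S>] g \<in> \<L>"
  unfolding smash_simps by (rule lin_maps_restrict[OF lin_plus[OF mA]]) (simp_all add: lin_mapsD)

lemma unit_map_closed: "a @: A ==> \<U> a \<in> \<L>"
  unfolding smash_unit_map_def by (rule lin_maps_restrict[OF lin_counit_scaled])

lemma ev_agree:
  assumes M: "right_module A M" and ag: "agree A M M'" and f: "\<And>c. c @: C ==> f c @: A"
  shows "ev M' f t = ev M f t"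
proof -
  have agB: "agree R (\<B> M) (\<B> M')" using ag by (auto simp: agree_def)
  have "ev M' f t = tsum R (\<B> M) C (\<B> M) t (%x c. f c .[M'] x)"
    unfolding ev_def by (rule agree_tsum[OF agB mB[OF M] mC agB])
  also have "\<dots> = ev M f t" unfolding ev_def using ag f by (intro tsum_cong) (auto simp: agree_def)
  finally show ?thesis .
qed

lemma agree_base: "agree A M M' ==> agree R (\<B> M) (\<B> M')"
  by (auto simp: agree_def)

lemma ev_cong:
  assumes "\<And>c. c @: C ==> f c = g c" shows "ev M f t = ev M g t"
  unfolding ev_def using assms by (intro tsum_cong) simp_all

text \<open>Pairing the last two factors of \<open>M \<otimes> C \<otimes> C\<close> with \<open>f\<close> and \<open>g\<close>. The two sides of coassociativity are paired to
  \<open>m (f g)\<close> and to \<open>(m f) g\<close>.\<close>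

definition ev2 :: "('a, 'm, 'z) module_scheme => ('c => 'a) => ('c => 'a) => ('m, ('c, 'c) tens) tens => 'm" where
  "ev2 M f g w = tsum R (\<B> M) (tensor R C C) (\<B> M) w (%x u. tsum R C C A u (twist f g) .[M] x)"

context
  fixes M :: "('a, 'm, 'z) module_scheme"
  assumes M: "right_module A M"
begin

private lemma mTM: "module R (\<T> M)"
  by (rule module_tensor[OF mB[OF M] mC])

lemma bilin_ev: "lin R C A f ==> bilin R (\<B> M) C (\<B> M) (%x c. f c .[M] x)"
  by (intro bilinI lin_act1[OF M lin_id] lin_act2[OF M]) (simp_all add: lin_closed)

lemma ev_lin: "lin R C A f ==> lin R (\<T> M) (\<B> M) (ev M f)"
  unfolding ev_def by (rule tsum_lin[OF mB[OF M] mC mB[OF M] bilin_ev])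

lemma ev_pure: "lin R C A f ==> x @: M ==> c @: C ==>
    ev M f (pt M x c) = f c .[M] x"
  unfolding ev_def by (rule tsum_pure[OF mB[OF M] mC mB[OF M] bilin_ev]) simp_all

lemma ev_add:
  assumes f: "lin R C A f" and g: "lin R C A g" and t: "t @: \<T> M"
  shows "ev M (%c. f c +[A] g c) t = ev M f t +[M] ev M g t"
proof -
  interpret M: right_module A M by (rule M)
  have fg: "lin R C A (%c. f c +[A] g c)" by (rule lin_plus[OF mA f g])
  have l: "lin R (\<T> M) (\<B> M) (%t. ev M f t +[\<B> M] ev M g t)"
    by (rule lin_plus[OF mB[OF M] ev_lin[OF f] ev_lin[OF g]])
  have "ev M (%c. f c +[A] g c) t = ev M f t +[\<B> M] ev M g t"
  proof (rule lin_ext[OF mB[OF M] mC ev_lin[OF fg] l _ t])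
    fix x c assume "x @: \<B> M" and c: "c @: C"
    then have x: "x @: M" by simp
    show "ev M (%c. f c +[A] g c) (pt M x c) =
        ev M f (pt M x c) +[\<B> M] ev M g (pt M x c)"
      using M.ract_l_distr[OF lin_closed[OF f c] lin_closed[OF g c] x]
      by (simp add: ev_pure[OF fg x c] ev_pure[OF f x c] ev_pure[OF g x c])
  qed
  then show ?thesis by simp
qed

lemma ev_counit:
  assumes a: "a @: A" and t: "t @: \<T> M"
  shows "ev M (%c. \<epsilon> c .[A] a) t = a .[M] cE R C \<epsilon> (\<B> M) t"
proof (rule lin_ext[OF mB[OF M] mC ev_lin[OF lin_counit_scaled[OF a]] lin_act1[OF M cE_lin[OF mB[OF M]] a] _ t])
  interpret M: right_module A M by (rule M)
  fix x c assume "x @: \<B> M" and c: "c @: C"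
  then have x: "x @: M" by simp
  have "(\<epsilon> c .[A] a) .[M] x = ((\<epsilon> c .[A] 1[A]) *[A] a) .[M] x" using scaled_central(1)[of "\<epsilon> c" a] a c by simp
  also have "\<dots> = a .[M] ((\<epsilon> c .[A] 1[A]) .[M] x)" using M.ract_assoc a c x by simp
  finally show "ev M (%c. \<epsilon> c .[A] a) (pt M x c) =
      a .[M] cE R C \<epsilon> (\<B> M) (pt M x c)"
    using cE_pure[OF mB[OF M], of x c] x c by (simp add: ev_pure[OF lin_counit_scaled[OF a] x c])
qed

lemma ev_nat:
  assumes N: "right_module A N" and p: "lin A M N p" and f: "lin R C A f" and t: "t @: \<T> M"
  shows "ev N f (tm M N p t) = p (ev M f t)"
proof -
  have b: "bilin R (\<B> N) C (\<B> N) (%x c. f c .[N] x)"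
    using lin_closed[OF f] by (intro bilinI lin_act1[OF N lin_id] lin_act2[OF N f]) simp_all
  have "ev N f (tm M N p t) = tsum R (\<B> M) C (\<B> N) t (%x c. f c .[N] p x)"
    unfolding ev_def by (rule tsum_tmap[OF mB[OF M] mB[OF N] mC mB[OF N] lin_base[OF p] b t])
  also have "\<dots> = tsum R (\<B> M) C (\<B> N) t (%x c. p (f c .[M] x))"
    using lin_smult[OF p lin_closed[OF f]] by (intro tsum_cong) simp_all
  also have "\<dots> = p (ev M f t)"
    unfolding ev_def by (rule tsum_push[symmetric, OF mB[OF M] mC mB[OF M] mB[OF N] lin_base[OF p] bilin_ev[OF f] t])
  finally show ?thesis .
qed

text \<open>For \<open>a = f c'\<close> the right side is \<open>x\<close> acted on by
  \<open>twist f g c c'\<close>. So the twist in the product of \<open>#\<close> is the action of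
  \<open>A\<close> on \<open>M \<otimes> C\<close>, followed by pairing with
  \<open>g\<close>.\<close>

lemma twist_act:
  assumes g: "lin R C A g" and a: "a @: A" and c: "c @: C" and x: "x @: M"
  shows "ev M g (cP' M a (pt M x c)) =
    tsum R A C A (\<psi> (pure_tensor R C A c a)) (%b d. b *[A] g d) .[M] x"
proof -
  interpret M: right_module A M by (rule M)
  let ?p = "\<psi> (pure_tensor R C A c a)"
  have p: "?p @: tensor R A C" using pure_closed[OF mC mA c a] by simp
  have "ev M g (cP' M a (pt M x c)) =
      tsum R A C (\<B> M) ?p (%b d. ev M g (pt M (b .[M] x) d))"
    unfolding cP_pure[OF M a x c]
    by (rule tsum_push[OF mA mC mTM mB[OF M] ev_lin[OF g] bilin_act[OF M x] p])
  also have "\<dots> = tsum R A C (\<B> M) ?p (%b d. (b *[A] g d) .[M] x)"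
  proof (rule tsum_cong[OF refl])
    fix b d assume b: "b @: A" and d: "d @: C"
    show "ev M g (pt M (b .[M] x) d) = (b *[A] g d) .[M] x"
      using M.ract_assoc[OF b lin_closed[OF g d] x] by (simp add: ev_pure[OF g M.ract_closed[OF b x] d])
  qed
  also have "\<dots> = tsum R A C A ?p (%b d. b *[A] g d) .[M] x"
    by (rule tsum_push[symmetric, OF mA mC mA mB[OF M] lin_act2[OF M lin_id x] bilin_mult[OF g] p])
  finally show ?thesis .
qed

context
  fixes f g :: "'c => 'a"
  assumes f: "lin R C A f" and g: "lin R C A g"
begin

private lemma lin_tw: "lin R (tensor R C C) A (%u. tsum R C C A u (twist f g))"
  by (rule tsum_lin[OF mC mC mA bilin_twist[OF f g]])

lemma bilin_ev2: "bilin R (\<B> M) (tensor R C C) (\<B> M) (%x u. tsum R C C A u (twist f g) .[M] x)"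
  by (intro bilinI lin_act1[OF M lin_id] lin_act2[OF M lin_tw]) (simp_all add: lin_closed[OF lin_tw])

lemma ev2_lin: "lin R (tensor R (\<B> M) (tensor R C C)) (\<B> M) (ev2 M f g)"
  unfolding ev2_def by (rule tsum_lin[OF mB[OF M] mCC mB[OF M] bilin_ev2])

lemma ev2_pure: "x @: M ==> u @: tensor R C C ==>
    ev2 M f g (pure_tensor R (\<B> M) (tensor R C C) x u) = tsum R C C A u (twist f g) .[M] x"
  unfolding ev2_def by (rule tsum_pure[OF mB[OF M] mCC mB[OF M] bilin_ev2]) simp_all

lemma ev2_cL:
  assumes t: "t @: \<T> M"
  shows "ev2 M f g (cL R C \<Delta> (\<B> M) t) = ev M (%c. tsum R C C A (\<Delta> c) (twist f g)) t"
proof -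
  have l: "lin R C A (%c. tsum R C C A (\<Delta> c) (twist f g))"
    by (rule lin_tsum1[OF mC mC mA lin_Delta bilin_twist[OF f g]])
  show ?thesis
  proof (rule lin_ext[OF mB[OF M] mC lin_compose[OF cL_lin[OF mB[OF M]] ev2_lin] ev_lin[OF l] _ t])
    fix x c assume "x @: \<B> M" and c: "c @: C"
    then have x: "x @: M" by simp
    show "ev2 M f g (cL R C \<Delta> (\<B> M) (pt M x c)) =
        ev M (%c. tsum R C C A (\<Delta> c) (twist f g)) (pt M x c)"
      using cL_pure[OF mB[OF M], of x c] x c by (simp add: ev_pure[OF l x c] ev2_pure)
  qed
qed

text \<open>Stated for any linear \<open>\<rho>\<close> compatible with \<open>A\<close>, so that it
  applies to entwined modules and also to the coaction reconstructed on a rational module, whose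
  coassociativity is deduced from it.\<close>

lemma ev2_cR:
  assumes \<rho>: "lin R (\<B> M) (\<T> M) \<rho>" "\<And>x a. x @: M ==> a @: A ==> \<rho> (a .[M] x) = cP' M a (\<rho> x)"
    and t: "t @: \<T> M"
  shows "ev2 M f g (cR R C (\<B> M) \<rho> t) = ev M g (\<rho> (ev M f t))"
proof (rule lin_ext[OF mB[OF M] mC lin_compose[OF cR_lin[OF mB[OF M] \<rho>(1)] ev2_lin]
      lin_compose[OF lin_compose[OF ev_lin[OF f] \<rho>(1)] ev_lin[OF g]] _ t])
  fix x c assume "x @: \<B> M" and c: "c @: C"
  then have x: "x @: M" by simp
  have rx: "\<rho> x @: \<T> M" using lin_closed[OF \<rho>(1)] x by simp
  note fc = lin_closed[OF f c]
  have "ev2 M f g (cR R C (\<B> M) \<rho> (pt M x c)) = tsum R (\<B> M) C (\<B> M) (\<rho> x)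
      (%x' c'. ev2 M f g (pure_tensor R (\<B> M) (tensor R C C) x' (pure_tensor R C C c' c)))"
    using cR_pure[OF mB[OF M] \<rho>(1), of x c] x c
      tsum_push[OF mB[OF M] mC module_tensor[OF mB[OF M] mCC] mB[OF M] ev2_lin bilin_cR_inner[OF mB[OF M] c] rx] by simp
  also have "\<dots> = tsum R (\<B> M) C (\<B> M) (\<rho> x) (%x' c'. ev M g (cP' M (f c) (pt M x' c')))"
  proof (rule tsum_cong[OF refl])
    fix x' c' assume "x' @: \<B> M" and c': "c' @: C"
    then have x': "x' @: M" by simp
    show "ev2 M f g (pure_tensor R (\<B> M) (tensor R C C) x' (pure_tensor R C C c' c)) =
        ev M g (cP' M (f c) (pt M x' c'))"
      unfolding twist_act[OF g fc c' x'] ev2_pure[OF x' pure_closed[OF mC mC c' c]]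
        tsum_pure[OF mC mC mA bilin_twist[OF f g] c' c] twist_def ..
  qed
  also have "\<dots> = ev M g (cP' M (f c) (tsum R (\<B> M) C (\<T> M) (\<rho> x) (pt M)))"
    by (rule tsum_push[symmetric, OF mB[OF M] mC mTM mB[OF M] lin_compose[OF cP_lin[OF M fc] ev_lin[OF g]]
          bilin_pure[OF mB[OF M] mC] rx])
  also have "\<dots> = ev M g (\<rho> (f c .[M] x))" unfolding tsum_eta[OF mB[OF M] mC rx] \<rho>(2)[OF x fc] ..
  finally show "ev2 M f g (cR R C (\<B> M) \<rho> (pt M x c)) =
      ev M g (\<rho> (ev M f (pt M x c)))" unfolding ev_pure[OF f x c] .
qed

end

end

section \<open>Entwined modules as modules over \<open>#\<close>\<close>

definition act :: "('a, 'm, 'c) coact_module => ('c => 'a) => 'm => 'm" where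
  "act M f m = ev M f (coact M m)"

context
  fixes M :: "('a, 'm, 'c) coact_module"
  assumes M: "entwined M"
begin

private lemmas e = entwinedD[OF M]

lemma act_lin: "lin R C A f ==> lin R (\<B> M) (\<B> M) (act M f)"
  unfolding act_def by (rule lin_compose[OF e(2) ev_lin[OF e(1)]])

lemma act_in: "lin R C A f ==> m @: M ==> act M f m @: M"
  using lin_closed[OF act_lin] by simp

lemma act_mult:
  assumes f: "lin R C A f" and g: "lin R C A g" and m: "m @: M"
  shows "act M (f *[\<S>] g) m = act M g (act M f m)"
proof -
  have "act M (f *[\<S>] g) m = ev M (%c. tsum R C C A (\<Delta> c) (twist f g)) (coact M m)"
    unfolding act_def smash_mult by (rule ev_cong) simp
  also have "\<dots> = ev2 M f g (cL R C \<Delta> (\<B> M) (coact M m))" by (rule ev2_cL[symmetric, OF e(1) f g e(7)[OF m]])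
  also have "\<dots> = act M g (act M f m)"
    unfolding act_def e(4)[OF m] by (rule ev2_cR[OF e(1) f g e(2) e(6) e(7)[OF m]])
  finally show ?thesis .
qed

lemma act_unit: "a @: A ==> m @: M ==> act M (\<U> a) m = a .[M] m"
proof -
  assume a: "a @: A" and m: "m @: M"
  have "act M (\<U> a) m = ev M (%c. \<epsilon> c .[A] a) (coact M m)"
    unfolding act_def smash_unit_map_def by (rule ev_cong) simp
  then show ?thesis unfolding ev_counit[OF e(1) a e(7)[OF m]] e(5)[OF m] .
qed

lemma act_one: "m @: M ==> act M 1[\<S>] m = m"
  using act_unit[OF A.one_closed, of m] right_module.ract_one[OF e(1), of m] by (simp add: smash_unit_map_def)

lemma act_add: "lin R C A f ==> lin R C A g ==> m @: M ==> act M (f +[\<S>] g) m = act M f m +[M] act M g m"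
proof -
  assume f: "lin R C A f" and g: "lin R C A g" and m: "m @: M"
  have "act M (f +[\<S>] g) m = ev M (%c. f c +[A] g c) (coact M m)"
    unfolding act_def smash_simps by (rule ev_cong) simp
  then show ?thesis unfolding act_def ev_add[OF e(1) f g e(7)[OF m]] .
qed

lemma act_nat:
  assumes N: "entwined N" and p: "p \<in> \<H> M N" and f: "lin R C A f" and m: "m @: M"
  shows "act N f (p m) = p (act M f m)"
  unfolding act_def ent_mapsD(3)[OF p m]
  by (rule ev_nat[OF e(1) entwinedD(1)[OF N] ent_mapsD(1)[OF p] f e(7)[OF m]])

end

text \<open>The action on \<open>A \<otimes> C\<close> is faithful, since the counit recovers \<open>f c\<close> from \<open>(1 \<otimes> c) f\<close>.\<close>

lemma act_faithful:
  assumes f: "f \<in> \<L>" and g: "g \<in> \<L>"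
    and eq: "\<And>t. t @: cofree rself ==> act (cofree rself) f t = act (cofree rself) g t"
  shows "f = g"
proof -
  note rs = right_module_rself
  have v: "cE R C \<epsilon> (\<B> rself) (act (cofree rself) h (pt rself 1[A] c)) = h c"
    if h: "lin R C A h" and c: "c @: C" for h c
  proof -
    let ?T = "\<T> rself" let ?t = "pt rself 1[A] c"
    have t: "?t @: ?T" by (rule pure_closed[OF mB[OF rs] mC _ c]) simp
    have co: "coact (cofree rself) ?t = tassoc R (\<B> rself) C C (cL R C \<Delta> (\<B> rself) ?t)" using t by simp
    have r: "coact (cofree rself) ?t @: (\<T> (cofree rself))"
      by (rule entwinedD(7)[OF entwined_cofree[OF rs]]) (use t in simp)
    have "cE R C \<epsilon> (\<B> rself) (act (cofree rself) h ?t) =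
        ev rself h (tm (cofree rself) rself (cE R C \<epsilon> (\<B> rself)) (coact (cofree rself) ?t))"
      unfolding act_def by (rule ev_nat[symmetric, OF right_module_cofree[OF rs] rs cE_cofree_lin[OF rs] h r])
    also have "\<dots> = ev rself h ?t"
      unfolding tmap_agree_left[OF cofree_agree[OF rs] mB[OF rs] mC module_tensor[OF mB[OF rs] mC]] co tmap_cE_coact[OF rs t] ..
    also have "\<dots> = h c" using lin_closed[OF h c] by (simp add: ev_pure[OF rs h _ c])
    finally show ?thesis .
  qed
  show ?thesis
  proof (rule extensionalityI)
    show "f \<in> extensional (carrier C)" "g \<in> extensional (carrier C)" using f g by (simp_all add: lin_maps_iff)
    fix c assume c: "c @: C"
    have "pt rself 1[A] c @: cofree rself"
      unfolding cofree_simps by (rule pure_closed[OF mB[OF rs] mC _ c]) simp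
    then show "f c = g c" using eq v[OF lin_mapsD[OF f] c] v[OF lin_mapsD[OF g] c] by metis
  qed
qed

text \<open>The additive laws are pointwise. Each law involving the product holds for the operators
  \<open>act (cofree rself) f\<close>, where multiplication is composition, and returns to
  \<open>#\<close> by faithfulness.\<close>

lemma ring_smash: "ring \<S>"
proof -
  let ?M = "cofree rself"
  note M = entwined_cofree[OF right_module_rself]
  note e = entwinedD[OF M]
  interpret M: right_module A ?M by (rule e(1))
  note ac = abelian_monoid.a_comm[OF abelian_group.axioms(1)[OF module_abelian_group[OF mA]]]
    abelian_monoid.a_assoc[OF abelian_group.axioms(1)[OF module_abelian_group[OF mA]]]
  have L: "f \<in> \<L> ==> lin R C A f" for f by (rule lin_mapsD)
  note cl = smash_mult_closed smash_add_closed smash_one_closed smash_zero_closed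
  note rules = act_mult[OF M] act_one[OF M] act_add[OF M] act_in[OF M] lin_add[OF act_lin[OF M], unfolded base_module_simps]
  have c: "f c @: A" if "f \<in> \<L>" "c @: C" for f c using lin_closed[OF L] that by blast
  have ext: "f = g" if "f \<in> \<L>" "g \<in> \<L>" "\<And>c. c @: C ==> f c = g c" for f g
    using that(1,2) extensionalityI[of f "carrier C" g] that(3) by (simp add: lin_maps_iff)
  show ?thesis
  proof (intro ringI abelian_groupI monoidI)
    fix f g h assume "f @: \<S>" and "g @: \<S>"
    then have f: "f \<in> \<L>" and g: "g \<in> \<L>" by simp_all
    show "f +[\<S>] g @: \<S>" using smash_add_closed[OF f g] by simp
    show "f *[\<S>] g @: \<S>" using smash_mult_closed[OF f g] by simp
    show "f +[\<S>] g = g +[\<S>] f" using c[OF f] c[OF g] by (auto simp: fun_eq_iff restrict_def ac(1))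
    assume "h @: \<S>"
    then have h: "h \<in> \<L>" by simp
    note fgh = f g h cl
    show "(f +[\<S>] g) +[\<S>] h = f +[\<S>] (g +[\<S>] h)"
      using c[OF f] c[OF g] c[OF h] by (auto simp: fun_eq_iff restrict_def ac(2))
    show "(f *[\<S>] g) *[\<S>] h = f *[\<S>] (g *[\<S>] h)"
      by (rule act_faithful) (use f g h in \<open>simp_all del: cofree_simps smash_simps add: cl L rules\<close>)
    show "(f +[\<S>] g) *[\<S>] h = f *[\<S>] h +[\<S>] g *[\<S>] h"
      by (rule act_faithful) (use f g h in \<open>simp_all del: cofree_simps smash_simps add: cl L rules\<close>)
    show "h *[\<S>] (f +[\<S>] g) = h *[\<S>] f +[\<S>] h *[\<S>] g"
      by (rule act_faithful) (use f g h in \<open>simp_all del: cofree_simps smash_simps add: cl L rules\<close>)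
  next
    fix f assume "f @: \<S>"
    then have f: "f \<in> \<L>" by simp
    show "0[\<S>] +[\<S>] f = f"
      by (rule ext[OF smash_add_closed[OF smash_zero_closed f] f]) (use c[OF f] in simp)
    show "1[\<S>] *[\<S>] f = f"
      by (rule act_faithful) (use f in \<open>simp_all del: cofree_simps smash_simps add: cl L rules\<close>)
    show "f *[\<S>] 1[\<S>] = f"
      by (rule act_faithful) (use f in \<open>simp_all del: cofree_simps smash_simps add: cl L rules\<close>)
    let ?g = "restrict (%c. (\<ominus>\<^bsub>R\<^esub> 1[R]) .[A] f c) (carrier C)"
    have g: "?g \<in> \<L>" by (rule lin_maps_restrict[OF lin_scale[OF mA L[OF f]]]) simp
    have "?g +[\<S>] f = 0[\<S>]"
    proof (rule ext[OF smash_add_closed[OF g f] smash_zero_closed])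
      fix x assume x: "x @: C"
      have "(\<ominus>\<^bsub>R\<^esub> 1[R]) .[A] f x = \<ominus>\<^bsub>A\<^esub> f x"
        using module.smult_l_minus[OF mA, of "1[R]" "f x"] module.smult_one[OF mA] c[OF f x] by simp
      then show "(?g +[\<S>] f) x = 0[\<S>] x" using x c[OF f x] by (simp add: abelian_group.l_neg[OF module_abelian_group[OF mA]])
    qed
    then show "\<exists>g \<in> carrier \<S>. g +[\<S>] f = 0[\<S>]" using g unfolding smash_simps(1) by (rule bexI)
  next
    show "0[\<S>] @: \<S>" "1[\<S>] @: \<S>" using smash_zero_closed smash_one_closed by simp_all
  qed
qed

abbreviation "\<F> \<equiv> entwined_to_smash R A C"

lemma to_smash_simps [simp]:
  "carrier (\<F> M) = carrier M" "0[\<F> M] = 0[M]" "ring.add (\<F> M) = ring.add M"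
  "monoid.mult (\<F> M) = monoid.mult M" "monoid.one (\<F> M) = monoid.one M"
  by (simp_all add: entwined_to_smash_def)

lemma to_smash_act: "f \<in> \<L> ==> m @: M ==> f .[\<F> M] m = act M f m"
  by (simp add: entwined_to_smash_def act_def ev_def)

lemma right_module_to_smash:
  assumes M: "entwined M" shows "right_module \<S> (\<F> M)"
proof (intro right_module.intro right_module_axioms.intro ring_smash)
  have L: "f \<in> \<L> ==> lin R C A f" for f by (rule lin_mapsD)
  interpret M: right_module A M by (rule entwinedD(1)[OF M])
  note rules = to_smash_act act_mult[OF M] act_one[OF M] act_add[OF M] act_in[OF M]
    lin_add[OF act_lin[OF M], unfolded base_module_simps] smash_mult_closed smash_add_closed smash_one_closed L
  show "abelian_group (\<F> M)" by (rule abelian_group_cong[OF right_module_abelian_group[OF entwinedD(1)[OF M]]]) simp_all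
  fix s t x y
  show "s @: \<S> ==> x @: \<F> M ==> s .[\<F> M] x @: \<F> M"
    unfolding smash_simps(1) to_smash_simps by (simp only: rules)
  show "s @: \<S> ==> t @: \<S> ==> x @: \<F> M ==>
      (s +[\<S>] t) .[\<F> M] x = s .[\<F> M] x +[\<F> M] t .[\<F> M] x"
    unfolding smash_simps(1) to_smash_simps by (simp only: rules)
  show "s @: \<S> ==> x @: \<F> M ==> y @: \<F> M ==>
      s .[\<F> M] (x +[\<F> M] y) = s .[\<F> M] x +[\<F> M] s .[\<F> M] y"
    unfolding smash_simps(1) to_smash_simps by (simp only: rules M.M.a_closed)
  show "s @: \<S> ==> t @: \<S> ==> x @: \<F> M ==>
      (s *[\<S>] t) .[\<F> M] x = t .[\<F> M] (s .[\<F> M] x)"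
    unfolding smash_simps(1) to_smash_simps by (simp only: rules)
  show "x @: \<F> M ==> 1[\<S>] .[\<F> M] x = x"
    unfolding to_smash_simps by (simp only: rules)
qed

lemma agree_rself: "agree R A (\<B> rself)"
  unfolding agree_def using scaled_central(2) by auto

text \<open>Identifies the \<open>#\<close>-module \<open>A \<otimes> C\<close> of the statement
  with the one arising from the cofree entwined module on \<open>A\<close>; its module axioms and
  its rationality are inherited through this.\<close>

lemma coring_agree: "agree \<S> (\<F> (cofree rself)) (coring_smash_module R A C \<Delta> \<psi>)"
proof -
  note rs = right_module_rself
  let ?T = "\<T> rself" and ?M = "cofree rself"
  have ag: "agree R (tensor R A C) ?T" by (rule agree_tensor[OF agree_rself mA mC])
  have T: "module R ?T" using rs by simp
  have pure: "pure_tensor R A C = pt rself" by (rule agree_pure[OF agree_rself, symmetric])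
  have ts: "tsum R A C (tensor R A C) t b = tsum R (\<B> rself) C ?T t b" for t b
    by (rule agree_tsum[OF agree_rself mA mC ag, symmetric])
  have ts': "tsum R A C (tensor R A C) t b = tsum R A C ?T t b" for t b
    by (rule agree_tsum[OF agree_refl mA mC ag, symmetric])
  have ts'': "tsum R C C (tensor R A C) t b = tsum R C C ?T t b" for t b
    by (rule agree_tsum[OF agree_refl mC mC ag, symmetric])
  have ract: "coring_ract R A C \<psi> t a = cP' rself a t" for t a
  proof -
    have "coring_ract R A C \<psi> t a = tsum R (\<B> rself) C ?T t
       (%a' c. tsum R A C (tensor R A C) (\<psi> (pure_tensor R C A c a)) (%b d. pt rself (a' *[A] b) d))"
      unfolding coring_ract_def ts pure ..
    then show ?thesis unfolding cP_def ts' rself_simps .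
  qed
  have M: "entwined ?M" by (rule entwined_cofree[OF rs])
  have cag: "agree R ?T (\<B> ?M)" by (rule cofree_agree[OF rs])
  have K: "f .[coring_smash_module R A C \<Delta> \<psi>] t = act ?M f t" if f: "f \<in> \<L>" and t: "t @: ?T" for f t
  proof -
    note lf = lin_mapsD[OF f]
    have inner: "tsum R C C ?T (\<Delta> c) (%c1 c2. cP' rself (f c2) (pt rself a c1)) =
        act ?M f (pt rself a c)" if a: "a @: A" and c: "c @: C" for a c
    proof -
      have a': "a @: rself" using a by simp
      have p: "pt rself a c @: ?T" by (rule pure_closed[OF mB[OF rs] mC _ c]) (use a in simp)
      have co: "coact ?M (pt rself a c) = tmap R C ?T C (pt rself a) (\<Delta> c)"
        using cofree_coact_pure[OF rs a' c] p by simp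
      have "act ?M f (pt rself a c) =
          tsum R ?T C ?T (tmap R C ?T C (pt rself a) (\<Delta> c)) (%x c. f c .[?M] x)"
        unfolding act_def ev_def co by (rule agree_tsum[OF cag T mC cag])
      also have "\<dots> = tsum R C C ?T (\<Delta> c) (%c1 c2. f c2 .[?M] pt rself a c1)"
      proof (rule tsum_tmap[OF mC T mC T lin_pure_const[OF rs a'] _ Delta_closed[OF c]])
        have "bilin R (\<B> ?M) C (\<B> ?M) (%x c. f c .[?M] x)" by (rule bilin_ev[OF entwinedD(1)[OF M] lf])
        then show "bilin R ?T C ?T (%x c. f c .[?M] x)"
          unfolding bilin_def using agree_lin[OF cag cag] agree_lin[OF agree_refl cag] agree_carrier[OF cag] by blast
      qed
      finally show ?thesis by simp
    qed
    have l: "lin R ?T ?T (act ?M f)" using act_lin[OF M lf] agree_lin[OF cag cag] by blast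
    have "f .[coring_smash_module R A C \<Delta> \<psi>] t =
        tsum R (\<B> rself) C ?T t (%a c. tsum R C C ?T (\<Delta> c) (%c1 c2. cP' rself (f c2) (pt rself a c1)))"
      unfolding coring_smash_module_def by (simp add: ts ts'' pure ract)
    also have "\<dots> = tsum R (\<B> rself) C ?T t (%a c. act ?M f (pt rself a c))"
      by (rule tsum_cong[OF refl inner]) simp_all
    also have "\<dots> = act ?M f (tsum R (\<B> rself) C ?T t (pt rself))"
      by (rule tsum_push[symmetric, OF mB[OF rs] mC T T l bilin_pure[OF mB[OF rs] mC] t])
    finally show ?thesis unfolding tsum_eta[OF mB[OF rs] mC t] .
  qed
  have simps: "carrier (coring_smash_module R A C \<Delta> \<psi>) = carrier (tensor R A C)"
    "0[coring_smash_module R A C \<Delta> \<psi>] = 0[tensor R A C]"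
    "ring.add (coring_smash_module R A C \<Delta> \<psi>) = ring.add (tensor R A C)"
    by (simp_all add: coring_smash_module_def)
  show ?thesis
    unfolding agree_def
  proof (intro conjI ballI)
    show "carrier (\<F> ?M) = carrier (coring_smash_module R A C \<Delta> \<psi>)" using agree_carrier[OF ag] by (simp add: simps)
    show "0[\<F> ?M] = 0[coring_smash_module R A C \<Delta> \<psi>]" using agree_zero[OF ag] by (simp add: simps)
    fix x assume "x @: \<F> ?M"
    then have x: "x @: ?T" by simp
    show "x +[\<F> ?M] y = x +[coring_smash_module R A C \<Delta> \<psi>] y" if "y @: \<F> ?M" for y
      using ag x that unfolding agree_def by (simp add: simps)
  next
    fix s x assume "s @: \<S>" and "x @: \<F> ?M"
    then have s: "s \<in> \<L>" and x: "x @: ?T" by simp_all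
    have "x @: ?M" using x by simp
    then show "s .[\<F> ?M] x = s .[coring_smash_module R A C \<Delta> \<psi>] x" using K[OF s x] to_smash_act[OF s, of x ?M] by metis
  qed
qed

end

section \<open>Rational modules and isomorphisms of categories\<close>

text \<open>Endomorphisms \<open>c \<mapsto> \<Sum> \<chi>_j(c) d_j\<close>, generated one summand
  at a time so that proofs go by induction instead of through indexed sums.\<close>

inductive finrank :: "('r, 'k) ring_scheme => ('r, 'c, 'y) module_scheme => ('c => 'c) => bool"
  for R :: "('r, 'k) ring_scheme" and C :: "('r, 'c, 'y) module_scheme" where
  finrank_zero: "finrank R C (%_. 0[C])"
| finrank_add: "finrank R C D ==> \<chi> \<in> lin_maps R C (self_module R) ==> j @: C ==>
    finrank R C (%c. D c +[C] \<chi> c .[C] j)"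

text \<open>The dual basis lemma in its local form; local projectivity and projectivity both enter
  the isomorphisms of categories through it.\<close>

definition dual_bases :: "('r, 'k) ring_scheme => ('r, 'c, 'y) module_scheme => bool" where
  "dual_bases R C \<longleftrightarrow> (\<forall>X. finite X --> X \<subseteq> carrier C --> (\<exists>D. finrank R C D \<and> (\<forall>w \<in> X. D w = w)))"

lemma dual_basesE:
  assumes "dual_bases R C" "finite X" "X \<subseteq> carrier C"
  obtains D where "finrank R C D" "\<forall>w \<in> X. D w = w"
  using assms unfolding dual_bases_def by meson

context entwining
begin

section \<open>Functionals separate the tensors over \<open>C\<close>\<close>

lemma finrank_lin: "finrank R C D ==> lin R C C D"
proof (induction rule: finrank.induct)
  case finrank_zero
  show ?case by (rule lin_zero_map[OF mC])
next
  case (finrank_add D \<chi> j)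
  show ?case by (rule lin_plus[OF mC finrank_add(4) lin_scal1[OF mC lin_mapsD[OF finrank_add(2)] finrank_add(3)]])
qed

text \<open>If \<open>D(c) = \<Sum> \<chi>_j(c) d_j\<close> and
  \<open>s = \<Sum> x \<otimes> c\<close>, then applying \<open>D\<close> to the second factor gives
  the sum over \<open>j\<close> of \<open>(\<Sum> \<chi>_j(c) x) \<otimes> d_j\<close>, and each
  first factor vanishes by \<open>z\<close>.\<close>

lemma separation_finrank:
  assumes B: "module R B" and s: "s @: tensor R B C"
    and z: "\<And>\<chi>. \<chi> \<in> lin_maps R C (self_module R) ==> tsum R B C B s (%x c. \<chi> c .[B] x) = 0[B]"
    and D: "finrank R C D"
  shows "tsum R B C (tensor R B C) s (%x c. pure_tensor R B C x (D c)) = 0[tensor R B C]"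
proof -
  let ?T = "tensor R B C"
  interpret B: module R B by (rule B)
  interpret C: module R C by (rule mC)
  have T: "module R ?T" by (rule module_tensor[OF B mC])
  interpret T: module R ?T by (rule T)
  have bD: "bilin R B C ?T (%x c. pure_tensor R B C x (D c))" if "finrank R C D" for D
    using lin_closed[OF finrank_lin[OF that]]
    by (intro bilinI lin_pure1[OF B mC lin_id] lin_pure2[OF B mC finrank_lin[OF that]]) simp_all
  show ?thesis
    using D
  proof (induction rule: finrank.induct)
    case finrank_zero
    show ?case
    proof (rule lin_ext[OF B mC tsum_lin[OF B mC T bD[OF finrank.finrank_zero]] lin_zero_map[OF T] _ s])
      fix x c assume x: "x @: B" and c: "c @: C"
      show "tsum R B C ?T (pure_tensor R B C x c) (%x c. pure_tensor R B C x 0[C]) = 0[?T]"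
        unfolding tsum_pure[OF B mC T bD[OF finrank.finrank_zero] x c]
        by (rule lin_zero[OF module_abelian_group[OF mC] module_abelian_group[OF T] lin_pure2[OF B mC lin_id x]])
    qed
  next
    case (finrank_add D \<chi> j)
    note lx = lin_mapsD[OF finrank_add(2)] and fr = finrank.finrank_add[OF finrank_add(1-3)] and j = finrank_add(3)
    have bx: "bilin R B C B (%x c. \<chi> c .[B] x)"
      using lin_closed[OF lx] by (intro bilinI lin_scal1[OF B lx] lin_scal2[OF B lin_id]) simp_all
    have "tsum R B C ?T s (%x c. pure_tensor R B C x (D c +[C] \<chi> c .[C] j)) =
        tsum R B C ?T s (%x c. pure_tensor R B C x (D c)) +[?T]
        pure_tensor R B C (tsum R B C B s (%x c. \<chi> c .[B] x)) j"
    proof (rule lin_ext[OF B mC tsum_lin[OF B mC T bD[OF fr]] lin_plus[OF T tsum_lin[OF B mC T bD[OF finrank_add(1)]]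
            lin_pure1[OF B mC tsum_lin[OF B mC B bx] j]] _ s])
      fix x c assume x: "x @: B" and c: "c @: C"
      have r: "\<chi> c @: R" using lin_closed[OF lx c] by simp
      have Dc: "D c @: C" by (rule lin_closed[OF finrank_lin[OF finrank_add(1)] c])
      have "pure_tensor R B C x (D c +[C] \<chi> c .[C] j) =
          pure_tensor R B C x (D c) +[?T] pure_tensor R B C (\<chi> c .[B] x) j"
        using lin_add[OF lin_pure2[OF B mC lin_id x] Dc module.smult_closed[OF mC r j]] pure_balanced[OF B mC r x j] by simp
      then show "tsum R B C ?T (pure_tensor R B C x c) (%x c. pure_tensor R B C x (D c +[C] \<chi> c .[C] j)) =
          tsum R B C ?T (pure_tensor R B C x c) (%x c. pure_tensor R B C x (D c)) +[?T]
          pure_tensor R B C (tsum R B C B (pure_tensor R B C x c) (%x c. \<chi> c .[B] x)) j"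
        unfolding tsum_pure[OF B mC T bD[OF fr] x c] tsum_pure[OF B mC T bD[OF finrank_add(1)] x c] tsum_pure[OF B mC B bx x c] .
    qed
    also have "pure_tensor R B C (tsum R B C B s (%x c. \<chi> c .[B] x)) j = 0[?T]"
      unfolding z[OF finrank_add(2)]
      by (rule lin_zero[OF module_abelian_group[OF B] module_abelian_group[OF T] lin_pure1[OF B mC lin_id j]])
    finally show ?case unfolding finrank_add(4) by simp
  qed
qed

text \<open>The difference \<open>?s\<close> involves finitely many elements of \<open>C\<close>. A
  finite-rank \<open>D\<close> fixing them leaves \<open>?s\<close> unchanged, yet sends it to
  zero.\<close>

lemma separation:
  assumes db: "dual_bases R C" and B: "module R B" and t: "t @: tensor R B C" "t' @: tensor R B C"
    and eq: "\<And>\<chi>. \<chi> \<in> lin_maps R C (self_module R) ==>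
      tsum R B C B t (%x c. \<chi> c .[B] x) = tsum R B C B t' (%x c. \<chi> c .[B] x)"
  shows "t = t'"
proof -
  let ?T = "tensor R B C"
  have T: "module R ?T" by (rule module_tensor[OF B mC])
  note ag = module_abelian_group[OF T] module_abelian_group[OF B]
  interpret T: abelian_group ?T by (rule ag(1))
  interpret B: abelian_group B by (rule ag(2))
  let ?s = "t \<ominus>\<^bsub>?T\<^esub> t'"
  have s: "?s @: ?T" using t by simp
  have z: "tsum R B C B ?s (%x c. \<chi> c .[B] x) = 0[B]" if \<chi>: "\<chi> \<in> lin_maps R C (self_module R)" for \<chi>
  proof -
    note lx = lin_mapsD[OF \<chi>]
    have bx: "bilin R B C B (%x c. \<chi> c .[B] x)"
      using lin_closed[OF lx] by (intro bilinI lin_scal1[OF B lx] lin_scal2[OF B lin_id]) simp_all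
    note l = tsum_lin[OF B mC B bx]
    show ?thesis unfolding lin_diff[OF ag l t] eq[OF \<chi>]
      using abelian_group_diff_eq_zero[OF ag(2) lin_closed[OF l t(2)] lin_closed[OF l t(2)]] by simp
  qed
  obtain X where X: "finite X" "X \<subseteq> carrier C" "\<forall>b b'. bilin R B C ?T b --> bilin R B C ?T b' -->
      (\<forall>x \<in> carrier B. \<forall>w \<in> X. b x w = b' x w) --> tsum R B C ?T ?s b = tsum R B C ?T ?s b'"
    using tensor_finite_support[OF B mC T s] by (elim exE conjE)
  obtain D where D: "finrank R C D" "\<forall>w \<in> X. D w = w" by (rule dual_basesE[OF db X(1,2)])
  have bD: "bilin R B C ?T (%x c. pure_tensor R B C x (D c))"
    using lin_closed[OF finrank_lin[OF D(1)]]
    by (intro bilinI lin_pure1[OF B mC lin_id] lin_pure2[OF B mC finrank_lin[OF D(1)]]) simp_all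
  have "?s = tsum R B C ?T ?s (pure_tensor R B C)" by (rule tsum_eta[OF B mC s, symmetric])
  also have "\<dots> = tsum R B C ?T ?s (%x c. pure_tensor R B C x (D c))"
    by (rule X(3)[rule_format, OF bilin_pure[OF B mC] bD]) (simp add: D(2))
  also have "\<dots> = 0[?T]" by (rule separation_finrank[OF B s z D(1)])
  finally show ?thesis using abelian_group_diff_eq_zero[OF ag(1) t] by blast
qed

text \<open>Scalar functionals as elements of \<open>#\<close>, so that separation by functionals
  becomes separation by the action of \<open>#\<close>.\<close>

definition fn :: "('c => 'r) => 'c => 'a" where
  "fn \<chi> = (\<lambda>c\<in>carrier C. \<chi> c .[A] 1[A])"

lemma lin_scaled: "\<chi> \<in> lin_maps R C (self_module R) ==> a @: A ==> lin R C A (%c. \<chi> c .[A] a)"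
  by (rule lin_scal1[OF mA lin_mapsD])

lemma fn_closed: "\<chi> \<in> lin_maps R C (self_module R) ==> fn \<chi> \<in> \<L>"
  unfolding fn_def by (rule lin_maps_restrict[OF lin_scaled]) simp_all

lemma ev_fn: "ev M (fn \<chi>) t = tsum R (\<B> M) C (\<B> M) t (%x c. \<chi> c .[\<B> M] x)"
  unfolding ev_def by (rule tsum_cong) (simp_all add: fn_def)

lemma separation_ev:
  assumes "dual_bases R C" "right_module A M" "t @: \<T> M" "t' @: \<T> M"
    and eq: "\<And>f. f \<in> \<L> ==> ev M f t = ev M f t'"
  shows "t = t'"
  by (rule separation[OF assms(1) mB[OF assms(2)] assms(3,4)]) (use eq fn_closed in \<open>simp only: ev_fn[symmetric]\<close>)

text \<open>Separation applied twice, after rebracketing to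
  \<open>(M \<otimes> C) \<otimes> C\<close>: to the last factor and then to the one before it. For
  elements of the form \<open>fn \<chi>\<close> the twist is trivial, since \<open>\<psi>\<close>
  fixes \<open>1\<close>, so \<open>ev2\<close> is iterated evaluation; this is
  \<open>key\<close>.\<close>

lemma separation_ev2:
  assumes db: "dual_bases R C" and M: "right_module A M"
    and w: "w @: (tensor R (\<B> M) (tensor R C C))" "w' @: (tensor R (\<B> M) (tensor R C C))"
    and eq: "\<And>f g. f \<in> \<L> ==> g \<in> \<L> ==> ev2 M f g w = ev2 M f g w'"
  shows "w = w'"
proof -
  let ?B = "\<B> M" let ?T = "\<T> M" let ?a = "tassoc R (\<B> M) C C"
  interpret M: right_module A M by (rule M)
  interpret C: module R C by (rule mC)
  note B = mB[OF M]
  have T: "module R ?T" by (rule module_tensor[OF B mC])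
  have b: "bilin R B' C B' (%x c. \<chi> c .[B'] x)" if "module R B'" "\<chi> \<in> lin_maps R C (self_module R)"
    for B' :: "('r, 'q) module" and \<chi>
    using lin_closed[OF lin_mapsD[OF that(2)]]
    by (intro bilinI lin_scal1[OF that(1) lin_mapsD[OF that(2)]] lin_scal2[OF that(1) lin_id]) simp_all
  note al = tassoc_lin[OF B mC mC]
  have key: "tsum R ?B C ?B (tsum R ?T C ?T (?a v) (%y c. \<chi>' c .[?T] y)) (%x c. \<chi> c .[?B] x) = ev2 M (fn \<chi>') (fn \<chi>) v"
    if x: "\<chi> \<in> lin_maps R C (self_module R)" "\<chi>' \<in> lin_maps R C (self_module R)"
      and v: "v @: (tensor R ?B (tensor R C C))" for \<chi> \<chi>' v
  proof -
    note f = lin_mapsD[OF fn_closed[OF x(2)]] and g = lin_mapsD[OF fn_closed[OF x(1)]]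
    note l1 = tsum_lin[OF B mC B b[OF B x(1)]] and l2 = tsum_lin[OF T mC T b[OF T x(2)]]
    show ?thesis
    proof (rule lin_ext3[OF B mC mC B lin_compose[OF lin_compose[OF al l2] l1] ev2_lin[OF M f g] _ v])
      fix m c' c assume "m @: ?B" and c': "c' @: C" and c: "c @: C"
      then have m: "m @: M" "m @: ?B" by simp_all
      have r: "\<chi>' c @: R" "\<chi> c' @: R" using lin_closed[OF lin_mapsD[OF x(2)] c] lin_closed[OF lin_mapsD[OF x(1)] c'] by simp_all
      have p: "pure_tensor R ?B C m c' @: ?T" by (rule pure_closed[OF B mC m(2) c'])
      have tw: "twist (fn \<chi>') (fn \<chi>) c' c = \<chi>' c .[A] (\<chi> c' .[A] 1[A])"
      proof -
        have "\<psi> (pure_tensor R C A c' (fn \<chi>' c)) = pure_tensor R A C 1[A] (\<chi>' c .[C] c')"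
          using pure_balanced[OF mC mA r(1) c' A.one_closed] entwining_one[of "\<chi>' c .[C] c'"] r c c' by (simp add: fn_def)
        then have "twist (fn \<chi>') (fn \<chi>) c' c = 1[A] *[A] fn \<chi> (\<chi>' c .[C] c')"
          unfolding twist_def using tsum_pure[OF mA mC mA bilin_mult[OF g] A.one_closed, of "\<chi>' c .[C] c'"] r c' by simp
        also have "\<dots> = \<chi>' c .[A] fn \<chi> c'" using lin_smult[OF g r(1) c'] lin_closed[OF g c'] module.smult_closed[OF mA r(1)] by simp
        finally show ?thesis using c' by (simp add: fn_def)
      qed
      have "ev2 M (fn \<chi>') (fn \<chi>) (pure_tensor R ?B (tensor R C C) m (pure_tensor R C C c' c)) =
          (\<chi>' c .[A] (\<chi> c' .[A] 1[A])) .[M] m"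
        unfolding ev2_pure[OF M f g m(1) pure_closed[OF mC mC c' c]] tsum_pure[OF mC mC mA bilin_twist[OF f g] c' c] tw ..
      also have "\<dots> = \<chi>' c .[?B] (\<chi> c' .[?B] m)"
        using scaled_central(2)[OF r(1) one_scaled[OF r(2)]] M.ract_assoc[OF one_scaled[OF r(2)] one_scaled[OF r(1)] m(1)] by simp
      finally have rhs: "ev2 M (fn \<chi>') (fn \<chi>) (pure_tensor R ?B (tensor R C C) m (pure_tensor R C C c' c)) =
          \<chi>' c .[?B] (\<chi> c' .[?B] m)" .
      show "tsum R ?B C ?B (tsum R ?T C ?T (?a (pure_tensor R ?B (tensor R C C) m (pure_tensor R C C c' c))) (%y c. \<chi>' c .[?T] y))
          (%x c. \<chi> c .[?B] x) = ev2 M (fn \<chi>') (fn \<chi>) (pure_tensor R ?B (tensor R C C) m (pure_tensor R C C c' c))"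
        unfolding rhs tassoc_pure[OF B mC mC m(2) c' c] tsum_pure[OF T mC T b[OF T x(2)] p c] lin_smult[OF l1 r(1) p]
          tsum_pure[OF B mC B b[OF B x(1)] m(2) c'] ..
    qed
  qed
  have "?a w = ?a w'"
  proof (rule separation[OF db T lin_closed[OF al w(1)] lin_closed[OF al w(2)]])
    fix \<chi>' assume x': "\<chi>' \<in> lin_maps R C (self_module R)"
    note l2 = tsum_lin[OF T mC T b[OF T x']]
    show "tsum R ?T C ?T (?a w) (%y c. \<chi>' c .[?T] y) = tsum R ?T C ?T (?a w') (%y c. \<chi>' c .[?T] y)"
    proof (rule separation[OF db B lin_closed[OF l2 lin_closed[OF al w(1)]] lin_closed[OF l2 lin_closed[OF al w(2)]]])
      fix \<chi> assume x: "\<chi> \<in> lin_maps R C (self_module R)"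
      show "tsum R ?B C ?B (tsum R ?T C ?T (?a w) (%y c. \<chi>' c .[?T] y)) (%x c. \<chi> c .[?B] x) =
          tsum R ?B C ?B (tsum R ?T C ?T (?a w') (%y c. \<chi>' c .[?T] y)) (%x c. \<chi> c .[?B] x)"
        unfolding key[OF x x' w(1)] key[OF x x' w(2)] by (rule eq[OF fn_closed[OF x'] fn_closed[OF x]])
    qed
  qed
  then show ?thesis using tassoc_inv_tassoc[OF B mC mC w(1)] tassoc_inv_tassoc[OF B mC mC w(2)] by metis
qed

text \<open>Lets identities in \<open>#\<close> be verified by computing with an unspecified
  entwined module, from its axioms alone.\<close>

lemma smash_eqI:
  assumes "f \<in> \<L>" "g \<in> \<L>"
    "\<And>M :: ('a, ('a, 'c) tens, 'c) coact_module. \<And>m. entwined M ==> m @: M ==> act M f m = act M g m"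
  shows "f = g"
  using act_faithful[OF assms(1,2)] assms(3)[OF entwined_cofree[OF right_module_rself]] by blast

lemma unit_map_mult:
  assumes a: "a @: A" "b @: A"
  shows "\<U> (a *[A] b) = \<U> a *[\<S>] \<U> b"
proof (rule smash_eqI)
  fix M :: "('a, ('a, 'c) tens, 'c) coact_module" and m assume M: "entwined M" and m: "m @: M"
  interpret M: right_module A M by (rule entwinedD(1)[OF M])
  show "act M (\<U> (a *[A] b)) m = act M (\<U> a *[\<S>] \<U> b) m"
    using a m M.ract_assoc[OF a m] M.ract_closed[OF a(1) m]
    by (simp add: act_mult[OF M] lin_mapsD[OF unit_map_closed] act_unit[OF M])
qed (use a in \<open>simp_all add: unit_map_closed smash_mult_closed\<close>)

text \<open>\<open>r 1\<close> acts as the scalar \<open>r\<close>, and each operator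
  \<open>act M f\<close> is \<open>R\<close>-linear.\<close>

lemma unit_map_central:
  assumes r: "r @: R" and f: "f \<in> \<L>"
  shows "\<U> (r .[A] 1[A]) *[\<S>] f = f *[\<S>] \<U> (r .[A] 1[A])"
proof (rule smash_eqI)
  fix M :: "('a, ('a, 'c) tens, 'c) coact_module" and m assume M: "entwined M" and m: "m @: M"
  note a = one_scaled[OF r] and lf = lin_mapsD[OF f]
  show "act M (\<U> (r .[A] 1[A]) *[\<S>] f) m = act M (f *[\<S>] \<U> (r .[A] 1[A])) m"
    using lin_smult[OF act_lin[OF M lf] r, of m] m
    by (simp add: act_mult[OF M] lin_mapsD[OF unit_map_closed[OF a]] lf act_unit[OF M a] act_in[OF M lf])
qed (use r f in \<open>simp_all add: unit_map_closed smash_mult_closed\<close>)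

text \<open>Exhibits \<open>c \<mapsto> \<chi>(c) a\<close> as a product in \<open>#\<close>. This
  is how a map of finite rank can be evaluated in an arbitrary \<open>#\<close>-module, where no
  coaction is available.\<close>

lemma fn_mult_unit:
  assumes x: "\<chi> \<in> lin_maps R C (self_module R)" and a: "a @: A"
  shows "fn \<chi> *[\<S>] \<U> a = (\<lambda>c\<in>carrier C. \<chi> c .[A] a)"
proof (rule smash_eqI)
  fix M :: "('a, ('a, 'c) tens, 'c) coact_module" and m assume M: "entwined M" and m: "m @: M"
  note e = entwinedD[OF M] and lx = lin_mapsD[OF fn_closed[OF x]]
  interpret M: right_module A M by (rule e(1))
  have "act M (\<lambda>c\<in>carrier C. \<chi> c .[A] a) m = ev M (%c. \<chi> c .[A] a) (coact M m)"
    unfolding act_def by (rule ev_cong) simp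
  also have "\<dots> = a .[M] ev M (fn \<chi>) (coact M m)"
  proof (rule lin_ext[OF e(8) mC ev_lin[OF e(1) lin_scaled[OF x a]] lin_act1[OF e(1) ev_lin[OF e(1) lx] a] _ e(7)[OF m]])
    fix y c assume "y @: \<B> M" and c: "c @: C"
    then have y: "y @: M" by simp
    have r: "\<chi> c @: R" using lin_closed[OF lin_mapsD[OF x] c] by simp
    show "ev M (%c. \<chi> c .[A] a) (pt M y c) = a .[M] ev M (fn \<chi>) (pt M y c)"
      unfolding ev_pure[OF e(1) lin_scaled[OF x a] y c] ev_pure[OF e(1) lx y c]
      using M.ract_assoc[OF one_scaled[OF r] a y] scaled_central(1)[OF r a] c by (simp add: fn_def)
  qed
  finally have "act M (\<lambda>c\<in>carrier C. \<chi> c .[A] a) m = a .[M] act M (fn \<chi>) m" by (simp only: act_def)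
  then show "act M (fn \<chi> *[\<S>] \<U> a) m = act M (\<lambda>c\<in>carrier C. \<chi> c .[A] a) m"
    unfolding act_mult[OF M lx lin_mapsD[OF unit_map_closed[OF a]] m] act_unit[OF M a act_in[OF M lx m]] by (rule sym)
qed (use x a in \<open>simp_all add: unit_map_closed smash_mult_closed fn_closed lin_maps_restrict[OF lin_scaled]\<close>)

abbreviation "uA \<equiv> restrict_scalars (\<U>)"

lemma uA_simps [simp]:
  "carrier (uA N) = carrier N" "0[uA N] = 0[N]" "ring.add (uA N) = ring.add N"
  "a .[uA N] x = \<U> a .[N] x"
  by (simp_all add: restrict_scalars_def)

lemma right_module_uA:
  assumes N: "right_module \<S> N" shows "right_module A (uA N)"
proof (intro right_module.intro right_module_axioms.intro rA)
  interpret N: right_module \<S> N by (rule N)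
  have u: "\<U> a @: \<S>" if "a @: A" for a using unit_map_closed[OF that] by simp
  show "abelian_group (uA N)" by (rule abelian_group_cong[OF right_module_abelian_group[OF N]]) simp_all
  fix s t x y assume s: "s @: A" and "x @: uA N"
  then have x: "x @: N" by simp
  show "s .[uA N] x @: uA N" using N.ract_closed[OF u[OF s] x] by simp
  show "s .[uA N] (x +[uA N] y) = s .[uA N] x +[uA N] s .[uA N] y" if "y @: uA N"
    using N.ract_r_distr[OF u[OF s] x] that by simp
  assume t: "t @: A"
  have "\<U> (s +[A] t) = \<U> s +[\<S>] \<U> t"
    using module.smult_r_distr[OF mA _ s t] by (auto simp: smash_unit_map_def fun_eq_iff restrict_def)
  then show "(s +[A] t) .[uA N] x = s .[uA N] x +[uA N] t .[uA N] x"
    using N.ract_l_distr[OF u[OF s] u[OF t] x] by (simp del: smash_simps)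
  show "(s *[A] t) .[uA N] x = t .[uA N] (s .[uA N] x)"
    using N.ract_assoc[OF u[OF s] u[OF t] x] by (simp add: unit_map_mult[OF s t])
next
  interpret N: right_module \<S> N by (rule N)
  fix x assume "x @: uA N"
  then show "1[A] .[uA N] x = x" using N.ract_one[of x] by (simp add: smash_unit_map_def)
qed

text \<open>Rationality of a single element, so that it can be propagated separately through maps,
  sums and submodules.\<close>

definition rat_elem :: "('c => 'a, 'm, 'z) module_scheme => 'm => bool" where
  "rat_elem N m \<longleftrightarrow> m @: N \<and> (\<exists>t \<in> carrier (\<T> (uA N)). \<forall>f \<in> \<L>. f .[N] m = ev (uA N) f t)"

lemma smash_rational_iff: "smash_rational R A C \<epsilon> N \<longleftrightarrow> (\<forall>m \<in> carrier N. rat_elem N m)"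
  unfolding smash_rational_def rat_elem_def ev_def Let_def by blast

lemma rat_elem_map:
  assumes M: "right_module \<S> M" and N: "right_module \<S> N" and p: "lin \<S> M N p" and m: "rat_elem M m"
  shows "rat_elem N (p m)"
proof -
  obtain t where t: "t @: (\<T> (uA M))" "\<And>f. f \<in> \<L> ==> f .[M] m = ev (uA M) f t"
    using m unfolding rat_elem_def by blast
  have mM: "m @: M" using m unfolding rat_elem_def by blast
  have pA: "lin A (uA M) (uA N) p"
    using lin_closed[OF p] lin_add[OF p] lin_smult[OF p] unit_map_closed by (intro linI) simp_all
  note uM = right_module_uA[OF M] and uN = right_module_uA[OF N]
  have "f .[N] p m = ev (uA N) f (tm (uA M) (uA N) p t)" if f: "f \<in> \<L>" for f
    using lin_smult[OF p, of f m] f mM by (simp add: ev_nat[OF uM uN pA lin_mapsD[OF f] t(1)] t(2)[OF f])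
  then show ?thesis
    unfolding rat_elem_def using lin_closed[OF p mM] tmap_closed[OF mB[OF uM] mB[OF uN] mC lin_base[OF pA] t(1)] by blast
qed

lemma rat_elem_zero:
  assumes N: "right_module \<S> N" shows "rat_elem N 0[N]"
proof -
  interpret N: right_module \<S> N by (rule N)
  note uN = right_module_uA[OF N]
  have T: "module R (\<T> (uA N))" by (rule module_tensor[OF mB[OF uN] mC])
  interpret T: module R "\<T> (uA N)" by (rule T)
  have "f .[N] 0[N] = ev (uA N) f 0[\<T> (uA N)]" if f: "f \<in> \<L>" for f
    using lin_zero[OF module_abelian_group[OF T] module_abelian_group[OF mB[OF uN]] ev_lin[OF uN lin_mapsD[OF f]]]
      N.ract_zero_right[of f] f by simp
  then show ?thesis unfolding rat_elem_def using T.zero_closed N.M.zero_closed by blast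
qed

lemma rat_elem_add:
  assumes N: "right_module \<S> N" and x: "rat_elem N x" and y: "rat_elem N y" shows "rat_elem N (x +[N] y)"
proof -
  interpret N: right_module \<S> N by (rule N)
  note uN = right_module_uA[OF N]
  interpret T: module R "\<T> (uA N)" by (rule module_tensor[OF mB[OF uN] mC])
  obtain t where t: "t @: (\<T> (uA N))" "\<And>f. f \<in> \<L> ==> f .[N] x = ev (uA N) f t"
    using x unfolding rat_elem_def by blast
  obtain t' where t': "t' @: (\<T> (uA N))" "\<And>f. f \<in> \<L> ==> f .[N] y = ev (uA N) f t'"
    using y unfolding rat_elem_def by blast
  have xy: "x @: N" "y @: N" using x y unfolding rat_elem_def by blast+
  have "f .[N] (x +[N] y) = ev (uA N) f (t +[\<T> (uA N)] t')" if f: "f \<in> \<L>" for f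
    using lin_add[OF ev_lin[OF uN lin_mapsD[OF f]] t(1) t'(1)] N.ract_r_distr[of f x y] f xy t(2)[OF f] t'(2)[OF f] by simp
  then show ?thesis unfolding rat_elem_def using T.a_closed[OF t(1) t'(1)] N.M.a_closed[OF xy] by blast
qed

text \<open>For \<open>D(c) = \<Sum> \<chi>_j(c) d_j\<close> the map \<open>f \<circ> D\<close> is
  the sum of the products of \<open>fn \<chi>_j\<close> with the unit map at \<open>f(d_j)\<close>.
  So \<open>s = \<Sum> (m fn \<chi>_j) \<otimes> d_j\<close> represents
  \<open>m (f \<circ> D)\<close> for all \<open>f\<close> simultaneously.\<close>

lemma finrank_act:
  assumes N: "right_module \<S> N" and m: "m @: N" and D: "finrank R C D"
  shows "\<exists>s \<in> carrier (\<T> (uA N)). \<forall>f \<in> \<L>. (\<lambda>c\<in>carrier C. f (D c)) .[N] m = ev (uA N) f s"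
  using D
proof (induction rule: finrank.induct)
  case finrank_zero
  interpret N: right_module \<S> N by (rule N)
  note uN = right_module_uA[OF N]
  have T: "module R (\<T> (uA N))" by (rule module_tensor[OF mB[OF uN] mC])
  interpret T: module R "\<T> (uA N)" by (rule T)
  have "(\<lambda>c\<in>carrier C. f 0[C]) .[N] m = ev (uA N) f 0[\<T> (uA N)]" if f: "f \<in> \<L>" for f
    using lin_zero[OF module_abelian_group[OF T] module_abelian_group[OF mB[OF uN]] ev_lin[OF uN lin_mapsD[OF f]]]
      lin_zero[OF module_abelian_group[OF mC] module_abelian_group[OF mA] lin_mapsD[OF f]] N.ract_zero_left[OF m] by simp
  then show ?case using T.zero_closed by blast
next
  case (finrank_add D \<chi> j)
  interpret N: right_module \<S> N by (rule N)
  interpret C: module R C by (rule mC)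
  note uN = right_module_uA[OF N] and x = finrank_add(2) and j = finrank_add(3)
  interpret T: module R "\<T> (uA N)" by (rule module_tensor[OF mB[OF uN] mC])
  obtain s where s: "s @: (\<T> (uA N))"
    "\<And>f. f \<in> \<L> ==> (\<lambda>c\<in>carrier C. f (D c)) .[N] m = ev (uA N) f s" using finrank_add(4) by blast
  let ?n = "fn \<chi> .[N] m"
  have fx: "fn \<chi> @: \<S>" using fn_closed[OF x] by simp
  have n: "?n @: N" by (rule N.ract_closed[OF fx m])
  have p: "pt (uA N) ?n j @: (\<T> (uA N))"
    by (rule pure_closed[OF mB[OF uN] mC _ j]) (use n in simp)
  have "(\<lambda>c\<in>carrier C. f (D c +[C] \<chi> c .[C] j)) .[N] m =
      ev (uA N) f (s +[\<T> (uA N)] pt (uA N) ?n j)" if f: "f \<in> \<L>" for f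
  proof -
    note lf = lin_mapsD[OF f]
    have fj: "f j @: A" by (rule lin_closed[OF lf j])
    have u: "\<U> (f j) @: \<S>" using unit_map_closed[OF fj] by simp
    have g: "(\<lambda>c\<in>carrier C. f (D c)) @: \<S>"
      using lin_maps_restrict[OF lin_compose[OF finrank_lin[OF finrank_add(1)] lf]] by simp
    have "(\<lambda>c\<in>carrier C. f (D c +[C] \<chi> c .[C] j)) =
        (\<lambda>c\<in>carrier C. f (D c)) +[\<S>] (fn \<chi> *[\<S>] \<U> (f j))"
      unfolding fn_mult_unit[OF x fj] smash_simps
    proof (rule restrict_ext)
      fix c assume c: "c @: C"
      have r: "\<chi> c @: R" using lin_closed[OF lin_mapsD[OF x] c] by simp
      show "f (D c +[C] \<chi> c .[C] j) = (\<lambda>c\<in>carrier C. f (D c)) c +[A] (\<lambda>c\<in>carrier C. \<chi> c .[A] f j) c"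
        using lin_add[OF lf lin_closed[OF finrank_lin[OF finrank_add(1)] c] module.smult_closed[OF mC r j]] lin_smult[OF lf r j] c by simp
    qed
    then have "(\<lambda>c\<in>carrier C. f (D c +[C] \<chi> c .[C] j)) .[N] m =
        (\<lambda>c\<in>carrier C. f (D c)) .[N] m +[N] \<U> (f j) .[N] ?n"
      using N.ract_l_distr[OF g N.S.m_closed[OF fx u] m] N.ract_assoc[OF fx u m] by simp
    also have "\<dots> = ev (uA N) f s +[N] ev (uA N) f (pt (uA N) ?n j)"
      using n by (simp add: s(2)[OF f] ev_pure[OF uN lf _ j])
    also have "\<dots> = ev (uA N) f (s +[\<T> (uA N)] pt (uA N) ?n j)"
      using lin_add[OF ev_lin[OF uN lf] s(1) p] by simp
    finally show ?thesis .
  qed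
  then show ?case using T.a_closed[OF s(1) p] by blast
qed

lemma rat_elem_finrank:
  assumes N: "right_module \<S> N" and m: "m @: N" and D: "finrank R C D"
    and eq: "\<And>f. f \<in> \<L> ==> (\<lambda>c\<in>carrier C. f (D c)) .[N] m = f .[N] m"
  shows "rat_elem N m"
  using finrank_act[OF N m D] m eq unfolding rat_elem_def by metis

text \<open>A witness \<open>t\<close> for \<open>i m\<close> has its first factors in
  \<open>W\<close>, so one in \<open>N\<close> has to be manufactured. Let \<open>D\<close> fix the
  second factors of \<open>t\<close>: then \<open>f\<close> and \<open>f \<circ> D\<close> act alike
  on \<open>i m\<close>, hence on \<open>m\<close> by injectivity, and \<open>finrank_act\<close>
  supplies a witness inside \<open>N\<close>.\<close>

lemma rat_elem_sub:
  assumes db: "dual_bases R C" and N: "right_module \<S> N" and W: "right_module \<S> W" and i: "lin \<S> N W i" "inj_on i (carrier N)"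
    and m: "m @: N" "rat_elem W (i m)"
  shows "rat_elem N m"
proof -
  interpret N: right_module \<S> N by (rule N)
  interpret W: right_module \<S> W by (rule W)
  note uW = right_module_uA[OF W]
  obtain t where t: "t @: (\<T> (uA W))" "\<And>f. f \<in> \<L> ==> f .[W] i m = ev (uA W) f t"
    using m(2) unfolding rat_elem_def by blast
  note B = mB[OF uW]
  obtain X where X: "finite X" "X \<subseteq> carrier C" "\<forall>b b'. bilin R (\<B> (uA W)) C (\<B> (uA W)) b --> bilin R (\<B> (uA W)) C (\<B> (uA W)) b' -->
      (\<forall>x \<in> carrier (\<B> (uA W)). \<forall>w \<in> X. b x w = b' x w) --> tsum R (\<B> (uA W)) C (\<B> (uA W)) t b = tsum R (\<B> (uA W)) C (\<B> (uA W)) t b'"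
    using tensor_finite_support[OF B mC B t(1)] by (elim exE conjE)
  obtain D where D: "finrank R C D" "\<forall>w \<in> X. D w = w" by (rule dual_basesE[OF db X(1,2)])
  show ?thesis
  proof (rule rat_elem_finrank[OF N m(1) D(1)])
    fix f assume f: "f \<in> \<L>"
    let ?g = "\<lambda>c\<in>carrier C. f (D c)"
    have g: "?g \<in> \<L>" by (rule lin_maps_restrict[OF lin_compose[OF finrank_lin[OF D(1)] lin_mapsD[OF f]]])
    have "ev (uA W) ?g t = ev (uA W) f t"
      unfolding ev_def
      by (rule X(3)[rule_format, OF bilin_ev[OF uW lin_mapsD[OF g]] bilin_ev[OF uW lin_mapsD[OF f]]]) (use D(2) X(2) in auto)
    then have "i (?g .[N] m) = i (f .[N] m)"
      using lin_smult[OF i(1) _ m(1)] t(2)[OF f] t(2)[OF g] f g by simp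
    then show "?g .[N] m = f .[N] m" using inj_onD[OF i(2)] N.ract_closed[OF _ m(1)] f g by simp
  qed
qed

section \<open>The functor from entwined modules to rational modules\<close>

lemma agree_uA: "entwined M ==> agree A M (uA (\<F> M))"
  unfolding agree_def by (simp add: to_smash_act unit_map_closed act_unit)

lemma rational_to_smash:
  assumes M: "entwined M" and m: "m @: M" shows "rat_elem (\<F> M) m"
proof -
  note e = entwinedD[OF M]
  have t: "coact M m @: (\<T> (uA (\<F> M)))"
    using agree_carrier[OF agree_tensor[OF agree_base[OF agree_uA[OF M]] e(8) mC]] e(7)[OF m] by simp
  have "f .[\<F> M] m = ev (uA (\<F> M)) f (coact M m)" if f: "f \<in> \<L>" for f
    unfolding to_smash_act[OF f m] act_def using lin_closed[OF lin_mapsD[OF f]] by (rule ev_agree[OF e(1) agree_uA[OF M], symmetric])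
  then show ?thesis unfolding rat_elem_def using t m by auto
qed

text \<open>For a \<open>#\<close>-linear map the two sides of colinearity pair equally with every
  \<open>g\<close>, so separation identifies them; \<open>A\<close>-linearity comes from the unit
  map.\<close>

lemma to_smash_maps:
  assumes db: "dual_bases R C" and M: "entwined M" and N: "entwined N"
  shows "\<H> M N = lin_maps \<S> (\<F> M) (\<F> N)"
proof (intro equalityI subsetI)
  note e = entwinedD[OF M] and e' = entwinedD[OF N]
  fix f
  show "f \<in> lin_maps \<S> (\<F> M) (\<F> N)" if f: "f \<in> \<H> M N"
    unfolding lin_maps_iff
  proof (intro conjI linI)
    fix s x assume "s @: \<S>" and "x @: \<F> M"
    then have s: "s \<in> \<L>" and x: "x @: M" by simp_all
    show "f (s .[\<F> M] x) = s .[\<F> N] f x"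
      unfolding to_smash_act[OF s x] to_smash_act[OF s ent_mapsD(4)[OF f x]] act_nat[OF M N f lin_mapsD[OF s] x] ..
  qed (use ent_mapsD(2)[OF f] ent_mapsD(4)[OF f] lin_add[OF ent_mapsD(1)[OF f]] in simp_all)
  assume f: "f \<in> lin_maps \<S> (\<F> M) (\<F> N)"
  note lf = lin_mapsD[OF f]
  have fN: "f x @: N" if "x @: M" for x using lin_closed[OF lf] that by simp
  have nat: "act N g (f x) = f (act M g x)" if g: "g \<in> \<L>" and x: "x @: M" for g x
    using lin_smult[OF lf, of g x] g x by (simp add: to_smash_act fN)
  have fA: "lin A M N f"
  proof (rule linI[OF fN])
    show "f (x +[M] y) = f x +[N] f y" if "x @: M" "y @: M" for x y using lin_add[OF lf, of x y] that by simp
    show "f (a .[M] x) = a .[N] f x" if "a @: A" "x @: M" for a x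
      using nat[OF unit_map_closed[OF that(1)] that(2)] act_unit[OF M that] act_unit[OF N that(1) fN[OF that(2)]] by simp
  qed
  have "coact N (f x) = tm M N f (coact M x)" if x: "x @: M" for x
  proof (rule separation_ev[OF db e'(1) e'(7)[OF fN[OF x]] tmap_closed[OF e(8) e'(8) mC lin_base[OF fA] e(7)[OF x]]])
    fix g assume g: "g \<in> \<L>"
    show "ev N g (coact N (f x)) = ev N g (tm M N f (coact M x))"
      unfolding ev_nat[OF e(1) e'(1) fA lin_mapsD[OF g] e(7)[OF x]] using nat[OF g x] unfolding act_def .
  qed
  then show "f \<in> \<H> M N" unfolding entwined_maps_iff lin_maps_iff using fA f by (simp add: lin_maps_iff)
qed

text \<open>The action of \<open>A\<close> is recovered through the unit map and the coaction by
  separation; \<open>standard_module\<close> settles the values off the carrier.\<close>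

lemma to_smash_inj:
  assumes db: "dual_bases R C" and M: "entwined M" "standard_module A M" and N: "entwined N" "standard_module A N"
    and eq: "\<F> M = \<F> N"
  shows "M = N"
proof -
  note e = entwinedD[OF M(1)] and e' = entwinedD[OF N(1)]
  have c: "carrier M = carrier N" "0[M] = 0[N]" "ring.add M = ring.add N"
    "monoid.mult M = monoid.mult N" "monoid.one M = monoid.one N"
    using arg_cong[OF eq, of carrier] arg_cong[OF eq, of ring.zero] arg_cong[OF eq, of ring.add]
      arg_cong[OF eq, of monoid.mult] arg_cong[OF eq, of monoid.one] by simp_all
  have act: "act M f m = act N f m" if "f \<in> \<L>" "m @: M" for f m
    using to_smash_act[OF that] to_smash_act[OF that(1), of m N] that(2) c(1) eq by simp
  have s: "smult M = smult N"
  proof (intro ext)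
    fix a x
    show "a .[M] x = a .[N] x"
    proof (cases "a @: A \<and> x @: M")
      case True
      then show ?thesis using act[OF unit_map_closed, of a x] act_unit[OF M(1), of a x] act_unit[OF N(1), of a x] c(1) by simp
    next
      case False
      then show ?thesis using M(2) N(2) c(1) unfolding standard_module_def by metis
    qed
  qed
  have B: "\<B> M = \<B> N" by (simp add: base_module_def restrict_scalars_def c s)
  have ev: "ev M = ev N" by (simp add: fun_eq_iff ev_def B s)
  have "coact M = coact N"
  proof (rule extensionalityI[OF e(3)])
    show "coact N \<in> extensional (carrier M)" using e'(3) c(1) by simp
    fix m assume m: "m @: M"
    show "coact M m = coact N m"
    proof (rule separation_ev[OF db e(1) e(7)[OF m]])
      show "coact N m @: \<T> M" using e'(7) m c(1) B by simp
      show "ev M f (coact M m) = ev M f (coact N m)" if "f \<in> \<L>" for f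
        using act[OF that m] unfolding act_def ev .
    qed
  qed
  then show ?thesis using c s by (intro coact_module.equality) simp_all
qed

text \<open>\<open>\<rho> m\<close> is the only tensor that represents
  \<open>f \<mapsto> m f\<close>. Linearity and compatibility with \<open>A\<close> follow from
  \<open>uniq\<close> by checking that both sides represent the same action; coassociativity needs
  the separation of tensors with two factors \<open>C\<close>.\<close>

lemma entwined_of_rational:
  fixes N :: "('c => 'a, 'm) module"
  assumes db: "dual_bases R C" and N: "right_module \<S> N" "standard_module \<S> N" and rat: "\<And>m. m @: N ==> rat_elem N m"
  shows "\<exists>M. entwined M \<and> standard_module A M \<and> \<F> M = N"
proof -
  interpret N: right_module \<S> N by (rule N(1))
  define P :: "('a, 'm) module" where "P = \<lparr>carrier = carrier N, monoid.mult = undefined, monoid.one = undefined,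
    ring.zero = 0[N], ring.add = ring.add N,
    smult = (%a x. if a @: A \<and> x @: N then \<U> a .[N] x else undefined)\<rparr>"
  have Ps: "carrier P = carrier N" "0[P] = 0[N]" "ring.add P = ring.add N"
    "\<And>a x. a @: A ==> x @: N ==> a .[P] x = \<U> a .[N] x"
    "monoid.mult P = undefined" "monoid.one P = undefined" "\<And>a x. \<not> (a @: A \<and> x @: N) ==> a .[P] x = undefined"
    by (auto simp: P_def)
  note uN = right_module_uA[OF N(1)]
  have ag: "agree A (uA N) P" unfolding agree_def by (simp add: Ps)
  have P: "right_module A P" by (rule agree_right_module[OF ag uN])
  let ?T = "\<T> P"
  have T: "module R ?T" by (rule module_tensor[OF mB[OF P] mC])
  interpret T: module R ?T by (rule T)
  have carr: "f .[N] m @: N" if "f \<in> \<L>" "m @: N" for f m using N.ract_closed[of f m] that by simp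
  define \<rho> where "\<rho> = (\<lambda>m\<in>carrier N. SOME t. t @: ?T \<and> (\<forall>f \<in> \<L>. f .[N] m = ev P f t))"
  have \<rho>: "\<rho> m @: ?T \<and> (\<forall>f \<in> \<L>. f .[N] m = ev P f (\<rho> m))" if m: "m @: N" for m
  proof -
    obtain t where t: "t @: (\<T> (uA N))" "\<And>f. f \<in> \<L> ==> f .[N] m = ev (uA N) f t"
      using rat[OF m] unfolding rat_elem_def by blast
    have "t @: ?T" using t(1) agree_carrier[OF agree_tensor[OF agree_base[OF ag] mB[OF uN] mC]] by simp
    moreover have "f .[N] m = ev P f t" if f: "f \<in> \<L>" for f
      unfolding t(2)[OF f] using lin_closed[OF lin_mapsD[OF f]] by (rule ev_agree[OF uN ag, symmetric])
    ultimately have ex: "\<exists>t. t @: ?T \<and> (\<forall>f \<in> \<L>. f .[N] m = ev P f t)" by blast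
    have "\<rho> m = (SOME t. t @: ?T \<and> (\<forall>f \<in> \<L>. f .[N] m = ev P f t))"
      unfolding \<rho>_def using m by (rule restrict_apply')
    then show ?thesis using someI_ex[OF ex] by (rule ssubst)
  qed
  note \<rho>T = \<rho>[THEN conjunct1] and \<rho>f = \<rho>[THEN conjunct2, rule_format, symmetric]
  have uniq: "\<rho> m = t" if "m @: N" "t @: ?T" "\<And>f. f \<in> \<L> ==> f .[N] m = ev P f t" for m t
    using that(3) \<rho>f[OF that(1)] by (intro separation_ev[OF db P \<rho>T[OF that(1)] that(2)]) simp
  have unit: "\<U> a \<in> \<L>" if "a @: A" for a by (rule unit_map_closed[OF that])
  have assoc: "(f *[\<S>] g) .[N] m = g .[N] (f .[N] m)" if "f \<in> \<L>" "g \<in> \<L>" "m @: N" for f g m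
    using N.ract_assoc[of f g m] that by simp
  have lin: "lin R (\<B> P) ?T \<rho>"
  proof (rule linI)
    fix x assume "x @: \<B> P"
    then have x: "x @: N" by (simp add: Ps)
    show "\<rho> x @: ?T" by (rule \<rho>T[OF x])
    show "\<rho> (x +[\<B> P] y) = \<rho> x +[?T] \<rho> y" if "y @: \<B> P" for y
    proof -
      have y: "y @: N" using that by (simp add: Ps)
      have "\<rho> (x +[N] y) = \<rho> x +[?T] \<rho> y"
      proof (rule uniq[OF N.M.a_closed[OF x y] T.a_closed[OF \<rho>T[OF x] \<rho>T[OF y]]])
        fix f assume f: "f \<in> \<L>"
        show "f .[N] (x +[N] y) = ev P f (\<rho> x +[?T] \<rho> y)"
          using lin_add[OF ev_lin[OF P lin_mapsD[OF f]] \<rho>T[OF x] \<rho>T[OF y]] N.ract_r_distr[of f x y] f x y by (simp add: \<rho>f Ps)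
      qed
      then show ?thesis by (simp add: Ps)
    qed
    show "\<rho> (r .[\<B> P] x) = r .[?T] \<rho> x" if r: "r @: R" for r
    proof -
      let ?u = "\<U> (r .[A] 1[A])"
      note u = unit[OF one_scaled[OF r]]
      have "\<rho> (?u .[N] x) = r .[?T] \<rho> x"
      proof (rule uniq[OF carr[OF u x] T.smult_closed[OF r \<rho>T[OF x]]])
        fix f assume f: "f \<in> \<L>"
        have "f .[N] (?u .[N] x) = ?u .[N] (f .[N] x)"
          using assoc[OF u f x] assoc[OF f u x] unit_map_central[OF r f] by simp
        also have "\<dots> = r .[\<B> P] ev P f (\<rho> x)" using Ps(4)[OF one_scaled[OF r] carr[OF f x]] by (simp add: \<rho>f[OF x f])
        also have "\<dots> = ev P f (r .[?T] \<rho> x)" by (rule lin_smult[OF ev_lin[OF P lin_mapsD[OF f]] r \<rho>T[OF x], symmetric])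
        finally show "f .[N] (?u .[N] x) = ev P f (r .[?T] \<rho> x)" .
      qed
      then show ?thesis using Ps(4)[OF one_scaled[OF r] x] by simp
    qed
  qed
  have ent: "\<rho> (a .[P] x) = cP' P a (\<rho> x)" if "x @: P" and a: "a @: A" for x a
  proof -
    have x: "x @: N" using that by (simp add: Ps)
    have "\<rho> (\<U> a .[N] x) = cP' P a (\<rho> x)"
    proof (rule uniq[OF carr[OF unit[OF a] x] lin_closed[OF cP_lin[OF P a] \<rho>T[OF x]]])
      fix f assume f: "f \<in> \<L>"
      note lf = lin_mapsD[OF f]
      \<comment> \<open>The product of the unit map at \<open>a\<close> with \<open>f\<close>,
        written out. Pairing a tensor with \<open>h\<close> is letting \<open>a\<close> act on it
        and then pairing with \<open>f\<close>.\<close>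
      define h where "h = (\<lambda>c\<in>carrier C. tsum R A C A (\<psi> (pure_tensor R C A c a)) (%b d. b *[A] f d))"
      have h: "h \<in> \<L>"
        unfolding h_def by (rule lin_maps_restrict[OF lin_tsum1[OF mA mC mA lin_psi_r[OF a lin_id] bilin_mult[OF lf]]])
      have hev: "ev M h t = ev M f (cP' M a t)" if M: "right_module A M" and t: "t @: \<T> M"
        for M :: "('a, 'q, 'w) module_scheme" and t
      proof (rule lin_ext[OF mB[OF M] mC ev_lin[OF M lin_mapsD[OF h]] lin_compose[OF cP_lin[OF M a] ev_lin[OF M lf]] _ t])
        fix y c assume "y @: \<B> M" and c: "c @: C"
        then have y: "y @: M" by simp
        show "ev M h (pt M y c) = ev M f (cP' M a (pt M y c))"
          unfolding twist_act[OF M lf a c y] ev_pure[OF M lin_mapsD[OF h] y c] using c by (simp add: h_def)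
      qed
      have "\<U> a *[\<S>] f = h"
      proof (rule smash_eqI[OF smash_mult_closed[OF unit[OF a] f] h])
        fix M :: "('a, ('a, 'c) tens, 'c) coact_module" and m assume M: "entwined M" and m: "m @: M"
        show "act M (\<U> a *[\<S>] f) m = act M h m"
          unfolding act_mult[OF M lin_mapsD[OF unit[OF a]] lf m] act_unit[OF M a m]
          unfolding act_def hev[OF entwinedD(1)[OF M] entwinedD(7)[OF M m]] entwinedD(6)[OF M m a] ..
      qed
      then have "f .[N] (\<U> a .[N] x) = h .[N] x" using assoc[OF unit[OF a] f x] by simp
      then show "f .[N] (\<U> a .[N] x) = ev P f (cP' P a (\<rho> x))"
        unfolding hev[OF P \<rho>T[OF x], symmetric] \<rho>f[OF x h] .
    qed
    then show ?thesis unfolding Ps(4)[OF a x] .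
  qed
  let ?M = "with_coact P \<rho>"
  have "pre_entwined ?M"
    unfolding pre_entwined_def lin_maps_iff using right_module_with_coact[OF P] lin by (simp add: \<rho>_def Ps)
  moreover have "cE R C \<epsilon> (\<B> P) (\<rho> m) = m" if m: "m @: N" for m
  proof -
    interpret P: right_module A P by (rule P)
    have "m = ev P 1[\<S>] (\<rho> m)" using N.ract_one[OF m] \<rho>f[OF m smash_one_closed] by simp
    also have "\<dots> = ev P (%c. \<epsilon> c .[A] 1[A]) (\<rho> m)" by (rule ev_cong) simp
    also have "\<dots> = cE R C \<epsilon> (\<B> P) (\<rho> m)"
      unfolding ev_counit[OF P A.one_closed \<rho>T[OF m]]
      by (rule P.ract_one) (use lin_closed[OF cE_lin[OF mB[OF P]] \<rho>T[OF m]] in simp)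
    finally show ?thesis by simp
  qed
  \<comment> \<open>Paired with \<open>f\<close> and \<open>g\<close>, coassociativity reads
    \<open>m (f g) = (m f) g\<close>, an axiom of the \<open>#\<close>-module
    \<open>N\<close>.\<close>
  moreover have "cL R C \<Delta> (\<B> P) (\<rho> m) = cR R C (\<B> P) \<rho> (\<rho> m)" if m: "m @: N" for m
  proof (rule separation_ev2[OF db P lin_closed[OF cL_lin[OF mB[OF P]] \<rho>T[OF m]] lin_closed[OF cR_lin[OF mB[OF P] lin] \<rho>T[OF m]]])
    fix f g assume f: "f \<in> \<L>" and g: "g \<in> \<L>"
    note lf = lin_mapsD[OF f] and lg = lin_mapsD[OF g]
    have "ev P (%c. tsum R C C A (\<Delta> c) (twist f g)) (\<rho> m) = ev P (f *[\<S>] g) (\<rho> m)"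
      unfolding smash_mult by (rule ev_cong) simp
    also have "\<dots> = ev P g (\<rho> (ev P f (\<rho> m)))"
      using assoc[OF f g m] \<rho>f[OF m smash_mult_closed[OF f g]] \<rho>f[OF m f] \<rho>f[OF carr[OF f m] g] by simp
    also have "\<dots> = ev2 P f g (cR R C (\<B> P) \<rho> (\<rho> m))"
      by (rule ev2_cR[symmetric, OF P lf lg lin _ \<rho>T[OF m]]) (rule ent)
    finally show "ev2 P f g (cL R C \<Delta> (\<B> P) (\<rho> m)) = ev2 P f g (cR R C (\<B> P) \<rho> (\<rho> m))"
      unfolding ev2_cL[OF P lf lg \<rho>T[OF m]] .
  qed
  ultimately have M: "entwined ?M"
    unfolding entwined_iff using ent by (simp add: Ps cP_def)
  have "standard_module A ?M" using N(2) by (simp add: standard_module_def Ps)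
  moreover have "\<F> ?M = N"
  proof (rule module.equality)
    show "smult (\<F> ?M) = smult N"
    proof (intro ext)
      fix f m
      show "f .[\<F> ?M] m = f .[N] m"
      proof (cases "f \<in> \<L> \<and> m @: N")
        case True
        then have "f .[\<F> ?M] m = ev P f (\<rho> m)" using to_smash_act[of f m ?M] by (simp add: act_def ev_def Ps)
        then show ?thesis using True \<rho>f by simp
      next
        case False
        then have "f .[N] m = undefined" using N(2) unfolding standard_module_def smash_simps(1) by blast
        then show ?thesis using False by (auto simp: entwined_to_smash_def Ps)
      qed
    qed
  qed (use N(2) in \<open>simp_all add: Ps standard_module_def\<close>)
  ultimately show ?thesis using M by blast
qed

end

section \<open>Module categories, full subcategories and subgeneration\<close>

lemma mod_cat_simps [simp]:
  "X \<in> Obj (mod_cat U S) \<longleftrightarrow> right_module S X \<and> standard_module S X \<and> carrier X \<in> U"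
  "Hom (mod_cat U S) X Y = lin_maps S X Y" "Ident (mod_cat U S) X = (\<lambda>x\<in>carrier X. x)"
  "Comp (mod_cat U S) X Y Z g f = compose (carrier X) g f"
  by (auto simp: mod_cat_def)

lemma full_subcat_simps [simp]:
  "X \<in> Obj (full_subcat \<C> P) \<longleftrightarrow> X \<in> Obj \<C> \<and> P X" "Hom (full_subcat \<C> P) = Hom \<C>"
  "Ident (full_subcat \<C> P) = Ident \<C>" "Comp (full_subcat \<C> P) = Comp \<C>"
  by (auto simp: full_subcat_def)

lemma category_full_subcat:
  assumes "category \<C>" shows "category (full_subcat \<C> P)"
proof -
  interpret category \<C> by (rule assms)
  show ?thesis
    by (rule category.intro) (simp_all add: Ident_in Comp_in Comp_Ident_left Comp_Ident_right Comp_assoc)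
qed

lemma category_mod_cat:
  fixes U :: "'u set set" and S :: "('s, 'k) ring_scheme"
  shows "category (mod_cat U S)"
proof (rule category.intro)
  have fD: "f \<in> carrier X \<rightarrow> carrier Y" "f \<in> extensional (carrier X)" if "f \<in> lin_maps S X Y"
    for X Y :: "('s, 'u) module" and f
    using that lin_closed[OF lin_mapsD[OF that]] by (auto simp: lin_maps_iff)
  fix W X Y Z :: "('s, 'u) module" and f g h
  show "X \<in> Obj (mod_cat U S) ==> Ident (mod_cat U S) X \<in> Hom (mod_cat U S) X X"
    using lin_restrict[OF _ lin_id, of S X] by simp
  show "Comp (mod_cat U S) X Y Z g f \<in> Hom (mod_cat U S) X Z" if "X \<in> Obj (mod_cat U S)"
    "f \<in> Hom (mod_cat U S) X Y" "g \<in> Hom (mod_cat U S) Y Z"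
    using lin_restrict[OF _ lin_compose[OF lin_mapsD lin_mapsD], of S X f Y g Z] that by (simp add: compose_def)
  show "f \<in> Hom (mod_cat U S) X Y ==> Comp (mod_cat U S) X X Y f (Ident (mod_cat U S) X) = f"
    using fD[of f X Y] by (simp add: compose_Id)
  show "f \<in> Hom (mod_cat U S) X Y ==> Comp (mod_cat U S) X Y Y (Ident (mod_cat U S) Y) f = f"
    using fD[of f X Y] by (simp add: Id_compose)
  show "f \<in> Hom (mod_cat U S) W X ==>
      Comp (mod_cat U S) W Y Z h (Comp (mod_cat U S) W X Y g f) = Comp (mod_cat U S) W X Z (Comp (mod_cat U S) X Y Z h g) f"
    using fD[of f W X] by (simp add: compose_assoc)
qed

lemma is_cat_iso_refl: "category \<C> ==> is_cat_iso \<C> \<C> (%M. M) (%_ _ f. f)"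
  by (simp add: is_cat_iso_def is_functor_def bij_betw_def inj_on_def)

lemma right_module_direct_power: "right_module S K ==> right_module S (direct_power I K)"
  unfolding direct_power_eq_dsum by (rule right_module_dsum[OF right_module_ring]) simp_all

text \<open>\<open>P\<close> is the direct power modulo the kernel of \<open>h\<close>, so a module
  embedded in \<open>P\<close> is isomorphic to a submodule of that quotient.\<close>

lemma subgeneratedI:
  assumes K: "right_module S K" and P: "right_module S P" and N: "right_module S N" and I: "I \<in> U"
    and h: "lin S (direct_power I K) P h" "h ` carrier (direct_power I K) = carrier P"
    and i: "lin S N P i" "inj_on i (carrier N)"
  shows "subgenerated U S K N"
proof -
  let ?D = "direct_power I K" let ?J = "{x \<in> carrier ?D. h x = 0[P]}" let ?Q = "quotient_module ?D ?J"
  have D: "right_module S ?D" by (rule right_module_direct_power[OF K])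
  interpret D: right_module S ?D by (rule D)
  have J: "submodule ?J S ?D" by (rule lin_kernel_submodule[OF D P h(1)])
  note q = D.quotient_module_facts[OF J]
  have ker: "?J +>\<^bsub>?D\<^esub> x = 0[?Q]" if "x @: ?D" "h x = 0[P]" for x using q(4)[OF that(1)] that by blast
  obtain u where u: "lin S P ?Q u" and uh: "\<And>x. x @: ?D ==> u (h x) = ?J +>\<^bsub>?D\<^esub> x"
    by (rule lin_surj_factor[OF D P q(1) h q(2) ker]) (assumption, assumption, rule that)
  have inj: "inj_on u (carrier P)"
  proof (rule lin_inj_onI[OF right_module_abelian_group[OF P] right_module_abelian_group[OF q(1)] u])
    fix p assume p: "p @: P" and up: "u p = 0[?Q]"
    from p have "p \<in> h ` carrier ?D" unfolding h(2) .
    then obtain x where x: "p = h x" "x @: ?D" by (rule imageE)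
    then have "x \<in> ?J" using up uh[OF x(2)] q(4)[OF x(2)] by simp
    then show "p = 0[P]" using x(1) by simp
  qed
  let ?f = "%x. u (i x)" let ?H = "?f ` carrier N"
  have f: "lin S N ?Q ?f" by (rule lin_compose[OF i(1) u])
  have H: "submodule ?H S ?Q" by (rule lin_image_submodule[OF N q(1) f])
  have "lin S N (?Q\<lparr>carrier := ?H\<rparr>) ?f" using lin_add[OF f] lin_smult[OF f] by (intro linI) simp_all
  then have r: "restrict ?f (carrier N) \<in> lin_maps S N (?Q\<lparr>carrier := ?H\<rparr>)" by (rule lin_restrict[OF N])
  have "inj_on ?f (carrier N)"
    using comp_inj_on[OF i(2), of u] inj_on_subset[OF inj, of "i ` carrier N"] lin_closed[OF i(1)] by (auto simp: comp_def)
  then have "bij_betw (restrict ?f (carrier N)) (carrier N) (carrier (?Q\<lparr>carrier := ?H\<rparr>))"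
    by (simp add: bij_betw_def inj_on_restrict_eq)
  then have "mod_isomorphic S N (?Q\<lparr>carrier := ?H\<rparr>)" unfolding mod_isomorphic_def using r by blast
  then show ?thesis unfolding subgenerated_def using I J H by blast
qed

context entwining
begin

text \<open>Rationality passes from \<open>K\<close> to direct sums and quotients because linear
  maps preserve it, and on to submodules by \<open>rat_elem_sub\<close>, where the dual bases are
  used.\<close>

lemma subgenerated_rational:
  assumes db: "dual_bases R C" and K: "right_module \<S> K" "\<And>k. k @: K ==> rat_elem K k"
    and N: "right_module \<S> N" "subgenerated U \<S> K N" and m: "m @: N"
  shows "rat_elem N m"
proof -
  obtain I J H where "I \<in> U" and J: "submodule J \<S> (direct_power I K)" and H: "submodule H \<S> (quotient_module (direct_power I K) J)"
    and iso: "mod_isomorphic \<S> N ((quotient_module (direct_power I K) J)\<lparr>carrier := H\<rparr>)"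
    using N(2) unfolding subgenerated_def by (elim bexE exE conjE) (rule that)
  let ?D = "direct_power I K" let ?Q = "quotient_module ?D J"
  have D: "right_module \<S> ?D" by (rule right_module_direct_power[OF K(1)])
  interpret D: right_module \<S> ?D by (rule D)
  note q = D.quotient_module_facts[OF J]
  interpret Q: right_module \<S> ?Q by (rule q(1))
  obtain f where f: "f \<in> lin_maps \<S> N (?Q\<lparr>carrier := H\<rparr>)" "bij_betw f (carrier N) H"
    using iso unfolding mod_isomorphic_def by auto
  have HQ: "x @: ?Q" if "x \<in> H" for x using Q.submoduleD(1)[OF H] that by blast
  note lf = lin_mapsD[OF f(1)]
  have fQ: "lin \<S> N ?Q f"
  proof (rule linI)
    show "f x @: ?Q" if "x @: N" for x using lin_closed[OF lf that] HQ by simp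
    show "f (x +[N] y) = f x +[?Q] f y" if "x @: N" "y @: N" for x y using lin_add[OF lf that] by simp
    show "f (s .[N] x) = s .[?Q] f x" if "s @: \<S>" "x @: N" for s x using lin_smult[OF lf that] by simp
  qed
  have ratD: "rat_elem ?D d" if "d @: ?D" for d
    using that unfolding direct_power_eq_dsum
  proof (induction rule: dsum_induct[OF ring_smash K(1), consumes 1, case_names zero inj add])
    case zero
    show ?case by (rule rat_elem_zero[OF D[unfolded direct_power_eq_dsum]])
  next
    case (inj j k)
    show ?case by (rule rat_elem_map[OF K(1) D[unfolded direct_power_eq_dsum] dinj_lin[OF ring_smash K(1) inj(1)] K(2)[OF inj(2)]])
  next
    case (add d e)
    show ?case by (rule rat_elem_add[OF D[unfolded direct_power_eq_dsum] add(3,4)])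
  qed
  have "f m \<in> (%x. J +>\<^bsub>?D\<^esub> x) ` carrier ?D" unfolding q(3) by (rule lin_closed[OF fQ m])
  then obtain d where d: "f m = J +>\<^bsub>?D\<^esub> d" "d @: ?D" by (rule imageE)
  have "rat_elem ?Q (f m)" unfolding d(1) by (rule rat_elem_map[OF D q(1,2) ratD[OF d(2)]])
  then show ?thesis by (rule rat_elem_sub[OF db N(1) q(1) fQ bij_betw_imp_inj_on[OF f(2)] m])
qed

abbreviation "\<K> \<equiv> coring_smash_module R A C \<Delta> \<psi>"

lemma right_module_coring: "right_module \<S> \<K>"
  by (rule agree_right_module[OF coring_agree right_module_to_smash[OF entwined_cofree[OF right_module_rself]]])

lemma rational_coring: "k @: \<K> ==> rat_elem \<K> k"
proof -
  assume k: "k @: \<K>"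
  note M = entwined_cofree[OF right_module_rself]
  have "lin \<S> (\<F> (cofree rself)) \<K> (%x. x)" by (rule agree_lin_imp[OF agree_refl coring_agree lin_id])
  then show ?thesis
    using rat_elem_map[OF right_module_to_smash[OF M] right_module_coring _ rational_to_smash[OF M], of "%x. x" k]
      k agree_carrier[OF coring_agree] by simp
qed

text \<open>One copy of \<open>A \<otimes> C\<close> is taken for each \<open>m\<close> in
  \<open>M\<close>, mapped to \<open>M \<otimes> C\<close> by
  \<open>a \<otimes> c \<mapsto> m a \<otimes> c\<close>. These copies cover
  \<open>M \<otimes> C\<close>, as \<open>m \<otimes> c\<close> is the image of
  \<open>1 \<otimes> c\<close> in the copy at \<open>m\<close>; their index set is the carrier of
  \<open>M\<close>, a member of \<open>U\<close>.\<close>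

lemma to_smash_subgenerated:
  assumes db: "dual_bases R C" and M: "entwined M" and I: "carrier M \<in> U"
  shows "subgenerated U \<S> \<K> (\<F> M)"
proof -
  note e = entwinedD[OF M] and rs = right_module_rself
  note P = right_module_to_smash[OF entwined_cofree[OF e(1)]]
  interpret M: right_module A M by (rule e(1))
  let ?T = "\<T> M" let ?P = "\<F> (cofree M)"
  let ?i = "restrict (hat M M (%x. x)) (carrier M)"
  have "?i \<in> \<H> M (cofree M)"
    by (rule ent_mapsI[OF e(1) hat_lin[OF e(1) M lin_id] hat_coact[OF e(1) M lin_id]])
  then have i: "lin \<S> (\<F> M) ?P ?i" unfolding to_smash_maps[OF db M entwined_cofree[OF e(1)]] by (rule lin_mapsD)
  have iinj: "inj_on ?i (carrier (\<F> M))"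
  proof (rule inj_onI)
    fix x y assume "x @: \<F> M" "y @: \<F> M" and eq: "?i x = ?i y"
    then have xy: "x @: M" "y @: M" by simp_all
    then have "hat M M (%x. x) x = hat M M (%x. x) y" using eq by simp
    then show "x = y" using cE_hat[OF e(1) M lin_id xy(1)] cE_hat[OF e(1) M lin_id xy(2)] by metis
  qed
  define g where "g m = restrict (tm rself M (%a. a .[M] m)) (carrier (cofree rself))" for m
  have g: "lin \<S> \<K> ?P (g m)" if m: "m @: M" for m
  proof -
    have "g m \<in> \<H> (cofree rself) (cofree M)"
      unfolding g_def by (rule cofree_map[OF rs e(1) lin_rself[OF e(1) m]])
    then show ?thesis
      unfolding to_smash_maps[OF db entwined_cofree[OF rs] entwined_cofree[OF e(1)]]
      using agree_lin_imp[OF coring_agree agree_refl] lin_mapsD by blast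
  qed
  have "\<exists>h. lin \<S> (dsum (carrier M) (%_. \<K>)) ?P h \<and>
      (\<forall>m \<in> carrier M. \<forall>x \<in> carrier \<K>. h (dinj (carrier M) (%_. \<K>) m x) = g m x)"
    by (rule dsum_universal[OF ring_smash right_module_coring P g])
  then obtain h where "lin \<S> (dsum (carrier M) (%_. \<K>)) ?P h \<and>
      (\<forall>m \<in> carrier M. \<forall>x \<in> carrier \<K>. h (dinj (carrier M) (%_. \<K>) m x) = g m x)" ..
  then have h: "lin \<S> (direct_power (carrier M) \<K>) ?P h"
    and hd: "\<And>m x. m @: M ==> x @: \<K> ==> h (dinj (carrier M) (%_. \<K>) m x) = g m x"
    unfolding direct_power_eq_dsum by simp_all
  let ?D = "direct_power (carrier M) \<K>"
  have D: "right_module \<S> ?D" by (rule right_module_direct_power[OF right_module_coring])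
  interpret P: right_module \<S> ?P by (rule P)
  have sub: "submodule (h ` carrier ?D) \<S> ?P" by (rule lin_image_submodule[OF D P h])
  have "p \<in> h ` carrier ?D" if "p @: ?T" for p
    using e(8) mC that
  proof (induction rule: tensor_induct)
    case (pure x c)
    then have x: "x @: M" by simp
    let ?k = "pt rself 1[A] c"
    have k: "?k @: cofree rself"
      unfolding cofree_simps by (rule pure_closed[OF mB[OF rs] mC _ pure(2)]) simp
    then have kK: "?k @: \<K>" using agree_carrier[OF coring_agree] by simp
    have "h (dinj (carrier M) (%_. \<K>) x ?k) = tm rself M (%a. a .[M] x) ?k"
      unfolding hd[OF x kK] g_def by (rule restrict_apply'[OF k])
    also have "\<dots> = pt M x c"
      using tmap_pure[OF mB[OF rs] e(8) mC lin_base[OF lin_rself[OF e(1) x]], of "1[A]" c] pure(2) M.ract_one[OF x] by simp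
    finally have "h (dinj (carrier M) (%_. \<K>) x ?k) = pt M x c" .
    moreover have "dinj (carrier M) (%_. \<K>) x ?k @: ?D"
      unfolding direct_power_eq_dsum by (rule dinj_closed[OF ring_smash right_module_coring x kK])
    ultimately show ?case by (rule image_eqI[OF sym])
  next
    case (add s t)
    then show ?case using P.submoduleD(3)[OF sub add(3,4)] by simp
  qed
  then have "h ` carrier ?D = carrier ?P" using P.submoduleD(1)[OF sub] by auto
  then show ?thesis by (rule subgeneratedI[OF right_module_coring P right_module_to_smash[OF M] I h _ i iinj])
qed

end

text \<open>The last fact forms the span inside the span, which is what \<open>fin_gen\<close> asks
  of the submodule as a module in its own right.\<close>

lemma mod_span_facts:
  assumes W: "module R W" and X: "X \<subseteq> carrier W"
  shows "submodule (mod_span R W X) R W" "X \<subseteq> mod_span R W X"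
    "mod_span R (W\<lparr>carrier := mod_span R W X\<rparr>) X = mod_span R W X"
proof -
  interpret W: right_module R W by (rule right_module_of_module[OF W])
  have self: "submodule (carrier W) R W" by (rule W.submodule_of_closed) (simp_all add: W.ract_closed)
  show sub: "X \<subseteq> mod_span R W X" by (auto simp: mod_span_def)
  have D: "N \<subseteq> carrier W" "0[W] \<in> N" "\<And>x y. x \<in> N ==> y \<in> N ==> x +[W] y \<in> N"
    "\<And>s x. s @: R ==> x \<in> N ==> s .[W] x \<in> N" if "submodule N R W" for N
    using W.submoduleD[OF that] by blast+
  show span: "submodule (mod_span R W X) R W"
  proof (rule W.submodule_of_closed)
    show "mod_span R W X \<subseteq> carrier W" unfolding mod_span_def using self X by blast
  qed (auto simp: mod_span_def D)
  let ?F = "W\<lparr>carrier := mod_span R W X\<rparr>"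
  interpret F: right_module R ?F by (rule W.right_module_submodule[OF span])
  have "submodule N R W" if N: "submodule N R ?F" for N
    by (rule W.submodule_of_closed) (use F.submoduleD[OF N] D(1)[OF span] in auto)
  then have "mod_span R W X \<subseteq> mod_span R ?F X" unfolding mod_span_def[of R ?F] by (auto simp: mod_span_def)
  moreover have "submodule (mod_span R W X) R ?F"
    by (rule F.submodule_of_closed) (use D[OF span] in simp_all)
  then have "mod_span R ?F X \<subseteq> mod_span R W X" unfolding mod_span_def[of R ?F] using sub by blast
  ultimately show "mod_span R ?F X = mod_span R W X" by blast
qed

section \<open>Local dual bases and the isomorphisms of categories\<close>

context entwining_universe
begin

text \<open>Local projectivity is applied to the canonical surjection from the free module on the
  set \<open>C\<close> onto \<open>C\<close>, copied into \<open>U\<close>, and to the identity of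
  \<open>C\<close> on the span of \<open>X\<close>. The coordinates of the resulting local section
  \<open>\<gamma>\<close> are the functionals, with the elements of \<open>C\<close> as dual
  vectors.\<close>

lemma locally_projective_dual_bases:
  assumes lp: "locally_projective_module U R C"
  shows "dual_bases R C"
  unfolding dual_bases_def
proof (intro allI impI)
  fix X assume X: "finite X" "X \<subseteq> carrier C"
  have rR: "ring R" by (rule cring.axioms(1)[OF cR])
  have sR: "right_module R (self_module R)" by (rule right_module_of_module[OF mself])
  have rC: "right_module R C" by (rule right_module_of_module[OF mC])
  interpret C: right_module R C by (rule rC)
  interpret R: ring R by (rule rR)
  let ?s = "%_ :: 'c. self_module R" let ?L = "dsum (carrier C) ?s"
  have L: "right_module R ?L" by (rule right_module_dsum[OF rR sR])
  interpret L: right_module R ?L by (rule L)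
  have "\<exists>p. lin R ?L C p \<and> (\<forall>j \<in> carrier C. \<forall>r \<in> carrier (self_module R). p (dinj (carrier C) ?s j r) = r .[C] j)"
    by (rule dsum_universal[OF rR sR rC lin_scal1[OF mC lin_id]])
  then obtain p0 where p0: "lin R ?L C p0" "\<And>j r. j @: C ==> r @: R ==> p0 (dinj (carrier C) ?s j r) = r .[C] j"
    by (elim exE conjE) simp
  have sL: "small (carrier ?L)" by (rule small_dsum[OF small_C]) (simp add: small_R)
  obtain hL :: "('c => 'r) => 'u" where hL: "inj_on hL (carrier ?L)" "hL ` carrier ?L \<in> U" by (rule small_copy[OF sL])
  obtain hC :: "'c => 'u" where hC: "inj_on hC (carrier C)" "hC ` carrier C \<in> U" by (rule small_copy[OF small_C])
  note l = mcopy_facts[OF L hL(1)] and n = mcopy_facts[OF rC hC(1)]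
  let ?L' = "mcopy R ?L hL" and ?N = "mcopy R C hC"
  let ?k = "inv_into (carrier ?L) hL"
  have k: "lin R ?L' ?L ?k" by (rule lin_inv[OF L l(2,3)])
  let ?p = "restrict (%x. hC (p0 (?k x))) (carrier ?L')"
  have p: "?p \<in> lin_maps R ?L' ?N" by (rule lin_restrict[OF l(1) lin_compose[OF lin_compose[OF k p0(1)] n(2)]])
  have psurj: "?p ` carrier ?L' = carrier ?N"
  proof
    show "?p ` carrier ?L' \<subseteq> carrier ?N" using lin_closed[OF lin_mapsD[OF p]] by blast
    show "carrier ?N \<subseteq> ?p ` carrier ?L'"
    proof
      fix y assume "y @: ?N"
      then obtain j where j: "y = hC j" "j @: C" unfolding n(5) by (rule imageE)
      let ?d = "dinj (carrier C) ?s j 1[R]"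
      have d: "?d @: ?L" by (rule dinj_closed[OF rR sR j(2)]) simp
      have hd: "hL ?d @: ?L'" by (rule lin_closed[OF l(2) d])
      have "?p (hL ?d) = y" using hd inv_into_f_f[OF hL(1) d] p0(2)[OF j(2) R.one_closed] C.ract_one[OF j(2)] j(1) by simp
      then show "y \<in> ?p ` carrier ?L'" using hd by (rule image_eqI[OF sym])
    qed
  qed
  let ?g = "restrict hC (carrier C)"
  have g: "?g \<in> lin_maps R C ?N" by (rule lin_restrict[OF rC n(2)])
  note F = mod_span_facts[OF mC X(2)]
  have fg: "fin_gen R (C\<lparr>carrier := mod_span R C X\<rparr>)"
    unfolding fin_gen_def using X(1) F(2,3) by (intro exI[of _ X]) simp
  have "\<exists>g' \<in> lin_maps R C ?L'. \<forall>w \<in> mod_span R C X. ?p (g' w) = ?g w"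
    using lp[unfolded locally_projective_module_def, rule_format, OF module_of_right_module[OF cR l(1)]
        module_of_right_module[OF cR n(1)] hL(2)[folded l(5)] hC(2)[folded n(5)] p psurj g F(1) fg] .
  then obtain g' where g': "g' \<in> lin_maps R C ?L'" "\<forall>w \<in> mod_span R C X. ?p (g' w) = ?g w" ..
  define \<gamma> where "\<gamma> w = ?k (g' w)" for w
  have \<gamma>: "lin R C ?L \<gamma>" unfolding \<gamma>_def by (rule lin_compose[OF lin_mapsD[OF g'(1)] k])
  have p\<gamma>: "p0 (\<gamma> w) = w" if w: "w \<in> X" for w
  proof -
    have wC: "w @: C" using w X(2) by blast
    have "hC (p0 (\<gamma> w)) = hC w"
      using g'(2)[rule_format, of w] F(2) w wC lin_closed[OF lin_mapsD[OF g'(1)] wC] unfolding \<gamma>_def by auto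
    then show ?thesis by (rule inj_onD[OF hC(1) _ lin_closed[OF p0(1) lin_closed[OF \<gamma> wC]] wC])
  qed
  \<comment> \<open>\<open>\<gamma> w\<close> truncated to the coordinates in \<open>J\<close>. The
    support of \<open>\<gamma> w\<close> varies with \<open>w\<close>, while a finite-rank map needs
    one finite set of coordinates; for \<open>w\<close> in \<open>X\<close> the set
    \<open>?J\<close> below truncates nothing.\<close>
  let ?r = "%J w. \<lambda>j\<in>carrier C. if j \<in> J then \<gamma> w j else 0[R]"
  have \<gamma>R: "\<gamma> w j @: R" if "w @: C" "j @: C" for w j
    using dsum_carrierD(1)[OF rR sR lin_closed[OF \<gamma> that(1)] that(2)] by simp
  have rL: "?r J w @: ?L" if "finite J" "w @: C" for J w
  proof (rule dsum_carrierI[OF rR sR])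
    show "finite {i \<in> carrier C. ?r J w i ~= 0[self_module R]}" by (rule finite_subset[OF _ that(1)]) auto
  qed (use \<gamma>R that in simp_all)
  have "\<exists>D. finrank R C D \<and> (\<forall>w \<in> carrier C. D w = p0 (?r J w))" if "finite J" "J \<subseteq> carrier C" for J
    using that
  proof (induction J)
    case empty
    have "?r {} w = 0[?L]" for w by (simp add: dsum_def)
    then have "p0 (?r {} w) = 0[C]" for w
      using lin_zero[OF right_module_abelian_group[OF L] right_module_abelian_group[OF rC] p0(1)] by (simp only:)
    then show ?case using finrank_zero[of R C] by metis
  next
    case (insert j J)
    obtain D where D: "finrank R C D" "\<forall>w \<in> carrier C. D w = p0 (?r J w)" using insert by blast
    have j: "j @: C" using insert by blast
    let ?x = "restrict (%w. \<gamma> w j) (carrier C)"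
    have x: "?x \<in> lin_maps R C (self_module R)"
      by (rule lin_restrict[OF rC lin_compose[OF \<gamma> dsum_proj_lin[OF j]]])
    have "D w +[C] ?x w .[C] j = p0 (?r (insert j J) w)" if w: "w @: C" for w
    proof -
      have d: "dinj (carrier C) ?s j (\<gamma> w j) @: ?L" by (rule dinj_closed[OF rR sR j]) (simp add: \<gamma>R[OF w j])
      have "?r (insert j J) w = ?r J w +[?L] dinj (carrier C) ?s j (\<gamma> w j)"
        using insert(2) \<gamma>R[OF w] by (auto simp: dsum_def dinj_def fun_eq_iff restrict_def)
      then show ?thesis
        using lin_add[OF p0(1) rL[OF insert(1) w] d] p0(2)[OF j \<gamma>R[OF w j]] D(2) w by simp
    qed
    then show ?case using finrank_add[OF D(1) x j] by (intro exI[of _ "%c. D c +[C] ?x c .[C] j"]) blast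
  qed
  note ex = this
  let ?J = "\<Union>w\<in>X. {j \<in> carrier C. \<gamma> w j ~= 0[R]}"
  have J: "finite ?J" "?J \<subseteq> carrier C"
    using X dsum_carrierD(2)[OF rR sR lin_closed[OF \<gamma>]] by auto
  obtain D where D: "finrank R C D" "\<forall>w \<in> carrier C. D w = p0 (?r ?J w)" using ex[OF J] by (elim exE conjE)
  have "D w = w" if w: "w \<in> X" for w
  proof -
    have wC: "w @: C" using w X(2) by blast
    have "?r ?J w = \<gamma> w"
    proof (rule extensionalityI[OF _ dsum_carrierD(3)[OF rR sR lin_closed[OF \<gamma> wC]]])
      show "?r ?J w j = \<gamma> w j" if "j @: C" for j using that w by auto
    qed simp
    then show ?thesis using D(2) wC p\<gamma>[OF w] by simp
  qed
  then show "\<exists>D. finrank R C D \<and> (\<forall>w \<in> X. D w = w)" using D(1) by blast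
qed

lemma projective_imp_locally_projective:
  assumes pr: "projective_module U R C" shows "locally_projective_module U R C"
  unfolding locally_projective_module_def
proof (intro allI impI)
  fix L N :: "('r, 'u) module" and p g F
  assume a: "module R L" "module R N" "carrier L \<in> U" "carrier N \<in> U" "p \<in> lin_maps R L N" "p ` carrier L = carrier N"
    "g \<in> lin_maps R C N" and F: "submodule F R C"
  have "F \<subseteq> carrier C" by (rule right_module.submoduleD(1)[OF right_module_of_module[OF mC] F])
  moreover have "\<exists>g' \<in> lin_maps R C L. \<forall>w \<in> carrier C. p (g' w) = g w"
    by (rule pr[unfolded projective_module_def, rule_format, OF a])
  ultimately show "\<exists>g' \<in> lin_maps R C L. \<forall>w \<in> F. p (g' w) = g w" by (meson subsetD)
qed

text \<open>A finite-rank \<open>D\<close> that fixes a finite generating set is the identity on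
  \<open>C\<close>, so \<open>f \<circ> D = f\<close> and \<open>finrank_act\<close> applies to
  every element of every \<open>#\<close>-module.\<close>

lemma fin_gen_rational:
  assumes db: "dual_bases R C" and fg: "fin_gen R C" and N: "right_module \<S> N" and m: "m @: N"
  shows "rat_elem N m"
proof -
  obtain X where X: "finite X" "X \<subseteq> carrier C" "mod_span R C X = carrier C" using fg unfolding fin_gen_def by blast
  obtain D where D: "finrank R C D" "\<forall>w \<in> X. D w = w" by (rule dual_basesE[OF db X(1,2)])
  note l = finrank_lin[OF D(1)]
  interpret C: right_module R C by (rule right_module_of_module[OF mC])
  have "submodule {w \<in> carrier C. D w = w} R C"
    using lin_zero[OF module_abelian_group[OF mC] module_abelian_group[OF mC] l]
    by (intro C.submodule_of_closed) (auto simp: lin_add[OF l] lin_smult[OF l] C.ract_closed)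
  then have "mod_span R C X \<subseteq> {w \<in> carrier C. D w = w}" unfolding mod_span_def using X(2) D(2) by blast
  then have Dw: "D w = w" if "w @: C" for w using that X(3) by blast
  show ?thesis
  proof (rule rat_elem_finrank[OF N m D(1)])
    fix f assume f: "f \<in> \<L>"
    have "(\<lambda>c\<in>carrier C. f (D c)) = f"
      by (rule extensionalityI[of _ "carrier C"]) (use f Dw in \<open>simp_all add: lin_maps_iff\<close>)
    then show "(\<lambda>c\<in>carrier C. f (D c)) .[N] m = f .[N] m" by simp
  qed
qed

abbreviation "\<R> \<equiv> rational_cat U R A C \<Delta> \<epsilon> \<psi>"

lemma rational_cat_simps [simp]:
  "N \<in> Obj \<R> \<longleftrightarrow> right_module \<S> N \<and> standard_module \<S> N \<and> carrier N \<in> U \<and> (\<forall>m \<in> carrier N. rat_elem N m)"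
  "Hom \<R> = lin_maps \<S>" "Ident \<R> X = (\<lambda>x\<in>carrier X. x)" "Comp \<R> X Y Z g f = compose (carrier X) g f"
  by (auto simp: rational_cat_def smash_rational_iff fun_eq_iff)

lemma to_smash_obj:
  assumes M: "M \<in> Obj \<E>" shows "\<F> M \<in> Obj \<R>"
proof -
  have e: "entwined M" "standard_module A M" "carrier M \<in> U" using M by simp_all
  have "standard_module \<S> (\<F> M)"
    using e(2) by (auto simp: standard_module_def entwined_to_smash_def)
  then show ?thesis
    unfolding rational_cat_simps using right_module_to_smash[OF e(1)] rational_to_smash[OF e(1)] e(3) by simp
qed

lemma entwined_iso_rational:
  assumes db: "dual_bases R C"
  shows "is_cat_iso \<E> \<R> \<F> (%_ _ f. f)"
proof -
  have hom: "Hom \<E> X Y = Hom \<R> (\<F> X) (\<F> Y)" if "X \<in> Obj \<E>" "Y \<in> Obj \<E>" for X Y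
    using to_smash_maps[OF db, of X Y] that by simp
  have inj: "inj_on \<F> (Obj \<E>)"
  proof (rule inj_onI)
    fix M N assume "M \<in> Obj \<E>" "N \<in> Obj \<E>" and eq: "\<F> M = \<F> N"
    then have "entwined M" "standard_module A M" "entwined N" "standard_module A N" by simp_all
    then show "M = N" by (rule to_smash_inj[OF db _ _ _ _ eq])
  qed
  have "N \<in> \<F> ` Obj \<E>" if "N \<in> Obj \<R>" for N
  proof -
    have N: "right_module \<S> N" "standard_module \<S> N" "carrier N \<in> U" "\<And>m. m @: N ==> rat_elem N m"
      using that by simp_all
    obtain M where M: "entwined M" "standard_module A M" "\<F> M = N"
      using entwined_of_rational[OF db N(1,2,4)] by blast
    have "carrier M \<in> U" using N(3) unfolding M(3)[symmetric] by simp
    then have "M \<in> Obj \<E>" using M(1,2) by simp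
    then show ?thesis using M(3) by blast
  qed
  then have "bij_betw \<F> (Obj \<E>) (Obj \<R>)" unfolding bij_betw_def using inj to_smash_obj by blast
  moreover have "category \<R>" unfolding rational_cat_def by (rule category_full_subcat[OF category_mod_cat])
  then have "is_functor \<E> \<R> \<F> (%_ _ f. f)"
    unfolding is_functor_def using category_entwined to_smash_obj hom by simp
  ultimately show ?thesis unfolding is_cat_iso_def using hom by (simp add: bij_betw_def)
qed

text \<open>The two full subcategories have the same objects, so the second isomorphism of the
  theorem is an identity functor. That rational modules are subgenerated is seen by bringing them
  into the form of an entwined module.\<close>

lemma rational_eq_sigma:
  assumes db: "dual_bases R C"
  shows "\<R> = sigma_cat U \<S> \<K>"
proof (rule cat.equality)
  show "Obj \<R> = Obj (sigma_cat U \<S> \<K>)"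
  proof (intro Set.set_eqI iffI)
    fix N assume N: "N \<in> Obj \<R>"
    then obtain M where M: "M \<in> Obj \<E>" "N = \<F> M"
      using entwined_iso_rational[OF db] unfolding is_cat_iso_def bij_betw_def by blast
    have "subgenerated U \<S> \<K> N" unfolding M(2) by (rule to_smash_subgenerated[OF db]) (use M(1) in simp_all)
    then show "N \<in> Obj (sigma_cat U \<S> \<K>)" using N by (simp add: sigma_cat_def)
  next
    fix N assume "N \<in> Obj (sigma_cat U \<S> \<K>)"
    then have N: "N \<in> Obj (mod_cat U \<S>)" "subgenerated U \<S> \<K> N" unfolding sigma_cat_def by simp_all
    then have "right_module \<S> N" by simp
    then show "N \<in> Obj \<R>"
      using N subgenerated_rational[OF db right_module_coring rational_coring _ N(2)] by simp
  qed
qed (simp_all add: rational_cat_def sigma_cat_def full_subcat_def)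

lemma rational_eq_mod_cat:
  assumes db: "dual_bases R C" and fg: "fin_gen R C"
  shows "\<R> = mod_cat U \<S>"
proof (rule cat.equality)
  show "Obj \<R> = Obj (mod_cat U \<S>)" using fin_gen_rational[OF db fg] by auto
qed (simp_all add: rational_cat_def full_subcat_def)

theorem entwined_categories:
  "(flat_module U R C --> is_Grothendieck U \<E> \<and> has_enough_injectives \<E>) \<and>
   (locally_projective_module U R C -->
      is_cat_iso \<E> \<R> \<F> (%_ _ f. f) \<and> is_cat_iso \<R> (sigma_cat U \<S> \<K>) (%M. M) (%_ _ f. f)) \<and>
   (fin_gen R C \<and> projective_module U R C --> is_cat_iso \<E> (mod_cat U \<S>) \<F> (%_ _ f. f))"
proof (intro conjI impI)
  assume "flat_module U R C"
  then show "is_Grothendieck U \<E>" "has_enough_injectives \<E>" by (rule Grothendieck_entwined, rule enough_injectives)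
next
  assume "locally_projective_module U R C"
  then have db: "dual_bases R C" by (rule locally_projective_dual_bases)
  show "is_cat_iso \<E> \<R> \<F> (%_ _ f. f)" by (rule entwined_iso_rational[OF db])
  have "category \<R>" unfolding rational_cat_def by (rule category_full_subcat[OF category_mod_cat])
  then show "is_cat_iso \<R> (sigma_cat U \<S> \<K>) (%M. M) (%_ _ f. f)"
    unfolding rational_eq_sigma[OF db, symmetric] by (rule is_cat_iso_refl)
next
  assume a: "fin_gen R C \<and> projective_module U R C"
  then have db: "dual_bases R C" using locally_projective_dual_bases projective_imp_locally_projective by blast
  show "is_cat_iso \<E> (mod_cat U \<S>) \<F> (%_ _ f. f)"
    using entwined_iso_rational[OF db] rational_eq_mod_cat[OF db] a by simp
qed

end

theorem theorem3p10:
  fixes R :: "'r ring" and A :: "('r, 'a) module" and C :: "('r, 'c) module"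
    and \<Delta> :: "'c \<Rightarrow> ('c, 'c) tens" and \<epsilon> :: "'c \<Rightarrow> 'r"
    and \<psi> :: "('c, 'a) tens \<Rightarrow> ('a, 'c) tens"
    and U :: "'u set set"
  assumes "entwining R A C \<Delta> \<epsilon> \<psi>"
    and "is_universe (carrier R <+> carrier A <+> carrier C <+> (UNIV :: nat set)) U"
  shows
    "(flat_module U R C \<longrightarrow>
        is_Grothendieck U (entwined_cat U R A C \<Delta> \<epsilon> \<psi>) \<and>
        has_enough_injectives (entwined_cat U R A C \<Delta> \<epsilon> \<psi>)) \<and>
     (locally_projective_module U R C \<longrightarrow>
        is_cat_iso (entwined_cat U R A C \<Delta> \<epsilon> \<psi>) (rational_cat U R A C \<Delta> \<epsilon> \<psi>)
          (entwined_to_smash R A C) (\<lambda>_ _ f. f) \<and>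
        is_cat_iso (rational_cat U R A C \<Delta> \<epsilon> \<psi>)
          (sigma_cat U (smash_op R A C \<Delta> \<epsilon> \<psi>) (coring_smash_module R A C \<Delta> \<psi>))
          (\<lambda>M. M) (\<lambda>_ _ f. f)) \<and>
     (fin_gen R C \<and> projective_module U R C \<longrightarrow>
        is_cat_iso (entwined_cat U R A C \<Delta> \<epsilon> \<psi>) (mod_cat U (smash_op R A C \<Delta> \<epsilon> \<psi>))
          (entwined_to_smash R A C) (\<lambda>_ _ f. f))"
  using entwining_universe.entwined_categories[OF entwining_universe.intro[OF assms(1) entwining_universe_axioms.intro[OF assms(2)]]] .

end
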